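(* Assume (l1)–(l6). Fix $\bar\omega\in\Omega$ and consider the equations $$x'=\mathfrak c(\bar\omega\cdot t)+\mathfrak d(\bar\omega\cdot t)\,x+\mathfrak g^-(\bar\omega\cdot t,x)+\lambda \qquad (E_\lambda)$$ with maximal solutions $x_\lambda(t,s,x)$, $x_\lambda(s,s,x)=x$, defined on $(\alpha_{s,x,\lambda},\beta_{s,x,\lambda})$; let $r^-_\lambda$ and $a^-_\lambda$ denote the lower and upper bounded solutions of $(E_\lambda)$ when bounded solutions exist. Then: (i) there is $\lambda^{\bar\omega}_-\in\mathbb R$ such that $(E_\lambda)$ has two uniformly separated hyperbolic solutions $r^-_\lambda<a^-_\lambda$, $r^-_\lambda$ repulsive and $a^-_\lambda$ attractive, for $\lambda>\lambda^{\bar\omega}_-$; bounded solutions but neither hyperbolic solutions nor uniformly separated bounded solutions for $\lambda=\lambda^{\bar\omega}_-$; and no bounded solutions for $\lambda<\lambda^{\bar\omega}_-$; (ii) the maps $(\lambda^{\bar\omega}_-,\infty)\to C(\mathbb R,\mathbb R)$, $\lambda\mapsto-r^-_\lambda$ and $\lambda\mapsto a^-_\lambda$, are continuous for the uniform topology and strictly increasing; $a^-_{\lambda^{\bar\omega}_-}=\lim_{\lambda\to(\lambda^{\bar\omega}_-)^+}a^-_\lambda$ and $r^-_{\lambda^{\bar\omega}_-}=\lim_{\lambda\to(\lambda^{\bar\omega}_-)^+}r^-_\lambda$ pointwise; and $\lim_{\lambda\to\infty}a^-_\lambda=-\lim_{\lambda\to\infty}r^-_\lambda=\infty$ uniformly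 on $\mathbb R$; (iii) $\lambda^{\bar\omega}_-=\lambda^{\omega}_-$ for every $\omega\in\Omega$ with $\Omega_\omega=\Omega_{\bar\omega}$ (orbit closures); (iv) if $\mu^{\bar\omega}_-:=\inf\{\lambda\in\mathbb R:\mathfrak b_\lambda(\bar\omega\cdot t)\le0\text{ for all }t\in\mathbb R\}$, then $\mu^{\bar\omega}_->\lambda^{\bar\omega}_-$ and $r^-_\lambda(t)=\mathfrak b_\lambda(\bar\omega\cdot t)$ for all $t$ whenever $\lambda\ge\mu^{\bar\omega}_-$; (v) if $\lambda\ge\lambda^{\bar\omega}_-$, then $\lim_{t\to\alpha_{s,x,\lambda}^+}x_\lambda(t,s,x)=\infty$ iff $x>a^-_\lambda(s)$, and $\lim_{t\to\beta_{s,x,\lambda}^-}x_\lambda(t,s,x)=-\infty$ iff $x<r^-_\lambda(s)$; if $\lambda>\lambda^{\bar\omega}_-$, then $\lim_{t\to-\infty}|x_\lambda(t,s,x)-r^-_\lambda(t)|=0$ iff $x<a^-_\lambda(s)$, and $\lim_{t\to\infty}|x_\lambda(t,s,x)-a^-_\lambda(t)|=0$ iff $x>r^-_\lambda(s)$; if $\lambda<\lambda^{\bar\omega}_-$, then for every $(s,x)$, $\lim_{t\to\alpha_{s,x,\lambda}^+}x_\lambda(t,s,x)=\infty$ or $\lim_{t\to\beta_{s,x,\lambda}^-}x_\lambda(t,s,x)=-\infty$.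
   Context: $(\Omega,\sigma)$ is a continuous global flow on a compact metric space, $\omega\cdot t:=\sigma(t,\omega)$; $\mathfrak M_{\rm erg}(\Omega,\sigma)$ is the set of $\sigma$-ergodic invariant Borel probability measures; $C^{0,1}(\Omega\times\mathbb R,\mathbb R)$ is the set of continuous maps with continuous derivative in the second variable. Hypotheses: (l1) $\mathfrak c,\mathfrak d\in C(\Omega,\mathbb R)$, $\mathfrak g^-\in C^{0,1}(\Omega\times\mathbb R,\mathbb R)$; (l2) $\int_\Omega\mathfrak d\,dm>0$ for all $m\in\mathfrak M_{\rm erg}$; (l3) $\lim_{x\to\infty}(\mathfrak d(\omega)x+\mathfrak g^-(\omega,x))=-\infty$ uniformly on $\Omega$; (l4) $\mathfrak g^-\le0$, $\mathfrak g^-(\omega,x)=0$ for $x\le0$, and $m(\{\omega:\mathfrak g^-(\omega,x)<0\ \forall x>0\})=1$ for all $m\in\mathfrak M_{\rm erg}$; (l5) $m(\{\omega:x\mapsto\mathfrak g^-(\omega,x)\text{ concave}\})=1$ for all $m\in\mathfrak M_{\rm erg}$; (l6) $m(\{\omega:x\mapsto\mathfrak g^-_x(\omega,x)\text{ strictly decreasing on }\mathcal J\})>0$ for every compact interval $\mathcal J\subset[0,\infty)$ and $m\in\mathfrak M_{\rm erg}$. $\mathfrak b_\lambda(\omega):=-\int_0^\infty\exp(\int_s^0\mathfrak d(\omega\cdot l)dl)(\mathfrak c(\omega\cdot s)+\lambda)\,ds$ (the unique bounded equilibrium of $x'=\mathfrak c(\omega\cdot t)+\mathfrak d(\omega\cdot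 t)x+\lambda$). A bounded solution $b$ of $x'=f(t,x)$ is attractive (resp. repulsive) hyperbolic if there are $k\ge1,\gamma>0$ with $\exp\int_s^t f_x(r,b(r))dr\le ke^{-\gamma(t-s)}$ for $t\ge s$ (resp. $\le ke^{\gamma(t-s)}$ for $t\le s$); two bounded solutions are uniformly separated if $\inf_t|b_1(t)-b_2(t)|>0$. For $\omega\in\Omega$, $\Omega_\omega$ denotes the closure of $\{\omega\cdot t:t\in\mathbb R\}$ and $\lambda^\omega_-$ the value provided by (i) for the point $\omega$. *)

theory Defs
  imports "HOL-Probability.Probability"
begin

definition cont_flow :: "'w::metric_space set \<Rightarrow> (real \<Rightarrow> 'w \<Rightarrow> 'w) \<Rightarrow> bool" where
  "cont_flow \<Omega> flw \<longleftrightarrow> compact \<Omega> \<and> \<Omega> \<noteq> {} \<and>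
     (\<forall>t. \<forall>\<omega>\<in>\<Omega>. flw t \<omega> \<in> \<Omega>) \<and>
     (\<forall>\<omega>\<in>\<Omega>. flw 0 \<omega> = \<omega>) \<and>
     (\<forall>t s. \<forall>\<omega>\<in>\<Omega>. flw (t + s) \<omega> = flw t (flw s \<omega>)) \<and>
     continuous_on (UNIV \<times> \<Omega>) (\<lambda>(t, \<omega>). flw t \<omega>)"

definition inv_measures :: "'w::metric_space set \<Rightarrow> (real \<Rightarrow> 'w \<Rightarrow> 'w) \<Rightarrow> 'w measure set" where
  "inv_measures \<Omega> flw = {m. prob_space m \<and> space m = \<Omega> \<and>
       sets m = sets (restrict_space borel \<Omega>) \<and>
       (\<forall>t. \<forall>A\<in>sets m. measure m {\<omega>\<in>\<Omega>. flw t \<omega> \<in> A} = measure m A)}"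

definition erg_measures :: "'w::metric_space set \<Rightarrow> (real \<Rightarrow> 'w \<Rightarrow> 'w) \<Rightarrow> 'w measure set" where
  "erg_measures \<Omega> flw = {m \<in> inv_measures \<Omega> flw.
       \<forall>A\<in>sets m. (\<forall>t. {\<omega>\<in>\<Omega>. flw t \<omega> \<in> A} = A) \<longrightarrow> measure m A = 0 \<or> measure m A = 1}"

definition orbit_closure :: "(real \<Rightarrow> 'w::metric_space \<Rightarrow> 'w) \<Rightarrow> 'w \<Rightarrow> 'w set" where
  "orbit_closure flw \<omega> = closure (range (\<lambda>t. flw t \<omega>))"

definition C01 :: "'w::metric_space set \<Rightarrow> ('w \<Rightarrow> real \<Rightarrow> real) \<Rightarrow> bool" where
  "C01 \<Omega> g \<longleftrightarrow> continuous_on (\<Omega> \<times> UNIV) (\<lambda>(\<omega>, x). g \<omega> x) \<and>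
     (\<forall>\<omega>\<in>\<Omega>. \<forall>x. (g \<omega> has_real_derivative deriv (g \<omega>) x) (at x)) \<and>
     continuous_on (\<Omega> \<times> UNIV) (\<lambda>(\<omega>, x). deriv (g \<omega>) x)"

definition hyps_l :: "'w::metric_space set \<Rightarrow> (real \<Rightarrow> 'w \<Rightarrow> 'w) \<Rightarrow> ('w \<Rightarrow> real) \<Rightarrow> ('w \<Rightarrow> real)
    \<Rightarrow> ('w \<Rightarrow> real \<Rightarrow> real) \<Rightarrow> bool" where
  "hyps_l \<Omega> flw c d g \<longleftrightarrow>
     \<comment> \<open>(l1)\<close>
     continuous_on \<Omega> c \<and> continuous_on \<Omega> d \<and> C01 \<Omega> g \<and>
     \<comment> \<open>(l2)\<close>
     (\<forall>m\<in>erg_measures \<Omega> flw. integral\<^sup>L m d > 0) \<and>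
     \<comment> \<open>(l3)\<close>
     (\<forall>M. \<exists>X. \<forall>\<omega>\<in>\<Omega>. \<forall>x\<ge>X. d \<omega> * x + g \<omega> x \<le> M) \<and>
     \<comment> \<open>(l4)\<close>
     (\<forall>\<omega>\<in>\<Omega>. \<forall>x. g \<omega> x \<le> 0) \<and> (\<forall>\<omega>\<in>\<Omega>. \<forall>x\<le>0. g \<omega> x = 0) \<and>
     (\<forall>m\<in>erg_measures \<Omega> flw. measure m {\<omega>\<in>\<Omega>. \<forall>x>0. g \<omega> x < 0} = 1) \<and>
     \<comment> \<open>(l5)\<close>
     (\<forall>m\<in>erg_measures \<Omega> flw. measure m {\<omega>\<in>\<Omega>. concave_on UNIV (g \<omega>)} = 1) \<and>
     \<comment> \<open>(l6)\<close>
     (\<forall>m\<in>erg_measures \<Omega> flw. \<forall>a b. 0 \<le> a \<longrightarrow> a \<le> b \<longrightarrow>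
        measure m {\<omega>\<in>\<Omega>. \<forall>x\<in>{a..b}. \<forall>y\<in>{a..b}. x < y \<longrightarrow> deriv (g \<omega>) y < deriv (g \<omega>) x} > 0)"

definition fE :: "(real \<Rightarrow> 'w \<Rightarrow> 'w) \<Rightarrow> ('w \<Rightarrow> real) \<Rightarrow> ('w \<Rightarrow> real) \<Rightarrow> ('w \<Rightarrow> real \<Rightarrow> real)
    \<Rightarrow> 'w \<Rightarrow> real \<Rightarrow> real \<Rightarrow> real \<Rightarrow> real" where
  "fE flw c d g \<omega> lam t x = c (flw t \<omega>) + d (flw t \<omega>) * x + g (flw t \<omega>) x + lam"

definition bounded_sol :: "(real \<Rightarrow> real \<Rightarrow> real) \<Rightarrow> (real \<Rightarrow> real) \<Rightarrow> bool" where
  "bounded_sol f b \<longleftrightarrow> (\<forall>t. (b has_real_derivative f t (b t)) (at t)) \<and> bounded (range b)"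

definition lower_bsol :: "(real \<Rightarrow> real \<Rightarrow> real) \<Rightarrow> (real \<Rightarrow> real) \<Rightarrow> bool" where
  "lower_bsol f b \<longleftrightarrow> bounded_sol f b \<and> (\<forall>b'. bounded_sol f b' \<longrightarrow> (\<forall>t. b t \<le> b' t))"

definition upper_bsol :: "(real \<Rightarrow> real \<Rightarrow> real) \<Rightarrow> (real \<Rightarrow> real) \<Rightarrow> bool" where
  "upper_bsol f b \<longleftrightarrow> bounded_sol f b \<and> (\<forall>b'. bounded_sol f b' \<longrightarrow> (\<forall>t. b' t \<le> b t))"

definition attr_hyperbolic :: "(real \<Rightarrow> real \<Rightarrow> real) \<Rightarrow> (real \<Rightarrow> real) \<Rightarrow> bool" where
  "attr_hyperbolic f b \<longleftrightarrow> bounded_sol f b \<and> (\<exists>k\<ge>1. \<exists>\<gamma>>0. \<forall>s t. s \<le> t \<longrightarrow>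
     exp (integral {s..t} (\<lambda>r. deriv (f r) (b r))) \<le> k * exp (- \<gamma> * (t - s)))"

text \<open>For t \<le> s, the integral from s to t is minus the integral over [t,s].\<close>
definition rep_hyperbolic :: "(real \<Rightarrow> real \<Rightarrow> real) \<Rightarrow> (real \<Rightarrow> real) \<Rightarrow> bool" where
  "rep_hyperbolic f b \<longleftrightarrow> bounded_sol f b \<and> (\<exists>k\<ge>1. \<exists>\<gamma>>0. \<forall>s t. t \<le> s \<longrightarrow>
     exp (- integral {t..s} (\<lambda>r. deriv (f r) (b r))) \<le> k * exp (\<gamma> * (t - s)))"

definition hyperbolic :: "(real \<Rightarrow> real \<Rightarrow> real) \<Rightarrow> (real \<Rightarrow> real) \<Rightarrow> bool" where
  "hyperbolic f b \<longleftrightarrow> attr_hyperbolic f b \<or> rep_hyperbolic f b"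

definition unif_separated :: "(real \<Rightarrow> real) \<Rightarrow> (real \<Rightarrow> real) \<Rightarrow> bool" where
  "unif_separated b1 b2 \<longleftrightarrow> (\<exists>\<delta>>0. \<forall>t. \<delta> \<le> \<bar>b1 t - b2 t\<bar>)"

definition max_sol :: "(real \<Rightarrow> real \<Rightarrow> real) \<Rightarrow> real \<Rightarrow> real \<Rightarrow> ereal \<Rightarrow> ereal \<Rightarrow> (real \<Rightarrow> real) \<Rightarrow> bool" where
  "max_sol f s x0 \<alpha> \<beta> \<phi> \<longleftrightarrow> \<alpha> < ereal s \<and> ereal s < \<beta> \<and> \<phi> s = x0 \<and>
     (\<forall>t. \<alpha> < ereal t \<and> ereal t < \<beta> \<longrightarrow> (\<phi> has_real_derivative f t (\<phi> t)) (at t)) \<and>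
     (\<forall>\<alpha>' \<beta>' \<psi>. \<alpha>' < ereal s \<and> ereal s < \<beta>' \<and> \<psi> s = x0 \<and>
        (\<forall>t. \<alpha>' < ereal t \<and> ereal t < \<beta>' \<longrightarrow> (\<psi> has_real_derivative f t (\<psi> t)) (at t))
        \<longrightarrow> \<alpha> \<le> \<alpha>' \<and> \<beta>' \<le> \<beta>)"

definition lower_end :: "ereal \<Rightarrow> real filter" where
  "lower_end \<alpha> = (if \<alpha> = -\<infinity> then at_bot else at_right (real_of_ereal \<alpha>))"

definition upper_end :: "ereal \<Rightarrow> real filter" where
  "upper_end \<beta> = (if \<beta> = \<infinity> then at_top else at_left (real_of_ereal \<beta>))"

definition lam_minus :: "(real \<Rightarrow> 'w \<Rightarrow> 'w) \<Rightarrow> ('w \<Rightarrow> real) \<Rightarrow> ('w \<Rightarrow> real) \<Rightarrow> ('w \<Rightarrow> real \<Rightarrow> real)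
    \<Rightarrow> 'w \<Rightarrow> real" where
  "lam_minus flw c d g \<omega> = Inf {lam. \<exists>b. bounded_sol (fE flw c d g \<omega> lam) b}"

text \<open>The bounded equilibrium b_lambda of x' = c + d x + lambda.\<close>
definition bfrak :: "(real \<Rightarrow> 'w \<Rightarrow> 'w) \<Rightarrow> ('w \<Rightarrow> real) \<Rightarrow> ('w \<Rightarrow> real) \<Rightarrow> real \<Rightarrow> 'w \<Rightarrow> real" where
  "bfrak flw c d lam \<omega> =
     - integral {0..} (\<lambda>s. exp (- integral {0..s} (\<lambda>l. d (flw l \<omega>))) * (c (flw s \<omega>) + lam))"

end

theory Submission
  imports Defs
begin

text \<open>
  The hypotheses are integral conditions on ergodic measures; the differential equation only sees one
  orbit. The bridge is a uniform ergodic estimate: if \<open>H n\<close> is a decreasing sequence of continuous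
  functions and every ergodic measure gives some \<open>H n\<close> an integral below \<open>c\<close>, then a single \<open>H n\<close> has
  all its orbit averages below some \<open>K < c\<close>, uniformly over the base. Indeed the upper asymptotic mean is
  a sublinear functional on the continuous functions; by Zorn's lemma there is an extreme linear functional
  below it, which by Riesz representation is an ergodic measure.

  Along one orbit this yields that (1) the linear part has an exponential dichotomy, (2) the failure of
  concavity is small in the mean, and (3) strict concavity and negativity of \<open>g\<close> contribute a positive
  amount in the mean. For two uniformly separated solutions \<open>b1 < b2\<close> the difference quotient of the field
  is the logarithmic derivative of \<open>b2 - b1\<close>, hence has bounded integrals, while the derivatives at \<open>b1\<close>
  and \<open>b2\<close> lie above and below it up to (2), with a gain from (3). So uniformly separated solutions are
  hyperbolic, with uniform constants.

  The rest is a one-parameter comparison argument. Solutions above a constant barrier blow up backwards,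
  solutions below the bounded solution of the linear equation blow up forwards, so a bounded subsolution
  forces bounded solutions on both sides of it. Hence the parameters with bounded solutions form a closed
  half-line; above its end point the extreme bounded solutions are separated and so hyperbolic, and
  hyperbolicity persists for smaller parameters, which rules it out at the end point. The symmetry
  \<open>x(t) \<mapsto> - x(- t)\<close> halves the work.
\<close>

section \<open>Extreme linear functionals below a sublinear one\<close>

definition sublinear_fun :: "('a \<Rightarrow> real) set \<Rightarrow> (('a \<Rightarrow> real) \<Rightarrow> real) \<Rightarrow> bool" where
  "sublinear_fun V q \<longleftrightarrow> (\<forall>f\<in>V. \<forall>g\<in>V. q (\<lambda>x. f x + g x) \<le> q f + q g) \<and>
     (\<forall>f\<in>V. \<forall>k\<ge>0. q (\<lambda>x. k * f x) = k * q f)"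

definition linear_fun :: "('a \<Rightarrow> real) set \<Rightarrow> (('a \<Rightarrow> real) \<Rightarrow> real) \<Rightarrow> bool" where
  "linear_fun V L \<longleftrightarrow> (\<forall>f\<in>V. \<forall>g\<in>V. L (\<lambda>x. f x + g x) = L f + L g) \<and>
     (\<forall>f\<in>V. \<forall>k. L (\<lambda>x. k * f x) = k * L f)"

definition face_fun :: "('a \<Rightarrow> real) set \<Rightarrow> (('a \<Rightarrow> real) \<Rightarrow> real) \<Rightarrow> (('a \<Rightarrow> real) \<Rightarrow> real) \<Rightarrow> bool" where
  "face_fun V p q \<longleftrightarrow> sublinear_fun V q \<and> (\<forall>f\<in>V. q f \<le> p f) \<and>
     (\<forall>L1 L2 t. linear_fun V L1 \<longrightarrow> linear_fun V L2 \<longrightarrow> (\<forall>f\<in>V. L1 f \<le> p f \<and> L2 f \<le> p f) \<longrightarrow>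
        0 < t \<longrightarrow> t < 1 \<longrightarrow> (\<forall>f\<in>V. t * L1 f + (1 - t) * L2 f \<le> q f) \<longrightarrow> (\<forall>f\<in>V. L1 f \<le> q f))"

definition extreme_below :: "('a \<Rightarrow> real) set \<Rightarrow> (('a \<Rightarrow> real) \<Rightarrow> real) \<Rightarrow> (('a \<Rightarrow> real) \<Rightarrow> real) \<Rightarrow> bool" where
  "extreme_below V p L \<longleftrightarrow> (\<forall>L1 L2 t. linear_fun V L1 \<longrightarrow> linear_fun V L2 \<longrightarrow> (\<forall>g\<in>V. L1 g \<le> p g) \<longrightarrow>
     (\<forall>g\<in>V. L2 g \<le> p g) \<longrightarrow> 0 < t \<longrightarrow> t < 1 \<longrightarrow> (\<forall>g\<in>V. t * L1 g + (1 - t) * L2 g = L g) \<longrightarrow>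
     (\<forall>f\<in>V. L1 f = L f))"

lemma face_funD:
  assumes "face_fun V p q" "linear_fun V L1" "linear_fun V L2"
    "\<And>g. g \<in> V \<Longrightarrow> L1 g \<le> p g" "\<And>g. g \<in> V \<Longrightarrow> L2 g \<le> p g" "0 < t" "t < 1"
    "\<And>g. g \<in> V \<Longrightarrow> t * L1 g + (1 - t) * L2 g \<le> q g" "f \<in> V"
  shows "L1 f \<le> q f"
  using assms unfolding face_fun_def by auto

locale fun_space =
  fixes V :: "('a \<Rightarrow> real) set"
  assumes V_add: "f \<in> V \<Longrightarrow> g \<in> V \<Longrightarrow> (\<lambda>x. f x + g x) \<in> V"
    and V_scale: "f \<in> V \<Longrightarrow> (\<lambda>x. k * f x) \<in> V"
    and V_zero: "(\<lambda>x. 0) \<in> V"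
begin

lemma V_uminus: "f \<in> V \<Longrightarrow> (\<lambda>x. - f x) \<in> V"
  using V_scale[of f "-1"] by simp

lemma V_diff: "f \<in> V \<Longrightarrow> g \<in> V \<Longrightarrow> (\<lambda>x. f x - g x) \<in> V"
  using V_add[OF _ V_uminus] by simp

lemma sublinear_zero: "sublinear_fun V q \<Longrightarrow> q (\<lambda>x. 0) = 0"
  unfolding sublinear_fun_def using V_zero by force

lemma sublinear_add: "sublinear_fun V q \<Longrightarrow> f \<in> V \<Longrightarrow> g \<in> V \<Longrightarrow> q (\<lambda>x. f x + g x) \<le> q f + q g"
  unfolding sublinear_fun_def by blast

lemma sublinear_scale: "sublinear_fun V q \<Longrightarrow> f \<in> V \<Longrightarrow> k \<ge> 0 \<Longrightarrow> q (\<lambda>x. k * f x) = k * q f"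
  unfolding sublinear_fun_def by blast

lemma sublinear_minus:
  assumes "sublinear_fun V q" "f \<in> V" shows "- q (\<lambda>x. - f x) \<le> q f"
  using sublinear_add[OF assms V_uminus[OF assms(2)]] sublinear_zero[OF assms(1)] by simp

lemma sublinear_odd_imp_linear:
  assumes q: "sublinear_fun V q" and odd: "\<And>f. f \<in> V \<Longrightarrow> q (\<lambda>x. - f x) = - q f"
  shows "linear_fun V q"
proof -
  have "q f + q g \<le> q (\<lambda>x. f x + g x)" if fg: "f \<in> V" "g \<in> V" for f g
    using sublinear_add[OF q V_uminus[OF fg(1)] V_uminus[OF fg(2)]] odd[OF fg(1)] odd[OF fg(2)]
      odd[OF V_add[OF fg]] by simp
  then have add: "q (\<lambda>x. f x + g x) = q f + q g" if "f \<in> V" "g \<in> V" for f g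
    using sublinear_add[OF q that] that by (simp add: order_antisym)
  have "q (\<lambda>x. k * f x) = k * q f" if f: "f \<in> V" for f k
  proof (cases "k \<ge> 0")
    case True then show ?thesis using sublinear_scale[OF q f] by simp
  next
    case False
    then have "q (\<lambda>x. (-k) * f x) = (-k) * q f" by (intro sublinear_scale[OF q f]) simp
    then show ?thesis using odd[OF V_scale[OF f, of k]] by simp
  qed
  then show ?thesis using add unfolding linear_fun_def by blast
qed

text \<open>The functionals below the new one are those below \<open>q\<close> that attain the largest possible
  value on every \<open>H n\<close>; as maximisers of affine functionals they form a face.\<close>

lemma subface_exists:
  assumes q: "face_fun V p q" and H: "\<And>n::nat. H n \<in> V"
    and dec: "\<And>n m. n \<le> m \<Longrightarrow> q (\<lambda>x. H m x - H n x) \<le> 0"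
    and C: "\<And>n. C \<le> q (H n)" and Cinf: "\<And>e. e > 0 \<Longrightarrow> \<exists>n. q (H n) < C + e"
  shows "\<exists>q'. face_fun V p q' \<and> (\<forall>f\<in>V. q' f \<le> q f) \<and> (\<forall>n. q' (\<lambda>x. - H n x) \<le> - C)"
proof -
  have ql: "sublinear_fun V q" and qp: "\<And>f. f \<in> V \<Longrightarrow> q f \<le> p f"
    using q unfolding face_fun_def by auto
  define A where "A f = {q (\<lambda>x. f x + t * H n x) - t * C | n t. t \<ge> 0}" for f
  define q' where "q' f = Inf (A f)" for f
  have lb: "- q (\<lambda>x. - f x) \<le> y" if f: "f \<in> V" and y: "y \<in> A f" for f y
  proof -
    obtain n t where t: "t \<ge> 0" and y: "y = q (\<lambda>x. f x + t * H n x) - t * C"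
      using y unfolding A_def by auto
    have "q (\<lambda>x. t * H n x) \<le> q (\<lambda>x. f x + t * H n x) + q (\<lambda>x. - f x)"
      using sublinear_add[OF ql V_add[OF f V_scale[OF H, of t n]] V_uminus[OF f]] by simp
    moreover have "q (\<lambda>x. t * H n x) \<ge> t * C"
      using sublinear_scale[OF ql H t] C[of n] t by (simp add: mult_left_mono)
    ultimately show ?thesis using y by linarith
  qed
  have bdd: "bdd_below (A f)" if "f \<in> V" for f using lb[OF that] by (rule bdd_belowI)
  have le: "q' f \<le> q (\<lambda>x. f x + t * H n x) - t * C" if "f \<in> V" "t \<ge> 0" for f t n
    unfolding q'_def by (rule cInf_lower[OF _ bdd[OF that(1)]]) (use that in \<open>auto simp: A_def\<close>)
  have ne: "A f \<noteq> {}" for f unfolding A_def by (auto intro: exI[of _ 0])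
  have ge: "z \<le> q' f" if "\<And>n t. t \<ge> 0 \<Longrightarrow> z \<le> q (\<lambda>x. f x + t * H n x) - t * C" for f z
    unfolding q'_def by (rule cInf_greatest[OF ne]) (use that in \<open>auto simp: A_def\<close>)
  have step: "q (\<lambda>x. f x + t * H m x) \<le> q (\<lambda>x. f x + t * H n x)" if f: "f \<in> V" and "t \<ge> 0" "n \<le> m" for f t n m
  proof -
    have "q (\<lambda>x. (f x + t * H n x) + t * (H m x - H n x)) \<le> q (\<lambda>x. f x + t * H n x) + q (\<lambda>x. t * (H m x - H n x))"
      by (intro sublinear_add[OF ql] V_add V_scale V_diff f H)
    moreover have "q (\<lambda>x. t * (H m x - H n x)) \<le> 0"
      using sublinear_scale[OF ql V_diff[OF H H] \<open>t \<ge> 0\<close>] dec[OF \<open>n \<le> m\<close>] \<open>t \<ge> 0\<close>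
      by (simp add: mult_nonneg_nonpos)
    ultimately show ?thesis by (simp add: algebra_simps)
  qed
  have sub: "q' (\<lambda>x. f x + g x) \<le> q' f + q' g" if f: "f \<in> V" and g: "g \<in> V" for f g
  proof -
    have "q' (\<lambda>x. f x + g x) - (q (\<lambda>x. g x + s * H m x) - s * C) \<le> q (\<lambda>x. f x + t * H n x) - t * C"
      if ts: "t \<ge> 0" "s \<ge> 0" for t s n m
    proof -
      define k where "k = max n m"
      have "q' (\<lambda>x. f x + g x) \<le> q (\<lambda>x. (f x + g x) + (t + s) * H k x) - (t + s) * C"
        by (rule le) (use f g ts V_add in auto)
      also have "(\<lambda>x. (f x + g x) + (t + s) * H k x) = (\<lambda>x. (f x + t * H k x) + (g x + s * H k x))"
        by (auto simp: algebra_simps)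
      also have "q \<dots> \<le> q (\<lambda>x. f x + t * H k x) + q (\<lambda>x. g x + s * H k x)"
        by (intro sublinear_add[OF ql] V_add V_scale f g H)
      also have "q (\<lambda>x. f x + t * H k x) \<le> q (\<lambda>x. f x + t * H n x)"
        by (rule step) (use f ts in \<open>auto simp: k_def\<close>)
      also have "q (\<lambda>x. g x + s * H k x) \<le> q (\<lambda>x. g x + s * H m x)"
        by (rule step) (use g ts in \<open>auto simp: k_def\<close>)
      finally show ?thesis by (simp add: algebra_simps)
    qed
    then have "q' (\<lambda>x. f x + g x) - (q (\<lambda>x. g x + s * H m x) - s * C) \<le> q' f" if "s \<ge> 0" for s m
      by (intro ge) (use that in auto)
    then have "q' (\<lambda>x. f x + g x) - q' f \<le> q' g"
      by (intro ge) (force simp: algebra_simps)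
    then show ?thesis by simp
  qed
  have q'q: "q' f \<le> q f" if "f \<in> V" for f using le[OF that, of 0] by simp
  have zero: "q' (\<lambda>x. 0) = 0"
  proof (rule antisym)
    show "q' (\<lambda>x. 0) \<le> 0" using q'q[OF V_zero] sublinear_zero[OF ql] by simp
    show "0 \<le> q' (\<lambda>x. 0)"
      unfolding q'_def by (rule cInf_greatest[OF ne]) (use lb[OF V_zero] sublinear_zero[OF ql] in auto)
  qed
  have scale: "q' (\<lambda>x. k * f x) = k * q' f" if f: "f \<in> V" and "k \<ge> 0" for f k
  proof (cases "k = 0")
    case True then show ?thesis using zero by simp
  next
    case False
    then have k: "k > 0" using \<open>k \<ge> 0\<close> by simp
    have *: "q' (\<lambda>x. k * f x) \<le> k * q' f" if f: "f \<in> V" and k: "k > 0" for f k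
    proof -
      have "q' (\<lambda>x. k * f x) / k \<le> q' f"
      proof (rule ge)
        fix n and t :: real assume t: "t \<ge> 0"
        have "q' (\<lambda>x. k * f x) \<le> q (\<lambda>x. k * f x + (k * t) * H n x) - (k * t) * C"
          by (rule le) (use t k f V_scale in auto)
        also have "(\<lambda>x. k * f x + (k * t) * H n x) = (\<lambda>x. k * (f x + t * H n x))"
          by (auto simp: algebra_simps)
        also have "q \<dots> = k * q (\<lambda>x. f x + t * H n x)"
          by (rule sublinear_scale[OF ql]) (use k in \<open>auto intro!: V_add V_scale f H\<close>)
        finally show "q' (\<lambda>x. k * f x) / k \<le> q (\<lambda>x. f x + t * H n x) - t * C"
          using k by (simp add: field_simps)
      qed
      then show ?thesis using k by (simp add: field_simps)
    qed
    have "q' (\<lambda>x. (1/k) * (k * f x)) \<le> (1/k) * q' (\<lambda>x. k * f x)"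
      by (rule *) (use k f V_scale in auto)
    then have "k * q' f \<le> q' (\<lambda>x. k * f x)" using k by (simp add: field_simps)
    with *[OF f k] show ?thesis by simp
  qed
  have sl: "sublinear_fun V q'" unfolding sublinear_fun_def using sub scale by blast
  have neg: "q' (\<lambda>x. - H n x) \<le> - C" for n
    using le[OF V_uminus[OF H[of n]], of 1 n] sublinear_zero[OF ql] by simp
  have face: "L1 f \<le> q' f" if L: "linear_fun V L1" "linear_fun V L2" "\<forall>f\<in>V. L1 f \<le> p f \<and> L2 f \<le> p f"
      and t: "0 < t" "t < 1" and c: "\<forall>f\<in>V. t * L1 f + (1 - t) * L2 f \<le> q' f" and f: "f \<in> V" for L1 L2 t f
  proof -
    have cq: "\<forall>f\<in>V. t * L1 f + (1 - t) * L2 f \<le> q f" using c q'q by (meson order_trans)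
    have 1: "\<forall>f\<in>V. L1 f \<le> q f" using face_funD[OF q L(1,2) _ _ t] L(3) cq by blast
    have cq': "\<forall>f\<in>V. (1 - t) * L2 f + (1 - (1 - t)) * L1 f \<le> q f" using cq by (simp add: algebra_simps)
    have t': "0 < 1 - t" "1 - t < 1" using t by auto
    have 2: "\<forall>f\<in>V. L2 f \<le> q f" using face_funD[OF q L(2,1) _ _ t'] L(3) cq' by blast
    have Lneg: "L1 (\<lambda>x. - g x) = - L1 g" "L2 (\<lambda>x. - g x) = - L2 g" if "g \<in> V" for g
    proof -
      have "L1 (\<lambda>x. (-1) * g x) = (-1) * L1 g" "L2 (\<lambda>x. (-1) * g x) = (-1) * L2 g"
        using L that unfolding linear_fun_def by blast+
      then show "L1 (\<lambda>x. - g x) = - L1 g" "L2 (\<lambda>x. - g x) = - L2 g" by simp_all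
    qed
    have comb: "C \<le> t * L1 (H n) + (1 - t) * L2 (H n)" for n
    proof -
      have "t * L1 (\<lambda>x. - H n x) + (1 - t) * L2 (\<lambda>x. - H n x) \<le> q' (\<lambda>x. - H n x)"
        using c V_uminus[OF H] by blast
      then have "- (t * L1 (H n) + (1 - t) * L2 (H n)) \<le> - C"
        using neg[of n] Lneg[OF H[of n]] by (simp add: algebra_simps)
      then show ?thesis by simp
    qed
    have L1H: "C \<le> L1 (H n)" for n
    proof (rule ccontr)
      assume "\<not> C \<le> L1 (H n)"
      define e where "e = C - L1 (H n)"
      have e: "e > 0" using \<open>\<not> C \<le> L1 (H n)\<close> by (simp add: e_def)
      obtain m where m: "q (H m) < C + t * e" using Cinf[of "t * e"] e t by auto
      define k where "k = max n m"
      have mono: "L (H k) \<le> L (H j)" if "linear_fun V L" "\<forall>f\<in>V. L f \<le> q f" "j \<le> k" for L j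
      proof -
        have "L (\<lambda>x. H k x + (-1) * H j x) = L (H k) + (-1) * L (H j)"
          using that(1) H V_scale unfolding linear_fun_def by metis
        moreover have "L (\<lambda>x. H k x - H j x) \<le> q (\<lambda>x. H k x - H j x)" using that(2) V_diff[OF H H] by blast
        ultimately show ?thesis using dec[OF that(3)] by simp
      qed
      have a: "L1 (H k) \<le> C - e" using mono[OF L(1) 1, of n] e_def by (simp add: k_def)
      have "L2 (H k) \<le> L2 (H m)" using mono[OF L(2) 2, of m] by (simp add: k_def)
      also have "\<dots> < C + t * e" using 2 H[of m] m by (meson le_less_trans)
      finally have b: "L2 (H k) < C + t * e" .
      have "t * L1 (H k) \<le> t * (C - e)" using a t by simp
      moreover have "(1 - t) * L2 (H k) < (1 - t) * (C + t * e)" using b t by simp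
      ultimately have "t * L1 (H k) + (1 - t) * L2 (H k) < t * (C - e) + (1 - t) * (C + t * e)" by simp
      also have "\<dots> = C - t * t * e" by (simp add: algebra_simps)
      also have "\<dots> \<le> C" using e t by simp
      finally show False using comb[of k] by simp
    qed
    show "L1 f \<le> q' f"
    proof (rule ge)
      fix n and s :: real assume s: "s \<ge> 0"
      have "L1 (\<lambda>x. f x + s * H n x) = L1 f + s * L1 (H n)"
        using L(1) f V_scale[OF H] H unfolding linear_fun_def by metis
      moreover have "L1 (\<lambda>x. f x + s * H n x) \<le> q (\<lambda>x. f x + s * H n x)" using 1 V_add[OF f V_scale[OF H]] by blast
      moreover have "s * C \<le> s * L1 (H n)" using L1H[of n] s by (simp add: mult_left_mono)
      ultimately show "L1 f \<le> q (\<lambda>x. f x + s * H n x) - s * C" by linarith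
    qed
  qed
  have "face_fun V p q'" unfolding face_fun_def using sl q'q qp face by (meson order_trans)
  then show ?thesis using q'q neg by blast
qed

theorem extreme_functional_exists:
  assumes p: "sublinear_fun V p" and H: "\<And>n::nat. H n \<in> V"
    and dec: "\<And>n m. n \<le> m \<Longrightarrow> p (\<lambda>x. H m x - H n x) \<le> 0" and c: "\<And>n. c \<le> p (H n)"
  shows "\<exists>L. linear_fun V L \<and> (\<forall>f\<in>V. L f \<le> p f) \<and> (\<forall>n. c \<le> L (H n)) \<and> extreme_below V p L"
proof -
  have pface: "face_fun V p p" using p unfolding face_fun_def by auto
  define C where "C = (INF n. p (H n))"
  have bdd: "bdd_below (range (\<lambda>n. p (H n)))" using c by (rule bdd_belowI2)
  have "\<exists>q. face_fun V p q \<and> (\<forall>f\<in>V. q f \<le> p f) \<and> (\<forall>n. q (\<lambda>x. - H n x) \<le> - C)"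
  proof (rule subface_exists[OF pface H dec])
    show "C \<le> p (H n)" for n unfolding C_def by (rule cINF_lower[OF bdd]) simp
    show "\<exists>n. p (H n) < C + e" if "e > 0" for e
    proof -
      have "(INF n. p (H n)) < C + e" using that by (simp add: C_def)
      then show ?thesis using cINF_less_iff[OF _ bdd] by auto
    qed
  qed
  then obtain q0 where q0: "face_fun V p q0" "\<And>n. q0 (\<lambda>x. - H n x) \<le> - C" by blast
  have cC: "c \<le> C" unfolding C_def by (rule cINF_greatest) (use c in auto)
  define \<F> where "\<F> = {q. (\<forall>f. f \<notin> V \<longrightarrow> q f = 0) \<and> face_fun V p q \<and> (\<forall>n. q (\<lambda>x. - H n x) \<le> - C)}"
  define ext where "ext q f = (if f \<in> V then q f else 0)" for q :: "('a \<Rightarrow> real) \<Rightarrow> real" and f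
  have ext_face: "face_fun V p (ext q)" if "face_fun V p q" for q
    using that V_add V_scale unfolding face_fun_def sublinear_fun_def ext_def by auto
  have ext_in: "ext q \<in> \<F>" if "face_fun V p q" "\<And>n. q (\<lambda>x. - H n x) \<le> - C" for q
    using ext_face[OF that(1)] that(2) V_uminus[OF H] unfolding \<F>_def ext_def by auto
  have "\<exists>m\<in>\<F>. \<forall>a\<in>\<F>. m \<ge> a \<longrightarrow> a = m"
  proof (rule predicate_Zorn)
    show "partial_order_on \<F> (relation_of (\<ge>) \<F>)"
      unfolding partial_order_on_def preorder_on_def relation_of_def refl_on_def trans_def antisym_def by auto
    fix K assume K: "K \<in> Chains (relation_of (\<ge>) \<F>)"
    then have KF: "K \<subseteq> \<F>" and tot: "\<And>a b. a \<in> K \<Longrightarrow> b \<in> K \<Longrightarrow> a \<le> b \<or> b \<le> a"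
      unfolding Chains_def relation_of_def by auto
    show "\<exists>u\<in>\<F>. \<forall>a\<in>K. a \<ge> u"
    proof (cases "K = {}")
      case True then show ?thesis using ext_in[OF q0] by blast
    next
      case False
      have Kface: "face_fun V p q" "sublinear_fun V q" if "q \<in> K" for q
        using that KF unfolding \<F>_def face_fun_def by auto
      have Kp: "q f \<le> p f" if "q \<in> K" "f \<in> V" for q f
        using Kface(1)[OF that(1)] that(2) unfolding face_fun_def by blast
      have lb: "- p (\<lambda>x. - f x) \<le> q f" if "q \<in> K" "f \<in> V" for q f
        using sublinear_minus[OF Kface(2)[OF that(1)] that(2)] Kp[OF that(1) V_uminus[OF that(2)]] by linarith
      define u where "u f = (INF q\<in>K. q f)" for f
      have bdd: "bdd_below ((\<lambda>q. q f) ` K)" for f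
      proof (cases "f \<in> V")
        case True show ?thesis by (rule bdd_belowI2) (rule lb[OF _ True])
      next
        case False
        then have "0 \<le> q f" if "q \<in> K" for q using that KF unfolding \<F>_def by auto
          then show ?thesis by (rule bdd_belowI2)
      qed
      have ule: "u f \<le> q f" if "q \<in> K" for q f unfolding u_def by (rule cINF_lower[OF bdd that])
      have uge: "z \<le> u f" if "\<And>q. q \<in> K \<Longrightarrow> z \<le> q f" for z f
        unfolding u_def by (rule cINF_greatest[OF False that])
      have sub: "u (\<lambda>x. f x + g x) \<le> u f + u g" if fg: "f \<in> V" "g \<in> V" for f g
      proof -
        have *: "u (\<lambda>x. f x + g x) - q1 f \<le> q2 g" if K12: "q1 \<in> K" "q2 \<in> K" for q1 q2
        proof -
          obtain q where q: "q \<in> K" "q \<le> q1" "q \<le> q2" using tot[OF K12] K12 by auto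
          have "u (\<lambda>x. f x + g x) \<le> q (\<lambda>x. f x + g x)" by (rule ule[OF q(1)])
          also have "\<dots> \<le> q f + q g" by (rule sublinear_add[OF Kface(2)[OF q(1)] fg])
          also have "\<dots> \<le> q1 f + q2 g" using q by (simp add: le_fun_def add_mono)
          finally show ?thesis by simp
        qed
        have **: "u (\<lambda>x. f x + g x) - q1 f \<le> u g" if "q1 \<in> K" for q1 by (rule uge) (rule *[OF that])
        have "u (\<lambda>x. f x + g x) - u g \<le> u f"
        proof (rule uge)
          fix q assume "q \<in> K"
          from **[OF this] show "u (\<lambda>x. f x + g x) - u g \<le> q f" by simp
        qed
        then show ?thesis by simp
      qed
      have scale: "u (\<lambda>x. k * f x) = k * u f" if f: "f \<in> V" and k: "k \<ge> 0" for f k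
      proof (cases "k = 0")
        case True
        have "u (\<lambda>x. 0) = 0"
        proof -
          have "(\<lambda>q. q (\<lambda>x. 0)) ` K = (\<lambda>q. 0) ` K"
            by (rule image_cong[OF refl]) (rule sublinear_zero[OF Kface(2)])
          then show ?thesis unfolding u_def using False by simp
        qed
        then show ?thesis using True by simp
      next
        case False
        then have k: "k > 0" using k by simp
        have s: "q (\<lambda>x. k * f x) = k * q f" if "q \<in> K" for q
          using sublinear_scale[OF Kface(2)[OF that] f] k by simp
        show ?thesis
        proof (rule antisym)
          have "u (\<lambda>x. k * f x) / k \<le> u f"
          proof (rule uge)
            fix q assume "q \<in> K"
            from ule[OF this, of "\<lambda>x. k * f x"] s[OF this] k show "u (\<lambda>x. k * f x) / k \<le> q f"
              by (simp add: field_simps)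
          qed
          then show "u (\<lambda>x. k * f x) \<le> k * u f" using k by (simp add: field_simps)
          show "k * u f \<le> u (\<lambda>x. k * f x)"
          proof (rule uge)
            fix q assume "q \<in> K"
            from ule[OF this, of f] s[OF this] k show "k * u f \<le> q (\<lambda>x. k * f x)"
              by (simp add: mult_left_mono)
          qed
        qed
      qed
      have uface: "face_fun V p u"
        unfolding face_fun_def
      proof (intro conjI allI impI ballI)
        show "sublinear_fun V u" unfolding sublinear_fun_def using sub scale by blast
        show "u f \<le> p f" if "f \<in> V" for f
        proof -
          obtain q where "q \<in> K" using False by blast
          from ule[OF this, of f] Kp[OF this that] show ?thesis by simp
        qed
        fix L1 L2 t f
        assume L: "linear_fun V L1" "linear_fun V L2" "\<forall>f\<in>V. L1 f \<le> p f \<and> L2 f \<le> p f" "0 < t" "t < 1"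
          "\<forall>f\<in>V. t * L1 f + (1 - t) * L2 f \<le> u f" "f \<in> V"
        show "L1 f \<le> u f"
        proof (rule uge)
          fix q assume "q \<in> K"
          have "t * L1 g + (1 - t) * L2 g \<le> q g" if "g \<in> V" for g
            using bspec[OF L(6) that] ule[OF \<open>q \<in> K\<close>, of g] by simp
          then show "L1 f \<le> q f" using face_funD[OF Kface(1)[OF \<open>q \<in> K\<close>] L(1,2) _ _ L(4,5)] L(3,7) by blast
        qed
      qed
      have "u \<in> \<F>"
      proof -
        have "u f = 0" if "f \<notin> V" for f
        proof -
          have "(\<lambda>q. q f) ` K = (\<lambda>q. 0) ` K"
            by (rule image_cong[OF refl]) (use KF that in \<open>auto simp: \<F>_def\<close>)
          then show ?thesis unfolding u_def using False by simp
        qed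
        moreover have "u (\<lambda>x. - H n x) \<le> - C" for n
        proof -
          obtain q where "q \<in> K" using False by blast
          then have "q (\<lambda>x. - H n x) \<le> - C" using KF unfolding \<F>_def by blast
          then show ?thesis using ule[OF \<open>q \<in> K\<close>, of "\<lambda>x. - H n x"] by simp
        qed
        ultimately show ?thesis using uface unfolding \<F>_def by blast
      qed
      then show ?thesis using ule by (auto simp: le_fun_def)
    qed
  qed
  then obtain L where L: "L \<in> \<F>" and min: "\<And>a. a \<in> \<F> \<Longrightarrow> a \<le> L \<Longrightarrow> a = L" by blast
  have Lf: "face_fun V p L" and Ls: "sublinear_fun V L" and LH: "L (\<lambda>x. - H n x) \<le> - C" for n
    using L unfolding \<F>_def face_fun_def by auto
  have odd: "L (\<lambda>x. - f x) = - L f" if f: "f \<in> V" for f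
  proof -
    have "\<exists>q'. face_fun V p q' \<and> (\<forall>g\<in>V. q' g \<le> L g) \<and> (\<forall>n::nat. q' (\<lambda>x. - f x) \<le> - L f)"
      by (rule subface_exists[OF Lf, of "\<lambda>_. f"]) (use f sublinear_zero[OF Ls] in auto)
    then obtain q' where q': "face_fun V p q'" "\<forall>g\<in>V. q' g \<le> L g" "q' (\<lambda>x. - f x) \<le> - L f" by blast
    have "q' (\<lambda>x. - H n x) \<le> - C" for n using bspec[OF q'(2) V_uminus[OF H[of n]]] LH[of n] by simp
    then have "ext q' \<in> \<F>" by (rule ext_in[OF q'(1)])
    moreover have "ext q' \<le> L" using q'(2) L unfolding ext_def \<F>_def le_fun_def by auto
    ultimately have "ext q' = L" by (rule min)
    then have "L (\<lambda>x. - f x) = q' (\<lambda>x. - f x)" using V_uminus[OF f] by (auto simp: ext_def)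
    then have "L (\<lambda>x. - f x) \<le> - L f" using q'(3) by simp
    then show ?thesis using sublinear_minus[OF Ls f] by simp
  qed
  have lin: "linear_fun V L" by (rule sublinear_odd_imp_linear[OF Ls odd])
  show ?thesis
    unfolding extreme_below_def
  proof (intro exI[of _ L] conjI lin allI impI ballI)
    show "L f \<le> p f" if "f \<in> V" for f using Lf that unfolding face_fun_def by blast
    show "c \<le> L (H n)" for n using LH[of n] odd[OF H[of n]] cC by simp
    fix L1 L2 t f
    assume A: "linear_fun V L1" "linear_fun V L2" "\<forall>g\<in>V. L1 g \<le> p g"
       "\<forall>g\<in>V. L2 g \<le> p g" "0 < t" "t < 1"
       "\<forall>g\<in>V. t * L1 g + (1 - t) * L2 g = L g" "f \<in> V"
    have "\<forall>g\<in>V. t * L1 g + (1 - t) * L2 g \<le> L g" using A(7) by simp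
    then have le: "\<forall>g\<in>V. L1 g \<le> L g" using face_funD[OF Lf A(1,2) _ _ A(5,6)] A(3,4) by blast
    have "L1 (\<lambda>x. (-1) * f x) = (-1) * L1 f" using A(1,8) unfolding linear_fun_def by blast
    then have "- L1 f \<le> - L f" using bspec[OF le V_uminus[OF A(8)]] odd[OF A(8)] by simp
    then show "L1 f = L f" using bspec[OF le A(8)] by simp
  qed
qed

end

section \<open>Riesz representation\<close>

lemma fun_space_continuous_on: "fun_space {f. continuous_on \<Omega> f}"
  by unfold_locales (auto intro!: continuous_intros)

lemma openin_positivity_set:
  fixes \<Omega> :: "'a::metric_space set"
  assumes "openin (top_of_set \<Omega>) U"
  obtains h :: "'a \<Rightarrow> real" where "continuous_on \<Omega> h" "\<And>x. 0 \<le> h x" "\<And>x. x \<in> \<Omega> \<Longrightarrow> x \<in> U \<longleftrightarrow> 0 < h x"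
proof (cases "\<Omega> - U = {}")
  case True
  show ?thesis by (rule that[of "\<lambda>_. 1"]) (use True in auto)
next
  case False
  obtain W where W: "open W" "U = \<Omega> \<inter> W" using assms by (auto simp: openin_open)
  have "closed (- W)" using W by auto
  have ne: "- W \<noteq> {}" using False W by auto
  show ?thesis
  proof (rule that[of "\<lambda>x. infdist x (- W)"])
    show "continuous_on \<Omega> (\<lambda>x. infdist x (- W))" by (intro continuous_intros)
    show "x \<in> U \<longleftrightarrow> 0 < infdist x (- W)" if "x \<in> \<Omega>" for x
      using in_closed_iff_infdist_zero[OF \<open>closed (- W)\<close> ne, of x] infdist_nonneg[of x "- W"] W that
      by (auto simp: less_le)
  qed (simp add: infdist_nonneg)
qed

lemma sum_clamp_eq: "0 \<le> y \<Longrightarrow> (\<Sum>k<n. min 1 (max 0 (y - real k))) = min y (real n)"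
  by (induction n) (auto simp: min_def max_def)

lemma sum_less_count_le: "0 \<le> y \<Longrightarrow> (\<Sum>k<n. if real k < y then 1 else 0) \<le> min (real n) (y + 1 :: real)"
  by (induction n) (auto simp: min_def split: if_splits)

lemma sets_restrict_borel_sigma:
  assumes "compact (\<Omega> :: 'a::metric_space set)"
  shows "sets (restrict_space borel \<Omega>) = sigma_sets \<Omega> {U. openin (top_of_set \<Omega>) U}"
proof -
  have "sets (restrict_space borel \<Omega>) = sigma_sets \<Omega> ((\<inter>) \<Omega> ` {S. open S})"
    using sigma_sets_Int[of \<Omega> UNIV "{S. open S}"] borel_closed[OF compact_imp_closed[OF assms]]
    unfolding sets_restrict_space borel_def by (simp add: sets_measure_of)
  also have "(\<inter>) \<Omega> ` {S. open S} = {U. openin (top_of_set \<Omega>) U}" by (auto simp: openin_open)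
  finally show ?thesis .
qed

locale positive_functional =
  fixes \<Omega> :: "'a::metric_space set" and L :: "('a \<Rightarrow> real) \<Rightarrow> real"
  assumes comp: "compact \<Omega>" and lin: "linear_fun {f. continuous_on \<Omega> f} L"
    and pos: "continuous_on \<Omega> f \<Longrightarrow> (\<And>x. x \<in> \<Omega> \<Longrightarrow> 0 \<le> f x) \<Longrightarrow> 0 \<le> L f"
    and one: "L (\<lambda>x. 1) = 1"
begin

lemma L_add: "continuous_on \<Omega> f \<Longrightarrow> continuous_on \<Omega> g \<Longrightarrow> L (\<lambda>x. f x + g x) = L f + L g"
  using lin unfolding linear_fun_def by simp

lemma L_scale: "continuous_on \<Omega> f \<Longrightarrow> L (\<lambda>x. k * f x) = k * L f"
  using lin unfolding linear_fun_def by simp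

lemma L_const: "L (\<lambda>x. k) = k"
  using L_scale[of "\<lambda>x. 1" k] one by simp

lemma L_mono:
  assumes "continuous_on \<Omega> f" "continuous_on \<Omega> g" "\<And>x. x \<in> \<Omega> \<Longrightarrow> f x \<le> g x"
  shows "L f \<le> L g"
proof -
  have "0 \<le> L (\<lambda>x. g x + (-1) * f x)" using assms by (intro pos) (auto intro!: continuous_intros)
  also have "\<dots> = L g + (-1) * L f"
    using assms L_scale[of f "-1"] by (subst L_add) (auto intro!: continuous_intros)
  finally show ?thesis by simp
qed

lemma L_sum: "finite I \<Longrightarrow> (\<And>i. i \<in> I \<Longrightarrow> continuous_on \<Omega> (f i)) \<Longrightarrow> L (\<lambda>x. \<Sum>i\<in>I. f i x) = (\<Sum>i\<in>I. L (f i))"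
proof (induction I rule: finite_induct)
  case empty then show ?case using L_const[of 0] by simp
next
  case (insert i I)
  then show ?case using L_add[of "f i" "\<lambda>x. \<Sum>i\<in>I. f i x"] by (auto intro!: continuous_intros)
qed

definition sub_ind :: "'a set \<Rightarrow> ('a \<Rightarrow> real) set" where
  "sub_ind U = {f. continuous_on \<Omega> f \<and> (\<forall>x\<in>\<Omega>. 0 \<le> f x \<and> f x \<le> 1 \<and> (x \<notin> U \<longrightarrow> f x = 0))}"

definition content :: "'a set \<Rightarrow> real" where "content U = Sup (L ` sub_ind U)"

definition outer :: "'a set \<Rightarrow> real" where
  "outer A = Inf (content ` {U. openin (top_of_set \<Omega>) U \<and> A \<subseteq> U})"

lemma sub_ind_le1: "f \<in> sub_ind U \<Longrightarrow> L f \<le> 1"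
  using L_mono[of f "\<lambda>_. 1"] one unfolding sub_ind_def by auto

lemma zero_sub_ind: "(\<lambda>_. 0) \<in> sub_ind U"
  unfolding sub_ind_def by auto

lemma content_ge: "f \<in> sub_ind U \<Longrightarrow> L f \<le> content U"
  unfolding content_def using sub_ind_le1 by (intro cSup_upper) (auto intro!: bdd_aboveI2)

lemma content_le: "(\<And>f. f \<in> sub_ind U \<Longrightarrow> L f \<le> z) \<Longrightarrow> content U \<le> z"
  unfolding content_def using zero_sub_ind[of U] by (intro cSup_least) auto

lemma content_approx: "z < content U \<Longrightarrow> \<exists>f\<in>sub_ind U. z < L f"
  using content_le[of U z] by force

lemma content_nonneg: "0 \<le> content U"
  using content_ge[OF zero_sub_ind[of U]] L_const[of 0] by simp

lemma content_mono: "U \<subseteq> W \<Longrightarrow> content U \<le> content W"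
  by (rule content_le, rule content_ge) (auto simp: sub_ind_def)

lemma content_empty: "content {} \<le> 0"
  by (rule content_le) (use L_mono[of _ "\<lambda>_. 0"] L_const[of 0] in \<open>auto simp: sub_ind_def\<close>)

lemma content_space: "content \<Omega> = 1"
proof (rule antisym)
  show "content \<Omega> \<le> 1" by (rule content_le) (rule sub_ind_le1)
  have "(\<lambda>_. 1) \<in> sub_ind \<Omega>" unfolding sub_ind_def by auto
  then show "1 \<le> content \<Omega>" using content_ge one by metis
qed

lemma content_subadditive:
  assumes U: "\<And>n::nat. openin (top_of_set \<Omega>) (U n)" and e: "e > 0" and f: "f \<in> sub_ind (\<Union>n. U n)"
  shows "\<exists>N. L f \<le> e + (\<Sum>n<N. content (U n))"
proof -
  have "\<exists>h. continuous_on \<Omega> h \<and> (\<forall>x. 0 \<le> h x) \<and> (\<forall>x\<in>\<Omega>. x \<in> U n \<longleftrightarrow> 0 < (h x::real))" for n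
    using openin_positivity_set[OF U[of n]] by metis
  then obtain h where h: "\<And>n. continuous_on \<Omega> (h n)" "\<And>n x. 0 \<le> h n x"
    "\<And>n x. x \<in> \<Omega> \<Longrightarrow> x \<in> U n \<longleftrightarrow> 0 < (h n x::real)" by metis
  have fc: "continuous_on \<Omega> f" using f unfolding sub_ind_def by auto
  define K where "K = {x\<in>\<Omega>. e \<le> f x}"
  have Kc: "compact K"
  proof -
    have "K = \<Omega> \<inter> f -` {e..}" unfolding K_def by auto
    then have "closedin (top_of_set \<Omega>) K" using continuous_closedin_preimage[OF fc, of "{e..}"] by simp
    then show ?thesis using comp closedin_compact by blast
  qed
  have "\<exists>N. \<forall>x\<in>K. \<exists>n<N. real N * h n x > 1"
  proof (rule ccontr)
    assume "\<not> ?thesis"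
    then have "\<forall>N. \<exists>x. x \<in> K \<and> (\<forall>n<N. real N * h n x \<le> 1)" by (meson not_le)
    then obtain x where x: "\<And>N. x N \<in> K" "\<And>N n. n < N \<Longrightarrow> real N * h n (x N) \<le> 1" by metis
    obtain l r where l: "l \<in> K" "strict_mono r" "(x \<circ> r) \<longlonglongrightarrow> l"
      using Kc x(1) unfolding compact_def by metis
    have lO: "l \<in> \<Omega>" and "f l \<noteq> 0" using l e unfolding K_def by auto
    then obtain n where n: "l \<in> U n" using f unfolding sub_ind_def by auto
    then have hl: "0 < h n l" using h(3)[OF lO] by simp
    have "(\<lambda>k. h n ((x \<circ> r) k)) \<longlonglongrightarrow> h n l"
      by (rule continuous_on_tendsto_compose[OF h(1)[of n] l(3) lO]) (use x(1) in \<open>auto simp: K_def\<close>)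
    then have "\<forall>\<^sub>F k in sequentially. h n ((x \<circ> r) k) > h n l / 2"
      using hl by (intro order_tendstoD) auto
    moreover have "\<forall>\<^sub>F k in sequentially. real k > max (real n) (2 / h n l)"
      using filterlim_real_sequentially unfolding filterlim_at_top_dense by blast
    ultimately have "\<forall>\<^sub>F k in sequentially. False"
    proof eventually_elim
      case (elim k)
      have "k \<le> r k" using seq_suble[OF l(2)] .
      then have rk: "n < r k" "real (r k) > 2 / h n l" using elim(2) by linarith+
      have "1 < real (r k) * (h n l / 2)" using rk(2) hl by (simp add: field_simps)
      also have "\<dots> \<le> real (r k) * h n (x (r k))" using elim(1) by (intro mult_left_mono) auto
      also have "\<dots> \<le> 1" by (rule x(2)[OF rk(1)])
      finally show False by simp
    qed
    then show False by simp
  qed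
  then obtain N where N: "\<And>x. x \<in> K \<Longrightarrow> \<exists>n<N. real N * h n x > 1" by blast
  define g where "g n x = min 1 (real N * h n x)" for n x
  have gc: "continuous_on \<Omega> (g n)" for n unfolding g_def by (intro continuous_intros h)
  have gs: "g n \<in> sub_ind (U n)" for n
    using gc[of n] h(2)[of n] h(3)[of _ n] unfolding sub_ind_def g_def by (auto simp: less_le)
  have "L f \<le> L (\<lambda>x. e + (\<Sum>n<N. g n x))"
  proof (rule L_mono[OF fc])
    show "continuous_on \<Omega> (\<lambda>x. e + (\<Sum>n<N. g n x))" by (intro continuous_intros gc)
    fix x assume x: "x \<in> \<Omega>"
    have g0: "0 \<le> g n x" for n unfolding g_def using h(2) by simp
    show "f x \<le> e + (\<Sum>n<N. g n x)"
    proof (cases "x \<in> K")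
      case True
      then obtain n where n: "n < N" "real N * h n x > 1" using N by blast
      then have "1 = g n x" unfolding g_def by simp
      also have "\<dots> \<le> (\<Sum>n<N. g n x)" using n g0 by (intro member_le_sum) auto
      finally show ?thesis using f x e unfolding sub_ind_def by force
    next
      case False
      then show ?thesis using x sum_nonneg[of "{..<N}" "\<lambda>n. g n x"] g0 unfolding K_def by force
    qed
  qed
  also have "\<dots> = e + (\<Sum>n<N. L (g n))"
    using L_add[of "\<lambda>_. e" "\<lambda>x. \<Sum>n<N. g n x"] L_sum[of "{..<N}" g] gc L_const
    by (auto intro!: continuous_intros)
  also have "\<dots> \<le> e + (\<Sum>n<N. content (U n))" using content_ge[OF gs] by (simp add: sum_mono)
  finally show ?thesis by blast
qed

lemma outer_le: "openin (top_of_set \<Omega>) U \<Longrightarrow> A \<subseteq> U \<Longrightarrow> outer A \<le> content U"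
  unfolding outer_def using content_nonneg by (intro cInf_lower) (auto intro!: bdd_belowI2[where m = 0])

lemma outer_ge:
  assumes "A \<subseteq> \<Omega>" "\<And>U. openin (top_of_set \<Omega>) U \<Longrightarrow> A \<subseteq> U \<Longrightarrow> z \<le> content U"
  shows "z \<le> outer A"
proof -
  have "openin (top_of_set \<Omega>) \<Omega>" by simp
  then show ?thesis unfolding outer_def using assms by (intro cInf_greatest) auto
qed

lemma outer_approx: "A \<subseteq> \<Omega> \<Longrightarrow> outer A < z \<Longrightarrow> \<exists>U. openin (top_of_set \<Omega>) U \<and> A \<subseteq> U \<and> content U < z"
  using outer_ge[of A z] by force

lemma outer_nonneg: "A \<subseteq> \<Omega> \<Longrightarrow> 0 \<le> outer A"
  by (rule outer_ge) (auto intro: content_nonneg)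

lemma outer_open: "openin (top_of_set \<Omega>) U \<Longrightarrow> outer U = content U"
  by (intro antisym outer_le outer_ge content_mono) (auto dest: openin_imp_subset)

lemma outer_mono: "A \<subseteq> B \<Longrightarrow> B \<subseteq> \<Omega> \<Longrightarrow> outer A \<le> outer B"
  by (intro outer_ge[of B] outer_le) auto

lemma outer_measure_space_outer: "outer_measure_space (Pow \<Omega>) (\<lambda>A. ennreal (outer A))"
  unfolding outer_measure_space_def
proof (intro conjI)
  have "outer {} \<le> 0" using outer_le[of "{}" "{}"] content_empty by simp
  then show "positive (Pow \<Omega>) (\<lambda>A. ennreal (outer A))" by (simp add: positive_def ennreal_eq_0_iff)
  show "increasing (Pow \<Omega>) (\<lambda>A. ennreal (outer A))"
    by (auto simp: increasing_def intro!: ennreal_leI outer_mono)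
  show "countably_subadditive (Pow \<Omega>) (\<lambda>A. ennreal (outer A))"
    unfolding countably_subadditive_def
  proof (intro allI impI)
    fix A :: "nat \<Rightarrow> 'a set" assume A: "range A \<subseteq> Pow \<Omega>"
    then have AO: "A n \<subseteq> \<Omega>" for n by auto
    show "ennreal (outer (\<Union>i. A i)) \<le> (\<Sum>i. ennreal (outer (A i)))"
    proof (rule ennreal_le_epsilon)
      fix e :: real assume e: "e > 0"
      define ee where "ee n = e / 2 * (1/2)^Suc n" for n
      have ee: "ee n > 0" for n using e unfolding ee_def by simp
      have "\<exists>U. openin (top_of_set \<Omega>) U \<and> A n \<subseteq> U \<and> content U < outer (A n) + ee n" for n
        by (rule outer_approx[OF AO]) (use ee[of n] in simp)
      then obtain U where U: "\<And>n. openin (top_of_set \<Omega>) (U n)" "\<And>n. A n \<subseteq> U n"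
        "\<And>n. content (U n) < outer (A n) + ee n" by metis
      have sumee: "(\<Sum>n. ennreal (ee n)) = ennreal (e / 2)"
      proof -
        have "ee sums (e / 2)" unfolding ee_def using sums_mult[OF power_half_series, of "e / 2"] by simp
        then show ?thesis using ee by (intro suminf_ennreal_eq) (auto simp: less_imp_le)
      qed
      have fin: "ennreal (L f) \<le> ennreal (e / 2) + (\<Sum>n. ennreal (content (U n)))" if f: "f \<in> sub_ind (\<Union>n. U n)" for f
      proof -
        obtain N where "L f \<le> e / 2 + (\<Sum>n<N. content (U n))"
          using content_subadditive[OF U(1) _ f, of "e / 2"] e by auto
        then have "ennreal (L f) \<le> ennreal (e / 2 + (\<Sum>n<N. content (U n)))" by (rule ennreal_leI)
        also have "\<dots> = ennreal (e / 2) + (\<Sum>n<N. ennreal (content (U n)))"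
          using e content_nonneg by (simp add: ennreal_plus sum_nonneg sum_ennreal)
        also have "(\<Sum>n<N. ennreal (content (U n))) \<le> (\<Sum>n. ennreal (content (U n)))"
          by (rule sum_le_suminf) auto
        finally show ?thesis by (simp add: add_left_mono)
      qed
      have Uo: "openin (top_of_set \<Omega>) (\<Union>n. U n)" using U(1) by auto
      have "ennreal (outer (\<Union>i. A i)) \<le> ennreal (content (\<Union>n. U n))"
        by (intro ennreal_leI outer_le[OF Uo]) (use U(2) in blast)
      also have "\<dots> \<le> ennreal (e / 2) + (\<Sum>n. ennreal (content (U n)))"
      proof (cases "(\<Sum>n. ennreal (content (U n)))")
        case (real r)
        have "content (\<Union>n. U n) \<le> e / 2 + r"
        proof (rule content_le)
          fix f assume "f \<in> sub_ind (\<Union>n. U n)"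
          from fin[OF this] show "L f \<le> e / 2 + r"
            using real e by (simp add: ennreal_plus[symmetric] del: ennreal_plus)
        qed
        then show ?thesis using real e by (simp add: ennreal_plus[symmetric] ennreal_leI del: ennreal_plus)
      next
        case top then show ?thesis by simp
      qed
      also have "(\<Sum>n. ennreal (content (U n))) \<le> (\<Sum>n. ennreal (outer (A n)) + ennreal (ee n))"
      proof (intro suminf_le summableI)
        fix n
        have "ennreal (content (U n)) \<le> ennreal (outer (A n) + ee n)"
          using U(3)[of n] by (intro ennreal_leI) simp
        then show "ennreal (content (U n)) \<le> ennreal (outer (A n)) + ennreal (ee n)"
          using outer_nonneg[OF AO] ee[of n] by (simp add: ennreal_plus less_imp_le)
      qed
      also have "\<dots> = (\<Sum>n. ennreal (outer (A n))) + ennreal (e / 2)"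
        using sumee by (subst suminf_add[symmetric]) (auto intro: summableI)
      finally have "ennreal (outer (\<Union>i. A i)) \<le> ennreal (e / 2) + ((\<Sum>n. ennreal (outer (A n))) + ennreal (e / 2))"
        by (simp add: add_left_mono)
      also have "\<dots> = (\<Sum>n. ennreal (outer (A n))) + (ennreal (e / 2) + ennreal (e / 2))"
        by (simp add: ac_simps)
      also have "ennreal (e / 2) + ennreal (e / 2) = ennreal e" using e by (simp add: ennreal_plus[symmetric] del: ennreal_plus)
      finally show "ennreal (outer (\<Union>i. A i)) \<le> (\<Sum>i. ennreal (outer (A i))) + ennreal e" .
    qed
  qed
qed

lemma open_splits_outer:
  assumes U: "openin (top_of_set \<Omega>) U" and A: "A \<subseteq> \<Omega>"
  shows "outer (U \<inter> A) + outer (A - U) \<le> outer A"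
proof (rule outer_ge[OF A], rule field_le_epsilon)
  fix W and e :: real assume W: "openin (top_of_set \<Omega>) W" "A \<subseteq> W" and e: "e > 0"
  define d where "d = e / 3"
  have d: "d > 0" using e unfolding d_def by simp
  have UW: "openin (top_of_set \<Omega>) (U \<inter> W)" using U W by auto
  obtain f where f: "f \<in> sub_ind (U \<inter> W)" "content (U \<inter> W) - d < L f"
    using content_approx[of "content (U \<inter> W) - d" "U \<inter> W"] d by auto
  have fc: "continuous_on \<Omega> f" using f unfolding sub_ind_def by auto
  define W' where "W' = W \<inter> (\<Omega> \<inter> f -` {..<d})"
  have W'o: "openin (top_of_set \<Omega>) W'"
    unfolding W'_def using W(1) continuous_openin_preimage_gen[OF fc, of "{..<d}"] by auto
  obtain g where g: "g \<in> sub_ind W'" "content W' - d < L g"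
    using content_approx[of "content W' - d" W'] d by auto
  have gc: "continuous_on \<Omega> g" using g unfolding sub_ind_def by auto
  define f' where "f' x = max 0 (f x - d)" for x
  have f'c: "continuous_on \<Omega> f'" unfolding f'_def by (intro continuous_intros fc)
  have sum: "(\<lambda>x. f' x + g x) \<in> sub_ind W"
    unfolding sub_ind_def
  proof (intro CollectI conjI ballI impI)
    show "continuous_on \<Omega> (\<lambda>x. f' x + g x)" by (intro continuous_intros f'c gc)
    fix x assume x: "x \<in> \<Omega>"
    have g0: "0 \<le> g x" "g x \<le> 1" "x \<notin> W' \<Longrightarrow> g x = 0" and f0: "0 \<le> f x" "f x \<le> 1" "x \<notin> U \<inter> W \<Longrightarrow> f x = 0"
      using f(1) g(1) x unfolding sub_ind_def by auto
    show "0 \<le> f' x + g x" using g0 unfolding f'_def by simp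
    show "f' x + g x \<le> 1"
    proof (cases "f x < d")
      case True then show ?thesis using g0 unfolding f'_def by simp
    next
      case False
      then have "x \<notin> W'" unfolding W'_def by simp
      then show ?thesis using g0 f0 d unfolding f'_def by auto
    qed
    show "f' x + g x = 0" if "x \<notin> W" using that g0(3) f0(3) d unfolding f'_def W'_def by auto
  qed
  have "L f \<le> L (\<lambda>x. f' x + d)"
    by (rule L_mono[OF fc]) (auto simp: f'_def intro!: continuous_intros fc)
  also have "\<dots> = L f' + d" using L_add[OF f'c, of "\<lambda>_. d"] L_const by simp
  finally have 1: "L f \<le> L f' + d" .
  have 2: "L f' + L g \<le> content W" using content_ge[OF sum] L_add[OF f'c gc] by simp
  have 3: "outer (U \<inter> A) \<le> content (U \<inter> W)" by (rule outer_le[OF UW]) (use W in auto)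
  have "A - U \<subseteq> W'" using W(2) A f(1) d unfolding W'_def sub_ind_def by auto
  then have 4: "outer (A - U) \<le> content W'" by (rule outer_le[OF W'o])
  show "outer (U \<inter> A) + outer (A - U) \<le> content W + e"
    using 1 2 3 4 f(2) g(2) unfolding d_def by linarith
qed

theorem representing_measure:
  "\<exists>m. prob_space m \<and> space m = \<Omega> \<and> sets m = sets (restrict_space borel \<Omega>) \<and>
     (\<forall>f. continuous_on \<Omega> f \<longrightarrow> integral\<^sup>L m f = L f)"
proof -
  let ?o = "\<lambda>A. ennreal (outer A)"
  let ?S = "sets (restrict_space borel \<Omega>)"
  interpret P: sigma_algebra \<Omega> "Pow \<Omega>" by (rule sigma_algebra_Pow)
  have ms: "measure_space \<Omega> (lambda_system \<Omega> (Pow \<Omega>) ?o) ?o"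
    by (rule P.caratheodory_lemma[OF outer_measure_space_outer])
  have sa: "subadditive (Pow \<Omega>) ?o"
    using outer_measure_space_outer P.countably_subadditive_subadditive unfolding outer_measure_space_def by blast
  have open_in: "U \<in> lambda_system \<Omega> (Pow \<Omega>) ?o" if U: "openin (top_of_set \<Omega>) U" for U
    unfolding P.lambda_system_eq
  proof (intro CollectI conjI ballI)
    show UO: "U \<in> Pow \<Omega>" using openin_imp_subset[OF U] by simp
    fix A assume A: "A \<in> Pow \<Omega>"
    show "?o (A \<inter> U) + ?o (A - U) = ?o A"
    proof (rule antisym)
      have "outer (A \<inter> U) + outer (A - U) \<le> outer A" using open_splits_outer[OF U] A by (simp add: Int_commute)
      moreover have "0 \<le> outer (A \<inter> U)" "0 \<le> outer (A - U)" using A by (auto intro!: outer_nonneg)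
      ultimately show "?o (A \<inter> U) + ?o (A - U) \<le> ?o A"
        by (simp add: ennreal_plus[symmetric] ennreal_leI del: ennreal_plus)
      have "?o ((A \<inter> U) \<union> (A - U)) \<le> ?o (A \<inter> U) + ?o (A - U)"
        by (rule subadditiveD[OF sa]) (use A in auto)
      then show "?o A \<le> ?o (A \<inter> U) + ?o (A - U)" by (simp add: Int_Diff_Un)
    qed
  qed
  have saL: "sigma_algebra \<Omega> (lambda_system \<Omega> (Pow \<Omega>) ?o)" using ms unfolding measure_space_def by blast
  have sub: "?S \<subseteq> lambda_system \<Omega> (Pow \<Omega>) ?o"
    unfolding sets_restrict_borel_sigma[OF comp]
    by (rule sigma_algebra.sigma_sets_subset[OF saL]) (use open_in in auto)
  have spS: "space (restrict_space borel \<Omega>) = \<Omega>" by (simp add: space_restrict_space)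
  have saS: "sigma_algebra \<Omega> ?S" using sets.sigma_algebra_axioms[of "restrict_space borel \<Omega>"] spS by simp
  have msS: "measure_space \<Omega> ?S ?o" by (rule measure_down[OF ms saS sub])
  define m where "m = measure_of \<Omega> ?S ?o"
  have S\<Omega>: "?S \<subseteq> Pow \<Omega>" using sets.space_closed[of "restrict_space borel \<Omega>"] spS by simp
  have spm: "space m = \<Omega>" and stm: "sets m = ?S"
    unfolding m_def using S\<Omega> sigma_algebra.sigma_sets_eq[OF saS]
    by (simp_all add: space_measure_of sets_measure_of)
  have em: "emeasure m A = ?o A" if "A \<in> ?S" for A
    unfolding m_def by (rule emeasure_measure_of_sigma[OF saS]) (use msS that in \<open>auto simp: measure_space_def\<close>)
  have openS: "U \<in> ?S" if "openin (top_of_set \<Omega>) U" for U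
    unfolding sets_restrict_borel_sigma[OF comp] using that by (auto intro: sigma_sets.Basic)
  have om: "measure m U = content U" if "openin (top_of_set \<Omega>) U" for U
    using em[OF openS[OF that]] outer_open[OF that] content_nonneg[of U] by (simp add: measure_def)
  have prob: "prob_space m"
  proof
    have "openin (top_of_set \<Omega>) \<Omega>" by simp
    then show "emeasure m (space m) = 1"
      using em[OF openS] outer_open content_space spm by fastforce
  qed
  interpret prob_space m by (rule prob)
  have meas: "f \<in> borel_measurable m" if "continuous_on \<Omega> f" for f :: "'a \<Rightarrow> real"
    using borel_measurable_continuous_on_restrict[OF that] stm by (simp cong: measurable_cong_sets)
  have int: "integrable m f" if f: "continuous_on \<Omega> f" for f :: "'a \<Rightarrow> real"
  proof -
    obtain B where "\<And>x. x \<in> \<Omega> \<Longrightarrow> norm (f x) \<le> B"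
      using compact_imp_bounded[OF compact_continuous_image[OF f comp]] by (auto simp: bounded_iff)
    then show ?thesis by (intro integrable_const_bound[where B = B]) (use meas[OF f] spm in auto)
  qed
  have unit: "L f \<le> integral\<^sup>L m f" if f: "continuous_on \<Omega> f" and f01: "\<And>x. x \<in> \<Omega> \<Longrightarrow> 0 \<le> f x \<and> f x \<le> 1" for f
  proof (rule field_le_epsilon)
    fix e :: real assume "e > 0"
    then obtain n :: nat where n: "1 / e < real n" using reals_Archimedean2 by blast
    have n0: "real n > 0" using n \<open>e > 0\<close> by (meson divide_pos_pos less_trans zero_less_one)
    define F where "F k x = min 1 (max 0 (real n * f x - real k))" for k :: nat and x
    define U where "U k = \<Omega> \<inter> (\<lambda>x. real n * f x) -` {real k<..}" for k :: nat
    have Uo: "openin (top_of_set \<Omega>) (U k)" for k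
      unfolding U_def by (intro continuous_openin_preimage_gen continuous_intros f)
    have Fc: "continuous_on \<Omega> (F k)" for k unfolding F_def by (intro continuous_intros f)
    have FU: "F k \<in> sub_ind (U k)" for k
      using Fc[of k] unfolding sub_ind_def F_def U_def by auto
    have "real n * L f = L (\<lambda>x. real n * f x)" using L_scale[OF f] by simp
    also have "\<dots> \<le> L (\<lambda>x. \<Sum>k<n. F k x)"
    proof (rule L_mono)
      show "continuous_on \<Omega> (\<lambda>x. \<Sum>k<n. F k x)" "continuous_on \<Omega> (\<lambda>x. real n * f x)"
        by (intro continuous_intros Fc f)+
      fix x assume "x \<in> \<Omega>"
      then have "real n * f x \<le> real n" "0 \<le> real n * f x" using f01[of x] n0 by (auto simp: mult_left_le)
      then show "real n * f x \<le> (\<Sum>k<n. F k x)" unfolding F_def using sum_clamp_eq[of "real n * f x" n] by simp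
    qed
    also have "\<dots> = (\<Sum>k<n. L (F k))" by (rule L_sum) (use Fc in auto)
    also have "\<dots> \<le> (\<Sum>k<n. measure m (U k))" using content_ge[OF FU] om[OF Uo] by (simp add: sum_mono)
    also have "\<dots> = (\<integral>x. (\<Sum>k<n. indicator (U k) x) \<partial>m)"
      using openS[OF Uo] stm by (subst Bochner_Integration.integral_sum) (auto simp: emeasure_eq_measure)
    also have "\<dots> \<le> (\<integral>x. real n * f x + 1 \<partial>m)"
    proof (rule integral_mono_AE)
      show "integrable m (\<lambda>x. \<Sum>k<n. indicator (U k) x :: real)"
        using openS[OF Uo] stm by (auto simp: emeasure_eq_measure)
      show "integrable m (\<lambda>x. real n * f x + 1)" by (intro int continuous_intros f)
      show "AE x in m. (\<Sum>k<n. indicator (U k) x) \<le> real n * f x + 1"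
      proof (rule AE_I2)
        fix x assume "x \<in> space m"
        then have x: "x \<in> \<Omega>" using spm by simp
        have "(\<Sum>k<n. indicator (U k) x) = (\<Sum>k<n. if real k < real n * f x then 1 else (0::real))"
          using x unfolding U_def by (intro sum.cong) (auto simp: indicator_def)
        also have "\<dots> \<le> real n * f x + 1"
          using sum_less_count_le[of "real n * f x" n] f01[OF x] n0 by simp
        finally show "(\<Sum>k<n. indicator (U k) x) \<le> real n * f x + 1" .
      qed
    qed
    also have "\<dots> = real n * integral\<^sup>L m f + 1" using int[OF f] by (simp add: prob_space)
    finally have "real n * L f \<le> real n * integral\<^sup>L m f + 1" .
    then have "L f \<le> integral\<^sup>L m f + 1 / real n" using n0 by (simp add: field_simps)
    moreover have "1 / real n \<le> e" using n n0 \<open>e > 0\<close> by (simp add: field_simps)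
    ultimately show "L f \<le> integral\<^sup>L m f + e" by simp
  qed
  have le: "L f \<le> integral\<^sup>L m f" if f: "continuous_on \<Omega> f" for f
  proof -
    obtain B0 where B0: "\<And>x. x \<in> \<Omega> \<Longrightarrow> \<bar>f x\<bar> \<le> B0"
      using compact_imp_bounded[OF compact_continuous_image[OF f comp]] by (auto simp: bounded_iff)
    define B where "B = max B0 1"
    have B: "\<And>x. x \<in> \<Omega> \<Longrightarrow> \<bar>f x\<bar> \<le> B" "B > 0" using B0 unfolding B_def by force+
    define g where "g x = 1/2 + (1 / (2*B)) * f x" for x
    have gc: "continuous_on \<Omega> g" unfolding g_def by (intro continuous_intros f)
    have "L g \<le> integral\<^sup>L m g"
    proof (rule unit[OF gc])
      fix x assume "x \<in> \<Omega>"
      then have "- B \<le> f x" "f x \<le> B" using B(1)[of x] by auto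
      then show "0 \<le> g x \<and> g x \<le> 1" unfolding g_def using B(2) by (simp add: field_simps)
    qed
    moreover have "L g = 1/2 + (1 / (2*B)) * L f"
      unfolding g_def using L_scale[OF f, of "1 / (2*B)"] L_const
        continuous_on_mult_left[OF f, of "1 / (2*B)"]
      by (subst L_add) simp_all
    moreover have "integral\<^sup>L m g = 1/2 + (1 / (2*B)) * integral\<^sup>L m f"
      unfolding g_def using int[OF f] by (simp add: prob_space)
    ultimately show ?thesis using B(2) by (simp add: field_simps)
  qed
  have "integral\<^sup>L m f = L f" if f: "continuous_on \<Omega> f" for f
  proof -
    have "L (\<lambda>x. (-1) * f x) \<le> integral\<^sup>L m (\<lambda>x. (-1) * f x)" by (intro le continuous_intros f)
    then show ?thesis using le[OF f] L_scale[OF f, of "-1"] by simp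
  qed
  then show ?thesis using prob spm stm by blast
qed

end

section \<open>Uniform time averages\<close>

lemma measure_eqI_continuous_integrals:
  fixes \<Omega> :: "'a::metric_space set"
  assumes comp: "compact \<Omega>" and fin: "finite_measure m1" "finite_measure m2"
    and sets1: "sets m1 = sets (restrict_space borel \<Omega>)" and sets2: "sets m2 = sets (restrict_space borel \<Omega>)"
    and eq: "\<And>f::'a \<Rightarrow> real. continuous_on \<Omega> f \<Longrightarrow> integral\<^sup>L m1 f = integral\<^sup>L m2 f"
  shows "m1 = m2"
proof (rule measure_eqI_generator_eq[where E = "{U. openin (top_of_set \<Omega>) U}" and A = "\<lambda>_. \<Omega>" and \<Omega> = \<Omega>])
  show "Int_stable {U. openin (top_of_set \<Omega>) U}" by (auto simp: Int_stable_def)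
  show "{U. openin (top_of_set \<Omega>) U} \<subseteq> Pow \<Omega>" by (auto dest: openin_imp_subset)
  show "sets m1 = sigma_sets \<Omega> {U. openin (top_of_set \<Omega>) U}" "sets m2 = sigma_sets \<Omega> {U. openin (top_of_set \<Omega>) U}"
    using sets1 sets2 sets_restrict_borel_sigma[OF comp] by auto
  show "emeasure m1 \<Omega> \<noteq> \<infinity>" for i :: nat using fin(1) by (simp add: finite_measure.emeasure_finite)
  fix U assume "U \<in> {U. openin (top_of_set \<Omega>) U}"
  then have U: "openin (top_of_set \<Omega>) U" by simp
  then have Us: "U \<in> sets (restrict_space borel \<Omega>)"
    unfolding sets_restrict_borel_sigma[OF comp] by (auto intro: sigma_sets.Basic)
  obtain h :: "'a \<Rightarrow> real" where h: "continuous_on \<Omega> h" "\<And>x. 0 \<le> h x" "\<And>x. x \<in> \<Omega> \<Longrightarrow> x \<in> U \<longleftrightarrow> 0 < h x"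
    using openin_positivity_set[OF U] by metis
  define f where "f n x = min 1 (real n * h x)" for n :: nat and x
  have fc: "continuous_on \<Omega> (f n)" for n unfolding f_def by (intro continuous_intros h)
  have lim: "(\<lambda>n. integral\<^sup>L m (f n)) \<longlonglongrightarrow> measure m U"
    if m: "finite_measure m" "sets m = sets (restrict_space borel \<Omega>)" for m
  proof -
    interpret finite_measure m by (rule m)
    have sp: "space m = \<Omega>" using sets_eq_imp_space_eq[OF m(2)] by (simp add: space_restrict_space)
    have "(\<lambda>n. integral\<^sup>L m (f n)) \<longlonglongrightarrow> (\<integral>x. indicator U x \<partial>m)"
    proof (rule integral_dominated_convergence[where w = "\<lambda>_. 1"])
      show "(\<lambda>x. indicator U x :: real) \<in> borel_measurable m" using Us m by simp
      show "f n \<in> borel_measurable m" for n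
        using borel_measurable_continuous_on_restrict[OF fc[of n]] m(2) by (simp cong: measurable_cong_sets)
      show "AE x in m. (\<lambda>n. f n x) \<longlonglongrightarrow> indicator U x"
      proof (rule AE_I2)
        fix x assume "x \<in> space m"
        then have x: "x \<in> \<Omega>" using sp by simp
        show "(\<lambda>n. f n x) \<longlonglongrightarrow> indicator U x"
        proof (cases "x \<in> U")
          case True
          then have hx: "0 < h x" using h(3)[OF x] by simp
          have "\<forall>\<^sub>F n in sequentially. real n > 1 / h x"
            using filterlim_real_sequentially unfolding filterlim_at_top_dense by blast
          then have "\<forall>\<^sub>F n in sequentially. f n x = indicator U x"
            by eventually_elim (use True hx in \<open>auto simp: f_def field_simps\<close>)
          then show ?thesis by (rule tendsto_eventually)
        next
          case False
          then have "h x = 0" using h(2)[of x] h(3)[OF x] by simp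
          then show ?thesis using False by (simp add: f_def)
        qed
      qed
      show "AE x in m. norm (f n x) \<le> 1" for n using h(2) by (auto simp: f_def)
    qed simp
    then show ?thesis using Us m(2) sets.Int_space_eq2[of U m] by simp
  qed
  have "measure m1 U = measure m2 U"
    using LIMSEQ_unique[OF lim[OF fin(1) sets1]] lim[OF fin(2) sets2] eq[OF fc] by simp
  then show "emeasure m1 U = emeasure m2 U" using fin by (simp add: finite_measure.emeasure_eq_measure)
qed auto

locale compact_flow =
  fixes \<Omega> :: "'w::metric_space set" and flw :: "real \<Rightarrow> 'w \<Rightarrow> 'w"
  assumes flow: "cont_flow \<Omega> flw"
begin

lemma comp: "compact \<Omega>" and ne: "\<Omega> \<noteq> {}"
  and flw_in: "\<omega> \<in> \<Omega> \<Longrightarrow> flw t \<omega> \<in> \<Omega>" and flw_0: "\<omega> \<in> \<Omega> \<Longrightarrow> flw 0 \<omega> = \<omega>"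
  and flw_add: "\<omega> \<in> \<Omega> \<Longrightarrow> flw (t + s) \<omega> = flw t (flw s \<omega>)"
  and flw_joint: "continuous_on (UNIV \<times> \<Omega>) (\<lambda>(t, \<omega>). flw t \<omega>)"
  using flow unfolding cont_flow_def by auto

lemma flw_cont: "continuous_on \<Omega> (flw t)"
proof -
  have "continuous_on \<Omega> ((\<lambda>(t, \<omega>). flw t \<omega>) \<circ> (\<lambda>\<omega>. (t, \<omega>)))"
    by (intro continuous_on_compose continuous_intros continuous_on_subset[OF flw_joint]) auto
  then show ?thesis by (simp add: o_def)
qed

lemma orbit_cont: "\<omega> \<in> \<Omega> \<Longrightarrow> continuous_on S (\<lambda>t. flw t \<omega>)"
proof -
  assume "\<omega> \<in> \<Omega>"
  then have "continuous_on S ((\<lambda>(t, \<omega>). flw t \<omega>) \<circ> (\<lambda>t. (t, \<omega>)))"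
    by (intro continuous_on_compose continuous_intros continuous_on_subset[OF flw_joint]) auto
  then show ?thesis by (simp add: o_def)
qed

lemma flw_comp_cont: "continuous_on \<Omega> f \<Longrightarrow> continuous_on \<Omega> (\<lambda>\<omega>. f (flw t \<omega>))"
  by (rule continuous_on_compose2[OF _ flw_cont]) (auto intro: flw_in)

lemma cont_bounded:
  fixes f :: "'w \<Rightarrow> real" assumes "continuous_on \<Omega> f"
  obtains B where "B > 0" "\<And>\<omega>. \<omega> \<in> \<Omega> \<Longrightarrow> \<bar>f \<omega>\<bar> \<le> B"
proof -
  obtain B0 where "\<And>x. x \<in> \<Omega> \<Longrightarrow> \<bar>f x\<bar> \<le> B0"
    using compact_imp_bounded[OF compact_continuous_image[OF assms comp]] by (auto simp: bounded_iff)
  then show thesis using that[of "max B0 1"] by force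
qed

abbreviation "V \<equiv> {f :: 'w \<Rightarrow> real. continuous_on \<Omega> f}"

sublocale fun_space V by (rule fun_space_continuous_on)

definition avg_ub :: "('w \<Rightarrow> real) \<Rightarrow> real set" where
  "avg_ub f = {K. \<exists>ts. ts \<noteq> [] \<and> (\<forall>\<omega>\<in>\<Omega>. (\<Sum>t\<leftarrow>ts. f (flw t \<omega>)) \<le> K * real (length ts))}"

text \<open>Invariant measures are exactly the positive functionals dominated by \<open>avg_sup\<close>.\<close>

definition avg_sup :: "('w \<Rightarrow> real) \<Rightarrow> real" where "avg_sup f = Inf (avg_ub f)"

lemma avg_ub_ge:
  assumes "K \<in> avg_ub f" "\<And>\<omega>. \<omega> \<in> \<Omega> \<Longrightarrow> z \<le> f \<omega>"
  shows "z \<le> K"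
proof -
  obtain ts where ts: "ts \<noteq> []" "\<And>\<omega>. \<omega> \<in> \<Omega> \<Longrightarrow> (\<Sum>t\<leftarrow>ts. f (flw t \<omega>)) \<le> K * real (length ts)"
    using assms(1) unfolding avg_ub_def by auto
  obtain \<omega> where \<omega>: "\<omega> \<in> \<Omega>" using ne by blast
  have "real (length ts) * z = (\<Sum>t\<leftarrow>ts. z)" by (simp add: sum_list_triv)
  also have "\<dots> \<le> (\<Sum>t\<leftarrow>ts. f (flw t \<omega>))" by (rule sum_list_mono) (use assms(2) flw_in[OF \<omega>] in blast)
  also have "\<dots> \<le> K * real (length ts)" by (rule ts(2)[OF \<omega>])
  finally show ?thesis using ts(1) by (simp add: mult.commute)
qed

lemma avg_ub_bound: "(\<And>\<omega>. \<omega> \<in> \<Omega> \<Longrightarrow> f \<omega> \<le> K) \<Longrightarrow> K \<in> avg_ub f"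
  unfolding avg_ub_def using flw_0 by (auto intro!: exI[of _ "[0]"])

lemma avg_ub_bdd: "f \<in> V \<Longrightarrow> bdd_below (avg_ub f)"
proof -
  assume "f \<in> V"
  then obtain B where B: "\<And>\<omega>. \<omega> \<in> \<Omega> \<Longrightarrow> \<bar>f \<omega>\<bar> \<le> B" using cont_bounded by (metis mem_Collect_eq)
  have "- B \<le> f \<omega>" if "\<omega> \<in> \<Omega>" for \<omega> using B[OF that] by simp
  then show ?thesis using avg_ub_ge by (intro bdd_belowI[of _ "- B"]) blast
qed

lemma avg_ub_ne: "f \<in> V \<Longrightarrow> avg_ub f \<noteq> {}"
proof -
  assume "f \<in> V"
  then obtain B where B: "\<And>\<omega>. \<omega> \<in> \<Omega> \<Longrightarrow> \<bar>f \<omega>\<bar> \<le> B" using cont_bounded by (metis mem_Collect_eq)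
  have "f \<omega> \<le> B" if "\<omega> \<in> \<Omega>" for \<omega> using B[OF that] by simp
  then show ?thesis using avg_ub_bound by blast
qed

lemma avg_sup_le: "f \<in> V \<Longrightarrow> K \<in> avg_ub f \<Longrightarrow> avg_sup f \<le> K"
  unfolding avg_sup_def by (rule cInf_lower[OF _ avg_ub_bdd])

lemma avg_sup_ge: "f \<in> V \<Longrightarrow> (\<And>K. K \<in> avg_ub f \<Longrightarrow> z \<le> K) \<Longrightarrow> z \<le> avg_sup f"
  unfolding avg_sup_def by (rule cInf_greatest[OF avg_ub_ne])

lemma avg_sup_less: "f \<in> V \<Longrightarrow> avg_sup f < z \<Longrightarrow> \<exists>K\<in>avg_ub f. K < z"
  using avg_sup_ge[of f z] by force

lemma avg_ub_add:
  assumes "K1 \<in> avg_ub f" "K2 \<in> avg_ub g"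
  shows "K1 + K2 \<in> avg_ub (\<lambda>x. f x + g x)"
proof -
  obtain ts where ts: "ts \<noteq> []" "\<And>\<omega>. \<omega> \<in> \<Omega> \<Longrightarrow> (\<Sum>t\<leftarrow>ts. f (flw t \<omega>)) \<le> K1 * real (length ts)"
    using assms(1) unfolding avg_ub_def by auto
  obtain us where us: "us \<noteq> []" "\<And>\<omega>. \<omega> \<in> \<Omega> \<Longrightarrow> (\<Sum>t\<leftarrow>us. g (flw t \<omega>)) \<le> K2 * real (length us)"
    using assms(2) unfolding avg_ub_def by auto
  define P where "P = List.product ts us"
  define vs where "vs = map (\<lambda>(t, u). t + u) P"
  have len: "length vs = length ts * length us" unfolding vs_def P_def by simp
  have swap: "(\<Sum>(t, u)\<leftarrow>List.product xs ys. h t u) = (\<Sum>u\<leftarrow>ys. \<Sum>t\<leftarrow>xs. h t u)" for h :: "real \<Rightarrow> real \<Rightarrow> real" and xs ys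
    by (induction xs) (simp_all add: sum_list_addf o_def)
  have swap2: "(\<Sum>(t, u)\<leftarrow>List.product xs ys. h t u) = (\<Sum>t\<leftarrow>xs. \<Sum>u\<leftarrow>ys. h t u)" for h :: "real \<Rightarrow> real \<Rightarrow> real" and xs ys
    by (induction xs) (simp_all add: o_def)
  have "(\<Sum>v\<leftarrow>vs. f (flw v \<omega>) + g (flw v \<omega>)) \<le> (K1 + K2) * real (length vs)" if \<omega>: "\<omega> \<in> \<Omega>" for \<omega>
  proof -
    have "(\<Sum>v\<leftarrow>vs. f (flw v \<omega>)) = (\<Sum>(t, u)\<leftarrow>P. f (flw t (flw u \<omega>)))"
      unfolding vs_def using flw_add[OF \<omega>] by (simp add: o_def case_prod_unfold)
    also have "\<dots> = (\<Sum>u\<leftarrow>us. \<Sum>t\<leftarrow>ts. f (flw t (flw u \<omega>)))" unfolding P_def by (rule swap)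
    also have "\<dots> \<le> (\<Sum>u\<leftarrow>us. K1 * real (length ts))" by (rule sum_list_mono) (rule ts(2)[OF flw_in[OF \<omega>]])
    also have "\<dots> = K1 * real (length vs)" by (simp add: sum_list_triv len)
    finally have 1: "(\<Sum>v\<leftarrow>vs. f (flw v \<omega>)) \<le> K1 * real (length vs)" .
    have "(\<Sum>v\<leftarrow>vs. g (flw v \<omega>)) = (\<Sum>(t, u)\<leftarrow>P. g (flw u (flw t \<omega>)))"
    proof -
      have "flw (t + u) \<omega> = flw u (flw t \<omega>)" for t u using flw_add[OF \<omega>, of u t] by (simp add: add.commute)
      then show ?thesis unfolding vs_def by (simp add: o_def case_prod_unfold)
    qed
    also have "\<dots> = (\<Sum>t\<leftarrow>ts. \<Sum>u\<leftarrow>us. g (flw u (flw t \<omega>)))" unfolding P_def by (rule swap2)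
    also have "\<dots> \<le> (\<Sum>t\<leftarrow>ts. K2 * real (length us))" by (rule sum_list_mono) (rule us(2)[OF flw_in[OF \<omega>]])
    also have "\<dots> = K2 * real (length vs)" by (simp add: sum_list_triv len)
    finally show ?thesis using 1 by (simp add: sum_list_addf algebra_simps)
  qed
  moreover have "vs \<noteq> []" using len ts(1) us(1) by (metis length_0_conv mult_eq_0_iff)
  ultimately show ?thesis unfolding avg_ub_def by blast
qed

lemma avg_ub_scale: "K \<in> avg_ub f \<Longrightarrow> k \<ge> 0 \<Longrightarrow> k * K \<in> avg_ub (\<lambda>x. k * f x)"
  unfolding avg_ub_def by (auto simp: sum_list_const_mult mult.assoc intro!: mult_left_mono)

lemma avg_sup_sublinear: "sublinear_fun V avg_sup"
  unfolding sublinear_fun_def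
proof (intro conjI ballI allI impI)
  fix f g assume f: "f \<in> V" and g: "g \<in> V"
  have *: "avg_sup (\<lambda>x. f x + g x) - K1 \<le> K2" if "K1 \<in> avg_ub f" "K2 \<in> avg_ub g" for K1 K2
    using avg_sup_le[OF V_add[OF f g] avg_ub_add[OF that]] by simp
  have "avg_sup (\<lambda>x. f x + g x) - K1 \<le> avg_sup g" if "K1 \<in> avg_ub f" for K1
    by (rule avg_sup_ge[OF g]) (rule *[OF that])
  then have "avg_sup (\<lambda>x. f x + g x) - avg_sup g \<le> avg_sup f" by (intro avg_sup_ge[OF f]) force
  then show "avg_sup (\<lambda>x. f x + g x) \<le> avg_sup f + avg_sup g" by simp
next
  fix f and k :: real assume f: "f \<in> V" and k: "0 \<le> k"
  have le: "avg_sup (\<lambda>x. k * f x) \<le> k * avg_sup f" if f: "f \<in> V" and k: "k > 0" for f k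
  proof -
    have "avg_sup (\<lambda>x. k * f x) / k \<le> avg_sup f"
    proof (rule avg_sup_ge[OF f])
      fix K assume "K \<in> avg_ub f"
      then have "avg_sup (\<lambda>x. k * f x) \<le> k * K" using k by (intro avg_sup_le V_scale f avg_ub_scale) auto
      then show "avg_sup (\<lambda>x. k * f x) / k \<le> K" using k by (simp add: field_simps)
    qed
    then show ?thesis using k by (simp add: field_simps)
  qed
  show "avg_sup (\<lambda>x. k * f x) = k * avg_sup f"
  proof (cases "k = 0")
    case True
    have "avg_sup (\<lambda>x. 0) = 0"
    proof (rule antisym)
      show "avg_sup (\<lambda>x. 0) \<le> 0" by (rule avg_sup_le[OF V_zero avg_ub_bound]) simp
      show "0 \<le> avg_sup (\<lambda>x. 0)" by (rule avg_sup_ge[OF V_zero], erule avg_ub_ge) simp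
    qed
    then show ?thesis using True by simp
  next
    case False
    then have k: "k > 0" using k by simp
    have "avg_sup (\<lambda>x. (1/k) * (k * f x)) \<le> (1/k) * avg_sup (\<lambda>x. k * f x)"
      by (rule le[OF V_scale[OF f]]) (use k in simp)
    then have "k * avg_sup f \<le> avg_sup (\<lambda>x. k * f x)" using k by (simp add: field_simps)
    then show ?thesis using le[OF f k] by simp
  qed
qed

lemma avg_sup_coboundary:
  assumes f: "f \<in> V"
  shows "avg_sup (\<lambda>x. f (flw t x) - f x) \<le> 0"
proof (rule field_le_epsilon)
  fix e :: real assume e: "e > 0"
  obtain B where B: "B > 0" "\<And>\<omega>. \<omega> \<in> \<Omega> \<Longrightarrow> \<bar>f \<omega>\<bar> \<le> B" using cont_bounded f by (metis mem_Collect_eq)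
  obtain n :: nat where n: "2 * B / e < real n" using reals_Archimedean2 by blast
  have n0: "real n > 0" using n B e by (meson divide_pos_pos less_trans mult_pos_pos zero_less_numeral)
  define ts where "ts = map (\<lambda>j. real j * t) [0..<n]"
  have "(\<Sum>s\<leftarrow>ts. f (flw t (flw s \<omega>)) - f (flw s \<omega>)) \<le> e * real (length ts)" if \<omega>: "\<omega> \<in> \<Omega>" for \<omega>
  proof -
    have "(\<Sum>s\<leftarrow>ts. f (flw t (flw s \<omega>)) - f (flw s \<omega>)) = (\<Sum>j<n. f (flw (real (Suc j) * t) \<omega>) - f (flw (real j * t) \<omega>))"
      unfolding ts_def using flw_add[OF \<omega>, symmetric]
      by (simp add: interv_sum_list_conv_sum_set_nat atLeast0LessThan o_def algebra_simps)
    also have "\<dots> = f (flw (real n * t) \<omega>) - f (flw 0 \<omega>)"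
      using sum_lessThan_telescope[of "\<lambda>j. f (flw (real j * t) \<omega>)" n] by simp
    also have "\<dots> \<le> 2 * B"
    proof -
      have "f a - f b \<le> 2 * B" if "a \<in> \<Omega>" "b \<in> \<Omega>" for a b using B(2)[OF that(1)] B(2)[OF that(2)] by linarith
      then show ?thesis using flw_in[OF \<omega>] by blast
    qed
    also have "\<dots> \<le> e * real (length ts)" using n e unfolding ts_def by (simp add: field_simps)
    finally show ?thesis .
  qed
  moreover have "ts \<noteq> []" using n0 unfolding ts_def by simp
  ultimately have "e \<in> avg_ub (\<lambda>x. f (flw t x) - f x)" unfolding avg_ub_def by blast
  then show "avg_sup (\<lambda>x. f (flw t x) - f x) \<le> 0 + e"
    using flw_comp_cont[of f t] f by (intro order_trans[OF avg_sup_le]) (auto intro!: continuous_intros)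
qed

lemma extreme_ergodic_measure:
  assumes H: "\<And>n::nat. continuous_on \<Omega> (H n)" and dec: "\<And>n k \<omega>. n \<le> k \<Longrightarrow> \<omega> \<in> \<Omega> \<Longrightarrow> H k \<omega> \<le> H n \<omega>"
    and c: "\<And>n. c \<le> avg_sup (H n)"
  shows "\<exists>m\<in>erg_measures \<Omega> flw. \<forall>n. c \<le> integral\<^sup>L m (H n)"
proof -
  have HV: "H n \<in> V" for n using H by simp
  have dec': "avg_sup (\<lambda>x. H k x - H n x) \<le> 0" if "n \<le> k" for n k
    by (rule avg_sup_le[OF V_diff[OF HV HV] avg_ub_bound]) (use dec[OF that] in auto)
  have "\<exists>L. linear_fun V L \<and> (\<forall>f\<in>V. L f \<le> avg_sup f) \<and> (\<forall>n. c \<le> L (H n)) \<and> extreme_below V avg_sup L"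
    by (rule extreme_functional_exists[where H = H and c = c, OF avg_sup_sublinear HV dec' c])
  then obtain L where L: "linear_fun V L" "\<And>f. f \<in> V \<Longrightarrow> L f \<le> avg_sup f" "\<And>n. c \<le> L (H n)"
    "extreme_below V avg_sup L" by blast
  have Lneg: "L (\<lambda>x. - f x) = - L f" if "f \<in> V" for f
  proof -
    have "L (\<lambda>x. (-1) * f x) = (-1) * L f" using L(1) that unfolding linear_fun_def by blast
    then show ?thesis by simp
  qed
  have Lub: "L f \<le> K" if "f \<in> V" "\<And>\<omega>. \<omega> \<in> \<Omega> \<Longrightarrow> f \<omega> \<le> K" for f K
    using L(2)[OF that(1)] avg_sup_le[OF that(1) avg_ub_bound[OF that(2)]] by linarith
  interpret positive_functional \<Omega> L
  proof
    show "compact \<Omega>" by (rule comp)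
    show "linear_fun V L" by (rule L)
    fix f :: "'w \<Rightarrow> real" assume f: "continuous_on \<Omega> f" "\<And>x. x \<in> \<Omega> \<Longrightarrow> 0 \<le> f x"
    have "L (\<lambda>x. - f x) \<le> 0" using f by (intro Lub) (auto intro!: continuous_intros)
    then show "0 \<le> L f" using Lneg[of f] f by simp
  next
    have "L (\<lambda>x. - 1) \<le> - 1" "L (\<lambda>x. 1) \<le> 1" by (intro Lub; auto)+
    then show "L (\<lambda>x. 1) = 1" using Lneg[of "\<lambda>x. 1"] by simp
  qed
  obtain m where m: "prob_space m" "space m = \<Omega>" "sets m = sets (restrict_space borel \<Omega>)"
    "\<And>f. continuous_on \<Omega> f \<Longrightarrow> integral\<^sup>L m f = L f" using representing_measure by blast
  interpret prob_space m by (rule m)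
  have meas: "f \<in> borel_measurable m" if "continuous_on \<Omega> f" for f :: "'w \<Rightarrow> real"
    using borel_measurable_continuous_on_restrict[OF that] m(3) by (simp cong: measurable_cong_sets)
  have int: "integrable m f" if f: "continuous_on \<Omega> f" for f :: "'w \<Rightarrow> real"
  proof -
    obtain B where "\<And>x. x \<in> \<Omega> \<Longrightarrow> \<bar>f x\<bar> \<le> B" using cont_bounded[OF f] by metis
    then show ?thesis by (intro integrable_const_bound[where B = B]) (use meas[OF f] m(2) in auto)
  qed
  have flwm: "flw t \<in> measurable m m" for t
  proof -
    have "flw t \<in> measurable (restrict_space borel \<Omega>) (restrict_space borel \<Omega>)"
      by (rule measurable_restrict_space2)
        (use flw_in borel_measurable_continuous_on_restrict[OF flw_cont] in \<open>auto simp: space_restrict_space\<close>)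
    then show ?thesis using m(3) by (simp cong: measurable_cong_sets)
  qed
  have Linv: "L (\<lambda>x. f (flw t x)) = L f" if f: "f \<in> V" for f t
  proof -
    have fV: "(\<lambda>x. f (flw t x)) \<in> V" using flw_comp_cont f by simp
    have le: "L (\<lambda>x. f (flw t x)) \<le> L f" if f: "f \<in> V" for f
    proof -
      have fV: "(\<lambda>x. f (flw t x)) \<in> V" using flw_comp_cont f by simp
      have "L (\<lambda>x. f (flw t x) + - f x) \<le> 0"
        using L(2)[OF V_add[OF fV V_uminus[OF f]]] avg_sup_coboundary[OF f, of t] by simp
      then show ?thesis using L_add[of "\<lambda>x. f (flw t x)" "\<lambda>x. - f x"] fV V_uminus[OF f] Lneg[OF f] by simp
    qed
    show ?thesis using le[OF f] le[OF V_uminus[OF f]] Lneg[OF f] Lneg[OF fV] by simp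
  qed
  have distr: "distr m m (flw t) = m" for t
  proof (rule measure_eqI_continuous_integrals[OF comp])
    show "finite_measure (distr m m (flw t))" by (rule finite_measure_distr[OF flwm])
    show "finite_measure m" by unfold_locales
    fix f :: "'w \<Rightarrow> real" assume f: "continuous_on \<Omega> f"
    have "integral\<^sup>L (distr m m (flw t)) f = (\<integral>x. f (flw t x) \<partial>m)"
      by (rule integral_distr[OF flwm meas[OF f]])
    also have "\<dots> = L f" using m(4)[OF flw_comp_cont[OF f]] Linv[of f t] f by simp
    finally show "integral\<^sup>L (distr m m (flw t)) f = integral\<^sup>L m f" using m(4)[OF f] by simp
  qed (use m in auto)
  have inv: "m \<in> inv_measures \<Omega> flw"
    unfolding inv_measures_def
  proof (intro CollectI conjI allI ballI)
    fix t A assume A: "A \<in> sets m"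
    have "measure m A = measure (distr m m (flw t)) A" using distr by simp
    also have "\<dots> = measure m (flw t -` A \<inter> space m)" by (rule measure_distr[OF flwm A])
    also have "flw t -` A \<inter> space m = {\<omega> \<in> \<Omega>. flw t \<omega> \<in> A}" using m(2) by auto
    finally show "measure m {\<omega> \<in> \<Omega>. flw t \<omega> \<in> A} = measure m A" by simp
  qed (use m in auto)
  define cond where "cond A f = (\<integral>x. f x * indicator A x \<partial>m) / measure m A" for A and f :: "'w \<Rightarrow> real"
  have cint: "integrable m (\<lambda>x. f x * indicator A x)" if "A \<in> sets m" "continuous_on \<Omega> f" for A and f :: "'w \<Rightarrow> real"
    using integrable_real_mult_indicator[OF that(1) int[OF that(2)]] by simp
  have cond_lin: "linear_fun V (cond A)" if A: "A \<in> sets m" for A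
    unfolding linear_fun_def cond_def
    using cint[OF A] by (auto simp: distrib_right add_divide_distrib mult.assoc)
  have cond_le: "cond A f \<le> avg_sup f" if A: "A \<in> sets m" "measure m A > 0"
    and Ainv: "\<And>t. {\<omega>\<in>\<Omega>. flw t \<omega> \<in> A} = A" and f: "f \<in> V" for A f
  proof (rule avg_sup_ge[OF f])
    fix K assume "K \<in> avg_ub f"
    then obtain ts where ts: "ts \<noteq> []" "\<And>\<omega>. \<omega> \<in> \<Omega> \<Longrightarrow> (\<Sum>t\<leftarrow>ts. f (flw t \<omega>)) \<le> K * real (length ts)"
      unfolding avg_ub_def by auto
    have fc: "continuous_on \<Omega> f" using f by simp
    have shift: "(\<integral>x. f (flw t x) * indicator A x \<partial>m) = (\<integral>x. f x * indicator A x \<partial>m)" for t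
    proof -
      have fm: "(\<lambda>x. f x * indicator A x) \<in> borel_measurable m" using meas[OF fc] A(1) by measurable
      have "(\<integral>x. f x * indicator A x \<partial>m) = (\<integral>x. f (flw t x) * indicator A (flw t x) \<partial>m)"
        using integral_distr[OF flwm[of t] fm] distr[of t] by simp
      also have "\<dots> = (\<integral>x. f (flw t x) * indicator A x \<partial>m)"
      proof (rule Bochner_Integration.integral_cong[OF refl])
        fix x assume "x \<in> space m"
        then have "flw t x \<in> A \<longleftrightarrow> x \<in> A" using Ainv[of t] m(2) by auto
        then show "f (flw t x) * indicator A (flw t x) = f (flw t x) * indicator A x" by (simp add: indicator_def)
      qed
      finally show ?thesis by simp
    qed
    have sumint: "integrable m (\<lambda>x. (\<Sum>t\<leftarrow>us. f (flw t x)) * indicator A x) \<and>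
        (\<integral>x. (\<Sum>t\<leftarrow>us. f (flw t x)) * indicator A x \<partial>m) = real (length us) * (\<integral>x. f x * indicator A x \<partial>m)" for us
    proof (induction us)
      case (Cons t us)
      then show ?case using cint[OF A(1) flw_comp_cont[OF fc, of t]] shift[of t]
        by (simp add: distrib_right algebra_simps)
    qed simp
    have "real (length ts) * (\<integral>x. f x * indicator A x \<partial>m) \<le> (\<integral>x. K * real (length ts) * indicator A x \<partial>m)"
      unfolding sumint[THEN conjunct2, symmetric]
    proof (rule integral_mono[OF sumint[THEN conjunct1]])
      show "integrable m (\<lambda>x. K * real (length ts) * indicator A x)" using A by (simp add: emeasure_eq_measure)
      fix x assume "x \<in> space m"
      then show "(\<Sum>t\<leftarrow>ts. f (flw t x)) * indicator A x \<le> K * real (length ts) * indicator A x"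
        using ts(2)[of x] m(2) by (simp add: indicator_def)
    qed
    also have "\<dots> = real (length ts) * (K * measure m A)" using A by simp
    finally have "(\<integral>x. f x * indicator A x \<partial>m) \<le> K * measure m A" using ts(1) by simp
    then show "cond A f \<le> K" unfolding cond_def using A(2) by (simp add: field_simps)
  qed
  have "m \<in> erg_measures \<Omega> flw"
    unfolding erg_measures_def
  proof (intro CollectI conjI inv ballI impI)
    fix A assume A: "A \<in> sets m" and Ainv: "\<forall>t. {\<omega> \<in> \<Omega>. flw t \<omega> \<in> A} = A"
    show "measure m A = 0 \<or> measure m A = 1"
    proof (rule ccontr)
      assume nt: "\<not> (measure m A = 0 \<or> measure m A = 1)"
      define B where "B = \<Omega> - A"
      have B: "B \<in> sets m" using A m(2) sets.compl_sets[OF A] by (simp add: B_def)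
      have mB: "measure m B = 1 - measure m A" using prob_compl[OF A] m(2) by (simp add: B_def)
      have mA: "0 < measure m A" "measure m A < 1" using nt prob_le_1[of A] measure_nonneg[of m A] by (auto simp: less_le)
      have Binv: "{\<omega> \<in> \<Omega>. flw t \<omega> \<in> B} = B" for t
      proof -
        have "{\<omega> \<in> \<Omega>. flw t \<omega> \<in> B} = \<Omega> - {\<omega> \<in> \<Omega>. flw t \<omega> \<in> A}" using flw_in unfolding B_def by auto
        then show ?thesis using Ainv B_def by simp
      qed
      have condL: "\<forall>f\<in>V. cond A f = L f"
      proof (rule L(4)[unfolded extreme_below_def, rule_format, OF cond_lin[OF A] cond_lin[OF B] _ _ mA, THEN ballI])
        show "cond A g \<le> avg_sup g" if "g \<in> V" for g by (rule cond_le[OF A mA(1) _ that]) (use Ainv in blast)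
        show "cond B g \<le> avg_sup g" if "g \<in> V" for g by (rule cond_le[OF B _ Binv that]) (use mB mA in simp)
        fix g assume g: "g \<in> V"
        then have gc: "continuous_on \<Omega> g" by simp
        have "measure m A * cond A g + (1 - measure m A) * cond B g
          = (\<integral>x. g x * indicator A x \<partial>m) + (\<integral>x. g x * indicator B x \<partial>m)"
          unfolding cond_def mB[symmetric] using mA mB by simp
        also have "\<dots> = (\<integral>x. g x * indicator A x + g x * indicator B x \<partial>m)"
          using cint[OF A gc] cint[OF B gc] by simp
        also have "\<dots> = integral\<^sup>L m g"
          by (rule Bochner_Integration.integral_cong[OF refl]) (use m(2) in \<open>auto simp: B_def indicator_def\<close>)
        finally show "measure m A * cond A g + (1 - measure m A) * cond B g = L g" using m(4)[OF gc] by simp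
      qed
      define m1 where "m1 = density m (\<lambda>x. ennreal (indicator A x / measure m A))"
      have ind: "(\<lambda>x. indicator A x / measure m A) \<in> borel_measurable m" using A by measurable
      have em1: "emeasure m1 X = ennreal (measure m (X \<inter> A) / measure m A)" if X: "X \<in> sets m" for X
      proof -
        have "emeasure m1 X = (\<integral>\<^sup>+x. ennreal (indicator A x / measure m A) * indicator X x \<partial>m)"
          unfolding m1_def using ind X by (simp add: emeasure_density)
        also have "\<dots> = (\<integral>\<^sup>+x. ennreal (1 / measure m A) * indicator (X \<inter> A) x \<partial>m)"
          by (rule nn_integral_cong) (auto simp: indicator_def)
        also have "\<dots> = ennreal (1 / measure m A) * emeasure m (X \<inter> A)"
          using A X by (simp add: nn_integral_cmult_indicator)
        finally show ?thesis using mA by (simp add: emeasure_eq_measure ennreal_mult[symmetric])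
      qed
      have "m1 = m"
      proof (rule measure_eqI_continuous_integrals[OF comp])
        show "finite_measure m1"
          using em1[OF sets.top] by (intro finite_measureI) (simp add: m1_def)
        show "finite_measure m" by unfold_locales
        show "sets m1 = sets (restrict_space borel \<Omega>)" "sets m = sets (restrict_space borel \<Omega>)"
          using m(3) by (auto simp: m1_def)
        fix f :: "'w \<Rightarrow> real" assume f: "continuous_on \<Omega> f"
        have "integral\<^sup>L m1 f = (\<integral>x. (indicator A x / measure m A) *\<^sub>R f x \<partial>m)"
          unfolding m1_def by (rule integral_density[OF meas[OF f] ind]) auto
        also have "\<dots> = (\<integral>x. (f x * indicator A x) / measure m A \<partial>m)"
          by (rule Bochner_Integration.integral_cong[OF refl]) simp
        also have "\<dots> = cond A f" unfolding cond_def by simp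
        finally show "integral\<^sup>L m1 f = integral\<^sup>L m f" using condL m(4)[OF f] f by simp
      qed
      moreover have "emeasure m1 B = 0" using em1[OF B] by (simp add: B_def Int_commute Diff_disjoint Int_Diff)
      ultimately have "measure m B = 0" by (simp add: measure_def)
      then show False using mB mA by simp
    qed
  qed
  moreover have "c \<le> integral\<^sup>L m (H n)" for n using L(3)[of n] m(4)[OF H[of n]] by simp
  ultimately show ?thesis by blast
qed

theorem uniform_time_average:
  assumes H: "\<And>n::nat. continuous_on \<Omega> (H n)" and dec: "\<And>n k \<omega>. n \<le> k \<Longrightarrow> \<omega> \<in> \<Omega> \<Longrightarrow> H k \<omega> \<le> H n \<omega>"
    and erg: "\<And>m. m \<in> erg_measures \<Omega> flw \<Longrightarrow> \<exists>n. integral\<^sup>L m (H n) < c"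
  shows "\<exists>n K D. K < c \<and> (\<forall>\<omega>\<in>\<Omega>. \<forall>s t. s \<le> t \<longrightarrow> integral {s..t} (\<lambda>r. H n (flw r \<omega>)) \<le> K * (t - s) + D)"
proof -
  have "\<exists>n. avg_sup (H n) < c"
  proof (rule ccontr)
    assume "\<not> ?thesis"
    then have "c \<le> avg_sup (H n)" for n by (meson not_le)
    then obtain m where "m \<in> erg_measures \<Omega> flw" "\<And>n. c \<le> integral\<^sup>L m (H n)"
      using extreme_ergodic_measure[where H = H, OF H dec] by blast
    then show False using erg by (meson not_le)
  qed
  then obtain n where "avg_sup (H n) < c" by blast
  then obtain K where K: "K \<in> avg_ub (H n)" "K < c" using avg_sup_less[of "H n" c] H by blast
  then obtain ts where ts: "ts \<noteq> []" "\<And>\<omega>. \<omega> \<in> \<Omega> \<Longrightarrow> (\<Sum>t\<leftarrow>ts. H n (flw t \<omega>)) \<le> K * real (length ts)"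
    unfolding avg_ub_def by auto
  obtain B where B: "B > 0" "\<And>\<omega>. \<omega> \<in> \<Omega> \<Longrightarrow> \<bar>H n \<omega>\<bar> \<le> B" using cont_bounded[OF H] by metis
  define D where "D = (\<Sum>u\<leftarrow>ts. 2 * B * \<bar>u\<bar>)"
  have "integral {s..t} (\<lambda>r. H n (flw r \<omega>)) \<le> K * (t - s) + D / real (length ts)" if \<omega>: "\<omega> \<in> \<Omega>" and st: "s \<le> t" for \<omega> s t
  proof -
    define h where "h r = H n (flw r \<omega>)" for r
    have hc: "continuous_on S h" for S
      unfolding h_def by (rule continuous_on_compose2[OF H orbit_cont[OF \<omega>]]) (use flw_in[OF \<omega>] in auto)
    have hi: "h integrable_on {a..b}" for a b by (rule integrable_continuous_interval[OF hc])
    have hB: "\<bar>h r\<bar> \<le> B" for r unfolding h_def by (rule B(2)[OF flw_in[OF \<omega>]])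
    have small: "\<bar>integral {a..b} h\<bar> \<le> B * (b - a)" if "a \<le> b" for a b
      using integral_bound[OF that hc, of B] hB by simp
    have shift: "integral {s..t} (\<lambda>r. h (r + u)) = integral {s+u..t+u} h" for u
      using integral_shift[OF hc] by (simp add: o_def)
    have shift_le: "integral {s..t} h \<le> integral {s..t} (\<lambda>r. h (r + u)) + 2 * B * \<bar>u\<bar>" for u
    proof -
      have "integral {s..t} h - integral {s+u..t+u} h \<le> 2 * B * \<bar>u\<bar>"
      proof (cases "u \<ge> 0")
        case True
        have "integral {s..t} h + integral {t..t+u} h = integral {s..t+u} h"
          using st True hi by (intro Henstock_Kurzweil_Integration.integral_combine) auto
        moreover have "integral {s..s+u} h + integral {s+u..t+u} h = integral {s..t+u} h"
          using st True hi by (intro Henstock_Kurzweil_Integration.integral_combine) auto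
        ultimately show ?thesis using small[of t "t+u"] small[of s "s+u"] True by simp
      next
        case False
        have "integral {s+u..s} h + integral {s..t} h = integral {s+u..t} h"
          using st False hi by (intro Henstock_Kurzweil_Integration.integral_combine) auto
        moreover have "integral {s+u..t+u} h + integral {t+u..t} h = integral {s+u..t} h"
          using st False hi by (intro Henstock_Kurzweil_Integration.integral_combine) auto
        ultimately show ?thesis using small[of "t+u" t] small[of "s+u" s] False by simp
      qed
      then show ?thesis using shift by simp
    qed
    have hsc: "continuous_on S (\<lambda>r. h (r + u))" for u S
      by (rule continuous_on_compose2[OF hc[of UNIV]]) (auto intro!: continuous_intros)
    have slc: "continuous_on S (\<lambda>r. \<Sum>u\<leftarrow>us. h (r + u))" for S us
      by (induction us) (auto intro!: continuous_intros hsc)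
    have "real (length us) * integral {s..t} h \<le> integral {s..t} (\<lambda>r. \<Sum>u\<leftarrow>us. h (r + u)) + (\<Sum>u\<leftarrow>us. 2 * B * \<bar>u\<bar>)" for us
    proof (induction us)
      case (Cons u us)
      have "integral {s..t} (\<lambda>r. \<Sum>u\<leftarrow>u # us. h (r + u)) = integral {s..t} (\<lambda>r. h (r + u)) + integral {s..t} (\<lambda>r. \<Sum>u\<leftarrow>us. h (r + u))"
        by (simp, rule Henstock_Kurzweil_Integration.integral_add)
          (auto intro!: integrable_continuous_interval hsc slc)
      then show ?case using Cons shift_le[of u] by (simp add: algebra_simps)
    qed simp
    from this[of ts] have "real (length ts) * integral {s..t} h \<le> integral {s..t} (\<lambda>r. \<Sum>u\<leftarrow>ts. h (r + u)) + D"
      by (simp add: D_def)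
    also have "integral {s..t} (\<lambda>r. \<Sum>u\<leftarrow>ts. h (r + u)) \<le> integral {s..t} (\<lambda>r. K * real (length ts))"
    proof (rule integral_le)
      show "(\<lambda>r. \<Sum>u\<leftarrow>ts. h (r + u)) integrable_on {s..t}" by (rule integrable_continuous_interval[OF slc])
      fix r assume "r \<in> {s..t}"
      show "(\<Sum>u\<leftarrow>ts. h (r + u)) \<le> K * real (length ts)"
        using ts(2)[OF flw_in[OF \<omega>, of r]] flw_add[OF \<omega>, of _ r] by (simp add: h_def add.commute)
    qed (simp add: integrable_const_ivl)
    also have "integral {s..t} (\<lambda>r. K * real (length ts)) = real (length ts) * (K * (t - s))" using st by simp
    finally have "integral {s..t} h \<le> K * (t - s) + D / real (length ts)" using ts(1) by (simp add: field_simps)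
    then show ?thesis unfolding h_def by simp
  qed
  then show ?thesis using K(2) by blast
qed

end

section \<open>Scalar differential equations\<close>

lemma antiderivative_exists:
  fixes h :: "real \<Rightarrow> real"
  assumes "continuous_on UNIV h"
  obtains P where "P 0 = 0" "\<And>t. (P has_real_derivative h t) (at t)"
proof -
  have "\<exists>F. \<forall>x :: real. -\<infinity> < ereal x \<longrightarrow> ereal x < \<infinity> \<longrightarrow> (F has_vector_derivative h x) (at x)"
    by (rule einterval_antiderivative) (use assms in \<open>auto simp: continuous_on_eq_continuous_at\<close>)
  then obtain F where F: "\<And>t. (F has_real_derivative h t) (at t)"
    by (auto simp: has_real_derivative_iff_has_vector_derivative)
  show thesis
    by (rule that[of "\<lambda>t. F t - F 0"]) (auto intro!: derivative_eq_intros F)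
qed

lemma has_integral_antiderivative:
  fixes P :: "real \<Rightarrow> real"
  assumes "\<And>t. t \<in> {a..b} \<Longrightarrow> (P has_real_derivative h t) (at t)" "a \<le> b"
  shows "(h has_integral (P b - P a)) {a..b}"
  using assms by (intro fundamental_theorem_of_calculus)
    (auto simp: has_real_derivative_iff_has_vector_derivative[symmetric] intro: has_field_derivative_at_within)

lemma continuous_on_UNIV_deriv:
  fixes u :: "real \<Rightarrow> real"
  shows "(\<And>t. (u has_real_derivative u' t) (at t)) \<Longrightarrow> continuous_on S u"
  by (meson DERIV_isCont continuous_at_imp_continuous_on)

lemma comparison_forward:
  fixes w :: "real \<Rightarrow> real"
  assumes st: "s \<le> t" and der: "\<And>r. r \<in> {s..t} \<Longrightarrow> (w has_real_derivative w' r) (at r)"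
    and init: "w s \<le> 0" and ineq: "\<And>r. r \<in> {s..t} \<Longrightarrow> w r > 0 \<Longrightarrow> w' r \<le> L * w r"
  shows "w t \<le> 0"
proof (rule ccontr)
  assume "\<not> w t \<le> 0"
  then have wt: "w t > 0" by simp
  have cont: "continuous_on {s..t} w"
    by (meson DERIV_isCont continuous_at_imp_continuous_on der)
  define S where "S = {s..t} \<inter> w -` {..0}"
  have Scl: "closed S" unfolding S_def by (rule continuous_closed_preimage[OF cont]) auto
  have Sbd: "bounded S" by (rule bounded_subset[OF bounded_closed_interval[of s t]]) (auto simp: S_def)
  have Sc: "compact S" using Scl Sbd by (rule compact_eq_bounded_closed[THEN iffD2, OF conjI, rotated])
  have Sne: "s \<in> S" using init st by (simp add: S_def)
  obtain t0 where t0: "t0 \<in> S" "\<And>r. r \<in> S \<Longrightarrow> r \<le> t0"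
    using compact_attains_sup[OF Sc] Sne by blast
  have t0t: "s \<le> t0" "t0 < t" "w t0 \<le> 0" using t0(1) wt by (auto simp: S_def less_le)
  have pos: "w r > 0" if "t0 < r" "r \<le> t" for r
    using t0(2)[of r] that t0t by (force simp: S_def)
  have "\<exists>z. t0 < z \<and> z < t \<and> w t * exp (- L * t) - w t0 * exp (- L * t0) = (t - t0) * ((w' z - L * w z) * exp (- L * z))"
  proof (rule MVT2[OF t0t(2)])
    fix x assume "t0 \<le> x" "x \<le> t"
    then have "(w has_real_derivative w' x) (at x)" using der t0t by auto
    then show "((\<lambda>r. w r * exp (- L * r)) has_real_derivative (w' x - L * w x) * exp (- L * x)) (at x)"
      by (auto intro!: derivative_eq_intros simp: algebra_simps)
  qed
  then obtain z where z: "t0 < z" "z < t"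
    "w t * exp (- L * t) - w t0 * exp (- L * t0) = (t - t0) * ((w' z - L * w z) * exp (- L * z))" by blast
  have "w' z - L * w z \<le> 0" using ineq[of z] pos[of z] z t0t by auto
  then have "(t - t0) * ((w' z - L * w z) * exp (- L * z)) \<le> 0"
    using t0t by (simp add: mult_nonneg_nonpos mult_nonpos_nonneg)
  then have "w t * exp (- L * t) \<le> w t0 * exp (- L * t0)" using z(3) by simp
  also have "\<dots> \<le> 0" using t0t by (simp add: mult_nonpos_nonneg)
  finally show False using wt by (simp add: mult_le_0_iff)
qed

lemma has_real_derivative_reflect:
  assumes "(w has_real_derivative D) (at (- r))"
  shows "((\<lambda>x. w (- x)) has_real_derivative - D) (at r)"
  using DERIV_mirror[of w D r] assms by blast

lemma comparison_backward:
  fixes w :: "real \<Rightarrow> real"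
  assumes st: "s \<le> t" and der: "\<And>r. r \<in> {s..t} \<Longrightarrow> (w has_real_derivative w' r) (at r)"
    and init: "w t \<le> 0" and ineq: "\<And>r. r \<in> {s..t} \<Longrightarrow> w r > 0 \<Longrightarrow> - w' r \<le> L * w r"
  shows "w s \<le> 0"
proof -
  have "w (- (- s)) \<le> 0"
    by (rule comparison_forward[of "- t" "- s" "\<lambda>r. w (- r)" "\<lambda>r. - w' (- r)" L])
      (use assms in \<open>auto intro!: has_real_derivative_reflect\<close>)
  then show ?thesis by simp
qed

lemma gronwall_forward:
  fixes w :: "real \<Rightarrow> real"
  assumes t: "0 \<le> t" and der: "\<And>r. r \<in> {0..t} \<Longrightarrow> (w has_real_derivative w' r) (at r)"
    and L: "L \<ge> 0" and e: "e \<ge> 0" and ineq: "\<And>r. r \<in> {0..t} \<Longrightarrow> \<bar>w' r\<bar> \<le> L * \<bar>w r\<bar> + e"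
  shows "\<bar>w t\<bar> \<le> (\<bar>w 0\<bar> + e * t) * exp (L * t)"
proof -
  define Z where "Z r = (\<bar>w 0\<bar> + e * r) * exp (L * r)" for r
  have Zd: "(Z has_real_derivative L * Z r + e * exp (L * r)) (at r)" for r
    unfolding Z_def by (auto intro!: derivative_eq_intros simp: algebra_simps)
  have Z0: "Z r \<ge> 0" if "r \<ge> 0" for r unfolding Z_def using that e by simp
  have ex: "e \<le> e * exp (L * r)" if "r \<ge> 0" for r
    using that e L by (simp add: mult_le_cancel_left1)
  have "w t - Z t \<le> 0"
  proof (rule comparison_forward[OF t, of "\<lambda>r. w r - Z r" "\<lambda>r. w' r - (L * Z r + e * exp (L * r))" L])
    fix r assume r: "r \<in> {0..t}"
    show "((\<lambda>r. w r - Z r) has_real_derivative w' r - (L * Z r + e * exp (L * r))) (at r)"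
      by (auto intro!: derivative_eq_intros der[OF r] Zd)
    assume "w r - Z r > 0"
    then have "\<bar>w r\<bar> = w r" using Z0[of r] r by simp
    then show "w' r - (L * Z r + e * exp (L * r)) \<le> L * (w r - Z r)"
      using ineq[OF r] ex[of r] r by (simp add: algebra_simps)
  qed (simp add: Z_def)
  moreover have "- w t - Z t \<le> 0"
  proof (rule comparison_forward[OF t, of "\<lambda>r. - w r - Z r" "\<lambda>r. - w' r - (L * Z r + e * exp (L * r))" L])
    fix r assume r: "r \<in> {0..t}"
    show "((\<lambda>r. - w r - Z r) has_real_derivative - w' r - (L * Z r + e * exp (L * r))) (at r)"
      by (auto intro!: derivative_eq_intros der[OF r] Zd)
    assume "- w r - Z r > 0"
    then have "\<bar>w r\<bar> = - w r" using Z0[of r] r by simp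
    then show "- w' r - (L * Z r + e * exp (L * r)) \<le> L * (- w r - Z r)"
      using ineq[OF r] ex[of r] r by (simp add: algebra_simps)
  qed (simp add: Z_def)
  ultimately show ?thesis unfolding Z_def by simp
qed

lemma gronwall:
  fixes w :: "real \<Rightarrow> real"
  assumes t: "\<bar>t\<bar> \<le> T" and der: "\<And>r. \<bar>r\<bar> \<le> T \<Longrightarrow> (w has_real_derivative w' r) (at r)"
    and L: "L \<ge> 0" and e: "e \<ge> 0" and ineq: "\<And>r. \<bar>r\<bar> \<le> T \<Longrightarrow> \<bar>w' r\<bar> \<le> L * \<bar>w r\<bar> + e"
  shows "\<bar>w t\<bar> \<le> (\<bar>w 0\<bar> + e * \<bar>t\<bar>) * exp (L * \<bar>t\<bar>)"
proof (cases "t \<ge> 0")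
  case True
  then show ?thesis using gronwall_forward[OF True der L e ineq] t by simp
next
  case False
  have "\<bar>w (- (- t))\<bar> \<le> (\<bar>w (- 0)\<bar> + e * (- t)) * exp (L * (- t))"
    by (rule gronwall_forward[of "- t" "\<lambda>r. w (- r)" "\<lambda>r. - w' (- r)" L e])
      (use False t ineq in \<open>auto intro!: has_real_derivative_reflect der L e\<close>)
  then show ?thesis using False by simp
qed

lemma antiderivative_exp_bound:
  fixes P :: "real \<Rightarrow> real"
  assumes P0: "P 0 = 0" and der: "\<And>r. (P has_real_derivative h r) (at r)"
    and K: "K > 0" and bd: "\<And>r. \<bar>h r\<bar> \<le> C * exp (K * \<bar>r\<bar>)"
  shows "\<bar>P t\<bar> \<le> (C / K) * exp (K * \<bar>t\<bar>)"
proof -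
  have C: "C \<ge> 0" using bd[of 0] by simp
  have fwd: "\<bar>P t\<bar> \<le> (C / K) * exp (K * t)"
    if t: "t \<ge> 0" and P0: "P 0 = 0" and der: "\<And>r. (P has_real_derivative h r) (at r)"
      and bd: "\<And>r. r \<ge> 0 \<Longrightarrow> \<bar>h r\<bar> \<le> C * exp (K * r)" for P h :: "real \<Rightarrow> real" and t
  proof -
    have "(C / K) * exp (K * 0) - \<sigma> * P 0 \<le> (C / K) * exp (K * t) - \<sigma> * P t" if "\<sigma> = 1 \<or> \<sigma> = - 1" for \<sigma>
    proof (rule DERIV_nonneg_imp_nondecreasing[OF t])
      fix x assume x: "0 \<le> x" "x \<le> t"
      have "((\<lambda>r. (C / K) * exp (K * r) - \<sigma> * P r) has_real_derivative C * exp (K * x) - \<sigma> * h x) (at x)"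
        using K by (auto intro!: derivative_eq_intros der)
      moreover have "0 \<le> C * exp (K * x) - \<sigma> * h x" using bd[OF x(1)] that by auto
      ultimately show "\<exists>y. ((\<lambda>r. (C / K) * exp (K * r) - \<sigma> * P r) has_real_derivative y) (at x) \<and> 0 \<le> y" by blast
    qed
    moreover have "0 \<le> C / K" using C K by simp
    ultimately show ?thesis using P0 by (force simp: abs_le_iff)
  qed
  show ?thesis
  proof (cases "t \<ge> 0")
    case True
    have "\<bar>h r\<bar> \<le> C * exp (K * r)" if "r \<ge> 0" for r using bd[of r] that by simp
    then show ?thesis using fwd[OF True P0 der] True by simp
  next
    case False
    have hb: "\<bar>- h (- r)\<bar> \<le> C * exp (K * r)" if "r \<ge> 0" for r using bd[of "- r"] that by simp
    have "\<bar>P (- (- t))\<bar> \<le> (C / K) * exp (K * (- t))"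
      by (rule fwd[of "- t" "\<lambda>r. P (- r)" "\<lambda>r. - h (- r)"])
        (use False P0 hb in \<open>auto intro!: has_real_derivative_reflect der\<close>)
    then show ?thesis using False by simp
  qed
qed

text \<open>Contraction in the norm with weight \<open>exp (- K \<bar>t\<bar>)\<close>, which makes the solution global at once.\<close>

lemma global_solution_bounded_Lipschitz:
  fixes F :: "real \<Rightarrow> real \<Rightarrow> real"
  assumes cont: "continuous_on UNIV (\<lambda>(t, x). F t x)" and bd: "\<And>t x. \<bar>F t x\<bar> \<le> M"
    and lip: "\<And>t x y. \<bar>F t x - F t y\<bar> \<le> L * \<bar>x - y\<bar>"
  shows "\<exists>u. u 0 = x0 \<and> (\<forall>t. (u has_real_derivative F t (u t)) (at t))"
proof -
  have L: "L \<ge> 0" using lip[of 0 1 0] by simp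
  define K where "K = 2 * L + 1"
  have K: "K > 0" "K \<ge> 1" using L by (auto simp: K_def)
  define h where "h v r = F r (exp (K * \<bar>r\<bar>) * apply_bcontfun v r)" for v :: "real \<Rightarrow>\<^sub>C real" and r
  have hc: "continuous_on UNIV (h v)" for v
  proof -
    have "continuous_on UNIV ((\<lambda>(t, x). F t x) \<circ> (\<lambda>r. (r, exp (K * \<bar>r\<bar>) * apply_bcontfun v r)))"
      by (intro continuous_on_compose continuous_intros continuous_on_subset[OF cont]) auto
    then show ?thesis by (simp add: o_def h_def[abs_def])
  qed
  have "\<exists>P. P 0 = 0 \<and> (\<forall>t. (P has_real_derivative h v t) (at t))" for v
    using antiderivative_exists[OF hc[of v]] by metis
  then obtain P where P0: "\<And>v. P v 0 = 0" and P: "\<And>v t. (P v has_real_derivative h v t) (at t)" by metis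
  have Pb: "\<bar>P v t\<bar> \<le> (M / K) * exp (K * \<bar>t\<bar>)" for v t
  proof (rule antiderivative_exp_bound[OF P0 P K(1)])
    fix r
    have "M \<ge> 0" using bd[of 0 0] by simp
    then have "M \<le> M * exp (K * \<bar>r\<bar>)" using K by (simp add: mult_le_cancel_left1)
    then show "\<bar>h v r\<bar> \<le> M * exp (K * \<bar>r\<bar>)" using bd[of r "exp (K * \<bar>r\<bar>) * apply_bcontfun v r"] by (simp add: h_def)
  qed
  define G where "G v t = exp (- K * \<bar>t\<bar>) * (x0 + P v t)" for v t
  have Gb: "G v \<in> bcontfun" for v
  proof (rule bcontfun_normI)
    show "continuous_on UNIV (G v)" unfolding G_def[abs_def]
      by (intro continuous_intros continuous_on_UNIV_deriv[OF P])
    fix t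
    have "norm (G v t) \<le> exp (- K * \<bar>t\<bar>) * (\<bar>x0\<bar> + (M / K) * exp (K * \<bar>t\<bar>))"
      unfolding G_def using Pb[of v t] by (simp add: abs_mult mult_left_mono)
    also have "\<dots> = exp (- K * \<bar>t\<bar>) * \<bar>x0\<bar> + M / K" by (simp add: distrib_left exp_minus field_simps)
    also have "\<dots> \<le> \<bar>x0\<bar> + M / K" using K mult_right_mono[of "exp (- K * \<bar>t\<bar>)" 1 "\<bar>x0\<bar>"] by simp
    finally show "norm (G v t) \<le> \<bar>x0\<bar> + M / K" .
  qed
  define T where "T v = Bcontfun (G v)" for v
  have Tv: "apply_bcontfun (T v) = G v" for v unfolding T_def by (rule Bcontfun_inverse[OF Gb])
  have "\<exists>!v. T v = v"
  proof (rule banach_fix_type[of "L / K"])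
    show "0 \<le> L / K" "L / K < 1" using L K by (auto simp: K_def)
    show "\<forall>v w. dist (T v) (T w) \<le> L / K * dist v w"
    proof (intro allI dist_bound)
      fix v w t
      have "\<bar>P v t - P w t\<bar> \<le> (L * dist v w / K) * exp (K * \<bar>t\<bar>)"
      proof (rule antiderivative_exp_bound[where h = "\<lambda>r. h v r - h w r"])
        show "((\<lambda>t. P v t - P w t) has_real_derivative h v r - h w r) (at r)" for r
          by (intro derivative_intros P)
        fix r
        have "\<bar>h v r - h w r\<bar> \<le> L * \<bar>exp (K * \<bar>r\<bar>) * apply_bcontfun v r - exp (K * \<bar>r\<bar>) * apply_bcontfun w r\<bar>"
          unfolding h_def by (rule lip)
        also have "\<dots> = L * (exp (K * \<bar>r\<bar>) * \<bar>apply_bcontfun v r - apply_bcontfun w r\<bar>)"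
          by (simp add: right_diff_distrib[symmetric] abs_mult)
        also have "\<dots> \<le> L * (exp (K * \<bar>r\<bar>) * dist v w)"
          using dist_bounded[of v r w] L by (intro mult_left_mono) (auto simp: dist_real_def)
        finally show "\<bar>h v r - h w r\<bar> \<le> L * dist v w * exp (K * \<bar>r\<bar>)" by (simp add: ac_simps)
      qed (use P0 K in auto)
      then have "exp (- K * \<bar>t\<bar>) * \<bar>P v t - P w t\<bar> \<le> exp (- K * \<bar>t\<bar>) * ((L * dist v w / K) * exp (K * \<bar>t\<bar>))"
        by (intro mult_left_mono) auto
      also have "\<dots> = L / K * dist v w" by (simp add: exp_minus field_simps)
      finally show "dist (apply_bcontfun (T v) t) (apply_bcontfun (T w) t) \<le> L / K * dist v w"
        unfolding Tv G_def dist_real_def by (simp add: right_diff_distrib[symmetric] abs_mult)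
    qed
  qed
  then obtain v where v: "T v = v" by blast
  define u where "u t = x0 + P v t" for t
  have "exp (K * \<bar>t\<bar>) * apply_bcontfun v t = u t" for t
    using fun_cong[OF Tv[of v], of t] unfolding v G_def u_def by (simp add: exp_minus)
  then have "h v t = F t (u t)" for t unfolding h_def by simp
  then have "(u has_real_derivative F t (u t)) (at t)" for t
    using P[of v t] unfolding u_def by (auto intro!: derivative_eq_intros)
  then show ?thesis using P0 by (intro exI[of _ u]) (auto simp: u_def)
qed

definition clamp_abs :: "real \<Rightarrow> real \<Rightarrow> real" where "clamp_abs R x = max (- R) (min R x)"

lemma clamp_abs_bound: "R \<ge> 0 \<Longrightarrow> \<bar>clamp_abs R x\<bar> \<le> R" and clamp_abs_id: "\<bar>x\<bar> \<le> R \<Longrightarrow> clamp_abs R x = x"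
  and clamp_abs_lip: "\<bar>clamp_abs R x - clamp_abs R y\<bar> \<le> \<bar>x - y\<bar>"
  by (auto simp: clamp_abs_def min_def max_def)

lemma clamped_solution:
  fixes f :: "real \<Rightarrow> real \<Rightarrow> real"
  assumes cont: "continuous_on UNIV (\<lambda>(t, x). f t x)" and R: "R \<ge> 0"
    and bd: "\<And>t x. \<bar>x\<bar> \<le> R \<Longrightarrow> \<bar>f t x\<bar> \<le> M"
    and lip: "\<And>t x y. \<bar>x\<bar> \<le> R \<Longrightarrow> \<bar>y\<bar> \<le> R \<Longrightarrow> \<bar>f t x - f t y\<bar> \<le> L * \<bar>x - y\<bar>"
  shows "\<exists>u. u s = x0 \<and> (\<forall>t. (u has_real_derivative f t (clamp_abs R (u t))) (at t))"
proof -
  define L' where "L' = max L 0"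
  have "\<exists>u. u 0 = x0 \<and> (\<forall>t. (u has_real_derivative f (t + s) (clamp_abs R (u t))) (at t))"
  proof (rule global_solution_bounded_Lipschitz[where M = M and L = L'])
    have "continuous_on UNIV ((\<lambda>(t, x). f t x) \<circ> (\<lambda>p. (fst p + s, clamp_abs R (snd p))))"
      unfolding clamp_abs_def
      by (intro continuous_on_compose continuous_intros continuous_on_subset[OF cont]) auto
    then show "continuous_on UNIV (\<lambda>(t, x). f (t + s) (clamp_abs R x))" by (simp add: o_def case_prod_unfold)
    show "\<bar>f (t + s) (clamp_abs R x)\<bar> \<le> M" for t x by (rule bd[OF clamp_abs_bound[OF R]])
    fix t x y
    have "\<bar>f (t + s) (clamp_abs R x) - f (t + s) (clamp_abs R y)\<bar> \<le> L * \<bar>clamp_abs R x - clamp_abs R y\<bar>"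
      by (rule lip[OF clamp_abs_bound[OF R] clamp_abs_bound[OF R]])
    also have "\<dots> \<le> L' * \<bar>clamp_abs R x - clamp_abs R y\<bar>" unfolding L'_def by (intro mult_right_mono) auto
    also have "\<dots> \<le> L' * \<bar>x - y\<bar>" unfolding L'_def by (intro mult_left_mono clamp_abs_lip) auto
    finally show "\<bar>f (t + s) (clamp_abs R x) - f (t + s) (clamp_abs R y)\<bar> \<le> L' * \<bar>x - y\<bar>" .
  qed
  then obtain u where u: "u 0 = x0" "\<And>t. (u has_real_derivative f (t + s) (clamp_abs R (u t))) (at t)" by blast
  have "((\<lambda>t. u (t - s)) has_real_derivative f t (clamp_abs R (u (t - s)))) (at t)" for t
    using u(2)[of "t - s"] DERIV_shift[of u _ t "-s"] by simp
  then show ?thesis using u(1) by (intro exI[of _ "\<lambda>t. u (t - s)"]) auto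
qed

lemma solution_compactness:
  fixes f :: "real \<Rightarrow> real \<Rightarrow> real" and fn :: "nat \<Rightarrow> real \<Rightarrow> real \<Rightarrow> real" and u :: "nat \<Rightarrow> real \<Rightarrow> real"
  assumes cont: "continuous_on UNIV (\<lambda>(t, x). f t x)" and R: "R > 0"
    and bd: "\<And>t x. \<bar>x\<bar> \<le> R \<Longrightarrow> \<bar>f t x\<bar> \<le> M"
    and lip: "\<And>t x y. \<bar>x\<bar> \<le> R \<Longrightarrow> \<bar>y\<bar> \<le> R \<Longrightarrow> \<bar>f t x - f t y\<bar> \<le> L * \<bar>x - y\<bar>"
    and sol: "\<And>n t. \<bar>t\<bar> \<le> real n \<Longrightarrow> (u n has_real_derivative fn n t (u n t)) (at t)"
    and ub: "\<And>n t. \<bar>t\<bar> \<le> real n \<Longrightarrow> \<bar>u n t\<bar> \<le> R"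
    and conv: "\<And>T e. e > 0 \<Longrightarrow> \<exists>N. \<forall>n\<ge>N. \<forall>t x. \<bar>t\<bar> \<le> T \<longrightarrow> \<bar>x\<bar> \<le> R \<longrightarrow> \<bar>fn n t x - f t x\<bar> \<le> e"
  shows "\<exists>b r. strict_mono r \<and> (\<forall>t. (b has_real_derivative f t (b t)) (at t)) \<and> (\<forall>t. \<bar>b t\<bar> \<le> R) \<and>
    (\<forall>t. (\<lambda>n. u (r n) t) \<longlonglongrightarrow> b t)"
proof -
  have "0 \<le> L * R" using lip[of R 0 0] R by simp
  then have L: "L \<ge> 0" using R by (simp add: zero_le_mult_iff)
  have u0: "\<forall>n. u n 0 \<in> {-R..R}"
  proof
    fix n show "u n 0 \<in> {-R..R}" using ub[of 0 n] by auto
  qed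
  obtain x0 r where r: "strict_mono r" "((\<lambda>n. u n 0) \<circ> r) \<longlonglongrightarrow> x0"
    by (rule seq_compactE[OF compact_imp_seq_compact[OF compact_Icc[of "-R" R]] u0])
  obtain b where b: "b 0 = x0" "\<And>t. (b has_real_derivative f t (clamp_abs R (b t))) (at t)"
    using clamped_solution[OF cont less_imp_le[OF R] bd lip, of 0 x0] by blast
  have lim: "(\<lambda>n. u (r n) t) \<longlonglongrightarrow> b t" for t
  proof (rule tendstoI)
    fix e :: real assume e: "e > 0"
    define T where "T = \<bar>t\<bar> + 1"
    define E where "E = exp (L * \<bar>t\<bar>)"
    have E: "E > 0" by (simp add: E_def)
    define d where "d = e / (2 * T * E)"
    have T: "T > 0" "\<bar>t\<bar> \<le> T" "\<bar>t\<bar> < T" by (auto simp: T_def)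
    have d: "d > 0" using e E T by (simp add: d_def)
    obtain N where N: "\<And>n t x. n \<ge> N \<Longrightarrow> \<bar>t\<bar> \<le> T \<Longrightarrow> \<bar>x\<bar> \<le> R \<Longrightarrow> \<bar>fn n t x - f t x\<bar> \<le> d" using conv[OF d, of T] by blast
    have "\<forall>\<^sub>F n in sequentially. dist (((\<lambda>n. u n 0) \<circ> r) n) x0 < e / (2 * E)"
      using tendstoD[OF r(2), of "e / (2 * E)"] e E by simp
    moreover have "\<forall>\<^sub>F n in sequentially. n \<ge> N" by (rule eventually_ge_at_top)
    moreover have "\<forall>\<^sub>F n in sequentially. real n \<ge> T"
      using filterlim_real_sequentially unfolding filterlim_at_top by blast
    ultimately show "\<forall>\<^sub>F n in sequentially. dist (u (r n) t) (b t) < e"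
    proof eventually_elim
      case (elim n)
      have rn: "r n \<ge> n" by (rule seq_suble[OF r(1)])
      have rT: "real (r n) \<ge> T" "r n \<ge> N" using elim(2,3) rn by linarith+
      have "\<bar>u (r n) t - b t\<bar> \<le> (\<bar>u (r n) 0 - b 0\<bar> + d * \<bar>t\<bar>) * exp (L * \<bar>t\<bar>)"
      proof (rule gronwall[OF T(2), where w' = "\<lambda>r'. fn (r n) r' (u (r n) r') - f r' (clamp_abs R (b r'))"])
        fix s assume s: "\<bar>s\<bar> \<le> T"
        then have sn: "\<bar>s\<bar> \<le> real (r n)" using rT by simp
        show "((\<lambda>t. u (r n) t - b t) has_real_derivative fn (r n) s (u (r n) s) - f s (clamp_abs R (b s))) (at s)"
          by (rule DERIV_diff[OF sol[OF sn] b(2)])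
        have ubs: "\<bar>u (r n) s\<bar> \<le> R" by (rule ub[OF sn])
        have 1: "\<bar>fn (r n) s (u (r n) s) - f s (u (r n) s)\<bar> \<le> d" using N[OF rT(2) s ubs] .
        have "\<bar>f s (u (r n) s) - f s (clamp_abs R (b s))\<bar> \<le> L * \<bar>u (r n) s - clamp_abs R (b s)\<bar>"
          by (rule lip[OF ubs clamp_abs_bound]) (use R in simp)
        also have "\<dots> \<le> L * \<bar>u (r n) s - b s\<bar>"
          using clamp_abs_lip[of R "u (r n) s" "b s"] clamp_abs_id[OF ubs] L by (intro mult_left_mono) auto
        finally show "\<bar>fn (r n) s (u (r n) s) - f s (clamp_abs R (b s))\<bar> \<le> L * \<bar>u (r n) s - b s\<bar> + d"
          using 1 by linarith
      qed (use L d in auto)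
      also have "\<dots> < (e / (2 * E) + d * T) * E"
      proof -
        have "\<bar>u (r n) 0 - b 0\<bar> < e / (2 * E)" using elim(1) b(1) by (simp add: dist_real_def)
        moreover have "d * \<bar>t\<bar> \<le> d * T" using T d by simp
        ultimately have "\<bar>u (r n) 0 - b 0\<bar> + d * \<bar>t\<bar> < e / (2 * E) + d * T" by linarith
        then show ?thesis unfolding E_def[symmetric] by (rule mult_strict_right_mono[OF _ E])
      qed
      also have "\<dots> = e" using E T by (simp add: d_def field_simps)
      finally show ?case by (simp add: dist_real_def)
    qed
  qed
  have bR: "\<bar>b t\<bar> \<le> R" for t
  proof (rule LIMSEQ_le_const2[OF tendsto_rabs[OF lim[of t]]])
    obtain N :: nat where "\<bar>t\<bar> \<le> real N" using real_arch_simple by blast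
    then have "\<bar>u (r n) t\<bar> \<le> R" if "n \<ge> N" for n
      using ub[of t "r n"] seq_suble[OF r(1), of n] that by linarith
    then show "\<exists>N. \<forall>n\<ge>N. \<bar>u (r n) t\<bar> \<le> R" by blast
  qed
  have bd: "(b has_real_derivative f t (b t)) (at t)" for t
    by (rule b(2)[of t, unfolded clamp_abs_id[OF bR[of t]]])
  show ?thesis
  proof (rule exI[of _ b], rule exI[of _ r], intro conjI)
    show "strict_mono r" by (rule r(1))
    show "\<forall>t. (b has_real_derivative f t (b t)) (at t)" using bd by (rule allI)
    show "\<forall>t. \<bar>b t\<bar> \<le> R" using bR by (rule allI)
    show "\<forall>t. (\<lambda>n. u (r n) t) \<longlonglongrightarrow> b t" using lim by (rule allI)
  qed
qed

lemma has_integral_to_inf_dominated: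
  fixes h :: "real \<Rightarrow> real"
  assumes K: "\<And>y. (K has_real_derivative h y) (at y)" and hc: "continuous_on UNIV h" and \<gamma>: "\<gamma> > 0"
    and bd: "\<And>y. y \<ge> a \<Longrightarrow> \<bar>h y\<bar> \<le> C * exp (- \<gamma> * y)" and lim: "(K \<longlongrightarrow> l) at_top"
  shows "(h has_integral (l - K a)) {a..}"
proof -
  define J where "J y = C * exp (- \<gamma> * y)" for y
  have Jd: "((\<lambda>y. - (C / \<gamma>) * exp (- \<gamma> * y)) has_real_derivative J y) (at y)" for y
    using \<gamma> unfolding J_def by (auto intro!: derivative_eq_intros)
  have Jint: "(J has_integral C * (exp (- \<gamma> * a) / \<gamma>)) {a..}"
    unfolding J_def[abs_def] by (rule has_integral_mult_right[OF has_integral_exp_minus_to_infinity[OF \<gamma>]])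
  have Jlim: "((\<lambda>y. (C / \<gamma>) * exp (- \<gamma> * y)) \<longlongrightarrow> 0) at_top"
    using \<gamma> by real_asymp
  have sumd: "((\<lambda>y. K y - (C / \<gamma>) * exp (- \<gamma> * y)) has_real_derivative h y + J y) (at y)" for y
    using DERIV_add[OF K[of y] Jd[of y]] by simp
  have "((\<lambda>y. h y + J y) has_integral (l - K a + C * (exp (- \<gamma> * a) / \<gamma>))) {a..}"
  proof (rule has_integral_to_inf)
    show "(\<lambda>y. h y + J y) integrable_on {a..y}" for y
      unfolding J_def by (intro integrable_continuous_interval continuous_intros continuous_on_subset[OF hc]) auto
    have ev: "integral {a..y} (\<lambda>y. h y + J y) = (K y - (C / \<gamma>) * exp (- \<gamma> * y)) - (K a - (C / \<gamma>) * exp (- \<gamma> * a))"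
      if "y \<ge> a" for y
      by (rule integral_unique[OF has_integral_antiderivative[OF sumd that]])
    have "((\<lambda>y. (K y - (C / \<gamma>) * exp (- \<gamma> * y)) - (K a - (C / \<gamma>) * exp (- \<gamma> * a))) \<longlongrightarrow>
        (l - 0) - (K a - (C / \<gamma>) * exp (- \<gamma> * a))) at_top"
      by (intro tendsto_diff lim Jlim tendsto_const)
    then show "((\<lambda>y. integral {a..y} (\<lambda>y. h y + J y)) \<longlongrightarrow> l - K a + C * (exp (- \<gamma> * a) / \<gamma>)) at_top"
      by (rule Lim_transform_eventually[THEN tendsto_eq_rhs])
        (use ev in \<open>auto simp: eventually_at_top_linorder intro!: exI[of _ a]\<close>)
    show "0 \<le> h y + J y" if "y \<ge> a" for y using bd[OF that] by (simp add: J_def)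
  qed
  from has_integral_diff[OF this Jint] show ?thesis by simp
qed

lemma antiderivative_converges:
  fixes K :: "real \<Rightarrow> real"
  assumes K: "\<And>y. (K has_real_derivative h y) (at y)" and \<gamma>: "\<gamma> > 0"
    and bd: "\<And>y. y \<ge> a \<Longrightarrow> \<bar>h y\<bar> \<le> C * exp (- \<gamma> * y)"
  shows "\<exists>l. (K \<longlongrightarrow> l) at_top"
proof -
  have "\<bar>h a\<bar> \<le> C * exp (- \<gamma> * a)" by (rule bd) simp
  then have "0 \<le> C * exp (- \<gamma> * a)" by linarith
  then have C: "C \<ge> 0" by (simp add: zero_le_mult_iff)
  define E where "E y = (C / \<gamma>) * exp (- \<gamma> * y)" for y
  have Ed: "(E has_real_derivative - C * exp (- \<gamma> * y)) (at y)" for y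
    using \<gamma> unfolding E_def[abs_def] by (auto intro!: derivative_eq_intros)
  have tail: "\<bar>K z - K y\<bar> \<le> E y - E z" if "a \<le> y" "y \<le> z" for y z
  proof -
    have "K z + E z \<le> K y + E y"
    proof (rule DERIV_nonpos_imp_nonincreasing[OF that(2)])
      fix x assume "y \<le> x" "x \<le> z"
      then show "\<exists>d. ((\<lambda>y. K y + E y) has_real_derivative d) (at x) \<and> d \<le> 0"
        using DERIV_add[OF K[of x] Ed[of x]] bd[of x] that by (intro exI[of _ "h x + - C * exp (- \<gamma> * x)"]) auto
    qed
    moreover have "K y - E y \<le> K z - E z"
    proof (rule DERIV_nonneg_imp_nondecreasing[OF that(2)])
      fix x assume "y \<le> x" "x \<le> z"
      then show "\<exists>d. ((\<lambda>y. K y - E y) has_real_derivative d) (at x) \<and> 0 \<le> d"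
        using DERIV_diff[OF K[of x] Ed[of x]] bd[of x] that by (intro exI[of _ "h x - - C * exp (- \<gamma> * x)"]) auto
    qed
    ultimately show ?thesis by linarith
  qed
  have E0: "E y \<ge> 0" for y using C \<gamma> by (simp add: E_def)
  have Elim: "(E \<longlongrightarrow> 0) at_top" unfolding E_def[abs_def] using \<gamma> by real_asymp
  have "Cauchy (\<lambda>n. K (a + real n))"
  proof (rule metric_CauchyI)
    fix e :: real assume e: "e > 0"
    have "\<forall>\<^sub>F y in at_top. E y < e" using order_tendstoD(2)[OF Elim e] .
    then obtain y0 where y0: "\<And>y. y \<ge> y0 \<Longrightarrow> E y < e" by (auto simp: eventually_at_top_linorder)
    obtain N :: nat where N: "y0 - a \<le> real N" using real_arch_simple by blast
    have *: "\<bar>K (a + real n) - K (a + real m)\<bar> < e" if "N \<le> m" "m \<le> n" for m n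
      using tail[of "a + real m" "a + real n"] E0[of "a + real n"] y0[of "a + real m"] that N by simp
    show "\<exists>N. \<forall>m\<ge>N. \<forall>n\<ge>N. dist (K (a + real m)) (K (a + real n)) < e"
    proof (intro exI allI impI)
      fix m n assume "N \<le> m" "N \<le> n"
      then show "dist (K (a + real m)) (K (a + real n)) < e"
        using *[of m n] *[of n m] by (cases "m \<le> n") (auto simp: dist_real_def abs_minus_commute)
    qed
  qed
  then obtain l where l: "(\<lambda>n. K (a + real n)) \<longlonglongrightarrow> l" using Cauchy_convergent convergent_def by blast
  have lE: "\<bar>K y - l\<bar> \<le> E y" if "y \<ge> a" for y
  proof (rule LIMSEQ_le_const2)
    show "(\<lambda>n. \<bar>K y - K (a + real n)\<bar>) \<longlonglongrightarrow> \<bar>K y - l\<bar>" by (intro tendsto_intros l)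
    obtain N :: nat where N: "y - a \<le> real N" using real_arch_simple by blast
    have "\<bar>K y - K (a + real n)\<bar> \<le> E y" if "n \<ge> N" for n
      using tail[of y "a + real n"] E0[of "a + real n"] N that \<open>y \<ge> a\<close> by (simp add: abs_minus_commute)
    then show "\<exists>N. \<forall>n\<ge>N. \<bar>K y - K (a + real n)\<bar> \<le> E y" by blast
  qed
  have "((\<lambda>y. K y - l) \<longlongrightarrow> 0) at_top"
    by (rule Lim_null_comparison[OF _ Elim]) (use lE in \<open>auto simp: eventually_at_top_linorder intro!: exI[of _ a]\<close>)
  then show ?thesis using Lim_null by blast
qed

lemma linear_bounded_solution:
  fixes A q :: "real \<Rightarrow> real"
  assumes A: "continuous_on UNIV A" and q: "continuous_on UNIV q" and Q: "\<And>t. \<bar>q t\<bar> \<le> Q" and \<gamma>: "\<gamma> > 0"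
    and dich: "\<And>s t. s \<le> t \<Longrightarrow> \<gamma> * (t - s) - D \<le> integral {s..t} A"
  defines "I \<equiv> \<lambda>t s. exp (- integral {0..s} (\<lambda>l. A (l + t))) * q (s + t)"
  shows linear_integrable: "I t integrable_on {0..}"
    and linear_solution: "((\<lambda>t. - integral {0..} (I t)) has_real_derivative A t * (- integral {0..} (I t)) + q t) (at t)"
    and linear_bound: "\<bar>integral {0..} (I t)\<bar> \<le> Q * exp D / \<gamma>"
proof -
  obtain P where P: "\<And>t. (P has_real_derivative A t) (at t)" using antiderivative_exists[OF A] by metis
  have PA: "integral {s..t} A = P t - P s" if "s \<le> t" for s t
    by (rule integral_unique[OF has_integral_antiderivative[OF P that]])
  have Pge: "\<gamma> * (t - s) - D \<le> P t - P s" if "s \<le> t" for s t using dich[OF that] PA[OF that] by simp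
  have Ieq: "I t s = exp (- (P (s + t) - P t)) * q (s + t)" if "s \<ge> 0" for t s
  proof -
    have "((\<lambda>l. A (l + t)) has_integral (P (s + t) - P (0 + t))) {0..s}"
      by (rule has_integral_antiderivative[OF _ that]) (use P DERIV_shift in blast)
    then show ?thesis unfolding I_def by (simp add: integral_unique)
  qed
  define k where "k y = exp (- P y) * q y" for y
  have Pc: "continuous_on UNIV P" by (rule continuous_on_UNIV_deriv[OF P])
  have kc: "continuous_on UNIV k" unfolding k_def by (intro continuous_intros Pc q)
  obtain K where K: "\<And>t. (K has_real_derivative k t) (at t)" using antiderivative_exists[OF kc] by metis
  have Q0: "Q \<ge> 0" using Q[of 0] by simp
  have expb: "exp (- (P (s + t) - P t)) \<le> exp D * exp (- \<gamma> * s)" if "s \<ge> 0" for s t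
    using Pge[of t "s + t"] that by (simp add: exp_add[symmetric])
  have kb: "\<bar>k y\<bar> \<le> (Q * exp (D - P 0)) * exp (- \<gamma> * y)" if "y \<ge> 0" for y
  proof -
    have "\<bar>k y\<bar> = exp (- P 0) * (exp (- (P (y + 0) - P 0)) * \<bar>q y\<bar>)" by (simp add: k_def abs_mult exp_add[symmetric])
    also have "\<dots> \<le> exp (- P 0) * ((exp D * exp (- \<gamma> * y)) * Q)"
      using expb[OF that, of 0] Q[of y] Q0 by (intro mult_left_mono mult_mono) auto
    also have "\<dots> = (Q * exp (D - P 0)) * exp (- \<gamma> * y)" by (simp add: exp_diff exp_minus field_simps)
    finally show ?thesis .
  qed
  obtain l where l: "(K \<longlongrightarrow> l) at_top" using antiderivative_converges[OF K \<gamma> kb] by blast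
  have hasI: "(I t has_integral exp (P t) * (l - K t)) {0..}" for t
  proof -
    define h where "h s = exp (P t) * k (s + t)" for s
    have "(h has_integral (exp (P t) * l - exp (P t) * K (0 + t))) {0..}"
    proof (rule has_integral_to_inf_dominated[OF _ _ \<gamma>])
      show "((\<lambda>s. exp (P t) * K (s + t)) has_real_derivative h y) (at y)" for y
        unfolding h_def using K[of "y + t"] DERIV_shift[of K _ y t] by (intro DERIV_cmult) simp
      show "continuous_on UNIV h" unfolding h_def
        by (intro continuous_intros continuous_on_compose2[OF kc]) auto
      show "\<bar>h y\<bar> \<le> (Q * exp D) * exp (- \<gamma> * y)" if "y \<ge> 0" for y
      proof -
        have "\<bar>h y\<bar> = exp (- (P (y + t) - P t)) * \<bar>q (y + t)\<bar>"
          by (simp add: h_def k_def abs_mult exp_add[symmetric] exp_diff exp_minus field_simps)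
        also have "\<dots> \<le> (exp D * exp (- \<gamma> * y)) * Q" using expb[OF that] Q Q0 by (intro mult_mono) auto
        finally show ?thesis by (simp add: ac_simps)
      qed
      have "((\<lambda>s. K (s + t)) \<longlongrightarrow> l) at_top"
        by (rule filterlim_compose[OF l]) real_asymp
      then show "((\<lambda>s. exp (P t) * K (s + t)) \<longlongrightarrow> exp (P t) * l) at_top" by (rule tendsto_mult_left)
    qed
    moreover have "h s = I t s" if "s \<in> {0..}" for s
      using Ieq[of s t] that by (simp add: h_def k_def exp_diff exp_minus field_simps)
    ultimately have "(I t has_integral (exp (P t) * l - exp (P t) * K (0 + t))) {0..}"
      by (rule has_integral_eq[rotated])
    then show ?thesis by (simp add: algebra_simps)
  qed
  then have val: "integral {0..} (I t) = exp (P t) * (l - K t)" for t by (rule integral_unique)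
  show "I t integrable_on {0..}" using hasI by (rule has_integral_integrable)
  have "((\<lambda>t. - (exp (P t) * (l - K t))) has_real_derivative A t * (- (exp (P t) * (l - K t))) + exp (P t) * k t) (at t)"
    by (auto intro!: derivative_eq_intros P K simp: algebra_simps)
  moreover have "exp (P t) * k t = q t" by (simp add: k_def exp_minus)
  ultimately show "((\<lambda>t. - integral {0..} (I t)) has_real_derivative A t * (- integral {0..} (I t)) + q t) (at t)"
    unfolding val by simp
  have J: "((\<lambda>s. (Q * exp D) * exp (- \<gamma> * s)) has_integral (Q * exp D) * (exp (- \<gamma> * 0) / \<gamma>)) {0..}"
    by (rule has_integral_mult_right[OF has_integral_exp_minus_to_infinity[OF \<gamma>]])
  have "norm (integral {0..} (I t)) \<le> integral {0..} (\<lambda>s. (Q * exp D) * exp (- \<gamma> * s))"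
  proof (rule integral_norm_bound_integral)
    show "I t integrable_on {0..}" using hasI by (rule has_integral_integrable)
    show "(\<lambda>s. (Q * exp D) * exp (- \<gamma> * s)) integrable_on {0..}" using J by (rule has_integral_integrable)
    fix s :: real assume s: "s \<in> {0..}"
    have "norm (I t s) = exp (- (P (s + t) - P t)) * \<bar>q (s + t)\<bar>" using Ieq[of s t] s by (simp add: abs_mult)
    also have "\<dots> \<le> (exp D * exp (- \<gamma> * s)) * Q" using expb[of s t] s Q Q0 by (intro mult_mono) auto
    finally show "norm (I t s) \<le> (Q * exp D) * exp (- \<gamma> * s)" by (simp add: ac_simps)
  qed
  then show "\<bar>integral {0..} (I t)\<bar> \<le> Q * exp D / \<gamma>" using integral_unique[OF J] by simp
qed

lemma linear_unit_lower:
  fixes A :: "real \<Rightarrow> real"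
  assumes A: "continuous_on UNIV A" and M: "\<And>t. A t \<le> M" "M > 0" and \<gamma>: "\<gamma> > 0"
    and dich: "\<And>s t. s \<le> t \<Longrightarrow> \<gamma> * (t - s) - D \<le> integral {s..t} A"
  shows "1 / M \<le> integral {0..} (\<lambda>s. exp (- integral {0..s} (\<lambda>l. A (l + t))) * 1)"
proof -
  have q: "continuous_on UNIV (\<lambda>_. 1 :: real)" by simp
  have int: "(\<lambda>s. exp (- integral {0..s} (\<lambda>l. A (l + t))) * 1) integrable_on {0..}"
    by (rule linear_integrable[OF A q, of 1 \<gamma> D]) (use \<gamma> dich in auto)
  have "exp (- M * 0) / M \<le> integral {0..} (\<lambda>s. exp (- integral {0..s} (\<lambda>l. A (l + t))) * 1)"
  proof (rule has_integral_le[OF has_integral_exp_minus_to_infinity[OF M(2)] integrable_integral[OF int]])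
    fix s :: real assume "s \<in> {0..}"
    then have "integral {0..s} (\<lambda>l. A (l + t)) \<le> integral {0..s} (\<lambda>l. M)"
      by (intro integral_le integrable_continuous_interval continuous_on_compose2[OF A] continuous_intros M) auto
    then show "exp (- M * s) \<le> exp (- integral {0..s} (\<lambda>l. A (l + t))) * 1"
      using \<open>s \<in> {0..}\<close> by (simp add: mult.commute)
  qed
  then show ?thesis by simp
qed

section \<open>One-parameter families of scalar equations\<close>

definition ode_sol :: "(real \<Rightarrow> real \<Rightarrow> real) \<Rightarrow> real \<Rightarrow> real set \<Rightarrow> (real \<Rightarrow> real) \<Rightarrow> bool" where
  "ode_sol f l I u \<longleftrightarrow> (\<forall>t\<in>I. (u has_real_derivative f t (u t) + l) (at t))"

definition ode_sub :: "(real \<Rightarrow> real \<Rightarrow> real) \<Rightarrow> real \<Rightarrow> real set \<Rightarrow> (real \<Rightarrow> real) \<Rightarrow> bool" where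
  "ode_sub f l I u \<longleftrightarrow> (\<forall>t\<in>I. \<exists>D. (u has_real_derivative D) (at t) \<and> D \<le> f t (u t) + l)"

definition ode_super :: "(real \<Rightarrow> real \<Rightarrow> real) \<Rightarrow> real \<Rightarrow> real set \<Rightarrow> (real \<Rightarrow> real) \<Rightarrow> bool" where
  "ode_super f l I u \<longleftrightarrow> (\<forall>t\<in>I. \<exists>D. (u has_real_derivative D) (at t) \<and> f t (u t) + l \<le> D)"

text \<open>The time reversal \<open>x(t) \<mapsto> - x(- t)\<close> maps solutions to solutions, keeps concavity in \<open>x\<close> and
  the sign of the parameter, and exchanges upper with lower and attractive with repulsive solutions.\<close>

definition dual_field :: "(real \<Rightarrow> real \<Rightarrow> real) \<Rightarrow> real \<Rightarrow> real \<Rightarrow> real" where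
  "dual_field f t x = f (- t) (- x)"

definition dual_curve :: "(real \<Rightarrow> real) \<Rightarrow> real \<Rightarrow> real" where
  "dual_curve u t = - u (- t)"

lemma dual_field_dual [simp]: "dual_field (dual_field f) = f"
  by (intro ext) (simp add: dual_field_def)

lemma dual_curve_dual [simp]: "dual_curve (dual_curve u) = u"
  by (intro ext) (simp add: dual_curve_def)

lemma dual_curve_derivative:
  "(u has_real_derivative D) (at (- t)) \<Longrightarrow> (dual_curve u has_real_derivative D) (at t)"
  using DERIV_minus[OF has_real_derivative_reflect[of u D t]] by (simp add: dual_curve_def[abs_def])

lemma ode_sol_dual: "ode_sol f l I u \<Longrightarrow> ode_sol (dual_field f) l (uminus ` I) (dual_curve u)"
  unfolding ode_sol_def using dual_curve_derivative[of u]
  by (force simp: dual_field_def dual_curve_def)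

lemma ode_sub_dual: "ode_sub f l I u \<Longrightarrow> ode_sub (dual_field f) l (uminus ` I) (dual_curve u)"
  unfolding ode_sub_def
proof
  fix t assume a: "\<forall>t\<in>I. \<exists>D. (u has_real_derivative D) (at t) \<and> D \<le> f t (u t) + l" and "t \<in> uminus ` I"
  then obtain D where "(u has_real_derivative D) (at (- t))" "D \<le> f (- t) (u (- t)) + l" by force
  then show "\<exists>D. (dual_curve u has_real_derivative D) (at t) \<and> D \<le> dual_field f t (dual_curve u t) + l"
    using dual_curve_derivative[of u D t] by (auto simp: dual_field_def dual_curve_def)
qed

lemma bounded_sol_iff: "bounded_sol (\<lambda>t x. f t x + l) b \<longleftrightarrow> ode_sol f l UNIV b \<and> bounded (range b)"
  by (simp add: bounded_sol_def ode_sol_def)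

lemma bounded_dual_curve: "bounded (range b) \<Longrightarrow> bounded (range (dual_curve b))"
  unfolding bounded_iff by (auto simp: dual_curve_def)

lemma surj_uminus_real: "range (uminus :: real \<Rightarrow> real) = UNIV"
  by (metis surj_def minus_minus)

lemma bounded_sol_dual: "bounded_sol (\<lambda>t x. f t x + l) b \<Longrightarrow> bounded_sol (\<lambda>t x. dual_field f t x + l) (dual_curve b)"
  unfolding bounded_sol_iff using ode_sol_dual[of f l UNIV b] bounded_dual_curve[of b] surj_uminus_real by simp

lemma ode_sol_imp_sub: "ode_sol f l I u \<Longrightarrow> ode_sub f l I u"
  and ode_sol_imp_super: "ode_sol f l I u \<Longrightarrow> ode_super f l I u"
  unfolding ode_sol_def ode_sub_def ode_super_def by auto

lemma ode_sol_subset: "ode_sol f l I u \<Longrightarrow> J \<subseteq> I \<Longrightarrow> ode_sol f l J u"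
  and ode_sub_subset: "ode_sub f l I u \<Longrightarrow> J \<subseteq> I \<Longrightarrow> ode_sub f l J u"
  and ode_super_subset: "ode_super f l I u \<Longrightarrow> J \<subseteq> I \<Longrightarrow> ode_super f l J u"
  unfolding ode_sol_def ode_sub_def ode_super_def by blast+

lemma ode_sub_mono: "ode_sub f l I u \<Longrightarrow> l \<le> m \<Longrightarrow> ode_sub f m I u"
  unfolding ode_sub_def by (meson add_left_mono order_trans)

lemma ode_sub_continuous: "ode_sub f l I u \<Longrightarrow> continuous_on I u"
  and ode_super_continuous: "ode_super f l I u \<Longrightarrow> continuous_on I u"
  and ode_sol_continuous: "ode_sol f l I u \<Longrightarrow> continuous_on I u"
  unfolding ode_sub_def ode_super_def ode_sol_def
  by (intro continuous_at_imp_continuous_on ballI; blast dest: DERIV_isCont)+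

lemma continuous_on_Icc_bounded:
  fixes u :: "real \<Rightarrow> real" assumes "continuous_on {s..t} u"
  obtains R where "\<And>r. r \<in> {s..t} \<Longrightarrow> \<bar>u r\<bar> \<le> R"
proof -
  obtain R where "\<forall>x\<in>u ` {s..t}. norm x \<le> R"
    using compact_imp_bounded[OF compact_continuous_image[OF assms compact_Icc]] unfolding bounded_iff by blast
  then have "\<bar>u r\<bar> \<le> R" if "r \<in> {s..t}" for r using that by simp
  then show thesis by (rule that)
qed

lemma linear_growth_contradiction:
  fixes g1 g2 D1 D2 :: real assumes "g1 > 0" "g2 > 0"
  obtains T where "T \<ge> 0" "D2 - g2 * T < g1 * T - D1"
proof -
  define T where "T = (\<bar>D1\<bar> + \<bar>D2\<bar> + 1) / (g1 + g2)"
  have "(g1 + g2) * T = \<bar>D1\<bar> + \<bar>D2\<bar> + 1" using assms by (simp add: T_def)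
  then have "D2 - g2 * T < g1 * T - D1" by (simp add: algebra_simps)
  moreover have "T \<ge> 0" using assms by (simp add: T_def)
  ultimately show thesis using that by blast
qed

definition upper_sol :: "(real \<Rightarrow> real \<Rightarrow> real) \<Rightarrow> real \<Rightarrow> real \<Rightarrow> real" where
  "upper_sol f l = (SOME a. upper_bsol (\<lambda>t x. f t x + l) a)"

definition lower_sol :: "(real \<Rightarrow> real \<Rightarrow> real) \<Rightarrow> real \<Rightarrow> real \<Rightarrow> real" where
  "lower_sol f l = (SOME a. lower_bsol (\<lambda>t x. f t x + l) a)"

definition bsol_params :: "(real \<Rightarrow> real \<Rightarrow> real) \<Rightarrow> real set" where
  "bsol_params f = {l. \<exists>b. bounded_sol (\<lambda>t x. f t x + l) b}"

lemma bsol_params_dual: "bsol_params (dual_field f) = bsol_params f"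
proof -
  have "bsol_params f \<subseteq> bsol_params (dual_field f)" for f
    unfolding bsol_params_def using bounded_sol_dual by blast
  from this[of f] this[of "dual_field f"] show ?thesis by simp
qed

lemma upper_bsol_dual:
  assumes "lower_bsol (\<lambda>t x. f t x + l) b" shows "upper_bsol (\<lambda>t x. dual_field f t x + l) (dual_curve b)"
  unfolding upper_bsol_def
proof (intro conjI allI impI)
  show "bounded_sol (\<lambda>t x. dual_field f t x + l) (dual_curve b)"
    using assms bounded_sol_dual unfolding lower_bsol_def by blast
  fix b' t assume "bounded_sol (\<lambda>t x. dual_field f t x + l) b'"
  from bounded_sol_dual[OF this] have "bounded_sol (\<lambda>t x. f t x + l) (dual_curve b')" by simp
  then have "b (- t) \<le> dual_curve b' (- t)" using assms unfolding lower_bsol_def by blast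
  then show "b' t \<le> dual_curve b t" by (simp add: dual_curve_def)
qed

lemma lower_bsol_dual:
  assumes "upper_bsol (\<lambda>t x. f t x + l) b" shows "lower_bsol (\<lambda>t x. dual_field f t x + l) (dual_curve b)"
  unfolding lower_bsol_def
proof (intro conjI allI impI)
  show "bounded_sol (\<lambda>t x. dual_field f t x + l) (dual_curve b)"
    using assms bounded_sol_dual unfolding upper_bsol_def by blast
  fix b' t assume "bounded_sol (\<lambda>t x. dual_field f t x + l) b'"
  from bounded_sol_dual[OF this] have "bounded_sol (\<lambda>t x. f t x + l) (dual_curve b')" by simp
  then have "dual_curve b' (- t) \<le> b (- t)" using assms unfolding upper_bsol_def by blast
  then show "dual_curve b t \<le> b' t" by (simp add: dual_curve_def)
qed

lemma upper_bsol_unique: "upper_bsol F a \<Longrightarrow> upper_bsol F b \<Longrightarrow> a = b"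
  unfolding upper_bsol_def by (intro ext antisym) auto

lemma lower_sol_dual:
  assumes "lower_bsol (\<lambda>t x. f t x + l) b"
  shows "upper_sol (dual_field f) l = dual_curve (lower_sol f l)"
proof -
  have "lower_bsol (\<lambda>t x. f t x + l) (lower_sol f l)" unfolding lower_sol_def by (rule someI[of _ b]) fact
  note 1 = upper_bsol_dual[OF this]
  have "upper_bsol (\<lambda>t x. dual_field f t x + l) (upper_sol (dual_field f) l)"
    unfolding upper_sol_def by (rule someI[of "upper_bsol (\<lambda>t x. dual_field f t x + l)", OF 1])
  then show ?thesis using 1 upper_bsol_unique by blast
qed

locale scalar_family =
  fixes f fx :: "real \<Rightarrow> real \<Rightarrow> real"
  assumes f_cont: "continuous_on UNIV (\<lambda>(t, x). f t x)"
    and fx_der: "\<And>t x. (f t has_real_derivative fx t x) (at x)"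
    and fx_cont: "continuous_on UNIV (\<lambda>(t, x). fx t x)"
    and f_bdd: "\<And>R. \<exists>M. \<forall>t x. \<bar>x\<bar> \<le> R \<longrightarrow> \<bar>f t x\<bar> \<le> M \<and> \<bar>fx t x\<bar> \<le> M"
    and fx_ucont: "\<And>R e. e > 0 \<Longrightarrow> \<exists>d>0. \<forall>t x y. \<bar>x\<bar> \<le> R \<longrightarrow> \<bar>y\<bar> \<le> R \<longrightarrow> \<bar>x - y\<bar> < d \<longrightarrow> \<bar>fx t x - fx t y\<bar> \<le> e"
    and esc_up: "\<And>\<Lambda>. \<exists>R. \<forall>l. \<bar>l\<bar> \<le> \<Lambda> \<longrightarrow> (\<exists>B k. k > 0 \<and> (\<forall>t. \<bar>B t\<bar> \<le> R) \<and>
        (\<forall>s t u. s \<le> t \<longrightarrow> ode_sub f l {s..t} u \<longrightarrow> B t < u t \<longrightarrow>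
           k * ((u t - B t) + (t - s) * min (u t - B t) 1) \<le> u s - B s))"
    and esc_dn: "\<And>\<Lambda>. \<exists>R. \<forall>l. \<bar>l\<bar> \<le> \<Lambda> \<longrightarrow> (\<exists>B k. k > 0 \<and> (\<forall>t. \<bar>B t\<bar> \<le> R) \<and>
        (\<forall>s t u. s \<le> t \<longrightarrow> ode_sub f l {s..t} u \<longrightarrow> u s < B s \<longrightarrow>
           k * ((B s - u s) + (t - s) * min (B s - u s) 1) \<le> B t - u t))"
    and hypE: "\<And>\<delta> R \<Lambda>. \<delta> > 0 \<Longrightarrow> \<exists>\<sigma>>0. \<exists>\<gamma>>0. \<exists>D. \<forall>l1 l2 b1 b2 s t. s \<le> t \<longrightarrow> \<bar>l1\<bar> \<le> \<Lambda> \<longrightarrow> \<bar>l2\<bar> \<le> \<Lambda> \<longrightarrow>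
        \<bar>l1 - l2\<bar> \<le> \<sigma> \<longrightarrow> ode_sol f l1 {s..t} b1 \<longrightarrow> ode_sol f l2 {s..t} b2 \<longrightarrow>
        (\<forall>r\<in>{s..t}. \<bar>b1 r\<bar> \<le> R \<and> \<bar>b2 r\<bar> \<le> R \<and> \<delta> \<le> b2 r - b1 r) \<longrightarrow>
        integral {s..t} (\<lambda>r. fx r (b2 r)) \<le> D - \<gamma> * (t - s) \<and> \<gamma> * (t - s) - D \<le> integral {s..t} (\<lambda>r. fx r (b1 r))"
    and params_bdd: "bdd_below (bsol_params f)"
begin

abbreviation "bsol l b \<equiv> bounded_sol (\<lambda>t x. f t x + l) b"

definition "dual_fx = (\<lambda>t x. - fx (- t) (- x))"

lemma dual_fx_curve: "integral {s..t} (\<lambda>r. dual_fx r (dual_curve b r)) = - integral {-t..-s} (\<lambda>r. fx r (b r))"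
  using Henstock_Kurzweil_Integration.integral_reflect_real[of "- s" "- t" "\<lambda>r. fx r (b r)"]
  by (simp add: dual_fx_def dual_curve_def)

lemma dual: "scalar_family (dual_field f) dual_fx"
proof
  have "continuous_on UNIV ((\<lambda>(t, x). f t x) \<circ> (\<lambda>p. (- fst p, - snd p)))"
    by (intro continuous_on_compose continuous_intros continuous_on_subset[OF f_cont]) auto
  then show "continuous_on UNIV (\<lambda>(t, x). dual_field f t x)" by (simp add: o_def case_prod_unfold dual_field_def)
  show "(dual_field f t has_real_derivative dual_fx t x) (at x)" for t x
    using has_real_derivative_reflect[OF fx_der[of "- t" "- x"]] by (simp add: dual_field_def[abs_def] dual_fx_def)
  have "continuous_on UNIV ((\<lambda>(t, x). fx t x) \<circ> (\<lambda>p. (- fst p, - snd p)))"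
    by (intro continuous_on_compose continuous_intros continuous_on_subset[OF fx_cont]) auto
  then show "continuous_on UNIV (\<lambda>(t, x). dual_fx t x)"
    by (simp add: o_def case_prod_unfold dual_fx_def continuous_on_minus)
  fix R
  obtain M where "\<forall>t x. \<bar>x\<bar> \<le> R \<longrightarrow> \<bar>f t x\<bar> \<le> M \<and> \<bar>fx t x\<bar> \<le> M" using f_bdd by blast
  then show "\<exists>M. \<forall>t x. \<bar>x\<bar> \<le> R \<longrightarrow> \<bar>dual_field f t x\<bar> \<le> M \<and> \<bar>dual_fx t x\<bar> \<le> M"
    by (intro exI[of _ M]) (simp add: dual_field_def dual_fx_def)
next
  fix R e :: real assume "e > 0"
  then obtain d where d: "d > 0" "\<And>t x y. \<bar>x\<bar> \<le> R \<Longrightarrow> \<bar>y\<bar> \<le> R \<Longrightarrow> \<bar>x - y\<bar> < d \<Longrightarrow> \<bar>fx t x - fx t y\<bar> \<le> e"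
    using fx_ucont[of e R] by blast
  have "\<bar>dual_fx t x - dual_fx t y\<bar> \<le> e" if "\<bar>x\<bar> \<le> R" "\<bar>y\<bar> \<le> R" "\<bar>x - y\<bar> < d" for t x y
    using d(2)[of "- x" "- y" "- t"] that by (simp add: dual_fx_def abs_minus_commute)
  then show "\<exists>d>0. \<forall>t x y. \<bar>x\<bar> \<le> R \<longrightarrow> \<bar>y\<bar> \<le> R \<longrightarrow> \<bar>x - y\<bar> < d \<longrightarrow> \<bar>dual_fx t x - dual_fx t y\<bar> \<le> e"
    using d(1) by blast
next
  fix \<Lambda>
  obtain R where R: "\<And>l. \<bar>l\<bar> \<le> \<Lambda> \<Longrightarrow> \<exists>B k. k > 0 \<and> (\<forall>t. \<bar>B t\<bar> \<le> R) \<and>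
        (\<forall>s t u. s \<le> t \<longrightarrow> ode_sub f l {s..t} u \<longrightarrow> u s < B s \<longrightarrow>
           k * ((B s - u s) + (t - s) * min (B s - u s) 1) \<le> B t - u t)" using esc_dn by blast
  have "\<exists>B k. k > 0 \<and> (\<forall>t. \<bar>B t\<bar> \<le> R) \<and>
        (\<forall>s t u. s \<le> t \<longrightarrow> ode_sub (dual_field f) l {s..t} u \<longrightarrow> B t < u t \<longrightarrow>
           k * ((u t - B t) + (t - s) * min (u t - B t) 1) \<le> u s - B s)" if l: "\<bar>l\<bar> \<le> \<Lambda>" for l
  proof -
    obtain B k where B: "k > 0" "\<And>t. \<bar>B t\<bar> \<le> R" "\<And>s t u. s \<le> t \<Longrightarrow> ode_sub f l {s..t} u \<Longrightarrow> u s < B s \<Longrightarrow>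
           k * ((B s - u s) + (t - s) * min (B s - u s) 1) \<le> B t - u t" using R[OF l] by blast
    have "k * ((u t - dual_curve B t) + (t - s) * min (u t - dual_curve B t) 1) \<le> u s - dual_curve B s"
      if "s \<le> t" "ode_sub (dual_field f) l {s..t} u" "dual_curve B t < u t" for s t u
    proof -
      have "ode_sub f l {-t..-s} (dual_curve u)" using ode_sub_dual[OF that(2)] by simp
      then show ?thesis using B(3)[of "-t" "-s" "dual_curve u"] that by (simp add: dual_curve_def algebra_simps)
    qed
    then show ?thesis using B(1,2) by (intro exI[of _ "dual_curve B"] exI[of _ k]) (auto simp: dual_curve_def)
  qed
  then show "\<exists>R. \<forall>l. \<bar>l\<bar> \<le> \<Lambda> \<longrightarrow> (\<exists>B k. k > 0 \<and> (\<forall>t. \<bar>B t\<bar> \<le> R) \<and>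
        (\<forall>s t u. s \<le> t \<longrightarrow> ode_sub (dual_field f) l {s..t} u \<longrightarrow> B t < u t \<longrightarrow>
           k * ((u t - B t) + (t - s) * min (u t - B t) 1) \<le> u s - B s))" by blast
next
  fix \<Lambda>
  obtain R where R: "\<And>l. \<bar>l\<bar> \<le> \<Lambda> \<Longrightarrow> \<exists>B k. k > 0 \<and> (\<forall>t. \<bar>B t\<bar> \<le> R) \<and>
        (\<forall>s t u. s \<le> t \<longrightarrow> ode_sub f l {s..t} u \<longrightarrow> B t < u t \<longrightarrow>
           k * ((u t - B t) + (t - s) * min (u t - B t) 1) \<le> u s - B s)" using esc_up by blast
  have "\<exists>B k. k > 0 \<and> (\<forall>t. \<bar>B t\<bar> \<le> R) \<and>
        (\<forall>s t u. s \<le> t \<longrightarrow> ode_sub (dual_field f) l {s..t} u \<longrightarrow> u s < B s \<longrightarrow>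
           k * ((B s - u s) + (t - s) * min (B s - u s) 1) \<le> B t - u t)" if l: "\<bar>l\<bar> \<le> \<Lambda>" for l
  proof -
    obtain B k where B: "k > 0" "\<And>t. \<bar>B t\<bar> \<le> R" "\<And>s t u. s \<le> t \<Longrightarrow> ode_sub f l {s..t} u \<Longrightarrow> B t < u t \<Longrightarrow>
           k * ((u t - B t) + (t - s) * min (u t - B t) 1) \<le> u s - B s" using R[OF l] by blast
    have "k * ((dual_curve B s - u s) + (t - s) * min (dual_curve B s - u s) 1) \<le> dual_curve B t - u t"
      if "s \<le> t" "ode_sub (dual_field f) l {s..t} u" "u s < dual_curve B s" for s t u
    proof -
      have "ode_sub f l {-t..-s} (dual_curve u)" using ode_sub_dual[OF that(2)] by simp
      moreover have "dual_curve u (- s) - B (- s) = dual_curve B s - u s" "dual_curve u (- t) - B (- t) = dual_curve B t - u t"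
        by (simp_all add: dual_curve_def)
      moreover have "B (- s) < dual_curve u (- s)" using that(3) by (simp add: dual_curve_def)
      ultimately show ?thesis using B(3)[of "-t" "-s" "dual_curve u"] that(1) by simp
    qed
    then show ?thesis using B(1,2) by (intro exI[of _ "dual_curve B"] exI[of _ k]) (auto simp: dual_curve_def)
  qed
  then show "\<exists>R. \<forall>l. \<bar>l\<bar> \<le> \<Lambda> \<longrightarrow> (\<exists>B k. k > 0 \<and> (\<forall>t. \<bar>B t\<bar> \<le> R) \<and>
        (\<forall>s t u. s \<le> t \<longrightarrow> ode_sub (dual_field f) l {s..t} u \<longrightarrow> u s < B s \<longrightarrow>
           k * ((B s - u s) + (t - s) * min (B s - u s) 1) \<le> B t - u t))" by blast
next
  fix \<delta> R \<Lambda> :: real assume "\<delta> > 0"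
  then obtain \<sigma> \<gamma> D where E: "\<sigma> > 0" "\<gamma> > 0"
    "\<And>l1 l2 b1 b2 s t. s \<le> t \<Longrightarrow> \<bar>l1\<bar> \<le> \<Lambda> \<Longrightarrow> \<bar>l2\<bar> \<le> \<Lambda> \<Longrightarrow>
        \<bar>l1 - l2\<bar> \<le> \<sigma> \<Longrightarrow> ode_sol f l1 {s..t} b1 \<Longrightarrow> ode_sol f l2 {s..t} b2 \<Longrightarrow>
        (\<forall>r\<in>{s..t}. \<bar>b1 r\<bar> \<le> R \<and> \<bar>b2 r\<bar> \<le> R \<and> \<delta> \<le> b2 r - b1 r) \<Longrightarrow>
        integral {s..t} (\<lambda>r. fx r (b2 r)) \<le> D - \<gamma> * (t - s) \<and> \<gamma> * (t - s) - D \<le> integral {s..t} (\<lambda>r. fx r (b1 r))"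
    using hypE[of \<delta> \<Lambda> R] by blast
  have "integral {s..t} (\<lambda>r. dual_fx r (b2 r)) \<le> D - \<gamma> * (t - s) \<and> \<gamma> * (t - s) - D \<le> integral {s..t} (\<lambda>r. dual_fx r (b1 r))"
    if A: "s \<le> t" "\<bar>l1\<bar> \<le> \<Lambda>" "\<bar>l2\<bar> \<le> \<Lambda>" "\<bar>l1 - l2\<bar> \<le> \<sigma>" "ode_sol (dual_field f) l1 {s..t} b1"
      "ode_sol (dual_field f) l2 {s..t} b2" "\<forall>r\<in>{s..t}. \<bar>b1 r\<bar> \<le> R \<and> \<bar>b2 r\<bar> \<le> R \<and> \<delta> \<le> b2 r - b1 r" for l1 l2 b1 b2 s t
  proof -
    have s1: "ode_sol f l1 {-t..-s} (dual_curve b1)" "ode_sol f l2 {-t..-s} (dual_curve b2)"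
      using ode_sol_dual[OF A(5)] ode_sol_dual[OF A(6)] by simp_all
    have "integral {-t..-s} (\<lambda>r. fx r (dual_curve b1 r)) \<le> D - \<gamma> * (-s - -t) \<and>
        \<gamma> * (-s - -t) - D \<le> integral {-t..-s} (\<lambda>r. fx r (dual_curve b2 r))"
    proof (rule E(3)[OF _ A(3) A(2) _ s1(2) s1(1)])
      show "\<forall>r\<in>{-t..-s}. \<bar>dual_curve b2 r\<bar> \<le> R \<and> \<bar>dual_curve b1 r\<bar> \<le> R \<and> \<delta> \<le> dual_curve b1 r - dual_curve b2 r"
      proof
        fix r assume "r \<in> {-t..-s}"
        then have "- r \<in> {s..t}" by auto
        with A(7) show "\<bar>dual_curve b2 r\<bar> \<le> R \<and> \<bar>dual_curve b1 r\<bar> \<le> R \<and> \<delta> \<le> dual_curve b1 r - dual_curve b2 r"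
          by (force simp: dual_curve_def)
      qed
    qed (use A in \<open>auto simp: abs_minus_commute\<close>)
    then show ?thesis using dual_fx_curve[of s t "dual_curve b1"] dual_fx_curve[of s t "dual_curve b2"]
      by (auto simp: algebra_simps)
  qed
  then show "\<exists>\<sigma>>0. \<exists>\<gamma>>0. \<exists>D. \<forall>l1 l2 b1 b2 s t. s \<le> t \<longrightarrow> \<bar>l1\<bar> \<le> \<Lambda> \<longrightarrow> \<bar>l2\<bar> \<le> \<Lambda> \<longrightarrow>
        \<bar>l1 - l2\<bar> \<le> \<sigma> \<longrightarrow> ode_sol (dual_field f) l1 {s..t} b1 \<longrightarrow> ode_sol (dual_field f) l2 {s..t} b2 \<longrightarrow>
        (\<forall>r\<in>{s..t}. \<bar>b1 r\<bar> \<le> R \<and> \<bar>b2 r\<bar> \<le> R \<and> \<delta> \<le> b2 r - b1 r) \<longrightarrow>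
        integral {s..t} (\<lambda>r. dual_fx r (b2 r)) \<le> D - \<gamma> * (t - s) \<and> \<gamma> * (t - s) - D \<le> integral {s..t} (\<lambda>r. dual_fx r (b1 r))"
    using E(1,2) by (intro exI[of _ \<sigma>] conjI exI[of _ \<gamma>] exI[of _ D]) auto
next
  show "bdd_below (bsol_params (dual_field f))" using params_bdd by (simp add: bsol_params_dual)
qed

lemma f_bound: obtains M where "M > 0" "\<And>t x. \<bar>x\<bar> \<le> R \<Longrightarrow> \<bar>f t x\<bar> \<le> M" "\<And>t x. \<bar>x\<bar> \<le> R \<Longrightarrow> \<bar>fx t x\<bar> \<le> M"
proof -
  obtain M where M: "\<forall>t x. \<bar>x\<bar> \<le> R \<longrightarrow> \<bar>f t x\<bar> \<le> M \<and> \<bar>fx t x\<bar> \<le> M" using f_bdd by blast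
  have 1: "\<bar>f t x\<bar> \<le> max M 1" if "\<bar>x\<bar> \<le> R" for t x using M that by (simp add: le_max_iff_disj)
  have 2: "\<bar>fx t x\<bar> \<le> max M 1" if "\<bar>x\<bar> \<le> R" for t x using M that by (simp add: le_max_iff_disj)
  show thesis by (rule that[of "max M 1"]) (use 1 2 in auto)
qed

lemma f_mvt:
  assumes "x < y"
  obtains z where "x < z" "z < y" "f t y - f t x = (y - x) * fx t z"
  using MVT2[OF assms, of "f t" "fx t"] fx_der by blast

lemma f_lip:
  assumes M: "\<And>t x. \<bar>x\<bar> \<le> R \<Longrightarrow> \<bar>fx t x\<bar> \<le> M" and "\<bar>x\<bar> \<le> R" "\<bar>y\<bar> \<le> R"
  shows "\<bar>f t x - f t y\<bar> \<le> M * \<bar>x - y\<bar>"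
proof -
  have less: "\<bar>f t x - f t y\<bar> \<le> M * \<bar>x - y\<bar>" if xy: "x < y" "\<bar>x\<bar> \<le> R" "\<bar>y\<bar> \<le> R" for x y
  proof -
    obtain z where z: "x < z" "z < y" "f t y - f t x = (y - x) * fx t z" by (rule f_mvt[OF xy(1)])
    have "\<bar>f t x - f t y\<bar> = \<bar>(y - x) * fx t z\<bar>" using z(3) by (metis abs_minus_commute)
    also have "\<dots> = (y - x) * \<bar>fx t z\<bar>" using xy(1) by (simp add: abs_mult)
    also have "\<dots> \<le> (y - x) * M" using xy z by (intro mult_left_mono M) auto
    finally show ?thesis using xy(1) by (simp add: mult.commute)
  qed
  show ?thesis
    using less[of x y] less[of y x] assms by (cases x y rule: linorder_cases) (auto simp: abs_minus_commute)
qed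

lemma sub_super_compare:
  assumes st: "s \<le> t" and u: "ode_sub f l {s..t} u" and v: "ode_super f m {s..t} v" and "l \<le> m" "u s \<le> v s"
  shows "u t \<le> v t"
proof -
  obtain R1 where R1: "\<And>r. r \<in> {s..t} \<Longrightarrow> \<bar>u r\<bar> \<le> R1" using continuous_on_Icc_bounded[OF ode_sub_continuous[OF u]] by blast
  obtain R2 where R2: "\<And>r. r \<in> {s..t} \<Longrightarrow> \<bar>v r\<bar> \<le> R2" using continuous_on_Icc_bounded[OF ode_super_continuous[OF v]] by blast
  define R where "R = max R1 R2"
  obtain M where M: "\<And>t x. \<bar>x\<bar> \<le> R \<Longrightarrow> \<bar>fx t x\<bar> \<le> M" using f_bound by metis
  have "\<forall>r\<in>{s..t}. \<exists>D. (u has_real_derivative D) (at r) \<and> D \<le> f r (u r) + l" using u unfolding ode_sub_def .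
  then obtain u' where u': "\<And>r. r \<in> {s..t} \<Longrightarrow> (u has_real_derivative u' r) (at r) \<and> u' r \<le> f r (u r) + l" by metis
  have "\<forall>r\<in>{s..t}. \<exists>D. (v has_real_derivative D) (at r) \<and> f r (v r) + m \<le> D" using v unfolding ode_super_def .
  then obtain v' where v': "\<And>r. r \<in> {s..t} \<Longrightarrow> (v has_real_derivative v' r) (at r) \<and> f r (v r) + m \<le> v' r" by metis
  have "u t - v t \<le> 0"
  proof (rule comparison_forward[OF st, of "\<lambda>r. u r - v r" "\<lambda>r. u' r - v' r" M])
    fix r assume r: "r \<in> {s..t}"
    show "((\<lambda>r. u r - v r) has_real_derivative u' r - v' r) (at r)"
      using u'[OF r] v'[OF r] by (intro DERIV_diff) auto
    assume pos: "u r - v r > 0"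
    have "\<bar>u r\<bar> \<le> R" "\<bar>v r\<bar> \<le> R" using R1[OF r] R2[OF r] by (simp_all add: R_def)
    then have "\<bar>f r (u r) - f r (v r)\<bar> \<le> M * \<bar>u r - v r\<bar>" using f_lip[of R M "u r" "v r" r] M by blast
    then show "u' r - v' r \<le> M * (u r - v r)" using u'[OF r] v'[OF r] pos \<open>l \<le> m\<close> by auto
  qed (use assms in simp)
  then show ?thesis by simp
qed

lemma sol_compare_back:
  assumes st: "s \<le> t" and u: "ode_sol f l {s..t} u" and v: "ode_sol f l {s..t} v" and "u t \<le> v t"
  shows "u s \<le> v s"
proof -
  have d: "scalar_family (dual_field f) dual_fx" by (rule dual)
  have "dual_curve v (- s) \<le> dual_curve u (- s)"
  proof (rule scalar_family.sub_super_compare[OF d, of "- t" "- s" l _ l])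
    show "ode_sub (dual_field f) l {-t..-s} (dual_curve v)"
      using ode_sol_imp_sub[OF ode_sol_dual[OF v]] by simp
    show "ode_super (dual_field f) l {-t..-s} (dual_curve u)"
      using ode_sol_imp_super[OF ode_sol_dual[OF u]] by simp
  qed (use assms in \<open>auto simp: dual_curve_def\<close>)
  then show ?thesis by (simp add: dual_curve_def)
qed

lemma sol_order:
  assumes u: "ode_sol f l {a..b} u" and v: "ode_sol f l {a..b} v" and "s \<in> {a..b}" "t \<in> {a..b}" "u s \<le> v s"
  shows "u t \<le> v t"
proof (cases "s \<le> t")
  case True
  show ?thesis
    by (rule sub_super_compare[OF True, of l u l v])
      (use assms True in \<open>auto intro!: ode_sol_imp_sub ode_sol_imp_super elim!: ode_sol_subset\<close>)
next
  case False
  show ?thesis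
    by (rule sol_compare_back[of t s l]) (use assms False in \<open>auto intro: ode_sol_subset\<close>)
qed

lemma sol_order_strict:
  assumes "ode_sol f l {a..b} u" "ode_sol f l {a..b} v" "s \<in> {a..b}" "t \<in> {a..b}" "u s < v s"
  shows "u t < v t"
  using sol_order[OF assms(2,1,4,3)] assms(5) by linarith

lemma sol_order_UNIV:
  assumes "ode_sol f l UNIV u" "ode_sol f l UNIV v" "u s \<le> v s" shows "u t \<le> v t"
  by (rule sol_order[of l "min s t" "max s t" _ _ s]) (use assms in \<open>auto intro: ode_sol_subset\<close>)

lemma sol_exists_apriori:
  assumes st: "s \<le> t" and R: "\<bar>x0\<bar> \<le> R"
    and apriori: "\<And>t' u. t' \<in> {s..t} \<Longrightarrow> ode_sol f l {s..t'} u \<Longrightarrow> u s = x0 \<Longrightarrow> \<bar>u t'\<bar> \<le> R"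
  shows "\<exists>u. u s = x0 \<and> ode_sol f l {s..t} u \<and> (\<forall>r\<in>{s..t}. \<bar>u r\<bar> \<le> R)"
proof -
  have R0: "0 \<le> R + 1" using R by simp
  obtain M where M: "\<And>t x. \<bar>x\<bar> \<le> R + 1 \<Longrightarrow> \<bar>f t x\<bar> \<le> M" "\<And>t x. \<bar>x\<bar> \<le> R + 1 \<Longrightarrow> \<bar>fx t x\<bar> \<le> M" using f_bound by metis
  have fl: "continuous_on UNIV (\<lambda>(t, x). f t x + l)" using f_cont by (auto simp: case_prod_unfold intro!: continuous_intros)
  have "\<exists>u. u s = x0 \<and> (\<forall>t. (u has_real_derivative f t (clamp_abs (R + 1) (u t)) + l) (at t))"
    by (rule clamped_solution[OF fl R0, of "M + \<bar>l\<bar>" M])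
      (use M(1) f_lip[OF M(2)] in \<open>auto intro!: order_trans[OF abs_triangle_ineq] add_mono\<close>)
  then obtain u where u: "u s = x0" "\<And>t. (u has_real_derivative f t (clamp_abs (R + 1) (u t)) + l) (at t)" by blast
  have sol: "ode_sol f l {s..t'} u" if "\<And>r. r \<in> {s..t'} \<Longrightarrow> \<bar>u r\<bar> \<le> R + 1" for t'
    unfolding ode_sol_def
  proof
    fix r assume "r \<in> {s..t'}"
    then show "(u has_real_derivative f r (u r) + l) (at r)" using u(2)[of r] clamp_abs_id[OF that[of r]] by simp
  qed
  have uc: "continuous_on S u" for S by (rule continuous_on_UNIV_deriv[OF u(2)])
  define S where "S = {s..t} \<inter> (\<lambda>r. \<bar>u r\<bar>) -` {R + 1..}"
  have "S = {}"
  proof (rule ccontr)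
    assume ne: "S \<noteq> {}"
    have Scl: "closed S" unfolding S_def by (intro continuous_closed_preimage continuous_intros uc)
    have Sbd: "bounded S" by (rule bounded_subset[OF bounded_closed_interval[of s t]]) (auto simp: S_def)
    have Sc: "compact S" using Scl Sbd by (rule compact_eq_bounded_closed[THEN iffD2, OF conjI, rotated])
    obtain \<tau> where \<tau>: "\<tau> \<in> S" "\<And>r. r \<in> S \<Longrightarrow> \<tau> \<le> r" using compact_attains_inf[OF Sc ne] by blast
    have \<tau>st: "\<tau> \<in> {s..t}" "R + 1 \<le> \<bar>u \<tau>\<bar>" using \<tau>(1) by (auto simp: S_def)
    have small: "\<bar>u r\<bar> < R + 1" if "s \<le> r" "r < \<tau>" for r
      using \<tau>(2)[of r] that \<tau>st by (force simp: S_def)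
    have \<tau>s: "s < \<tau>" using \<tau>st u(1) R by (cases "s = \<tau>") auto
    have "\<bar>u \<tau>\<bar> \<le> R + 1"
    proof (rule ccontr)
      assume "\<not> ?thesis"
      then have gt: "\<bar>u \<tau>\<bar> > R + 1" by simp
      have "isCont (\<lambda>r. \<bar>u r\<bar>) \<tau>" using uc[of UNIV] by (auto simp: continuous_on_eq_continuous_at intro!: continuous_intros)
      then have "\<forall>\<^sub>F r in at \<tau>. \<bar>u r\<bar> > R + 1" using gt by (intro order_tendstoD) (auto simp: isCont_def)
      then have "\<forall>\<^sub>F r in at_left \<tau>. \<bar>u r\<bar> > R + 1" by (rule filter_leD[OF at_le, rotated]) simp
      moreover have "\<forall>\<^sub>F r in at_left \<tau>. r \<in> {s<..<\<tau>}" by (rule eventually_at_leftI[OF _ \<tau>s])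
      ultimately have "\<forall>\<^sub>F r in at_left \<tau>. False"
      proof eventually_elim
        case (elim r)
        then show False using small[of r] by simp
      qed
      then show False by simp
    qed
    then have "\<bar>u r\<bar> \<le> R + 1" if "r \<in> {s..\<tau>}" for r
      using small[of r] that by (cases "r = \<tau>") auto
    from apriori[OF \<tau>st(1) sol[OF this] u(1)] show False using \<tau>st(2) by simp
  qed
  then have less: "\<bar>u r\<bar> \<le> R + 1" if "r \<in> {s..t}" for r using that by (auto simp: S_def)
  have "\<bar>u r\<bar> \<le> R" if "r \<in> {s..t}" for r
    by (rule apriori[OF that sol u(1)]) (use that less in auto)
  then show ?thesis using u(1) sol[OF less] by blast
qed

definition up_barrier :: "real \<Rightarrow> (real \<Rightarrow> real) \<Rightarrow> real \<Rightarrow> real \<Rightarrow> bool" where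
  "up_barrier l B k R \<longleftrightarrow> k > 0 \<and> (\<forall>t. \<bar>B t\<bar> \<le> R) \<and>
     (\<forall>s t u. s \<le> t \<longrightarrow> ode_sub f l {s..t} u \<longrightarrow> B t < u t \<longrightarrow>
        k * ((u t - B t) + (t - s) * min (u t - B t) 1) \<le> u s - B s)"

lemma up_barrierD:
  assumes "up_barrier l B k R"
  shows "k > 0" "\<bar>B t\<bar> \<le> R"
    "s \<le> t \<Longrightarrow> ode_sub f l {s..t} u \<Longrightarrow> B t < u t \<Longrightarrow> k * ((u t - B t) + (t - s) * min (u t - B t) 1) \<le> u s - B s"
  using assms unfolding up_barrier_def by blast+

lemma up_barrier_exists: "\<exists>R. \<forall>l. \<bar>l\<bar> \<le> \<Lambda> \<longrightarrow> (\<exists>B k. up_barrier l B k R)"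
  using esc_up[of \<Lambda>] unfolding up_barrier_def .

lemma bounded_sub_le_barrier:
  assumes B: "up_barrier l B k R" and v: "ode_sub f l UNIV v" and Rv: "\<And>t. \<bar>v t\<bar> \<le> Rv"
  shows "v t \<le> B t"
proof (rule ccontr)
  assume "\<not> v t \<le> B t"
  then have lt: "B t < v t" by simp
  define m where "m = min (v t - B t) 1"
  have m: "m > 0" using lt by (simp add: m_def)
  have k: "k > 0" by (rule up_barrierD(1)[OF B])
  have R0: "0 \<le> R" "0 \<le> Rv" using up_barrierD(2)[OF B, of 0] Rv[of 0] by linarith+
  define T where "T = (Rv + R + 1) / (k * m)"
  have T: "T \<ge> 0" "k * (T * m) = Rv + R + 1" using k m R0 by (auto simp: T_def)
  have "k * ((v t - B t) + (t - (t - T)) * min (v t - B t) 1) \<le> v (t - T) - B (t - T)"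
    by (rule up_barrierD(3)[OF B]) (use T lt ode_sub_subset[OF v] in auto)
  then have "k * (v t - B t) + k * (T * m) \<le> v (t - T) - B (t - T)" by (simp add: m_def distrib_left)
  moreover have "0 < k * (v t - B t)" using k lt by simp
  moreover have "v (t - T) - B (t - T) \<le> Rv + R" using Rv[of "t - T"] up_barrierD(2)[OF B, of "t - T"] by linarith
  ultimately show False using T(2) by linarith
qed

lemma bsol_sol: "bsol l b \<Longrightarrow> ode_sol f l UNIV b" and bsol_sol_on: "bsol l b \<Longrightarrow> ode_sol f l I b"
  unfolding bounded_sol_iff by (auto intro: ode_sol_subset)

lemma bsol_bounded: assumes "bsol l b" obtains R where "\<And>t. \<bar>b t\<bar> \<le> R"
proof -
  obtain R where "\<forall>x\<in>range b. norm x \<le> R" using assms unfolding bounded_sol_def bounded_iff by blast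
  then have "\<bar>b t\<bar> \<le> R" for t by simp
  then show thesis by (rule that)
qed

lemma bsolI: "ode_sol f l UNIV b \<Longrightarrow> (\<And>t. \<bar>b t\<bar> \<le> R) \<Longrightarrow> bsol l b"
  unfolding bounded_sol_iff bounded_iff by auto

lemma bsol_upper_bound: "\<exists>R. \<forall>l b t. \<bar>l\<bar> \<le> \<Lambda> \<longrightarrow> bsol l b \<longrightarrow> b t \<le> R"
proof -
  obtain R where R: "\<And>l. \<bar>l\<bar> \<le> \<Lambda> \<Longrightarrow> \<exists>B k. up_barrier l B k R" using up_barrier_exists by blast
  have "b t \<le> R" if l: "\<bar>l\<bar> \<le> \<Lambda>" and b: "bsol l b" for l b t
  proof -
    obtain B k where B: "up_barrier l B k R" using R[OF l] by blast
    obtain Rb where Rb: "\<And>t. \<bar>b t\<bar> \<le> Rb" using bsol_bounded[OF b] by blast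
    have "b t \<le> B t" by (rule bounded_sub_le_barrier[OF B ode_sol_imp_sub[OF bsol_sol[OF b]] Rb])
    then show ?thesis using up_barrierD(2)[OF B, of t] by linarith
  qed
  then show ?thesis by blast
qed

lemma bsol_dualI: "bsol l b \<Longrightarrow> bounded_sol (\<lambda>t x. dual_field f t x + l) (dual_curve b)"
  by (rule bounded_sol_dual)

lemma bsol_bound: "\<exists>R>0. \<forall>l b t. \<bar>l\<bar> \<le> \<Lambda> \<longrightarrow> bsol l b \<longrightarrow> \<bar>b t\<bar> \<le> R"
proof -
  obtain R1 where R1: "\<And>l b t. \<bar>l\<bar> \<le> \<Lambda> \<Longrightarrow> bsol l b \<Longrightarrow> b t \<le> R1" using bsol_upper_bound by blast
  obtain R2 where R2: "\<And>l b t. \<bar>l\<bar> \<le> \<Lambda> \<Longrightarrow> bounded_sol (\<lambda>t x. dual_field f t x + l) b \<Longrightarrow> b t \<le> R2"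
    using scalar_family.bsol_upper_bound[OF dual] by blast
  have "\<bar>b t\<bar> \<le> max 1 (max R1 R2)" if "\<bar>l\<bar> \<le> \<Lambda>" "bsol l b" for l b t
    using R1[OF that, of t] R2[OF that(1) bsol_dualI[OF that(2)], of "- t"] by (simp add: dual_curve_def)
  then show ?thesis by (intro exI[of _ "max 1 (max R1 R2)"] conjI allI impI) auto
qed

lemma family_compactness:
  assumes R: "R > 0" and sol: "\<And>n. ode_sol f (ls n) {- real n..real n} (u n)"
    and ub: "\<And>n t. t \<in> {- real n..real n} \<Longrightarrow> \<bar>u n t\<bar> \<le> R" and ls: "ls \<longlonglongrightarrow> l"
  shows "\<exists>b r. strict_mono r \<and> bsol l b \<and> (\<forall>t. \<bar>b t\<bar> \<le> R) \<and> (\<forall>t. (\<lambda>n. u (r n) t) \<longlonglongrightarrow> b t)"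
proof -
  obtain M where M: "M > 0" "\<And>t x. \<bar>x\<bar> \<le> R \<Longrightarrow> \<bar>f t x\<bar> \<le> M" "\<And>t x. \<bar>x\<bar> \<le> R \<Longrightarrow> \<bar>fx t x\<bar> \<le> M" using f_bound[of R] by blast
  have fl: "continuous_on UNIV (\<lambda>(t, x). f t x + l)" using f_cont by (auto simp: case_prod_unfold intro!: continuous_intros)
  have "\<exists>b r. strict_mono r \<and> (\<forall>t. (b has_real_derivative f t (b t) + l) (at t)) \<and> (\<forall>t. \<bar>b t\<bar> \<le> R) \<and>
    (\<forall>t. (\<lambda>n. u (r n) t) \<longlonglongrightarrow> b t)"
  proof (rule solution_compactness[OF fl R, where fn = "\<lambda>n t x. f t x + ls n"])
    show "\<bar>f t x + l\<bar> \<le> M + \<bar>l\<bar>" if "\<bar>x\<bar> \<le> R" for t x using M(2)[OF that, of t] by linarith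
    show "\<bar>(f t x + l) - (f t y + l)\<bar> \<le> M * \<bar>x - y\<bar>" if "\<bar>x\<bar> \<le> R" "\<bar>y\<bar> \<le> R" for t x y
      using f_lip[of R M x y t] M(3) that by simp
    show "(u n has_real_derivative f t (u n t) + ls n) (at t)" if "\<bar>t\<bar> \<le> real n" for n t
    proof -
      have "t \<in> {- real n..real n}" using that by auto
      then show ?thesis using sol[of n] unfolding ode_sol_def by blast
    qed
    show "\<bar>u n t\<bar> \<le> R" if "\<bar>t\<bar> \<le> real n" for n t by (rule ub) (use that in auto)
    fix T e :: real assume "e > 0"
    then obtain N where N: "\<And>n. n \<ge> N \<Longrightarrow> dist (ls n) l < e" using ls unfolding lim_sequentially by blast
    have "\<bar>(f t x + ls n) - (f t x + l)\<bar> \<le> e" if "n \<ge> N" for n t x using N[OF that] by (simp add: dist_real_def)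
    then show "\<exists>N. \<forall>n\<ge>N. \<forall>t x. \<bar>t\<bar> \<le> T \<longrightarrow> \<bar>x\<bar> \<le> R \<longrightarrow> \<bar>(f t x + ls n) - (f t x + l)\<bar> \<le> e" by blast
  qed
  then obtain b r where br: "strict_mono r" "\<And>t. (b has_real_derivative f t (b t) + l) (at t)" "\<And>t. \<bar>b t\<bar> \<le> R"
    "\<And>t. (\<lambda>n. u (r n) t) \<longlonglongrightarrow> b t" by blast
  have "bsol l b" by (rule bsolI[OF _ br(3)]) (simp add: ode_sol_def br(2))
  then show ?thesis using br by (intro exI[where x = b] exI[where x = r]) simp
qed

lemma exist_above:
  assumes v: "ode_sub f l UNIV v" and Rv: "\<And>t. \<bar>v t\<bar> \<le> Rv"
  shows "\<exists>b. bsol l b \<and> (\<forall>t. v t \<le> b t)"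
proof -
  obtain R B k where B: "up_barrier l B k R" using up_barrier_exists[of "\<bar>l\<bar>"] by blast
  have vB: "v t \<le> B t" for t by (rule bounded_sub_le_barrier[OF B v Rv])
  have R0: "0 \<le> R" "0 \<le> Rv" using up_barrierD(2)[OF B, of 0] Rv[of 0] by linarith+
  define R' where "R' = Rv + R + 1"
  have R': "R' > 0" using R0 by (simp add: R'_def)
  have ap: "v t' \<le> w t' \<and> \<bar>w t'\<bar> \<le> R'" if w: "s \<le> t'" "ode_sol f l {s..t'} w" "w s = v s" for s t' w
  proof -
    have 1: "v t' \<le> w t'"
      by (rule sub_super_compare[OF w(1) ode_sub_subset[OF v] ode_sol_imp_super[OF w(2)]]) (use w(3) in auto)
    have "w t' \<le> B t'"
    proof (rule ccontr)
      assume "\<not> ?thesis"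
      then have lt: "B t' < w t'" by simp
      have "k * ((w t' - B t') + (t' - s) * min (w t' - B t') 1) \<le> w s - B s"
        by (rule up_barrierD(3)[OF B w(1) ode_sol_imp_sub[OF w(2)] lt])
      moreover have "0 < k * ((w t' - B t') + (t' - s) * min (w t' - B t') 1)"
        using up_barrierD(1)[OF B] lt w(1) by (intro mult_pos_pos add_pos_nonneg) auto
      ultimately show False using vB[of s] w(3) by linarith
    qed
    then show ?thesis using 1 Rv[of t'] up_barrierD(2)[OF B, of t'] R0 unfolding R'_def by linarith
  qed
  have "\<exists>w. w (- real n) = v (- real n) \<and> ode_sol f l {- real n..real n} w \<and> (\<forall>r\<in>{- real n..real n}. \<bar>w r\<bar> \<le> R')" for n
  proof (rule sol_exists_apriori)
    show "\<bar>v (- real n)\<bar> \<le> R'" using Rv[of "- real n"] R0 unfolding R'_def by linarith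
    show "\<bar>w t'\<bar> \<le> R'" if "t' \<in> {- real n..real n}" "ode_sol f l {- real n..t'} w" "w (- real n) = v (- real n)" for t' w
      using ap[of "- real n" t' w] that by simp
  qed simp
  then obtain w where w: "\<And>n. w n (- real n) = v (- real n)" "\<And>n. ode_sol f l {- real n..real n} (w n)"
    "\<And>n r. r \<in> {- real n..real n} \<Longrightarrow> \<bar>w n r\<bar> \<le> R'" by metis
  obtain b r where br: "strict_mono r" "bsol l b" "\<And>t. (\<lambda>n. w (r n) t) \<longlonglongrightarrow> b t"
    using family_compactness[of R' "\<lambda>_. l" w l, OF R' w(2) w(3) tendsto_const] by blast
  have "v t \<le> b t" for t
  proof (rule LIMSEQ_le_const[OF br(3)])
    obtain N :: nat where N: "\<bar>t\<bar> \<le> real N" using real_arch_simple by blast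
    have "v t \<le> w (r n) t" if "n \<ge> N" for n
    proof -
      have t: "t \<in> {- real (r n)..real (r n)}" using N that seq_suble[OF br(1), of n] by auto
      show ?thesis
        using ap[of "- real (r n)" t "w (r n)"] ode_sol_subset[OF w(2)[of "r n"], of "{- real (r n)..t}"] w(1)[of "r n"] t by auto
    qed
    then show "\<exists>N. \<forall>n\<ge>N. v t \<le> w (r n) t" by blast
  qed
  then show ?thesis using br(2) by blast
qed

lemma exist_below:
  assumes v: "ode_sub f l UNIV v" and Rv: "\<And>t. \<bar>v t\<bar> \<le> Rv"
  shows "\<exists>b. bsol l b \<and> (\<forall>t. b t \<le> v t)"
proof -
  have dv: "ode_sub (dual_field f) l UNIV (dual_curve v)" using ode_sub_dual[OF v] surj_uminus_real by simp
  have "\<exists>b. bounded_sol (\<lambda>t x. dual_field f t x + l) b \<and> (\<forall>t. dual_curve v t \<le> b t)"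
    by (rule scalar_family.exist_above[OF dual dv, of Rv]) (use Rv in \<open>simp add: dual_curve_def\<close>)
  then obtain b where b: "bounded_sol (\<lambda>t x. dual_field f t x + l) b" "\<And>t. dual_curve v t \<le> b t" by blast
  have "bsol l (dual_curve b)" using bounded_sol_dual[OF b(1)] by simp
  moreover have "dual_curve b t \<le> v t" for t using b(2)[of "- t"] by (simp add: dual_curve_def)
  ultimately show ?thesis by blast
qed

lemma upper_exists:
  assumes b0: "bsol l b0"
  shows "upper_bsol (\<lambda>t x. f t x + l) (upper_sol f l)"
proof -
  obtain R where R: "R > 0" "\<And>b t. bsol l b \<Longrightarrow> \<bar>b t\<bar> \<le> R" using bsol_bound[of "\<bar>l\<bar>"] by blast
  define S where "S = {b 0 | b. bsol l b}"
  have S: "S \<noteq> {}" "bdd_above S"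
  proof -
    show "S \<noteq> {}" using b0 by (auto simp: S_def)
    have "x \<le> R" if "x \<in> S" for x using that R(2)[of _ 0] by (force simp: S_def)
    then show "bdd_above S" by (rule bdd_aboveI)
  qed
  have "\<exists>x\<in>S. Sup S - 1 / real (Suc n) < x" for n
    by (rule less_cSupD[OF S(1)]) simp
  then have "\<exists>b. bsol l b \<and> Sup S - 1 / real (Suc n) < b 0" for n unfolding S_def by blast
  then obtain bn where bn: "\<And>n. bsol l (bn n)" "\<And>n. Sup S - 1 / real (Suc n) < bn n 0" by metis
  have "\<exists>b r. strict_mono r \<and> bsol l b \<and> (\<forall>t. \<bar>b t\<bar> \<le> R) \<and> (\<forall>t. (\<lambda>n. bn (r n) t) \<longlonglongrightarrow> b t)"
    by (rule family_compactness[OF R(1), of "\<lambda>_. l"]) (use bn(1) R(2) bsol_sol_on in auto)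
  then obtain b r where br: "strict_mono r" "bsol l b" "\<And>t. (\<lambda>n. bn (r n) t) \<longlonglongrightarrow> b t" by blast
  have "Sup S \<le> b 0"
  proof (rule LIMSEQ_le[OF _ br(3)])
    have "(\<lambda>n. Sup S - 1 / real (Suc n)) \<longlonglongrightarrow> Sup S - 0" by (intro tendsto_intros LIMSEQ_Suc lim_1_over_n)
    then show "(\<lambda>n. Sup S - 1 / real (Suc n)) \<longlonglongrightarrow> Sup S" by simp
    have "Sup S - 1 / real (Suc n) \<le> bn (r n) 0" for n
    proof -
      have "1 / real (Suc (r n)) \<le> 1 / real (Suc n)" using seq_suble[OF br(1), of n] by (simp add: frac_le)
      then show ?thesis using bn(2)[of "r n"] by linarith
    qed
    then show "\<exists>N. \<forall>n\<ge>N. Sup S - 1 / real (Suc n) \<le> bn (r n) 0" by blast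
  qed
  then have "b' 0 \<le> b 0" if "bsol l b'" for b'
    using cSup_upper[OF _ S(2), of "b' 0"] that by (force simp: S_def)
  then have "upper_bsol (\<lambda>t x. f t x + l) b"
    unfolding upper_bsol_def using br(2) sol_order_UNIV[OF bsol_sol bsol_sol[OF br(2)]] by blast
  then show ?thesis unfolding upper_sol_def by (rule someI[of "upper_bsol (\<lambda>t x. f t x + l)"])
qed

lemma lower_exists:
  assumes b0: "bsol l b0"
  shows "lower_bsol (\<lambda>t x. f t x + l) (lower_sol f l)"
proof -
  have "upper_bsol (\<lambda>t x. dual_field f t x + l) (upper_sol (dual_field f) l)"
    by (rule scalar_family.upper_exists[OF dual bsol_dualI[OF b0]])
  from lower_bsol_dual[OF this] have "lower_bsol (\<lambda>t x. f t x + l) (dual_curve (upper_sol (dual_field f) l))" by simp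
  then show ?thesis unfolding lower_sol_def by (rule someI[of "lower_bsol (\<lambda>t x. f t x + l)"])
qed

definition "lam0 = Inf (bsol_params f)"

lemma bsol_params_upward: "l \<in> bsol_params f \<Longrightarrow> l \<le> m \<Longrightarrow> m \<in> bsol_params f"
proof -
  assume "l \<in> bsol_params f" "l \<le> m"
  then obtain b where b: "bsol l b" unfolding bsol_params_def by blast
  obtain R where R: "\<And>t. \<bar>b t\<bar> \<le> R" using bsol_bounded[OF b] by blast
  obtain b' where "bsol m b'"
    using exist_above[OF ode_sub_mono[OF ode_sol_imp_sub[OF bsol_sol[OF b]] \<open>l \<le> m\<close>] R] by blast
  then show ?thesis unfolding bsol_params_def by blast
qed

lemma const_sub:
  "\<exists>M. \<forall>l\<ge>M. ode_sub f l UNIV (\<lambda>_. x)"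
proof -
  obtain M where M: "\<And>t y. \<bar>y\<bar> \<le> \<bar>x\<bar> \<Longrightarrow> \<bar>f t y\<bar> \<le> M \<and> \<bar>fx t y\<bar> \<le> M" using f_bdd[of "\<bar>x\<bar>"] by blast
  have "ode_sub f l UNIV (\<lambda>_. x)" if "l \<ge> M" for l
    unfolding ode_sub_def
  proof
    fix t
    show "\<exists>D. ((\<lambda>_. x) has_real_derivative D) (at t) \<and> D \<le> f t x + l"
      using conjunct1[OF M[of x t]] that by (intro exI[of _ 0]) auto
  qed
  then show ?thesis by blast
qed

lemma bsol_params_ne: "bsol_params f \<noteq> {}"
proof -
  obtain M where "\<And>l. l \<ge> M \<Longrightarrow> ode_sub f l UNIV (\<lambda>_. 0)" using const_sub[of 0] by blast
  then have "\<exists>b. bsol M b \<and> (\<forall>t. 0 \<le> b t)" by (intro exist_above[where Rv = 0]) auto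
  then show ?thesis unfolding bsol_params_def by blast
qed

lemma lam0_mem: "lam0 \<in> bsol_params f"
proof -
  have "\<exists>l\<in>bsol_params f. l < lam0 + 1 / real (Suc n)" for n
    by (rule cInf_lessD[OF bsol_params_ne]) (simp add: lam0_def)
  then have "\<exists>l b. bsol l b \<and> l < lam0 + 1 / real (Suc n)" for n unfolding bsol_params_def by blast
  then obtain ls bn where ls: "\<And>n. bsol (ls n) (bn n)" "\<And>n. ls n < lam0 + 1 / real (Suc n)" by metis
  have ge: "lam0 \<le> ls n" for n
    unfolding lam0_def by (rule cInf_lower[OF _ params_bdd]) (use ls(1)[of n] in \<open>auto simp: bsol_params_def\<close>)
  have lim: "ls \<longlonglongrightarrow> lam0"
  proof (rule tendsto_sandwich[OF _ _ tendsto_const])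
    show "\<forall>\<^sub>F n in sequentially. lam0 \<le> ls n" using ge by simp
    show "\<forall>\<^sub>F n in sequentially. ls n \<le> lam0 + 1 / real (Suc n)" using ls(2) by (simp add: less_imp_le)
    have "(\<lambda>n. lam0 + 1 / real (Suc n)) \<longlonglongrightarrow> lam0 + 0" by (intro tendsto_intros LIMSEQ_Suc lim_1_over_n)
    then show "(\<lambda>n. lam0 + 1 / real (Suc n)) \<longlonglongrightarrow> lam0" by simp
  qed
  have lb: "\<bar>ls n\<bar> \<le> \<bar>lam0\<bar> + 1" for n
  proof -
    have "1 / real (Suc n) \<le> 1" by simp
    then show ?thesis using ge[of n] ls(2)[of n] by linarith
  qed
  obtain R where R: "R > 0" "\<And>l b t. \<bar>l\<bar> \<le> \<bar>lam0\<bar> + 1 \<Longrightarrow> bsol l b \<Longrightarrow> \<bar>b t\<bar> \<le> R"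
    using bsol_bound[of "\<bar>lam0\<bar> + 1"] by blast
  have "\<exists>b r. strict_mono r \<and> bsol lam0 b \<and> (\<forall>t. \<bar>b t\<bar> \<le> R) \<and> (\<forall>t. (\<lambda>n. bn (r n) t) \<longlonglongrightarrow> b t)"
    by (rule family_compactness[OF R(1) bsol_sol_on[OF ls(1)] R(2)[OF lb ls(1)] lim])
  then show ?thesis unfolding bsol_params_def by blast
qed

lemma bsol_iff: "(\<exists>b. bsol l b) \<longleftrightarrow> lam0 \<le> l"
proof
  assume "\<exists>b. bsol l b"
  then show "lam0 \<le> l" unfolding lam0_def by (intro cInf_lower[OF _ params_bdd]) (simp add: bsol_params_def)
next
  assume "lam0 \<le> l"
  from bsol_params_upward[OF lam0_mem this] show "\<exists>b. bsol l b" unfolding bsol_params_def by blast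
qed

lemma dual_lam0: "scalar_family.lam0 (dual_field f) = lam0"
  unfolding scalar_family.lam0_def[OF dual] lam0_def bsol_params_dual ..

abbreviation "up \<equiv> upper_sol f"
abbreviation "lo \<equiv> lower_sol f"

lemma up_upper: "lam0 \<le> l \<Longrightarrow> upper_bsol (\<lambda>t x. f t x + l) (up l)"
  using upper_exists bsol_iff by blast

lemma lo_lower: "lam0 \<le> l \<Longrightarrow> lower_bsol (\<lambda>t x. f t x + l) (lo l)"
  using lower_exists bsol_iff by blast

lemma up_bsol: "lam0 \<le> l \<Longrightarrow> bsol l (up l)" and up_ge: "lam0 \<le> l \<Longrightarrow> bsol l b \<Longrightarrow> b t \<le> up l t"
  using up_upper unfolding upper_bsol_def by blast+

lemma lo_bsol: "lam0 \<le> l \<Longrightarrow> bsol l (lo l)" and lo_le: "lam0 \<le> l \<Longrightarrow> bsol l b \<Longrightarrow> lo l t \<le> b t"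
  using lo_lower unfolding lower_bsol_def by blast+

lemma up_dual: "lam0 \<le> l \<Longrightarrow> upper_sol (dual_field f) l = dual_curve (lo l)"
  using lower_sol_dual lo_lower by blast

lemma lo_dual: "lam0 \<le> l \<Longrightarrow> lower_sol (dual_field f) l = dual_curve (up l)"
proof -
  assume "lam0 \<le> l"
  then have "lower_bsol (\<lambda>t x. dual_field f t x + l) (lower_sol (dual_field f) l)"
    using scalar_family.lo_lower[OF dual] dual_lam0 by simp
  from lower_sol_dual[OF this] show ?thesis by simp
qed

lemma up_ge_sub:
  assumes v: "ode_sub f l UNIV v" and Rv: "\<And>t. \<bar>v t\<bar> \<le> Rv"
  shows "lam0 \<le> l" "v t \<le> up l t"
proof -
  obtain b where b: "bsol l b" "\<And>t. v t \<le> b t" using exist_above[OF v Rv] by blast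
  then show l: "lam0 \<le> l" using bsol_iff by blast
  show "v t \<le> up l t" using b(2)[of t] up_ge[OF l b(1), of t] by linarith
qed

lemma lo_le_sub:
  assumes v: "ode_sub f l UNIV v" and Rv: "\<And>t. \<bar>v t\<bar> \<le> Rv"
  shows "lo l t \<le> v t"
proof -
  obtain b where b: "bsol l b" "\<And>t. b t \<le> v t" using exist_below[OF v Rv] by blast
  then have l: "lam0 \<le> l" using bsol_iff by blast
  show ?thesis using b(2)[of t] lo_le[OF l b(1), of t] by linarith
qed

lemma sep_above:
  assumes b: "bsol l b" and lm: "l < m"
  shows "\<exists>d>0. \<forall>t. b t + d \<le> up m t"
proof -
  obtain Rb where Rb: "\<And>t. \<bar>b t\<bar> \<le> Rb" using bsol_bounded[OF b] by blast
  have m: "lam0 \<le> m" and ge: "b t \<le> up m t" for t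
    using up_ge_sub[OF ode_sub_mono[OF ode_sol_imp_sub[OF bsol_sol[OF b]]] Rb, of m] lm by auto
  obtain Ru where Ru: "\<And>t. \<bar>up m t\<bar> \<le> Ru" using bsol_bounded[OF up_bsol[OF m]] by blast
  define R where "R = max Rb Ru"
  have Rs: "\<bar>b t\<bar> \<le> R" "\<bar>up m t\<bar> \<le> R" for t using Rb[of t] Ru[of t] by (auto simp: R_def)
  obtain M where M: "M > 0" "\<And>t x. \<bar>x\<bar> \<le> R \<Longrightarrow> \<bar>f t x\<bar> \<le> M" "\<And>t x. \<bar>x\<bar> \<le> R \<Longrightarrow> \<bar>fx t x\<bar> \<le> M"
    using f_bound[of R] by blast
  define d where "d = (m - l) / M"
  have d: "d > 0" "M * d = m - l" using lm M by (auto simp: d_def)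
  define w where "w t = up m t - b t" for t
  have wd: "(w has_real_derivative (f t (up m t) + m) - (f t (b t) + l)) (at t)" for t
    unfolding w_def using bsol_sol[OF b] bsol_sol[OF up_bsol[OF m]] unfolding ode_sol_def by (intro DERIV_diff) auto
  have w0: "w t \<ge> 0" for t using ge[of t] by (simp add: w_def)
  have ineq: "0 \<le> (f t (up m t) + m) - (f t (b t) + l) + M * (w t - d)" for t
  proof -
    have "\<bar>f t (up m t) - f t (b t)\<bar> \<le> M * \<bar>up m t - b t\<bar>" using f_lip[of R M] M(3) Rs by blast
    then have "- (M * w t) \<le> f t (up m t) - f t (b t)" using w0[of t] by (simp add: w_def)
    then show ?thesis using d(2) by (simp add: algebra_simps)
  qed
  have mono: "(w s - d) * exp (M * s) \<le> (w t - d) * exp (M * t)" if "s \<le> t" for s t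
  proof (rule DERIV_nonneg_imp_nondecreasing[OF that])
    fix x
    have "((\<lambda>t. (w t - d) * exp (M * t)) has_real_derivative ((f x (up m x) + m) - (f x (b x) + l) + M * (w x - d)) * exp (M * x)) (at x)"
      by (auto intro!: derivative_eq_intros wd simp: algebra_simps)
    moreover have "0 \<le> ((f x (up m x) + m) - (f x (b x) + l) + M * (w x - d)) * exp (M * x)"
      by (rule mult_nonneg_nonneg[OF ineq]) simp
    ultimately show "\<exists>y. ((\<lambda>t. (w t - d) * exp (M * t)) has_real_derivative y) (at x) \<and> 0 \<le> y" by blast
  qed
  have "d \<le> w t" for t
  proof (rule ccontr)
    assume "\<not> d \<le> w t"
    then have e: "d - w t > 0" by simp
    define T where "T = d / ((d - w t) * M)"
    have T: "T \<ge> 0" using d e M by (simp add: T_def)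
    have "(w (t - T) - d) * exp (M * (t - T)) \<le> (w t - d) * exp (M * t)" by (rule mono) (use T in simp)
    moreover have "- d * exp (M * (t - T)) \<le> (w (t - T) - d) * exp (M * (t - T))"
      using w0[of "t - T"] by (intro mult_right_mono) auto
    ultimately have "(d - w t) * exp (M * t) \<le> d * exp (M * (t - T))" by (simp add: algebra_simps)
    moreover have "exp (M * t) = exp (M * T) * exp (M * (t - T))" by (simp add: exp_add[symmetric] algebra_simps)
    ultimately have "((d - w t) * exp (M * T)) * exp (M * (t - T)) \<le> d * exp (M * (t - T))" by simp
    then have "(d - w t) * exp (M * T) \<le> d" by (rule mult_right_le_imp_le) simp
    moreover have "(d - w t) * (1 + M * T) \<le> (d - w t) * exp (M * T)" using e exp_ge_add_one_self[of "M * T"] by simp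
    moreover have "(d - w t) * (1 + M * T) = (d - w t) + d" using e M by (simp add: T_def field_simps)
    ultimately show False using e by linarith
  qed
  then show ?thesis using d(1) by (intro exI[of _ d]) (auto simp: w_def algebra_simps)
qed

lemma sep_below:
  assumes b: "bsol l b" and lm: "l < m"
  shows "\<exists>d>0. \<forall>t. lo m t + d \<le> b t"
proof -
  have m: "lam0 \<le> m" using b lm bsol_iff[of l] by force
  obtain d where d: "d > 0" "\<And>t. dual_curve b t + d \<le> upper_sol (dual_field f) m t"
    using scalar_family.sep_above[OF dual bsol_dualI[OF b] lm] by blast
  have "lo m t + d \<le> b t" for t using d(2)[of "- t"] up_dual[OF m] by (simp add: dual_curve_def)
  then show ?thesis using d(1) by blast
qed

lemma up_strict_mono: "lam0 \<le> l \<Longrightarrow> l < m \<Longrightarrow> up l t < up m t"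
proof -
  assume lm: "lam0 \<le> l" "l < m"
  obtain d where d: "d > 0" "\<forall>t. up l t + d \<le> up m t" using sep_above[OF up_bsol[OF lm(1)] lm(2)] by blast
  have "up l t + d \<le> up m t" using d(2) ..
  then show ?thesis using d(1) by linarith
qed

lemma lo_strict_mono: "lam0 \<le> l \<Longrightarrow> l < m \<Longrightarrow> lo m t < lo l t"
proof -
  assume lm: "lam0 \<le> l" "l < m"
  obtain d where d: "d > 0" "\<forall>t. lo m t + d \<le> lo l t" using sep_below[OF lo_bsol[OF lm(1)] lm(2)] by blast
  have "lo m t + d \<le> lo l t" using d(2) ..
  then show ?thesis using d(1) by linarith
qed

lemma lo_up_separated:
  assumes "lam0 < l" shows "\<exists>d>0. \<forall>t. lo l t + d \<le> up l t"
proof -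
  obtain b where b: "bsol lam0 b" using bsol_iff[of lam0] by blast
  obtain d1 where d1: "d1 > 0" "\<And>t. b t + d1 \<le> up l t" using sep_above[OF b assms] by blast
  obtain d2 where d2: "d2 > 0" "\<And>t. lo l t + d2 \<le> b t" using sep_below[OF b assms] by blast
  have "lo l t + (d1 + d2) \<le> up l t" for t using d1(2)[of t] d2(2)[of t] by linarith
  then show ?thesis using add_pos_pos[OF d1(1) d2(1)] by blast
qed

definition attractive :: "(real \<Rightarrow> real) \<Rightarrow> bool" where
  "attractive b \<longleftrightarrow> (\<exists>\<gamma>>0. \<exists>D. \<forall>s t. s \<le> t \<longrightarrow> integral {s..t} (\<lambda>r. fx r (b r)) \<le> D - \<gamma> * (t - s))"

definition repulsive :: "(real \<Rightarrow> real) \<Rightarrow> bool" where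
  "repulsive b \<longleftrightarrow> (\<exists>\<gamma>>0. \<exists>D. \<forall>s t. s \<le> t \<longrightarrow> \<gamma> * (t - s) - D \<le> integral {s..t} (\<lambda>r. fx r (b r)))"

lemma deriv_family: "deriv (\<lambda>x. f t x + l) x = fx t x"
  by (rule DERIV_imp_deriv) (auto intro!: derivative_eq_intros fx_der)

lemma attr_hyperbolic_iff: "attr_hyperbolic (\<lambda>t x. f t x + l) b \<longleftrightarrow> bsol l b \<and> attractive b"
proof
  assume "attr_hyperbolic (\<lambda>t x. f t x + l) b"
  then obtain k \<gamma> where k: "bsol l b" "k \<ge> 1" "\<gamma> > 0"
    "\<And>s t. s \<le> t \<Longrightarrow> exp (integral {s..t} (\<lambda>r. fx r (b r))) \<le> k * exp (- \<gamma> * (t - s))"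
    unfolding attr_hyperbolic_def deriv_family by blast
  have "integral {s..t} (\<lambda>r. fx r (b r)) \<le> ln k - \<gamma> * (t - s)" if "s \<le> t" for s t
  proof -
    have "exp (integral {s..t} (\<lambda>r. fx r (b r))) \<le> exp (ln k - \<gamma> * (t - s))"
      using k(4)[OF that] k(2) by (simp add: exp_diff exp_minus divide_inverse)
    then show ?thesis by simp
  qed
  then show "bsol l b \<and> attractive b" using k(1,3) unfolding attractive_def by blast
next
  assume "bsol l b \<and> attractive b"
  then obtain \<gamma> D where k: "bsol l b" "\<gamma> > 0"
    "\<And>s t. s \<le> t \<Longrightarrow> integral {s..t} (\<lambda>r. fx r (b r)) \<le> D - \<gamma> * (t - s)" unfolding attractive_def by blast
  have "exp (integral {s..t} (\<lambda>r. fx r (b r))) \<le> max 1 (exp D) * exp (- \<gamma> * (t - s))" if "s \<le> t" for s t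
  proof -
    have "exp (integral {s..t} (\<lambda>r. fx r (b r))) \<le> exp (D - \<gamma> * (t - s))" using k(3)[OF that] by simp
    also have "\<dots> = exp D * exp (- \<gamma> * (t - s))" by (simp add: exp_diff exp_minus divide_inverse)
    also have "\<dots> \<le> max 1 (exp D) * exp (- \<gamma> * (t - s))" by (rule mult_right_mono) auto
    finally show ?thesis .
  qed
  then show "attr_hyperbolic (\<lambda>t x. f t x + l) b" using k(1,2)
    unfolding attr_hyperbolic_def deriv_family by (intro conjI exI[of _ "max 1 (exp D)"] exI[of _ \<gamma>]) auto
qed

lemma rep_hyperbolic_iff: "rep_hyperbolic (\<lambda>t x. f t x + l) b \<longleftrightarrow> bsol l b \<and> repulsive b"
proof
  assume "rep_hyperbolic (\<lambda>t x. f t x + l) b"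
  then obtain k \<gamma> where k: "bsol l b" "k \<ge> 1" "\<gamma> > 0"
    "\<And>s t. t \<le> s \<Longrightarrow> exp (- integral {t..s} (\<lambda>r. fx r (b r))) \<le> k * exp (\<gamma> * (t - s))"
    unfolding rep_hyperbolic_def deriv_family by blast
  have "\<gamma> * (t - s) - ln k \<le> integral {s..t} (\<lambda>r. fx r (b r))" if "s \<le> t" for s t
  proof -
    have "exp (- integral {s..t} (\<lambda>r. fx r (b r))) \<le> exp (ln k + \<gamma> * (s - t))"
      using k(4)[OF that] k(2) by (simp add: exp_add)
    then have "- integral {s..t} (\<lambda>r. fx r (b r)) \<le> ln k + \<gamma> * (s - t)" by simp
    then show ?thesis by (simp add: algebra_simps)
  qed
  then show "bsol l b \<and> repulsive b" using k(1,3) unfolding repulsive_def by blast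
next
  assume "bsol l b \<and> repulsive b"
  then obtain \<gamma> D where k: "bsol l b" "\<gamma> > 0"
    "\<And>s t. s \<le> t \<Longrightarrow> \<gamma> * (t - s) - D \<le> integral {s..t} (\<lambda>r. fx r (b r))" unfolding repulsive_def by blast
  have "exp (- integral {t..s} (\<lambda>r. fx r (b r))) \<le> max 1 (exp D) * exp (\<gamma> * (t - s))" if "t \<le> s" for s t
  proof -
    have "exp (- integral {t..s} (\<lambda>r. fx r (b r))) \<le> exp (D + \<gamma> * (t - s))" using k(3)[OF that] by (simp add: algebra_simps)
    also have "\<dots> = exp D * exp (\<gamma> * (t - s))" by (simp add: exp_add)
    also have "\<dots> \<le> max 1 (exp D) * exp (\<gamma> * (t - s))" by (rule mult_right_mono) auto
    finally show ?thesis .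
  qed
  then show "rep_hyperbolic (\<lambda>t x. f t x + l) b" using k(1,2)
    unfolding rep_hyperbolic_def deriv_family by (intro conjI exI[of _ "max 1 (exp D)"] exI[of _ \<gamma>]) auto
qed

lemma attractive_dual: "scalar_family.attractive dual_fx (dual_curve b) \<longleftrightarrow> repulsive b"
proof -
  have "(\<forall>s t. s \<le> t \<longrightarrow> - integral {-t..-s} (\<lambda>r. fx r (b r)) \<le> D - \<gamma> * (t - s)) \<longleftrightarrow>
     (\<forall>s t. s \<le> t \<longrightarrow> \<gamma> * (t - s) - D \<le> integral {s..t} (\<lambda>r. fx r (b r)))" (is "?L \<longleftrightarrow> ?R") for \<gamma> D
  proof (intro iffI allI impI)
    fix s t :: real assume L: ?L and st: "s \<le> t"
    from L st have "- integral {-(-s)..-(-t)} (\<lambda>r. fx r (b r)) \<le> D - \<gamma> * (- s - - t)" by (metis neg_le_iff_le)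
    then show "\<gamma> * (t - s) - D \<le> integral {s..t} (\<lambda>r. fx r (b r))" by (simp add: algebra_simps)
  next
    fix s t :: real assume R: ?R and st: "s \<le> t"
    from R st have "\<gamma> * (- s - - t) - D \<le> integral {- t..- s} (\<lambda>r. fx r (b r))" by (metis neg_le_iff_le)
    then show "- integral {-t..-s} (\<lambda>r. fx r (b r)) \<le> D - \<gamma> * (t - s)" by (simp add: algebra_simps)
  qed
  then show ?thesis unfolding scalar_family.attractive_def[OF dual] repulsive_def dual_fx_curve by simp
qed

lemma separated_hyperbolic:
  assumes b: "bsol l b1" "bsol l b2" and d: "d > 0" "\<And>t. b1 t + d \<le> b2 t"
  shows "repulsive b1" "attractive b2"
proof -
  obtain R where R: "\<And>l' b t. \<bar>l'\<bar> \<le> \<bar>l\<bar> \<Longrightarrow> bsol l' b \<Longrightarrow> \<bar>b t\<bar> \<le> R" using bsol_bound[of "\<bar>l\<bar>"] by blast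
  obtain \<sigma> \<gamma> D where E: "\<sigma> > 0" "\<gamma> > 0"
    "\<And>l1 l2 b1 b2 s t. s \<le> t \<Longrightarrow> \<bar>l1\<bar> \<le> \<bar>l\<bar> \<Longrightarrow> \<bar>l2\<bar> \<le> \<bar>l\<bar> \<Longrightarrow>
        \<bar>l1 - l2\<bar> \<le> \<sigma> \<Longrightarrow> ode_sol f l1 {s..t} b1 \<Longrightarrow> ode_sol f l2 {s..t} b2 \<Longrightarrow>
        (\<forall>r\<in>{s..t}. \<bar>b1 r\<bar> \<le> R \<and> \<bar>b2 r\<bar> \<le> R \<and> d \<le> b2 r - b1 r) \<Longrightarrow>
        integral {s..t} (\<lambda>r. fx r (b2 r)) \<le> D - \<gamma> * (t - s) \<and> \<gamma> * (t - s) - D \<le> integral {s..t} (\<lambda>r. fx r (b1 r))"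
    using hypE[OF d(1), of "\<bar>l\<bar>" R] by blast
  have "integral {s..t} (\<lambda>r. fx r (b2 r)) \<le> D - \<gamma> * (t - s) \<and> \<gamma> * (t - s) - D \<le> integral {s..t} (\<lambda>r. fx r (b1 r))"
    if "s \<le> t" for s t
  proof (rule E(3)[OF that])
    show "\<forall>r\<in>{s..t}. \<bar>b1 r\<bar> \<le> R \<and> \<bar>b2 r\<bar> \<le> R \<and> d \<le> b2 r - b1 r"
    proof
      fix r show "\<bar>b1 r\<bar> \<le> R \<and> \<bar>b2 r\<bar> \<le> R \<and> d \<le> b2 r - b1 r"
        using R[OF order_refl b(1), of r] R[OF order_refl b(2), of r] d(2)[of r] by linarith
    qed
    show "ode_sol f l {s..t} b1" "ode_sol f l {s..t} b2" by (rule bsol_sol_on[OF b(1)], rule bsol_sol_on[OF b(2)])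
  qed (use E in auto)
  then show "repulsive b1" "attractive b2" unfolding repulsive_def attractive_def using E(2) by blast+
qed

lemma lo_repulsive: "lam0 < l \<Longrightarrow> repulsive (lo l)" and up_attractive: "lam0 < l \<Longrightarrow> attractive (up l)"
proof -
  assume l: "lam0 < l"
  then have l': "lam0 \<le> l" by simp
  obtain d where "d > 0" "\<And>t. lo l t + d \<le> up l t" using lo_up_separated[OF l] by blast
  from separated_hyperbolic[OF lo_bsol[OF l'] up_bsol[OF l'] this]
  show "repulsive (lo l)" "attractive (up l)" .
qed

lemma fx_curve_cont:
  assumes "continuous_on UNIV b" shows "continuous_on UNIV (\<lambda>t. fx t (b t))"
proof -
  have "continuous_on UNIV ((\<lambda>(t, x). fx t x) \<circ> (\<lambda>t. (t, b t)))"
    by (intro continuous_on_compose continuous_intros continuous_on_subset[OF fx_cont] assms) auto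
  then show ?thesis by (simp add: o_def)
qed

text \<open>A bounded solution of the inhomogeneous variational equation provides the
  sub- and supersolutions \<open>b - \<rho> z\<close> and \<open>b + \<rho> z\<close> below.\<close>

lemma attractive_variational:
  assumes b: "bsol l b" and att: "attractive b"
  shows "\<exists>z z0 z1. 0 < z0 \<and> (\<forall>t. z0 \<le> z t \<and> z t \<le> z1) \<and> (\<forall>t. (z has_real_derivative fx t (b t) * z t + 1) (at t))"
proof -
  obtain \<gamma> D where gD: "\<gamma> > 0" "\<And>s t. s \<le> t \<Longrightarrow> integral {s..t} (\<lambda>r. fx r (b r)) \<le> D - \<gamma> * (t - s)"
    using att unfolding attractive_def by blast
  obtain R where R: "\<And>t. \<bar>b t\<bar> \<le> R" using bsol_bounded[OF b] by blast
  obtain M where M: "M > 0" "\<And>t x. \<bar>x\<bar> \<le> R \<Longrightarrow> \<bar>f t x\<bar> \<le> M" "\<And>t x. \<bar>x\<bar> \<le> R \<Longrightarrow> \<bar>fx t x\<bar> \<le> M" using f_bound[of R] by blast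
  define A where "A t = - fx (- t) (b (- t))" for t
  have bc: "continuous_on UNIV b" using ode_sol_continuous[OF bsol_sol[OF b]] .
  have Ac: "continuous_on UNIV A" unfolding A_def[abs_def]
    by (intro continuous_intros continuous_on_compose2[OF fx_curve_cont[OF bc]]) auto
  have dich: "\<gamma> * (t - s) - D \<le> integral {s..t} A" if "s \<le> t" for s t
  proof -
    have "integral {s..t} A = - integral {-t..-s} (\<lambda>r. fx r (b r))"
      using Henstock_Kurzweil_Integration.integral_reflect_real[of "- s" "- t" "\<lambda>r. fx r (b r)"] by (simp add: A_def[abs_def])
    then show ?thesis using gD(2)[of "- t" "- s"] that by (simp add: algebra_simps)
  qed
  have one: "continuous_on UNIV (\<lambda>_. 1 :: real)" by simp
  define I where "I t = integral {0..} (\<lambda>s. exp (- integral {0..s} (\<lambda>l. A (l + t))) * 1)" for t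
  have Id: "((\<lambda>t. - I t) has_real_derivative A t * (- I t) + 1) (at t)" for t
    unfolding I_def by (rule linear_solution[OF Ac one _ gD(1) dich, of 1]) auto
  have Iub: "\<bar>I t\<bar> \<le> 1 * exp D / \<gamma>" for t
    unfolding I_def by (rule linear_bound[OF Ac one _ gD(1) dich, of 1]) auto
  have "A t \<le> M" for t using M(3)[OF R, of "- t" "- t"] by (simp add: A_def)
  then have Ilb: "1 / M \<le> I t" for t unfolding I_def using linear_unit_lower[OF Ac _ M(1) gD(1) dich] by blast
  define z where "z t = I (- t)" for t
  have "(z has_real_derivative fx t (b t) * z t + 1) (at t)" for t
  proof -
    have "dual_curve (\<lambda>t. - I t) = z" by (intro ext) (simp add: dual_curve_def z_def)
    then have "(z has_real_derivative A (- t) * (- I (- t)) + 1) (at t)"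
      using dual_curve_derivative[OF Id[of "- t"]] by simp
    then show ?thesis by (simp add: A_def z_def)
  qed
  moreover have "1 / M \<le> z t \<and> z t \<le> exp D / \<gamma>" for t using Ilb[of "- t"] Iub[of "- t"] by (simp add: z_def)
  ultimately show ?thesis using M(1) by (intro exI[of _ z] exI[of _ "1 / M"] exI[of _ "exp D / \<gamma>"]) auto
qed

lemma repulsive_variational:
  assumes b: "bsol l b" and rep: "repulsive b"
  shows "\<exists>z z0 z1. 0 < z0 \<and> (\<forall>t. z0 \<le> - z t \<and> - z t \<le> z1) \<and> (\<forall>t. (z has_real_derivative fx t (b t) * z t + 1) (at t))"
proof -
  have "scalar_family.attractive dual_fx (dual_curve b)" using rep attractive_dual by blast
  from scalar_family.attractive_variational[OF dual bsol_dualI[OF b] this]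
  obtain z z0 z1 where z: "0 < z0" "\<And>t. z0 \<le> z t \<and> z t \<le> z1"
    "\<And>t. (z has_real_derivative dual_fx t (dual_curve b t) * z t + 1) (at t)" by blast
  have "(dual_curve z has_real_derivative fx t (b t) * dual_curve z t + 1) (at t)" for t
    using dual_curve_derivative[OF z(3)[of "- t"]] by (simp add: dual_fx_def dual_curve_def)
  moreover have "z0 \<le> - dual_curve z t \<and> - dual_curve z t \<le> z1" for t using z(2)[of "- t"] by (simp add: dual_curve_def)
  ultimately show ?thesis using z(1) by (intro exI[of _ "dual_curve z"] exI[of _ z0] exI[of _ z1]) auto
qed

lemma variational_perturbation:
  assumes b: "bsol l b" and z: "\<And>t. (z has_real_derivative fx t (b t) * z t + 1) (at t)" and z1: "\<And>t. \<bar>z t\<bar> \<le> z1"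
  shows "\<exists>\<rho>0>0. \<forall>\<rho>. 0 < \<rho> \<longrightarrow> \<rho> \<le> \<rho>0 \<longrightarrow>
     ode_sub f (l - \<rho> / 2) UNIV (\<lambda>t. b t - \<rho> * z t) \<and> ode_super f (l + \<rho> / 2) UNIV (\<lambda>t. b t + \<rho> * z t)"
proof -
  obtain R where R: "\<And>t. \<bar>b t\<bar> \<le> R" using bsol_bounded[OF b] by blast
  define Z where "Z = max z1 1"
  have Z: "Z > 0" "\<And>t. \<bar>z t\<bar> \<le> Z" using z1 by (auto simp: Z_def le_max_iff_disj)
  obtain d where d: "d > 0" "\<And>t x y. \<bar>x\<bar> \<le> R + 1 \<Longrightarrow> \<bar>y\<bar> \<le> R + 1 \<Longrightarrow> \<bar>x - y\<bar> < d \<Longrightarrow> \<bar>fx t x - fx t y\<bar> \<le> 1 / (2 * Z)"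
    using fx_ucont[of "1 / (2 * Z)" "R + 1"] Z(1) by auto
  define \<rho>0 where "\<rho>0 = min 1 (d / 2) / Z"
  have \<rho>0: "\<rho>0 > 0" using d Z by (simp add: \<rho>0_def)
  have est: "\<bar>f t (b t + h) - f t (b t) - h * fx t (b t)\<bar> \<le> \<rho> / 2"
    if h: "\<bar>h\<bar> \<le> \<rho> * Z" and \<rho>: "0 < \<rho>" "\<rho> \<le> \<rho>0" for t h \<rho>
  proof -
    have "\<rho> * Z \<le> \<rho>0 * Z" using \<rho> Z by (intro mult_right_mono) auto
    also have "\<dots> = min 1 (d / 2)" using Z by (simp add: \<rho>0_def)
    finally have h1: "\<bar>h\<bar> \<le> 1" "\<bar>h\<bar> < d" using h d(1) by linarith+
    have key: "\<bar>fx t \<xi> - fx t (b t)\<bar> \<le> 1 / (2 * Z)" if "\<bar>\<xi> - b t\<bar> \<le> \<bar>h\<bar>" for \<xi>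
      by (rule d(2)) (use that h1 R[of t] in linarith)+
    have "\<exists>\<xi>. \<bar>\<xi> - b t\<bar> \<le> \<bar>h\<bar> \<and> f t (b t + h) - f t (b t) = h * fx t \<xi>"
    proof (cases h "0::real" rule: linorder_cases)
      case less
      then obtain \<xi> where "b t + h < \<xi>" "\<xi> < b t" "f t (b t) - f t (b t + h) = (b t - (b t + h)) * fx t \<xi>"
        using f_mvt[of "b t + h" "b t" t] by (metis add_less_same_cancel1)
      then show ?thesis using less by (intro exI[of _ \<xi>]) auto
    next
      case equal then show ?thesis by (intro exI[of _ "b t"]) auto
    next
      case greater
      then obtain \<xi> where "b t < \<xi>" "\<xi> < b t + h" "f t (b t + h) - f t (b t) = (b t + h - b t) * fx t \<xi>"
        using f_mvt[of "b t" "b t + h" t] by (metis less_add_same_cancel1)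
      then show ?thesis using greater by (intro exI[of _ \<xi>]) auto
    qed
    then obtain \<xi> where \<xi>: "\<bar>\<xi> - b t\<bar> \<le> \<bar>h\<bar>" "f t (b t + h) - f t (b t) = h * fx t \<xi>" by blast
    have "\<bar>f t (b t + h) - f t (b t) - h * fx t (b t)\<bar> = \<bar>h\<bar> * \<bar>fx t \<xi> - fx t (b t)\<bar>"
      using \<xi>(2) by (simp add: abs_mult[symmetric] right_diff_distrib)
    also have "\<dots> \<le> (\<rho> * Z) * (1 / (2 * Z))" using h key[OF \<xi>(1)] \<rho> Z by (intro mult_mono) auto
    also have "\<dots> = \<rho> / 2" using Z by simp
    finally show ?thesis .
  qed
  have bd: "(b has_real_derivative f t (b t) + l) (at t)" for t using bsol_sol[OF b] unfolding ode_sol_def by blast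
  have "ode_sub f (l - \<rho> / 2) UNIV (\<lambda>t. b t - \<rho> * z t) \<and> ode_super f (l + \<rho> / 2) UNIV (\<lambda>t. b t + \<rho> * z t)"
    if \<rho>: "0 < \<rho>" "\<rho> \<le> \<rho>0" for \<rho>
  proof -
    have hz: "\<bar>\<rho> * z t\<bar> \<le> \<rho> * Z" "\<bar>- (\<rho> * z t)\<bar> \<le> \<rho> * Z" for t
      using Z(2)[of t] \<rho> by (auto simp: abs_mult)
    have "\<exists>D. ((\<lambda>t. b t - \<rho> * z t) has_real_derivative D) (at t) \<and> D \<le> f t (b t - \<rho> * z t) + (l - \<rho> / 2)" for t
    proof (intro exI conjI)
      show "((\<lambda>t. b t - \<rho> * z t) has_real_derivative (f t (b t) + l) - \<rho> * (fx t (b t) * z t + 1)) (at t)"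
        by (rule DERIV_diff[OF bd DERIV_cmult[OF z]])
      show "(f t (b t) + l) - \<rho> * (fx t (b t) * z t + 1) \<le> f t (b t - \<rho> * z t) + (l - \<rho> / 2)"
        using est[OF hz(2)[of t] \<rho>, of t] unfolding abs_le_iff by (auto simp: algebra_simps)
    qed
    moreover have "\<exists>D. ((\<lambda>t. b t + \<rho> * z t) has_real_derivative D) (at t) \<and> f t (b t + \<rho> * z t) + (l + \<rho> / 2) \<le> D" for t
    proof (intro exI conjI)
      show "((\<lambda>t. b t + \<rho> * z t) has_real_derivative (f t (b t) + l) + \<rho> * (fx t (b t) * z t + 1)) (at t)"
        by (rule DERIV_add[OF bd DERIV_cmult[OF z]])
      show "f t (b t + \<rho> * z t) + (l + \<rho> / 2) \<le> (f t (b t) + l) + \<rho> * (fx t (b t) * z t + 1)"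
        using est[OF hz(1)[of t] \<rho>, of t] unfolding abs_le_iff by (auto simp: algebra_simps)
    qed
    ultimately show ?thesis unfolding ode_sub_def ode_super_def by blast
  qed
  then show ?thesis using \<rho>0 by blast
qed

lemma variational_persistence:
  assumes b: "bsol l b" and z: "\<And>t. (z has_real_derivative fx t (b t) * z t + 1) (at t)" and z1: "\<And>t. \<bar>z t\<bar> \<le> z1"
  shows "lam0 < l"
proof -
  obtain \<rho> where \<rho>: "\<rho> > 0" "ode_sub f (l - \<rho> / 2) UNIV (\<lambda>t. b t - \<rho> * z t)"
    using variational_perturbation[OF b z z1] by blast
  obtain R where R: "\<And>t. \<bar>b t\<bar> \<le> R" using bsol_bounded[OF b] by blast
  have "\<bar>b t - \<rho> * z t\<bar> \<le> R + \<rho> * z1" for t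
  proof -
    have "\<bar>\<rho> * z t\<bar> \<le> \<rho> * z1" using z1[of t] \<rho>(1) by (simp add: abs_mult)
    then show ?thesis using R[of t] by linarith
  qed
  from up_ge_sub(1)[OF \<rho>(2) this] show ?thesis using \<rho>(1) by simp
qed

lemma hyperbolic_imp_gt:
  assumes b: "bsol l b" and "attractive b \<or> repulsive b"
  shows "lam0 < l"
  using assms(2)
proof
  assume "attractive b"
  then obtain z z0 z1 where z: "0 < z0" "\<And>t. z0 \<le> z t \<and> z t \<le> z1" "\<And>t. (z has_real_derivative fx t (b t) * z t + 1) (at t)"
    using attractive_variational[OF b] by blast
  have "\<bar>z t\<bar> \<le> z1" for t using z(1) z(2)[of t] by linarith
  then show ?thesis by (rule variational_persistence[OF b z(3)])
next
  assume "repulsive b"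
  then obtain z z0 z1 where z: "0 < z0" "\<And>t. z0 \<le> - z t \<and> - z t \<le> z1" "\<And>t. (z has_real_derivative fx t (b t) * z t + 1) (at t)"
    using repulsive_variational[OF b] by blast
  have "\<bar>z t\<bar> \<le> z1" for t using z(1) z(2)[of t] by linarith
  then show ?thesis by (rule variational_persistence[OF b z(3)])
qed

lemma not_separated_lam0:
  assumes b: "bsol lam0 b1" "bsol lam0 b2" shows "\<not> unif_separated b1 b2"
proof
  assume "unif_separated b1 b2"
  then obtain d where d: "d > 0" "\<And>t. d \<le> \<bar>b1 t - b2 t\<bar>" unfolding unif_separated_def by blast
  have *: False if b: "bsol lam0 b1" "bsol lam0 b2" and d: "d > 0" "\<And>t. d \<le> \<bar>b1 t - b2 t\<bar>" and "b1 0 \<le> b2 0" for b1 b2 d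
  proof -
    have "b1 t + d \<le> b2 t" for t
      using d(2)[of t] sol_order_UNIV[OF bsol_sol[OF b(1)] bsol_sol[OF b(2)] \<open>b1 0 \<le> b2 0\<close>, of t] by linarith
    from separated_hyperbolic(2)[OF b d(1) this] hyperbolic_imp_gt[OF b(2)] show False by blast
  qed
  have d': "d \<le> \<bar>b2 t - b1 t\<bar>" for t using d(2)[of t] by linarith
  show False using *[OF b d] *[OF b(2,1) d(1) d'] by linarith
qed

lemma up_mono: "lam0 \<le> l \<Longrightarrow> l \<le> m \<Longrightarrow> up l t \<le> up m t"
  using up_strict_mono[of l m t] by (cases "l = m") auto

lemma up_tubes:
  assumes l: "lam0 < l" and e: "e > 0"
  shows "\<exists>\<rho>>0. \<exists>z0>0. \<exists>Z. (\<forall>t. z0 \<le> Z t \<and> Z t \<le> e) \<and>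
    ode_sub f (l - \<rho> / 2) UNIV (\<lambda>t. up l t - Z t) \<and> ode_super f (l + \<rho> / 2) UNIV (\<lambda>t. up l t + Z t)"
proof -
  have l': "lam0 \<le> l" using l by simp
  obtain z z0 z1 where z: "0 < z0" "\<And>t. z0 \<le> z t \<and> z t \<le> z1"
    "\<And>t. (z has_real_derivative fx t (up l t) * z t + 1) (at t)"
    using attractive_variational[OF up_bsol[OF l'] up_attractive[OF l]] by blast
  have z1: "z1 > 0" "\<And>t. \<bar>z t\<bar> \<le> z1"
  proof -
    show "z1 > 0" using z(1) z(2)[of 0] by linarith
    show "\<bar>z t\<bar> \<le> z1" for t using z(1) z(2)[of t] by linarith
  qed
  obtain \<rho>0 where \<rho>0: "\<rho>0 > 0" "\<And>\<rho>. 0 < \<rho> \<Longrightarrow> \<rho> \<le> \<rho>0 \<Longrightarrow>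
     ode_sub f (l - \<rho> / 2) UNIV (\<lambda>t. up l t - \<rho> * z t) \<and> ode_super f (l + \<rho> / 2) UNIV (\<lambda>t. up l t + \<rho> * z t)"
    using variational_perturbation[OF up_bsol[OF l'] z(3) z1(2)] by blast
  define \<rho> where "\<rho> = min \<rho>0 (e / z1)"
  have \<rho>: "\<rho> > 0" "\<rho> \<le> \<rho>0" "\<rho> \<le> e / z1" using \<rho>0 e z1 by (auto simp: \<rho>_def)
  have "\<rho> * z0 \<le> \<rho> * z t \<and> \<rho> * z t \<le> e" for t
  proof
    show "\<rho> * z0 \<le> \<rho> * z t" using z(2)[of t] \<rho> by simp
    have "\<rho> * z t \<le> \<rho> * z1" using z(2)[of t] \<rho> by simp
    also have "\<dots> \<le> e" using \<rho>(3) z1 by (simp add: field_simps)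
    finally show "\<rho> * z t \<le> e" .
  qed
  then show ?thesis using \<rho>0(2)[OF \<rho>(1,2)] \<rho>(1) z(1)
    by (intro exI[of _ \<rho>] conjI exI[of _ "\<rho> * z0"] exI[of _ "\<lambda>t. \<rho> * z t"]) auto
qed

lemma lo_tubes:
  assumes l: "lam0 < l" and e: "e > 0"
  shows "\<exists>\<rho>>0. \<exists>z0>0. \<exists>Z. (\<forall>t. z0 \<le> Z t \<and> Z t \<le> e) \<and> ode_sub f (l - \<rho> / 2) UNIV (\<lambda>t. lo l t + Z t)"
proof -
  have l': "lam0 \<le> l" using l by simp
  obtain z z0 z1 where z: "0 < z0" "\<And>t. z0 \<le> - z t \<and> - z t \<le> z1"
    "\<And>t. (z has_real_derivative fx t (lo l t) * z t + 1) (at t)"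
    using repulsive_variational[OF lo_bsol[OF l'] lo_repulsive[OF l]] by blast
  have z1: "z1 > 0" "\<And>t. \<bar>z t\<bar> \<le> z1"
  proof -
    show "z1 > 0" using z(1) z(2)[of 0] by linarith
    show "\<bar>z t\<bar> \<le> z1" for t using z(1) z(2)[of t] by linarith
  qed
  obtain \<rho>0 where \<rho>0: "\<rho>0 > 0" "\<And>\<rho>. 0 < \<rho> \<Longrightarrow> \<rho> \<le> \<rho>0 \<Longrightarrow>
     ode_sub f (l - \<rho> / 2) UNIV (\<lambda>t. lo l t - \<rho> * z t) \<and> ode_super f (l + \<rho> / 2) UNIV (\<lambda>t. lo l t + \<rho> * z t)"
    using variational_perturbation[OF lo_bsol[OF l'] z(3) z1(2)] by blast
  define \<rho> where "\<rho> = min \<rho>0 (e / z1)"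
  have \<rho>: "\<rho> > 0" "\<rho> \<le> \<rho>0" "\<rho> \<le> e / z1" using \<rho>0 e z1 by (auto simp: \<rho>_def)
  have "\<rho> * z0 \<le> \<rho> * (- z t) \<and> \<rho> * (- z t) \<le> e" for t
  proof
    show "\<rho> * z0 \<le> \<rho> * (- z t)" using z(2)[of t] \<rho>(1) by (intro mult_left_mono) auto
    have "\<rho> * (- z t) \<le> \<rho> * z1" using z(2)[of t] \<rho>(1) by (intro mult_left_mono) auto
    also have "\<dots> \<le> e" using \<rho>(3) z1 by (simp add: field_simps)
    finally show "\<rho> * (- z t) \<le> e" .
  qed
  then show ?thesis using \<rho>0(2)[OF \<rho>(1,2)] \<rho>(1) z(1)
    by (intro exI[of _ \<rho>] conjI exI[of _ "\<rho> * z0"] exI[of _ "\<lambda>t. \<rho> * (- z t)"]) auto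
qed

lemma up_continuous:
  assumes l: "lam0 < l" and e: "e > 0"
  shows "\<exists>\<delta>>0. \<forall>m. lam0 < m \<longrightarrow> \<bar>m - l\<bar> < \<delta> \<longrightarrow> (\<forall>t. \<bar>up m t - up l t\<bar> \<le> e)"
proof -
  have l': "lam0 \<le> l" using l by simp
  obtain \<rho> z0 Z where \<rho>: "\<rho> > 0" "z0 > 0" "\<And>t. z0 \<le> Z t \<and> Z t \<le> e"
    "ode_sub f (l - \<rho> / 2) UNIV (\<lambda>t. up l t - Z t)" "ode_super f (l + \<rho> / 2) UNIV (\<lambda>t. up l t + Z t)"
    using up_tubes[OF l e] by blast
  obtain \<gamma> D where att: "\<gamma> > 0" "\<And>s t. s \<le> t \<Longrightarrow> integral {s..t} (\<lambda>r. fx r (up l r)) \<le> D - \<gamma> * (t - s)"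
    using up_attractive[OF l] unfolding attractive_def by blast
  define \<Lambda> where "\<Lambda> = \<bar>l\<bar> + 1"
  obtain R where R: "\<And>l b t. \<bar>l\<bar> \<le> \<Lambda> \<Longrightarrow> bsol l b \<Longrightarrow> \<bar>b t\<bar> \<le> R" using bsol_bound[of \<Lambda>] by blast
  obtain \<sigma> \<gamma>' D' where E: "\<sigma> > 0" "\<gamma>' > 0"
    "\<And>l1 l2 b1 b2 s t. s \<le> t \<Longrightarrow> \<bar>l1\<bar> \<le> \<Lambda> \<Longrightarrow> \<bar>l2\<bar> \<le> \<Lambda> \<Longrightarrow>
        \<bar>l1 - l2\<bar> \<le> \<sigma> \<Longrightarrow> ode_sol f l1 {s..t} b1 \<Longrightarrow> ode_sol f l2 {s..t} b2 \<Longrightarrow>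
        (\<forall>r\<in>{s..t}. \<bar>b1 r\<bar> \<le> R \<and> \<bar>b2 r\<bar> \<le> R \<and> z0 \<le> b2 r - b1 r) \<Longrightarrow>
        integral {s..t} (\<lambda>r. fx r (b2 r)) \<le> D' - \<gamma>' * (t - s) \<and> \<gamma>' * (t - s) - D' \<le> integral {s..t} (\<lambda>r. fx r (b1 r))"
    using hypE[OF \<rho>(2), of \<Lambda> R] by blast
  define \<delta> where "\<delta> = min 1 (min \<sigma> (\<rho> / 2))"
  have \<delta>: "\<delta> > 0" "\<delta> \<le> 1" "\<delta> \<le> \<sigma>" "\<delta> \<le> \<rho> / 2" using E(1) \<rho>(1) by (auto simp: \<delta>_def)
  have "\<bar>up m t1 - up l t1\<bar> \<le> e" if m: "lam0 < m" "\<bar>m - l\<bar> < \<delta>" for m t1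
  proof (cases "m \<le> l")
    case True
    have mono: "up m t1 \<le> up l t1" by (rule up_mono) (use m True in auto)
    have Rb: "\<bar>up l t - Z t\<bar> \<le> R + e" for t
    proof -
      have "\<bar>up l t\<bar> \<le> R" by (rule R[OF _ up_bsol[OF l']]) (simp add: \<Lambda>_def)
      then show ?thesis using \<rho>(2) \<rho>(3)[of t] by linarith
    qed
    have "up l t1 - Z t1 \<le> up m t1"
      by (rule up_ge_sub(2)[OF ode_sub_mono[OF \<rho>(4)] Rb]) (use m(2) \<delta> True in auto)
    then show ?thesis using mono \<rho>(3)[of t1] by linarith
  next
    case False
    then have lm: "l < m" "lam0 \<le> m" using m by auto
    have mL: "\<bar>m\<bar> \<le> \<Lambda>" "\<bar>l\<bar> \<le> \<Lambda>" "\<bar>l - m\<bar> \<le> \<sigma>" using m(2) \<delta> by (auto simp: \<Lambda>_def)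
    have "\<exists>s\<le>t1. up m s - up l s < z0"
    proof (rule ccontr)
      assume "\<not> ?thesis"
      then have sep: "z0 \<le> up m s - up l s" if "s \<le> t1" for s using that by force
      obtain T where T: "T \<ge> 0" "D - \<gamma> * T < \<gamma>' * T - D'" using linear_growth_contradiction[OF E(2) att(1)] by blast
      have "\<gamma>' * (t1 - (t1 - T)) - D' \<le> integral {t1 - T..t1} (\<lambda>r. fx r (up l r))"
      proof (rule E(3)[THEN conjunct2, OF _ mL(2,1) mL(3) bsol_sol_on[OF up_bsol[OF l']] bsol_sol_on[OF up_bsol[OF lm(2)]]])
        show "\<forall>r\<in>{t1 - T..t1}. \<bar>up l r\<bar> \<le> R \<and> \<bar>up m r\<bar> \<le> R \<and> z0 \<le> up m r - up l r"
          using R[OF mL(2) up_bsol[OF l']] R[OF mL(1) up_bsol[OF lm(2)]] sep by auto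
      qed (use T in auto)
      then show False using att(2)[of "t1 - T" t1] T by simp
    qed
    then obtain s where s: "s \<le> t1" "up m s - up l s < z0" by blast
    have "up m t1 \<le> up l t1 + Z t1"
    proof (rule sub_super_compare[OF s(1) _ ode_super_subset[OF \<rho>(5)]])
      show "ode_sub f m {s..t1} (up m)" by (rule ode_sol_imp_sub[OF bsol_sol_on[OF up_bsol[OF lm(2)]]])
      show "m \<le> l + \<rho> / 2" using m(2) \<delta> by linarith
      show "up m s \<le> up l s + Z s" using s(2) \<rho>(3)[of s] by linarith
    qed simp
    moreover have "up l t1 \<le> up m t1" by (rule up_mono[OF l']) (use lm in simp)
    ultimately show ?thesis using \<rho>(3)[of t1] by linarith
  qed
  then show ?thesis using \<delta>(1) by blast
qed

lemma lo_continuous: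
  assumes l: "lam0 < l" and e: "e > 0"
  shows "\<exists>\<delta>>0. \<forall>m. lam0 < m \<longrightarrow> \<bar>m - l\<bar> < \<delta> \<longrightarrow> (\<forall>t. \<bar>lo m t - lo l t\<bar> \<le> e)"
proof -
  have "\<exists>\<delta>>0. \<forall>m. lam0 < m \<longrightarrow> \<bar>m - l\<bar> < \<delta> \<longrightarrow> (\<forall>t. \<bar>upper_sol (dual_field f) m t - upper_sol (dual_field f) l t\<bar> \<le> e)"
    using scalar_family.up_continuous[OF dual, of l e] l e unfolding dual_lam0 by blast
  then obtain \<delta> where \<delta>: "\<delta> > 0" "\<And>m t. lam0 < m \<Longrightarrow> \<bar>m - l\<bar> < \<delta> \<Longrightarrow> \<bar>upper_sol (dual_field f) m t - upper_sol (dual_field f) l t\<bar> \<le> e"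
    by blast
  have "\<bar>lo m t - lo l t\<bar> \<le> e" if "lam0 < m" "\<bar>m - l\<bar> < \<delta>" for m t
    using \<delta>(2)[OF that, of "- t"] up_dual[of m] up_dual[of l] that l by (simp add: dual_curve_def abs_minus_commute)
  then show ?thesis using \<delta>(1) by blast
qed

lemma up_tendsto_lam0: "((\<lambda>l. up l t) \<longlongrightarrow> up lam0 t) (at_right lam0)"
proof (rule order_tendstoI)
  fix y assume y: "y < up lam0 t"
  have "\<forall>\<^sub>F l in at_right lam0. l \<in> {lam0<..<lam0 + 1}" by (rule eventually_at_rightI[of lam0 "lam0 + 1"]) auto
  then show "\<forall>\<^sub>F l in at_right lam0. y < up l t"
  proof eventually_elim
    case (elim l)
    then show ?case using up_mono[of lam0 l t] y by auto
  qed
next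
  fix y assume y: "up lam0 t < y"
  define ls where "ls n = lam0 + 1 / real (Suc n)" for n
  have ls: "lam0 < ls n" "lam0 \<le> ls n" for n by (auto simp: ls_def)
  have lb: "\<bar>ls n\<bar> \<le> \<bar>lam0\<bar> + 1" for n
  proof -
    have "1 / real (Suc n) \<le> 1" "1 / real (Suc n) \<ge> 0" by simp_all
    then show ?thesis unfolding ls_def by linarith
  qed
  have lim: "ls \<longlonglongrightarrow> lam0"
  proof -
    have "(\<lambda>n. lam0 + 1 / real (Suc n)) \<longlonglongrightarrow> lam0 + 0" by (intro tendsto_intros LIMSEQ_Suc lim_1_over_n)
    then show ?thesis by (simp add: ls_def[abs_def])
  qed
  obtain R where R: "R > 0" "\<And>l b t. \<bar>l\<bar> \<le> \<bar>lam0\<bar> + 1 \<Longrightarrow> bsol l b \<Longrightarrow> \<bar>b t\<bar> \<le> R"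
    using bsol_bound[of "\<bar>lam0\<bar> + 1"] by blast
  have "\<exists>b r. strict_mono r \<and> bsol lam0 b \<and> (\<forall>t. \<bar>b t\<bar> \<le> R) \<and> (\<forall>t. (\<lambda>n. up (ls (r n)) t) \<longlonglongrightarrow> b t)"
    by (rule family_compactness[where u = "\<lambda>n. up (ls n)", OF R(1) bsol_sol_on[OF up_bsol[OF ls(2)]] R(2)[OF lb up_bsol[OF ls(2)]] lim])
  then obtain b r where br: "bsol lam0 b" "(\<lambda>n. up (ls (r n)) t) \<longlonglongrightarrow> b t" by blast
  have "b t < y" using up_ge[OF order_refl br(1), of t] y by linarith
  from order_tendstoD(2)[OF br(2) this] obtain n where n: "up (ls (r n)) t < y"
    using eventually_happens'[OF sequentially_bot] by blast
  have "\<forall>\<^sub>F l in at_right lam0. l \<in> {lam0<..<ls (r n)}" by (rule eventually_at_rightI[OF _ ls(1)])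
  then show "\<forall>\<^sub>F l in at_right lam0. up l t < y"
  proof eventually_elim
    case (elim l)
    then show ?case using up_mono[of l "ls (r n)" t] n by auto
  qed
qed

lemma lo_tendsto_lam0: "((\<lambda>l. lo l t) \<longlongrightarrow> lo lam0 t) (at_right lam0)"
proof -
  have "((\<lambda>l. upper_sol (dual_field f) l (- t)) \<longlongrightarrow> upper_sol (dual_field f) lam0 (- t)) (at_right lam0)"
    using scalar_family.up_tendsto_lam0[OF dual, of "- t"] unfolding dual_lam0 .
  from tendsto_minus[OF this] have lim: "((\<lambda>l. - upper_sol (dual_field f) l (- t)) \<longlongrightarrow> lo lam0 t) (at_right lam0)"
    using up_dual[of lam0] by (simp add: dual_curve_def)
  have "\<forall>\<^sub>F l in at_right lam0. l \<in> {lam0<..<lam0 + 1}" by (rule eventually_at_rightI[of lam0 "lam0 + 1"]) auto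
  then have "\<forall>\<^sub>F l in at_right lam0. - upper_sol (dual_field f) l (- t) = lo l t"
    by eventually_elim (simp add: up_dual dual_curve_def)
  with lim show ?thesis by (rule Lim_transform_eventually)
qed

lemma up_lo_unbounded: "\<exists>L. \<forall>l\<ge>L. \<forall>t. M \<le> up l t \<and> lo l t \<le> - M"
proof -
  obtain L1 where L1: "\<And>l. l \<ge> L1 \<Longrightarrow> ode_sub f l UNIV (\<lambda>_. M)" using const_sub[of M] by blast
  obtain L2 where L2: "\<And>l. l \<ge> L2 \<Longrightarrow> ode_sub f l UNIV (\<lambda>_. - M)" using const_sub[of "- M"] by blast
  have "M \<le> up l t \<and> lo l t \<le> - M" if "l \<ge> max L1 L2" for l t
    using up_ge_sub(2)[OF L1, of l "\<bar>M\<bar>" t] lo_le_sub[OF L2, of l "\<bar>M\<bar>" t] that by simp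
  then show ?thesis by blast
qed

end

section \<open>Maximal solutions\<close>

lemma lower_end_neq_bot: "lower_end \<alpha> \<noteq> bot"
  unfolding lower_end_def by auto

lemma eventually_lower_end:
  assumes "\<alpha> < ereal s"
  shows "\<forall>\<^sub>F r in lower_end \<alpha>. \<alpha> < ereal r \<and> r < s"
proof (cases \<alpha>)
  case (real a)
  then have "a < s" using assms by simp
  then have "\<forall>\<^sub>F r in at_right a. r \<in> {a<..<s}" by (intro eventually_at_rightI) auto
  then show ?thesis using real by (auto simp: lower_end_def elim: eventually_mono)
next
  case MInf
  have "\<forall>\<^sub>F r in at_bot. r < s" by (auto simp: eventually_at_bot_dense)
  then show ?thesis using MInf by (auto simp: lower_end_def elim: eventually_mono)
qed (use assms in auto)

lemma filterlim_dual_curve: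
  "filterlim (dual_curve \<phi>) at_top (lower_end (- \<beta>)) \<longleftrightarrow> filterlim \<phi> at_bot (upper_end \<beta>)"
proof (cases "\<beta> = \<infinity>")
  case True
  then show ?thesis
    by (simp add: lower_end_def upper_end_def filterlim_at_bot_mirror dual_curve_def[abs_def] filterlim_uminus_at_top)
next
  case False
  then have "- \<beta> \<noteq> - \<infinity>" by (metis ereal_uminus_uminus uminus_ereal.simps(2))
  moreover have "real_of_ereal (- \<beta>) = - real_of_ereal \<beta>" by simp
  ultimately show ?thesis using False
    by (simp add: lower_end_def upper_end_def at_right_minus[of "- real_of_ereal \<beta>"] filterlim_filtermap
        dual_curve_def[abs_def] filterlim_uminus_at_top)
qed

lemma max_sol_dual:
  assumes "max_sol (\<lambda>t x. f t x + l) s x \<alpha> \<beta> \<phi>"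
  shows "max_sol (\<lambda>t x. dual_field f t x + l) (- s) (- x) (- \<beta>) (- \<alpha>) (dual_curve \<phi>)"
proof -
  have m: "\<alpha> < ereal s" "ereal s < \<beta>" "\<phi> s = x"
    "\<And>t. \<alpha> < ereal t \<Longrightarrow> ereal t < \<beta> \<Longrightarrow> (\<phi> has_real_derivative f t (\<phi> t) + l) (at t)"
    "\<And>\<alpha>' \<beta>' \<psi>. \<alpha>' < ereal s \<Longrightarrow> ereal s < \<beta>' \<Longrightarrow> \<psi> s = x \<Longrightarrow>
        (\<forall>t. \<alpha>' < ereal t \<and> ereal t < \<beta>' \<longrightarrow> (\<psi> has_real_derivative f t (\<psi> t) + l) (at t)) \<Longrightarrow> \<alpha> \<le> \<alpha>' \<and> \<beta>' \<le> \<beta>"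
    using assms unfolding max_sol_def by blast+
  have flip: "- a < ereal t \<longleftrightarrow> ereal (- t) < a" "ereal t < - a \<longleftrightarrow> a < ereal (- t)" for a t
    by (metis ereal_uminus_less_reorder uminus_ereal.simps(1) ereal_less_uminus_reorder)+
  show ?thesis
    unfolding max_sol_def
  proof (intro conjI allI impI)
    show "- \<beta> < ereal (- s)" "ereal (- s) < - \<alpha>" using m(1,2) by (simp_all add: flip)
    show "dual_curve \<phi> (- s) = - x" using m(3) by (simp add: dual_curve_def)
    show "(dual_curve \<phi> has_real_derivative dual_field f t (dual_curve \<phi> t) + l) (at t)"
      if "- \<beta> < ereal t \<and> ereal t < - \<alpha>" for t
      using dual_curve_derivative[OF m(4)[of "- t"]] that by (simp add: flip dual_field_def dual_curve_def)
    fix \<alpha>' \<beta>' \<psi>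
    assume A: "\<alpha>' < ereal (- s) \<and> ereal (- s) < \<beta>' \<and> \<psi> (- s) = - x \<and>
       (\<forall>t. \<alpha>' < ereal t \<and> ereal t < \<beta>' \<longrightarrow> (\<psi> has_real_derivative dual_field f t (\<psi> t) + l) (at t))"
    have "\<alpha> \<le> - \<beta>' \<and> - \<alpha>' \<le> \<beta>"
    proof (rule m(5))
      show "- \<beta>' < ereal s" "ereal s < - \<alpha>'" using A by (simp_all add: flip)
      show "dual_curve \<psi> s = x" using A by (simp add: dual_curve_def)
      show "\<forall>t. - \<beta>' < ereal t \<and> ereal t < - \<alpha>' \<longrightarrow> (dual_curve \<psi> has_real_derivative f t (dual_curve \<psi> t) + l) (at t)"
      proof (intro allI impI)
        fix t assume "- \<beta>' < ereal t \<and> ereal t < - \<alpha>'"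
        then have "(\<psi> has_real_derivative dual_field f (- t) (\<psi> (- t)) + l) (at (- t))" using A by (simp add: flip)
        from dual_curve_derivative[OF this] show "(dual_curve \<psi> has_real_derivative f t (dual_curve \<psi> t) + l) (at t)"
          by (simp add: dual_field_def dual_curve_def)
      qed
    qed
    then show "- \<beta> \<le> \<alpha>'" "\<beta>' \<le> - \<alpha>" by (metis ereal_minus_le_minus ereal_uminus_uminus)+
  qed
qed

context scalar_family begin

lemma max_sol_on:
  assumes "max_sol (\<lambda>t x. f t x + l) s x \<alpha> \<beta> \<phi>" "\<alpha> < ereal p" "ereal q < \<beta>"
  shows "ode_sol f l {p..q} \<phi>"
  unfolding ode_sol_def
proof
  fix t assume t: "t \<in> {p..q}"
  have "\<alpha> < ereal t" using assms(2) t by (auto elim: less_le_trans)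
  moreover have "ereal t < \<beta>" using assms(3) t by (auto elim: le_less_trans[rotated])
  ultimately show "(\<phi> has_real_derivative f t (\<phi> t) + l) (at t)" using assms(1) unfolding max_sol_def by blast
qed

lemma max_sol_bounded_below_end:
  assumes m: "max_sol (\<lambda>t x. f t x + l) s x \<alpha> \<beta> \<phi>" and R: "\<And>r. \<alpha> < ereal r \<Longrightarrow> r \<le> s \<Longrightarrow> \<bar>\<phi> r\<bar> \<le> R"
  shows "\<alpha> = -\<infinity>"
proof (rule ccontr)
  assume "\<alpha> \<noteq> -\<infinity>"
  have as: "\<alpha> < ereal s" "ereal s < \<beta>" "\<phi> s = x" using m unfolding max_sol_def by blast+
  obtain a where a: "\<alpha> = ereal a" "a < s" using as(1) \<open>\<alpha> \<noteq> -\<infinity>\<close> by (cases \<alpha>) auto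
  have R0: "0 \<le> R" using R[OF as(1)] by simp
  obtain M where M: "M > 0" "\<And>t x. \<bar>x\<bar> \<le> R + 1 \<Longrightarrow> \<bar>f t x\<bar> \<le> M" "\<And>t x. \<bar>x\<bar> \<le> R + 1 \<Longrightarrow> \<bar>fx t x\<bar> \<le> M"
    using f_bound[of "R + 1"] by blast
  have fl: "continuous_on UNIV (\<lambda>(t, x). f t x + l)" using f_cont by (auto simp: case_prod_unfold intro!: continuous_intros)
  have "\<exists>y. y s = x \<and> (\<forall>t. (y has_real_derivative f t (clamp_abs (R + 1) (y t)) + l) (at t))"
  proof (rule clamped_solution[OF fl, of "R + 1" "M + \<bar>l\<bar>" M])
    show "\<bar>f t x + l\<bar> \<le> M + \<bar>l\<bar>" if "\<bar>x\<bar> \<le> R + 1" for t x using M(2)[OF that, of t] by linarith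
    show "\<bar>(f t x + l) - (f t y + l)\<bar> \<le> M * \<bar>x - y\<bar>" if "\<bar>x\<bar> \<le> R + 1" "\<bar>y\<bar> \<le> R + 1" for t x y
      using f_lip[of "R + 1" M x y t] M(3) that by simp
  qed (use R0 in simp)
  then obtain y where y: "y s = x" "\<And>t. (y has_real_derivative f t (clamp_abs (R + 1) (y t)) + l) (at t)" by blast
  have yc: "continuous_on UNIV y" by (rule continuous_on_UNIV_deriv[OF y(2)])
  have eq: "y r = \<phi> r" if r: "a < r" "r \<le> s" for r
  proof -
    have sol: "ode_sol f l {r..s} \<phi>" by (rule max_sol_on[OF m]) (use r a as in auto)
    have \<phi>d: "(\<phi> has_real_derivative f q (\<phi> q) + l) (at q)" if "q \<in> {r..s}" for q using sol that unfolding ode_sol_def by blast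
    have lip: "\<bar>f q (\<phi> q) - f q (clamp_abs (R + 1) (y q))\<bar> \<le> M * \<bar>\<phi> q - y q\<bar>" if q: "q \<in> {r..s}" for q
    proof -
      have \<phi>q: "\<bar>\<phi> q\<bar> \<le> R + 1" using R[of q] q r a by auto
      have "\<bar>f q (\<phi> q) - f q (clamp_abs (R + 1) (y q))\<bar> \<le> M * \<bar>\<phi> q - clamp_abs (R + 1) (y q)\<bar>"
        using f_lip[of "R + 1" M "\<phi> q" "clamp_abs (R + 1) (y q)" q] M(3) \<phi>q clamp_abs_bound[of "R + 1" "y q"] R0 by simp
      also have "\<dots> \<le> M * \<bar>\<phi> q - y q\<bar>"
        using clamp_abs_lip[of "R + 1" "\<phi> q" "y q"] clamp_abs_id[OF \<phi>q] M(1) by simp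
      finally show ?thesis .
    qed
    have "\<phi> r - y r \<le> 0"
    proof (rule comparison_backward[OF r(2), of "\<lambda>q. \<phi> q - y q" "\<lambda>q. (f q (\<phi> q) + l) - (f q (clamp_abs (R + 1) (y q)) + l)" M])
      fix q assume q: "q \<in> {r..s}"
      show "((\<lambda>q. \<phi> q - y q) has_real_derivative (f q (\<phi> q) + l) - (f q (clamp_abs (R + 1) (y q)) + l)) (at q)"
        by (rule DERIV_diff[OF \<phi>d[OF q] y(2)])
      assume "\<phi> q - y q > 0"
      then show "- ((f q (\<phi> q) + l) - (f q (clamp_abs (R + 1) (y q)) + l)) \<le> M * (\<phi> q - y q)" using lip[OF q] by simp
    qed (use as y in simp)
    moreover have "y r - \<phi> r \<le> 0"
    proof (rule comparison_backward[OF r(2), of "\<lambda>q. y q - \<phi> q" "\<lambda>q. (f q (clamp_abs (R + 1) (y q)) + l) - (f q (\<phi> q) + l)" M])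
      fix q assume q: "q \<in> {r..s}"
      show "((\<lambda>q. y q - \<phi> q) has_real_derivative (f q (clamp_abs (R + 1) (y q)) + l) - (f q (\<phi> q) + l)) (at q)"
        by (rule DERIV_diff[OF y(2) \<phi>d[OF q]])
      assume "y q - \<phi> q > 0"
      then show "- ((f q (clamp_abs (R + 1) (y q)) + l) - (f q (\<phi> q) + l)) \<le> M * (y q - \<phi> q)" using lip[OF q] by simp
    qed (use as y in simp)
    ultimately show ?thesis by simp
  qed
  have yR: "\<bar>y r\<bar> \<le> R" if "a < r" "r \<le> s" for r using eq[OF that] R[of r] that a by simp
  have cont: "isCont (\<lambda>r. \<bar>y r\<bar>) r" for r using yc by (auto simp: continuous_on_eq_continuous_at intro!: continuous_intros)
  have ya: "\<bar>y a\<bar> < R + 1"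
  proof (rule ccontr)
    assume "\<not> ?thesis"
    then have "R < \<bar>y a\<bar>" by simp
    then have "\<forall>\<^sub>F r in at a. R < \<bar>y r\<bar>" using cont[of a] by (intro order_tendstoD) (auto simp: isCont_def)
    then have "\<forall>\<^sub>F r in at_right a. R < \<bar>y r\<bar>" by (rule filter_leD[OF at_le, rotated]) simp
    moreover have "\<forall>\<^sub>F r in at_right a. r \<in> {a<..<s}" by (rule eventually_at_rightI[OF _ a(2)])
    ultimately have "\<forall>\<^sub>F r in at_right a. False"
    proof eventually_elim
      case (elim r)
      then show False using yR[of r] by simp
    qed
    then show False by simp
  qed
  have near: "\<exists>e>0. \<forall>t. \<bar>t - q\<bar> < e \<longrightarrow> \<bar>y t\<bar> < R + 1" if "\<bar>y q\<bar> < R + 1" for q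
  proof -
    have "\<forall>\<^sub>F t in nhds q. \<bar>y t\<bar> < R + 1"
      using cont[of q] that by (intro order_tendstoD(2)[of "\<lambda>t. \<bar>y t\<bar>" "\<bar>y q\<bar>"]) (simp_all add: isCont_def tendsto_nhds_iff)
    then show ?thesis by (auto simp: eventually_nhds_metric dist_real_def)
  qed
  obtain e1 where e1: "e1 > 0" "\<And>t. \<bar>t - a\<bar> < e1 \<Longrightarrow> \<bar>y t\<bar> < R + 1" using near[OF ya] by blast
  have "\<bar>y s\<bar> < R + 1" using yR[of s] a by simp
  then obtain e2 where e2: "e2 > 0" "\<And>t. \<bar>t - s\<bar> < e2 \<Longrightarrow> \<bar>y t\<bar> < R + 1" using near by blast
  have "(y has_real_derivative f t (y t) + l) (at t)" if t: "a - e1 < t" "t < s + e2" for t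
  proof -
    have "\<bar>y t\<bar> < R + 1"
    proof (cases "t \<le> a")
      case True then show ?thesis using e1 t by simp
    next
      case False
      then show ?thesis using yR[of t] e2(2)[of t] t by (cases "t \<le> s") auto
    qed
    then show ?thesis using y(2)[of t] clamp_abs_id[of "y t" "R + 1"] by simp
  qed
  then have "\<alpha> \<le> ereal (a - e1)"
    using m y(1) a(2) e1(1) e2(1) unfolding max_sol_def
    by (elim conjE allE[of _ "ereal (a - e1)"] allE[of _ "ereal (s + e2)"] allE[of _ y]) auto
  then show False using a(1) e1(1) by simp
qed

lemma max_sol_escape_up:
  assumes m: "max_sol (\<lambda>t x. f t x + l) s x \<alpha> \<beta> \<phi>" and B: "up_barrier l B k R"
    and t1: "\<alpha> < ereal t1" "ereal t1 < \<beta>" "B t1 < \<phi> t1"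
  shows "filterlim \<phi> at_top (lower_end \<alpha>)"
proof -
  have k: "k > 0" and BR: "\<And>t. \<bar>B t\<bar> \<le> R" using up_barrierD[OF B] by blast+
  have s: "\<alpha> < ereal s" "ereal s < \<beta>" "\<phi> s = x" using m unfolding max_sol_def by blast+
  have esc: "k * ((\<phi> q - B q) + (q - r) * min (\<phi> q - B q) 1) \<le> \<phi> r - B r"
    if "\<alpha> < ereal r" "r \<le> q" "ereal q < \<beta>" "B q < \<phi> q" for r q
    by (rule up_barrierD(3)[OF B that(2) ode_sol_imp_sub[OF max_sol_on[OF m that(1,3)]] that(4)])
  have above: "B r < \<phi> r" if "\<alpha> < ereal r" "r \<le> t1" for r
  proof -
    have "0 < k * ((\<phi> t1 - B t1) + (t1 - r) * min (\<phi> t1 - B t1) 1)"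
      using k t1(3) that by (intro mult_pos_pos add_pos_nonneg) auto
    then show ?thesis using esc[OF that t1(2,3)] by linarith
  qed
  show ?thesis
  proof (cases "\<alpha> = -\<infinity>")
    case True
    define mn where "mn = min (\<phi> t1 - B t1) 1"
    have mn: "mn > 0" using t1(3) by (simp add: mn_def)
    have "filterlim (\<lambda>r. - R + k * ((t1 - r) * mn)) at_top at_bot"
      using k mn by real_asymp
    moreover have "\<forall>\<^sub>F r in at_bot. - R + k * ((t1 - r) * mn) \<le> \<phi> r"
    proof -
      have "- R + k * ((t1 - r) * mn) \<le> \<phi> r" if "r \<le> t1" for r
      proof -
        have "k * ((\<phi> t1 - B t1) + (t1 - r) * mn) \<le> \<phi> r - B r" using esc[OF _ that t1(2,3)] True by (simp add: mn_def)
        moreover have "0 \<le> k * (\<phi> t1 - B t1)" using k t1(3) by simp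
        ultimately show ?thesis using BR[of r] by (simp add: distrib_left)
      qed
      then show ?thesis by (auto simp: eventually_at_bot_linorder)
    qed
    ultimately have "filterlim \<phi> at_top at_bot" by (rule filterlim_at_top_mono)
    then show ?thesis using True by (simp add: lower_end_def)
  next
    case False
    obtain a where a: "\<alpha> = ereal a" using False t1(1) by (cases \<alpha>) auto
    have as: "a < s" "a < t1" using s(1) t1(1) a by auto
    define p where "p = min s t1"
    have unb: "\<exists>r. a < r \<and> r \<le> p \<and> N < \<phi> r" for N
    proof (rule ccontr)
      assume no: "\<not> ?thesis"
      have sol: "ode_sol f l {p..s} \<phi>" by (rule max_sol_on[OF m]) (use as a s in \<open>auto simp: p_def min_def\<close>)
      obtain C where C: "\<And>r. r \<in> {p..s} \<Longrightarrow> \<bar>\<phi> r\<bar> \<le> C" using continuous_on_Icc_bounded[OF ode_sol_continuous[OF sol]] by blast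
      have "\<bar>\<phi> r\<bar> \<le> max C (max R \<bar>N\<bar>)" if r: "\<alpha> < ereal r" "r \<le> s" for r
      proof (cases "r \<le> p")
        case True
        have "\<phi> r \<le> N" using no True r a by force
        moreover have "- R \<le> \<phi> r" using above[OF r(1)] True BR[of r] by (force simp: p_def)
        ultimately show ?thesis by linarith
      next
        case False
        then show ?thesis using C[of r] r by auto
      qed
      from max_sol_bounded_below_end[OF m this] show False using False by blast
    qed
    have "filterlim \<phi> at_top (at_right a)"
      unfolding filterlim_at_top
    proof
      fix Z
      define N where "N = max R (R + (\<bar>Z\<bar> + R) / k)"
      obtain r0 where r0: "a < r0" "r0 \<le> p" "N < \<phi> r0" using unb by blast
      have "ereal r0 \<le> ereal s" using r0(2) by (simp add: p_def)
      then have r0\<beta>: "ereal r0 < \<beta>" using s(2) by (rule le_less_trans)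
      have N: "R < \<phi> r0" "R + (\<bar>Z\<bar> + R) / k < \<phi> r0" using r0(3) by (auto simp: N_def)
      have Br0: "B r0 < \<phi> r0" using N(1) BR[of r0] by linarith
      have "\<forall>\<^sub>F r in at_right a. r \<in> {a<..<r0}" by (rule eventually_at_rightI[OF _ r0(1)])
      then show "\<forall>\<^sub>F r in at_right a. Z \<le> \<phi> r"
      proof eventually_elim
        case (elim r)
        have e: "k * ((\<phi> r0 - B r0) + (r0 - r) * min (\<phi> r0 - B r0) 1) \<le> \<phi> r - B r"
          by (rule esc[OF _ _ r0\<beta> Br0]) (use elim a in auto)
        have "(\<bar>Z\<bar> + R) / k \<le> \<phi> r0 - B r0" using N(2) BR[of r0] by linarith
        then have "\<bar>Z\<bar> + R \<le> k * (\<phi> r0 - B r0)" using k by (simp add: field_simps)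
        moreover have "0 \<le> k * ((r0 - r) * min (\<phi> r0 - B r0) 1)" using k elim Br0 by (intro mult_nonneg_nonneg) auto
        ultimately show "Z \<le> \<phi> r" using e BR[of r] by (simp add: distrib_left)
      qed
    qed
    then show ?thesis using a by (simp add: lower_end_def)
  qed
qed

lemma max_sol_trichotomy:
  assumes m: "max_sol (\<lambda>t x. f t x + l) s x \<alpha> \<beta> \<phi>"
  shows "filterlim \<phi> at_top (lower_end \<alpha>) \<or> filterlim \<phi> at_bot (upper_end \<beta>) \<or> bsol l \<phi>"
proof -
  obtain R1 B1 k1 where B1: "up_barrier l B1 k1 R1" using up_barrier_exists[of "\<bar>l\<bar>"] by blast
  obtain R2 B2 k2 where B2: "scalar_family.up_barrier (dual_field f) l B2 k2 R2"
    using scalar_family.up_barrier_exists[OF dual, of "\<bar>l\<bar>"] by blast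
  note md = max_sol_dual[OF m]
  have flip: "- a < ereal t \<longleftrightarrow> ereal (- t) < a" "ereal t < - a \<longleftrightarrow> a < ereal (- t)" for a t
    by (metis ereal_uminus_less_reorder uminus_ereal.simps(1) ereal_less_uminus_reorder)+
  show ?thesis
  proof (cases "\<exists>t. \<alpha> < ereal t \<and> ereal t < \<beta> \<and> B1 t < \<phi> t")
    case True
    then show ?thesis using max_sol_escape_up[OF m B1] by blast
  next
    case up: False
    show ?thesis
    proof (cases "\<exists>t. - \<beta> < ereal t \<and> ereal t < - \<alpha> \<and> B2 t < dual_curve \<phi> t")
      case True
      then have "filterlim (dual_curve \<phi>) at_top (lower_end (- \<beta>))"
        using scalar_family.max_sol_escape_up[OF dual md B2] by blast
      then show ?thesis using filterlim_dual_curve by blast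
    next
      case dn: False
      have bd: "\<bar>\<phi> t\<bar> \<le> max R1 R2" if t: "\<alpha> < ereal t" "ereal t < \<beta>" for t
      proof -
        have "\<phi> t \<le> R1" using up t up_barrierD(2)[OF B1, of t] by force
        moreover have "dual_curve \<phi> (- t) \<le> R2"
        proof -
          have "- \<beta> < ereal (- t)" "ereal (- t) < - \<alpha>" using t by (simp_all add: flip)
          then have "dual_curve \<phi> (- t) \<le> B2 (- t)" using dn by force
          then show ?thesis using scalar_family.up_barrierD(2)[OF dual B2, of "- t"] by linarith
        qed
        ultimately show ?thesis by (simp add: dual_curve_def)
      qed
      have ss: "\<alpha> < ereal s" "ereal s < \<beta>" using m unfolding max_sol_def by blast+
      have "\<alpha> = -\<infinity>"
      proof (rule max_sol_bounded_below_end[OF m])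
        fix r assume "\<alpha> < ereal r" "r \<le> s"
        then show "\<bar>\<phi> r\<bar> \<le> max R1 R2" using bd[of r] ss(2) by (meson ereal_less_eq(3) le_less_trans)
      qed
      moreover have "- \<beta> = -\<infinity>"
      proof (rule scalar_family.max_sol_bounded_below_end[OF dual md])
        fix r assume r: "- \<beta> < ereal r" "r \<le> - s"
        then have "\<alpha> < ereal (- r)" using ss(1) by (metis ereal_less_eq(3) le_minus_iff less_le_trans)
        then show "\<bar>dual_curve \<phi> r\<bar> \<le> max R1 R2" using bd[of "- r"] r by (simp add: flip dual_curve_def)
      qed
      ultimately have ab: "\<alpha> = -\<infinity>" "\<beta> = \<infinity>" by (simp_all add: ereal_uminus_eq_reorder)
      have "ode_sol f l UNIV \<phi>" using m ab unfolding max_sol_def ode_sol_def by simp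
      then have "bsol l \<phi>" by (rule bsolI) (use bd ab in auto)
      then show ?thesis by blast
    qed
  qed
qed

lemma escape_up_iff:
  assumes l: "lam0 \<le> l" and m: "max_sol (\<lambda>t x. f t x + l) s x \<alpha> \<beta> \<phi>"
  shows "filterlim \<phi> at_top (lower_end \<alpha>) \<longleftrightarrow> up l s < x"
proof
  have ss: "\<alpha> < ereal s" "ereal s < \<beta>" "\<phi> s = x" using m unfolding max_sol_def by blast+
  obtain R where R: "\<And>t. \<bar>up l t\<bar> \<le> R" using bsol_bounded[OF up_bsol[OF l]] by blast
  {
    assume lim: "filterlim \<phi> at_top (lower_end \<alpha>)"
    show "up l s < x"
    proof (rule ccontr)
      assume "\<not> up l s < x"
      then have le: "\<phi> s \<le> up l s" using ss(3) by simp
      have "\<forall>\<^sub>F r in lower_end \<alpha>. R < \<phi> r" using lim by (simp add: filterlim_at_top_dense)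
      with eventually_lower_end[OF ss(1)] have "\<forall>\<^sub>F r in lower_end \<alpha>. False"
      proof eventually_elim
        case (elim r)
        have "\<phi> r \<le> up l r"
          by (rule sol_order[OF max_sol_on[OF m _ ss(2)] bsol_sol_on[OF up_bsol[OF l]], of r s])
            (use elim le in auto)
        then show False using elim R[of r] by linarith
      qed
      then show False using lower_end_neq_bot by (simp add: eventually_False)
    qed
  }
  assume gt: "up l s < x"
  have above: "up l r < \<phi> r" if r: "\<alpha> < ereal r" "ereal r < \<beta>" for r
  proof -
    have "\<alpha> < ereal (min r s)" "ereal (max r s) < \<beta>" using r ss by (auto simp: min_def max_def)
    from max_sol_on[OF m this] show ?thesis
      by (rule sol_order_strict[OF bsol_sol_on[OF up_bsol[OF l]], of "min r s" "max r s" _ s])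
        (use gt ss(3) in auto)
  qed
  have "\<not> filterlim \<phi> at_bot (upper_end \<beta>)"
  proof
    assume "filterlim \<phi> at_bot (upper_end \<beta>)"
    then have lim: "filterlim (dual_curve \<phi>) at_top (lower_end (- \<beta>))" using filterlim_dual_curve by blast
    have sb: "- \<beta> < ereal (- s)" using max_sol_dual[OF m] unfolding max_sol_def by blast
    have flip: "- a < ereal t \<longleftrightarrow> ereal (- t) < a" for a t
      by (metis ereal_uminus_less_reorder uminus_ereal.simps(1))
    have "\<forall>\<^sub>F r in lower_end (- \<beta>). R < dual_curve \<phi> r" using lim by (simp add: filterlim_at_top_dense)
    with eventually_lower_end[OF sb] have "\<forall>\<^sub>F r in lower_end (- \<beta>). False"
    proof eventually_elim
      case (elim r)
      have "\<alpha> < ereal (- r)" using elim ss(1) by (metis ereal_less_eq(3) le_minus_iff less_imp_le less_le_trans)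
      moreover have "ereal (- r) < \<beta>" using elim flip by blast
      ultimately have "up l (- r) < \<phi> (- r)" by (rule above)
      then show False using elim R[of "- r"] by (simp add: dual_curve_def)
    qed
    then show False using lower_end_neq_bot by (simp add: eventually_False)
  qed
  moreover have "\<not> bsol l \<phi>" using up_ge[OF l, of \<phi> s] gt ss(3) by auto
  ultimately show "filterlim \<phi> at_top (lower_end \<alpha>)" using max_sol_trichotomy[OF m] by blast
qed

lemma escape_dn_iff:
  assumes l: "lam0 \<le> l" and m: "max_sol (\<lambda>t x. f t x + l) s x \<alpha> \<beta> \<phi>"
  shows "filterlim \<phi> at_bot (upper_end \<beta>) \<longleftrightarrow> x < lo l s"
proof -
  have "filterlim (dual_curve \<phi>) at_top (lower_end (- \<beta>)) \<longleftrightarrow> upper_sol (dual_field f) l (- s) < - x"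
    by (rule scalar_family.escape_up_iff[OF dual _ max_sol_dual[OF m]]) (simp add: dual_lam0 l)
  then show ?thesis using filterlim_dual_curve up_dual[OF l] by (simp add: dual_curve_def)
qed

lemma forward_attraction_iff:
  assumes l: "lam0 < l" and m: "max_sol (\<lambda>t x. f t x + l) s x \<alpha> \<beta> \<phi>"
  shows "\<beta> = \<infinity> \<and> ((\<lambda>t. \<bar>\<phi> t - up l t\<bar>) \<longlongrightarrow> 0) at_top \<longleftrightarrow> lo l s < x"
proof
  have l': "lam0 \<le> l" using l by simp
  have ss: "\<alpha> < ereal s" "ereal s < \<beta>" "\<phi> s = x" using m unfolding max_sol_def by blast+
  note ub = up_bsol[OF l'] and lb = lo_bsol[OF l']
  {
    assume A: "\<beta> = \<infinity> \<and> ((\<lambda>t. \<bar>\<phi> t - up l t\<bar>) \<longlongrightarrow> 0) at_top"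
    show "lo l s < x"
    proof (rule ccontr)
      assume "\<not> lo l s < x"
      then have le: "\<phi> s \<le> lo l s" using ss(3) by simp
      obtain d where d: "d > 0" "\<And>t. lo l t + d \<le> up l t" using lo_up_separated[OF l] by blast
      have "\<forall>\<^sub>F t in at_top. \<bar>\<phi> t - up l t\<bar> < d" using A d(1) by (intro order_tendstoD) auto
      with eventually_ge_at_top[of s] have "\<forall>\<^sub>F t::real in at_top. False"
      proof eventually_elim
        case (elim t)
        have "\<phi> t \<le> lo l t"
          by (rule sol_order[OF max_sol_on[OF m ss(1)] bsol_sol_on[OF lb], of t s]) (use elim A le in auto)
        then show False using elim d(2)[of t] by linarith
      qed
      then show False by simp
    qed
  }
  assume gt: "lo l s < x"
  have above: "lo l r < \<phi> r" if r: "s \<le> r" "ereal r < \<beta>" for r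
    by (rule sol_order_strict[OF bsol_sol_on[OF lb] max_sol_on[OF m ss(1) r(2)], of s]) (use r gt ss(3) in auto)
  obtain R where R: "R > 0" "\<And>l' b t. \<bar>l'\<bar> \<le> \<bar>l\<bar> \<Longrightarrow> bsol l' b \<Longrightarrow> \<bar>b t\<bar> \<le> R" using bsol_bound[of "\<bar>l\<bar>"] by blast
  obtain R1 B k where B: "up_barrier l B k R1" using up_barrier_exists[of "\<bar>l\<bar>"] by blast
  have k: "k > 0" by (rule up_barrierD(1)[OF B])
  define R' where "R' = R + R1 + (\<bar>x\<bar> + R1) / k"
  have R1: "R1 \<ge> 0" using up_barrierD(2)[OF B, of 0] by linarith
  have RR': "R \<le> R'" using R1 k by (simp add: R'_def)
  have \<phi>b: "\<bar>\<phi> r\<bar> \<le> R'" if r: "s \<le> r" "ereal r < \<beta>" for r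
  proof -
    have "\<phi> r \<le> R1 + (\<bar>x\<bar> + R1) / k"
    proof (cases "B r < \<phi> r")
      case True
      have "k * ((\<phi> r - B r) + (r - s) * min (\<phi> r - B r) 1) \<le> \<phi> s - B s"
        by (rule up_barrierD(3)[OF B r(1) ode_sol_imp_sub[OF max_sol_on[OF m ss(1) r(2)]] True])
      moreover have "0 \<le> k * ((r - s) * min (\<phi> r - B r) 1)" using k r True by (intro mult_nonneg_nonneg) auto
      ultimately have "k * (\<phi> r - B r) \<le> \<bar>x\<bar> + R1" using ss(3) up_barrierD(2)[OF B, of s] by (simp add: distrib_left)
      then have "\<phi> r - B r \<le> (\<bar>x\<bar> + R1) / k" using k by (simp add: field_simps)
      then show ?thesis using up_barrierD(2)[OF B, of r] by linarith
    next
      case False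
      have "0 \<le> (\<bar>x\<bar> + R1) / k" using k R1 by simp
      then show ?thesis using False up_barrierD(2)[OF B, of r] by linarith
    qed
    moreover have "- R \<le> \<phi> r" using above[OF r] R(2)[OF order_refl lb, of r] by linarith
    moreover have "0 \<le> (\<bar>x\<bar> + R1) / k" using k R1 by simp
    ultimately show ?thesis using R(1) R1 unfolding R'_def by linarith
  qed
  have \<beta>: "\<beta> = \<infinity>"
  proof -
    have flip: "- a < ereal t \<longleftrightarrow> ereal (- t) < a" for a t
      by (metis ereal_uminus_less_reorder uminus_ereal.simps(1))
    have "- \<beta> = -\<infinity>"
    proof (rule scalar_family.max_sol_bounded_below_end[OF dual max_sol_dual[OF m]])
      fix r assume "- \<beta> < ereal r" "r \<le> - s"
      then show "\<bar>dual_curve \<phi> r\<bar> \<le> R'" using \<phi>b[of "- r"] by (simp add: flip dual_curve_def)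
    qed
    then show ?thesis by (simp add: ereal_uminus_eq_reorder)
  qed
  have sol: "ode_sol f l {p..q} \<phi>" if "s \<le> p" for p q
    by (rule max_sol_on[OF m]) (use that ss(1) \<beta> in \<open>auto elim: less_le_trans\<close>)
  have "\<exists>d>0. \<forall>r\<ge>s. lo l r + d \<le> \<phi> r"
  proof -
    have "x - lo l s > 0" using gt by simp
    from lo_tubes[OF l this] obtain \<rho> z0 Z where Z: "\<rho> > 0" "z0 > 0" "\<And>t. z0 \<le> Z t \<and> Z t \<le> x - lo l s"
      "ode_sub f (l - \<rho> / 2) UNIV (\<lambda>t. lo l t + Z t)" by blast
    have "lo l r + z0 \<le> \<phi> r" if r: "r \<ge> s" for r
    proof -
      have "lo l r + Z r \<le> \<phi> r"
        by (rule sub_super_compare[OF r ode_sub_subset[OF Z(4)] ode_sol_imp_super[OF sol[OF order_refl]]])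
          (use Z(1) Z(3)[of s] ss(3) in auto)
      then show ?thesis using Z(3)[of r] by linarith
    qed
    then show ?thesis using Z(2) by blast
  qed
  then obtain d where d: "d > 0" "\<And>r. r \<ge> s \<Longrightarrow> lo l r + d \<le> \<phi> r" by blast
  obtain \<sigma>1 \<gamma>1 D1 where E1: "\<sigma>1 > 0" "\<gamma>1 > 0"
    "\<And>l1 l2 b1 b2 s t. s \<le> t \<Longrightarrow> \<bar>l1\<bar> \<le> \<bar>l\<bar> \<Longrightarrow> \<bar>l2\<bar> \<le> \<bar>l\<bar> \<Longrightarrow>
        \<bar>l1 - l2\<bar> \<le> \<sigma>1 \<Longrightarrow> ode_sol f l1 {s..t} b1 \<Longrightarrow> ode_sol f l2 {s..t} b2 \<Longrightarrow>
        (\<forall>r\<in>{s..t}. \<bar>b1 r\<bar> \<le> R' \<and> \<bar>b2 r\<bar> \<le> R' \<and> d \<le> b2 r - b1 r) \<Longrightarrow>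
        integral {s..t} (\<lambda>r. fx r (b2 r)) \<le> D1 - \<gamma>1 * (t - s) \<and> \<gamma>1 * (t - s) - D1 \<le> integral {s..t} (\<lambda>r. fx r (b1 r))"
    using hypE[OF d(1), of "\<bar>l\<bar>" R'] by blast
  obtain \<gamma>2 D2 where att: "\<gamma>2 > 0" "\<And>s t. s \<le> t \<Longrightarrow> integral {s..t} (\<lambda>r. fx r (up l r)) \<le> D2 - \<gamma>2 * (t - s)"
    using up_attractive[OF l] unfolding attractive_def by blast
  have upR: "\<bar>up l r\<bar> \<le> R'" "\<bar>lo l r\<bar> \<le> R'" for r
    using R(2)[OF order_refl ub, of r] R(2)[OF order_refl lb, of r] RR' by linarith+
  have \<phi>R: "\<bar>\<phi> r\<bar> \<le> R'" if "s \<le> r" for r using \<phi>b[OF that] \<beta> by simp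
  have close: "\<exists>r\<ge>s. \<bar>\<phi> r - up l r\<bar> < \<eta>" if \<eta>: "\<eta> > 0" for \<eta>
  proof (rule ccontr)
    assume "\<not> ?thesis"
    then have far: "\<eta> \<le> \<bar>\<phi> r - up l r\<bar>" if "r \<ge> s" for r using that by force
    obtain \<sigma> \<gamma> D where E: "\<sigma> > 0" "\<gamma> > 0"
      "\<And>l1 l2 b1 b2 s t. s \<le> t \<Longrightarrow> \<bar>l1\<bar> \<le> \<bar>l\<bar> \<Longrightarrow> \<bar>l2\<bar> \<le> \<bar>l\<bar> \<Longrightarrow>
        \<bar>l1 - l2\<bar> \<le> \<sigma> \<Longrightarrow> ode_sol f l1 {s..t} b1 \<Longrightarrow> ode_sol f l2 {s..t} b2 \<Longrightarrow>
        (\<forall>r\<in>{s..t}. \<bar>b1 r\<bar> \<le> R' \<and> \<bar>b2 r\<bar> \<le> R' \<and> \<eta> \<le> b2 r - b1 r) \<Longrightarrow>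
        integral {s..t} (\<lambda>r. fx r (b2 r)) \<le> D - \<gamma> * (t - s) \<and> \<gamma> * (t - s) - D \<le> integral {s..t} (\<lambda>r. fx r (b1 r))"
      using hypE[OF \<eta>, of "\<bar>l\<bar>" R'] by blast
    show False
    proof (cases "up l s \<le> \<phi> s")
      case True
      obtain T where T: "T \<ge> 0" "D2 - \<gamma>2 * T < \<gamma> * T - D" using linear_growth_contradiction[OF E(2) att(1)] by blast
      have "\<gamma> * ((s + T) - s) - D \<le> integral {s..s + T} (\<lambda>r. fx r (up l r))"
      proof (rule E(3)[THEN conjunct2, OF _ order_refl order_refl _ bsol_sol_on[OF ub] sol[OF order_refl]])
        show "\<forall>r\<in>{s..s + T}. \<bar>up l r\<bar> \<le> R' \<and> \<bar>\<phi> r\<bar> \<le> R' \<and> \<eta> \<le> \<phi> r - up l r"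
        proof
          fix r assume r: "r \<in> {s..s + T}"
          have "up l r \<le> \<phi> r"
            by (rule sol_order[where a = s and b = "s + T" and s = s and t = r, OF bsol_sol_on[OF ub] sol[OF order_refl]]) (use r True in auto)
          then show "\<bar>up l r\<bar> \<le> R' \<and> \<bar>\<phi> r\<bar> \<le> R' \<and> \<eta> \<le> \<phi> r - up l r"
            using upR(1)[of r] \<phi>R[of r] far[of r] r by auto
        qed
      qed (use T E in auto)
      then show False using att(2)[of s "s + T"] T by simp
    next
      case False
      obtain T where T: "T \<ge> 0" "D1 - \<gamma>1 * T < \<gamma> * T - D" using linear_growth_contradiction[OF E(2) E1(2)] by blast
      have "\<gamma> * ((s + T) - s) - D \<le> integral {s..s + T} (\<lambda>r. fx r (\<phi> r))"
      proof (rule E(3)[THEN conjunct2, OF _ order_refl order_refl _ sol[OF order_refl] bsol_sol_on[OF ub]])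
        show "\<forall>r\<in>{s..s + T}. \<bar>\<phi> r\<bar> \<le> R' \<and> \<bar>up l r\<bar> \<le> R' \<and> \<eta> \<le> up l r - \<phi> r"
        proof
          fix r assume r: "r \<in> {s..s + T}"
          have "\<phi> r \<le> up l r"
            by (rule sol_order[where a = s and b = "s + T" and s = s and t = r, OF sol[OF order_refl] bsol_sol_on[OF ub]]) (use r False in auto)
          then show "\<bar>\<phi> r\<bar> \<le> R' \<and> \<bar>up l r\<bar> \<le> R' \<and> \<eta> \<le> up l r - \<phi> r"
            using upR(1)[of r] \<phi>R[of r] far[of r] r by auto
        qed
      qed (use T E in auto)
      moreover have "integral {s..s + T} (\<lambda>r. fx r (\<phi> r)) \<le> D1 - \<gamma>1 * ((s + T) - s)"
      proof (rule E1(3)[THEN conjunct1, OF _ order_refl order_refl _ bsol_sol_on[OF lb] sol[OF order_refl]])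
        show "\<forall>r\<in>{s..s + T}. \<bar>lo l r\<bar> \<le> R' \<and> \<bar>\<phi> r\<bar> \<le> R' \<and> d \<le> \<phi> r - lo l r"
        proof
          fix r assume r: "r \<in> {s..s + T}"
          then show "\<bar>lo l r\<bar> \<le> R' \<and> \<bar>\<phi> r\<bar> \<le> R' \<and> d \<le> \<phi> r - lo l r"
            using upR(2)[of r] \<phi>R[of r] d(2)[of r] by auto
        qed
      qed (use T E1 in auto)
      ultimately show False using T by simp
    qed
  qed
  have "((\<lambda>t. \<bar>\<phi> t - up l t\<bar>) \<longlongrightarrow> 0) at_top"
  proof (rule tendstoI)
    fix e :: real assume e: "e > 0"
    then have "e / 2 > 0" by simp
    from up_tubes[OF l this] obtain \<rho> z0 Z where Z: "\<rho> > 0" "z0 > 0" "\<And>t. z0 \<le> Z t \<and> Z t \<le> e / 2"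
      "ode_sub f (l - \<rho> / 2) UNIV (\<lambda>t. up l t - Z t)" "ode_super f (l + \<rho> / 2) UNIV (\<lambda>t. up l t + Z t)" by blast
    obtain r0 where r0: "r0 \<ge> s" "\<bar>\<phi> r0 - up l r0\<bar> < z0" using close[OF Z(2)] by blast
    have "dist \<bar>\<phi> r - up l r\<bar> 0 < e" if r: "r \<ge> r0" for r
    proof -
      have "up l r - Z r \<le> \<phi> r"
        by (rule sub_super_compare[OF r ode_sub_subset[OF Z(4)] ode_sol_imp_super[OF sol[OF r0(1)]]])
          (use Z(1) Z(3)[of r0] r0(2) in auto)
      moreover have "\<phi> r \<le> up l r + Z r"
        by (rule sub_super_compare[OF r ode_sol_imp_sub[OF sol[OF r0(1)]] ode_super_subset[OF Z(5)]])
          (use Z(1) Z(3)[of r0] r0(2) in auto)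
      ultimately have "\<bar>\<phi> r - up l r\<bar> < e" using Z(3)[of r] e by linarith
      then show ?thesis by simp
    qed
    then show "\<forall>\<^sub>F t in at_top. dist \<bar>\<phi> t - up l t\<bar> 0 < e" by (auto simp: eventually_at_top_linorder)
  qed
  then show "\<beta> = \<infinity> \<and> ((\<lambda>t. \<bar>\<phi> t - up l t\<bar>) \<longlongrightarrow> 0) at_top" using \<beta> by blast
qed

lemma backward_attraction_iff:
  assumes l: "lam0 < l" and m: "max_sol (\<lambda>t x. f t x + l) s x \<alpha> \<beta> \<phi>"
  shows "\<alpha> = -\<infinity> \<and> ((\<lambda>t. \<bar>\<phi> t - lo l t\<bar>) \<longlongrightarrow> 0) at_bot \<longleftrightarrow> x < up l s"
proof -
  have l': "lam0 \<le> l" using l by simp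
  have "- \<alpha> = \<infinity> \<and> ((\<lambda>t. \<bar>dual_curve \<phi> t - upper_sol (dual_field f) l t\<bar>) \<longlongrightarrow> 0) at_top
     \<longleftrightarrow> lower_sol (dual_field f) l (- s) < - x"
    by (rule scalar_family.forward_attraction_iff[OF dual _ max_sol_dual[OF m]]) (simp add: dual_lam0 l)
  moreover have "\<bar>dual_curve \<phi> t - upper_sol (dual_field f) l t\<bar> = \<bar>\<phi> (- t) - lo l (- t)\<bar>" for t
    using up_dual[OF l'] by (simp add: dual_curve_def abs_minus_commute)
  moreover have "- \<alpha> = \<infinity> \<longleftrightarrow> \<alpha> = -\<infinity>" by (auto simp: ereal_uminus_eq_reorder)
  ultimately show ?thesis using lo_dual[OF l'] by (simp add: filterlim_at_bot_mirror dual_curve_def)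
qed

end

section \<open>Concave equations along an orbit\<close>

lemma block_growth:
  fixes F :: "real \<Rightarrow> real"
  assumes st: "s \<le> t" and c: "continuous_on {s..t} F" and F0: "\<And>r. r \<in> {s..t} \<Longrightarrow> 0 \<le> F r"
    and T: "T > 0" and \<theta>: "\<theta> \<ge> 0" and blk: "\<And>r. s \<le> r \<Longrightarrow> r + T \<le> t \<Longrightarrow> \<theta> \<le> integral {r..r + T} F"
  shows "(\<theta> / T) * (t - s) - \<theta> \<le> integral {s..t} F"
proof -
  have int: "F integrable_on {a..b}" if "s \<le> a" "b \<le> t" for a b
    by (intro integrable_continuous_interval continuous_on_subset[OF c]) (use that in auto)
  have ind: "real n * \<theta> \<le> integral {s..s + real n * T} F" if "s + real n * T \<le> t" for n
    using that
  proof (induction n)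
    case (Suc n)
    have le: "s + real n * T + T \<le> t" using Suc.prems by (simp add: algebra_simps)
    have "real n * \<theta> \<le> integral {s..s + real n * T} F" using Suc.IH le T by simp
    moreover have "\<theta> \<le> integral {s + real n * T..s + real n * T + T} F" by (rule blk) (use T le in auto)
    moreover have "integral {s..s + real n * T} F + integral {s + real n * T..s + real n * T + T} F = integral {s..s + real n * T + T} F"
      using T le by (intro Henstock_Kurzweil_Integration.integral_combine int) auto
    ultimately show ?case by (simp add: algebra_simps)
  qed simp
  define n where "n = nat \<lfloor>(t - s) / T\<rfloor>"
  have q0: "0 \<le> (t - s) / T" using st T by simp
  have n: "real n \<le> (t - s) / T" "(t - s) / T - 1 \<le> real n" using q0 unfolding n_def by linarith+
  have nt: "s + real n * T \<le> t" using n(1) T by (simp add: field_simps)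
  have "((t - s) / T - 1) * \<theta> \<le> real n * \<theta>" using n(2) \<theta> by (rule mult_right_mono)
  also have "\<dots> \<le> integral {s..s + real n * T} F" by (rule ind[OF nt])
  also have "\<dots> \<le> integral {s..t} F"
    by (rule integral_subset_le) (use nt int F0 st in auto)
  finally show ?thesis by (simp add: algebra_simps)
qed

locale concave_orbit =
  fixes c d :: "real \<Rightarrow> real" and G Gx :: "real \<Rightarrow> real \<Rightarrow> real"
  assumes c_cont: "continuous_on UNIV c" and d_cont: "continuous_on UNIV d"
    and cd_bdd: "\<exists>M. \<forall>t. \<bar>c t\<bar> \<le> M \<and> \<bar>d t\<bar> \<le> M"
    and G_cont: "continuous_on UNIV (\<lambda>(t, x). G t x)" and G_der: "\<And>t x. (G t has_real_derivative Gx t x) (at x)"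
    and Gx_cont: "continuous_on UNIV (\<lambda>(t, x). Gx t x)"
    and G_bdd: "\<And>R. \<exists>M. \<forall>t x. \<bar>x\<bar> \<le> R \<longrightarrow> \<bar>G t x\<bar> \<le> M \<and> \<bar>Gx t x\<bar> \<le> M"
    and Gx_ucont: "\<And>R e. e > 0 \<Longrightarrow> \<exists>\<delta>>0. \<forall>t x y. \<bar>x\<bar> \<le> R \<longrightarrow> \<bar>y\<bar> \<le> R \<longrightarrow> \<bar>x - y\<bar> < \<delta> \<longrightarrow> \<bar>Gx t x - Gx t y\<bar> \<le> e"
    and G_nonpos: "\<And>t x. G t x \<le> 0" and G_zero: "\<And>t x. x \<le> 0 \<Longrightarrow> G t x = 0" and Gx_zero: "\<And>t x. x \<le> 0 \<Longrightarrow> Gx t x = 0"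
    and coercive: "\<And>M. \<exists>X. \<forall>t x. X \<le> x \<longrightarrow> d t * x + G t x \<le> M"
    and d_mean: "\<exists>\<gamma>>0. \<exists>D. \<forall>s t. s \<le> t \<longrightarrow> \<gamma> * (t - s) - D \<le> integral {s..t} d"
    and concave_mean: "\<And>R e. e > 0 \<Longrightarrow> \<exists>h D. continuous_on UNIV h \<and> (\<forall>s t. s \<le> t \<longrightarrow> integral {s..t} h \<le> e * (t - s) + D) \<and>
       (\<forall>t x y. - R \<le> x \<longrightarrow> x \<le> y \<longrightarrow> y \<le> R \<longrightarrow> Gx t y - Gx t x \<le> h t)"
    and strict_mean: "\<And>\<eta> R. 0 < \<eta> \<Longrightarrow> \<eta> \<le> R \<Longrightarrow> \<exists>q \<gamma> D. \<gamma> > 0 \<and> continuous_on UNIV q \<and> (\<forall>t. 0 \<le> q t) \<and>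
       (\<forall>s t. s \<le> t \<longrightarrow> \<gamma> * (t - s) - D \<le> integral {s..t} q) \<and>
       (\<forall>t x y. 0 \<le> x \<longrightarrow> x + \<eta> \<le> y \<longrightarrow> y \<le> R \<longrightarrow> 0 < q t \<longrightarrow> q t \<le> Gx t x - Gx t y)"
    and neg_mean: "\<And>\<eta> R e. 0 < \<eta> \<Longrightarrow> \<eta> \<le> R \<Longrightarrow> 0 < e \<Longrightarrow> \<exists>p n D. n > 0 \<and> continuous_on UNIV p \<and> (\<forall>t. 0 \<le> p t) \<and>
       (\<forall>s t. s \<le> t \<longrightarrow> integral {s..t} p \<le> e * (t - s) + D) \<and>
       (\<forall>t x. \<eta> \<le> x \<longrightarrow> x \<le> R \<longrightarrow> 1 - p t \<le> n * (- G t x))"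
begin

definition "f t x = c t + d t * x + G t x"
definition "fx t x = d t + Gx t x"

lemma G_mvt:
  assumes "x < y" shows "\<exists>z. x < z \<and> z < y \<and> G t y - G t x = (y - x) * Gx t z"
  using MVT2[OF assms, of "G t" "Gx t"] G_der by blast

definition "slope t x y = (G t y - G t x) / (y - x)"

lemma slope_mult: "x < y \<Longrightarrow> (y - x) * slope t x y = G t y - G t x"
  by (simp add: slope_def)

lemma gain_nonneg:
  assumes h: "\<And>x y. - R \<le> x \<Longrightarrow> x \<le> y \<Longrightarrow> y \<le> R \<Longrightarrow> Gx t y - Gx t x \<le> h" and x: "\<bar>x1\<bar> \<le> R" "\<bar>x2\<bar> \<le> R" "x1 < x2"
  shows "0 \<le> Gx t x1 - slope t x1 x2 + h" "0 \<le> slope t x1 x2 - Gx t x2 + h"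
proof -
  have xb: "- R \<le> x1" "x1 \<le> R" "- R \<le> x2" "x2 \<le> R" using x by auto
  obtain z where z: "x1 < z" "z < x2" "G t x2 - G t x1 = (x2 - x1) * Gx t z" using G_mvt[OF x(3)] by blast
  have "slope t x1 x2 = Gx t z" using z(3) x(3) by (simp add: slope_def)
  then show "0 \<le> Gx t x1 - slope t x1 x2 + h" "0 \<le> slope t x1 x2 - Gx t x2 + h"
    using h[of x1 z] h[of z x2] z(1,2) xb by linarith+
qed

lemma Gx_pos_part: "Gx t x = Gx t (max x 0)"
  using Gx_zero[of x t] Gx_zero[of 0 t] by (simp add: max_def)

lemma gain_strict:
  assumes h: "\<And>x y. - R \<le> x \<Longrightarrow> x \<le> y \<Longrightarrow> y \<le> R \<Longrightarrow> Gx t y - Gx t x \<le> h" and x: "\<bar>x1\<bar> \<le> R" "\<bar>x2\<bar> \<le> R"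
    and \<eta>: "0 < \<eta>" "\<eta> \<le> 1" "1 \<le> R" "4 * \<eta> \<le> x2 - x1" and u: "0 \<le> x1 + x2"
    and q: "0 \<le> q" "\<And>x y. 0 \<le> x \<Longrightarrow> x + \<eta> \<le> y \<Longrightarrow> y \<le> R \<Longrightarrow> 0 < q \<Longrightarrow> q \<le> Gx t x - Gx t y"
  shows "\<eta> / (4 * R\<^sup>2) * q \<le> Gx t x1 - slope t x1 x2 + h" "\<eta> / (4 * R\<^sup>2) * q \<le> slope t x1 x2 - Gx t x2 + h"
proof -
  have xb: "- R \<le> x1" "x1 \<le> R" "- R \<le> x2" "x2 \<le> R" using x by auto
  define w where "w = x2 - x1"
  have w: "4 * \<eta> \<le> w" "w \<le> 2 * R" "0 < w" using \<eta> x by (auto simp: w_def)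
  have x2: "2 * \<eta> \<le> x2" using u \<eta>(4) by simp
  have xl: "x1 < x2" using \<eta> by simp
  have h0: "0 \<le> h" using h[of 0 0] \<eta> by simp
  have key: "q - h \<le> Gx t a - Gx t b" if ab: "- R \<le> a" "a \<le> b" "max a 0 + \<eta> \<le> b" "b \<le> R" for a b
  proof (cases "q = 0")
    case True then show ?thesis using h[of a b] ab by simp
  next
    case False
    then have "q \<le> Gx t (max a 0) - Gx t b" using q ab by (intro q(2)) auto
    then show ?thesis using Gx_pos_part[of t a] h0 by simp
  qed
  have \<kappa>: "\<eta> / (4 * R\<^sup>2) \<le> 3 / 4" "\<eta> / (4 * R\<^sup>2) \<le> \<eta> / (2 * R)"
  proof -
    have R2: "R \<le> R\<^sup>2" "1 \<le> R\<^sup>2" using \<eta>(3) by (simp_all add: power2_eq_square mult_ge1_I)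
    show "\<eta> / (4 * R\<^sup>2) \<le> 3 / 4" using \<eta> R2 by (simp add: field_simps)
    show "\<eta> / (4 * R\<^sup>2) \<le> \<eta> / (2 * R)" using \<eta> R2 by (intro divide_left_mono mult_pos_pos) auto
  qed
  show "\<eta> / (4 * R\<^sup>2) * q \<le> slope t x1 x2 - Gx t x2 + h"
  proof -
    have z: "x1 < x2 - \<eta>" "x2 - \<eta> < x2" using \<eta> by auto
    obtain a where a: "x1 < a" "a < x2 - \<eta>" "G t (x2 - \<eta>) - G t x1 = (x2 - \<eta> - x1) * Gx t a" using G_mvt[OF z(1)] by blast
    obtain b where b: "x2 - \<eta> < b" "b < x2" "G t x2 - G t (x2 - \<eta>) = (x2 - (x2 - \<eta>)) * Gx t b" using G_mvt[OF z(2)] by blast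
    have "max a 0 + \<eta> \<le> x2" using a(2) x2 \<eta>(1) by (simp add: max_def)
    then have ga: "Gx t x2 + q - h \<le> Gx t a" using key[of a x2] a(1,2) xb \<eta>(1) by linarith
    have gb: "Gx t x2 - h \<le> Gx t b" using h[of b x2] b(1,2) z xb by linarith
    have "w * slope t x1 x2 = (w - \<eta>) * Gx t a + \<eta> * Gx t b"
      using slope_mult[OF xl, of t] a(3) b(3) by (simp add: w_def algebra_simps)
    moreover have "(w - \<eta>) * (Gx t x2 + q - h) \<le> (w - \<eta>) * Gx t a" using ga w \<eta> by (intro mult_left_mono) auto
    moreover have "\<eta> * (Gx t x2 - h) \<le> \<eta> * Gx t b" using gb \<eta> by (intro mult_left_mono) auto
    ultimately have "w * (Gx t x2 - h) + (w - \<eta>) * q \<le> w * slope t x1 x2" by (simp add: algebra_simps)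
    moreover have "w * (3 / 4 * q) \<le> (w - \<eta>) * q" using w q(1) mult_right_mono[of "w * (3/4)" "w - \<eta>" q] by simp
    ultimately have "w * (Gx t x2 - h + 3 / 4 * q) \<le> w * slope t x1 x2" by (simp add: algebra_simps)
    then have "Gx t x2 - h + 3 / 4 * q \<le> slope t x1 x2" using w by simp
    moreover have "\<eta> / (4 * R\<^sup>2) * q \<le> 3 / 4 * q" using \<kappa>(1) q(1) by (rule mult_right_mono)
    ultimately show ?thesis by linarith
  qed
  show "\<eta> / (4 * R\<^sup>2) * q \<le> Gx t x1 - slope t x1 x2 + h"
  proof -
    define z where "z = max x1 0 + \<eta>"
    have z: "x1 < z" "z \<le> x2 - \<eta>" "z < x2" using \<eta> x2 by (auto simp: z_def max_def)
    obtain a where a: "x1 < a" "a < z" "G t z - G t x1 = (z - x1) * Gx t a" using G_mvt[OF z(1)] by blast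
    obtain b where b: "z < b" "b < x2" "G t x2 - G t z = (x2 - z) * Gx t b" using G_mvt[OF z(3)] by blast
    have ga: "Gx t a \<le> Gx t x1 + h" using h[of x1 a] a(1,2) z xb by linarith
    have gb: "Gx t b \<le> Gx t x1 - q + h" using key[of x1 b] b(1,2) z xb z_def by linarith
    have "w * slope t x1 x2 = (z - x1) * Gx t a + (x2 - z) * Gx t b"
      using slope_mult[OF xl, of t] a(3) b(3) by (simp add: w_def algebra_simps)
    moreover have "(z - x1) * Gx t a \<le> (z - x1) * (Gx t x1 + h)" using ga z by (intro mult_left_mono) auto
    moreover have "(x2 - z) * Gx t b \<le> (x2 - z) * (Gx t x1 - q + h)" using gb z by (intro mult_left_mono) auto
    ultimately have "w * slope t x1 x2 \<le> w * (Gx t x1 + h) - (x2 - z) * q" by (simp add: w_def algebra_simps)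
    moreover have "w * (\<eta> / (2 * R) * q) \<le> (x2 - z) * q"
    proof -
      have "w * (\<eta> / (2 * R)) \<le> \<eta>" using w \<eta> by (simp add: field_simps mult_right_mono)
      also have "\<dots> \<le> x2 - z" using z by simp
      finally show ?thesis using q(1) mult_right_mono by (fastforce simp: mult.assoc[symmetric])
    qed
    ultimately have "w * (slope t x1 x2) \<le> w * (Gx t x1 + h - \<eta> / (2 * R) * q)" by (simp add: algebra_simps)
    then have "slope t x1 x2 \<le> Gx t x1 + h - \<eta> / (2 * R) * q" using w by simp
    moreover have "\<eta> / (4 * R\<^sup>2) * q \<le> \<eta> / (2 * R) * q" using \<kappa>(2) q(1) by (rule mult_right_mono)
    ultimately show ?thesis by linarith
  qed
qed

lemma gain_cross:
  assumes h: "\<And>x y. - R \<le> x \<Longrightarrow> x \<le> y \<Longrightarrow> y \<le> R \<Longrightarrow> Gx t y - Gx t x \<le> h" and x: "\<bar>x1\<bar> \<le> R" "\<bar>x2\<bar> \<le> R"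
    and \<eta>: "0 < \<eta>" "\<eta> \<le> 1" "1 \<le> R" "x1 \<le> - (\<eta> / 2)" "\<eta> / 2 \<le> x2"
  shows "\<eta> / (4 * R\<^sup>2) * (- G t x2) \<le> Gx t x1 - slope t x1 x2 + h" "\<eta> / (4 * R\<^sup>2) * (- G t x2) \<le> slope t x1 x2 - Gx t x2 + h"
proof -
  define w where "w = x2 - x1"
  have w: "0 < w" "w \<le> 2 * R" "x2 > 0" "x1 < x2" using \<eta> x by (auto simp: w_def)
  have h0: "0 \<le> h" using h[of 0 0] \<eta> by simp
  have sl: "slope t x1 x2 = G t x2 / w" using G_zero[of x1 t] \<eta> by (simp add: slope_def w_def)
  have g: "0 \<le> - G t x2" using G_nonpos[of t x2] by simp
  have R2: "R \<le> R\<^sup>2" using \<eta>(3) by (simp add: power2_eq_square)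
  show "\<eta> / (4 * R\<^sup>2) * (- G t x2) \<le> Gx t x1 - slope t x1 x2 + h"
  proof -
    have "\<eta> / (4 * R\<^sup>2) \<le> 1 / w"
    proof -
      have "\<eta> * w \<le> 1 * (2 * R)" using \<eta> w by (intro mult_mono) auto
      also have "\<dots> \<le> 4 * R\<^sup>2" using R2 \<eta>(3) by simp
      finally show ?thesis using w \<eta> by (simp add: field_simps)
    qed
    from mult_right_mono[OF this g] show ?thesis using Gx_zero[of x1 t] \<eta> sl h0 by simp
  qed
  show "\<eta> / (4 * R\<^sup>2) * (- G t x2) \<le> slope t x1 x2 - Gx t x2 + h"
  proof -
    obtain z where z: "0 < z" "z < x2" "G t x2 - G t 0 = (x2 - 0) * Gx t z" using G_mvt[OF w(3)] by blast
    have "Gx t z = G t x2 / x2" using z(3) G_zero[of 0 t] w by (simp add: field_simps)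
    moreover have "Gx t x2 \<le> Gx t z + h" using h[of z x2] z x by auto
    ultimately have 1: "Gx t x2 \<le> G t x2 / x2 + h" by simp
    have "\<eta> / (4 * R\<^sup>2) \<le> 1 / x2 - 1 / w"
    proof -
      have "\<eta> * (x2 * w) \<le> (2 * (w - x2)) * (R * (2 * R))"
        using \<eta> w x by (intro mult_mono) (auto simp: w_def)
      then have "\<eta> * (x2 * w) \<le> (w - x2) * (4 * R\<^sup>2)" by (simp add: power2_eq_square algebra_simps)
      then have "\<eta> / (4 * R\<^sup>2) \<le> (w - x2) / (x2 * w)" using w \<eta> by (simp add: divide_le_eq pos_le_divide_eq field_simps)
      also have "\<dots> = 1 / x2 - 1 / w" using w by (simp add: field_simps)
      finally show ?thesis .
    qed
    from mult_right_mono[OF this g] have "\<eta> / (4 * R\<^sup>2) * (- G t x2) \<le> G t x2 / w - G t x2 / x2" by (simp add: left_diff_distrib)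
    then show ?thesis using 1 sl by linarith
  qed
qed

lemma curve_cont:
  assumes F: "continuous_on UNIV (\<lambda>(t, x). F t x)" and b: "continuous_on I b"
  shows "continuous_on I (\<lambda>t. F t (b t) :: real)"
proof -
  have "continuous_on I ((\<lambda>(t, x). F t x) \<circ> (\<lambda>t. (t, b t)))"
    by (intro continuous_on_compose continuous_intros continuous_on_subset[OF F] b) auto
  then show ?thesis by (simp add: o_def)
qed

lemma slope_cont:
  assumes "continuous_on I b1" "continuous_on I b2" "\<And>r. r \<in> I \<Longrightarrow> b1 r < b2 r"
  shows "continuous_on I (\<lambda>r. slope r (b1 r) (b2 r))"
  unfolding slope_def using assms(3)
  by (intro continuous_intros curve_cont[OF G_cont] assms(1,2)) fastforce

lemma G_Lipschitz_zero:
  assumes L: "\<And>t x. \<bar>x\<bar> \<le> R \<Longrightarrow> \<bar>Gx t x\<bar> \<le> L" and x: "0 \<le> x" "x \<le> R"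
  shows "- (L * x) \<le> G t x"
proof (cases "x = 0")
  case True then show ?thesis using G_zero[of 0 t] by simp
next
  case False
  then have "0 < x" using x by simp
  then obtain z where z: "0 < z" "z < x" "G t x - G t 0 = (x - 0) * Gx t z" using G_mvt[of 0 x t] by blast
  have "- L \<le> Gx t z" using L[of z t] z x by auto
  then have "x * (- L) \<le> x * Gx t z" using x by (intro mult_left_mono) auto
  then show ?thesis using z(3) G_zero[of 0 t] by (simp add: mult.commute)
qed

lemma low_slope:
  assumes L: "\<And>t x. \<bar>x\<bar> \<le> R \<Longrightarrow> \<bar>Gx t x\<bar> \<le> L" "0 \<le> L" and x: "\<bar>x2\<bar> \<le> R" "x2 \<le> \<eta>" "0 \<le> \<eta>" "\<delta> \<le> x2 - x1" "0 < \<delta>" "x1 \<le> 0"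
  shows "- (L * \<eta> / \<delta>) \<le> slope t x1 x2"
proof -
  have "- (L * \<eta>) \<le> G t x2"
  proof (cases "x2 \<le> 0")
    case True then show ?thesis using G_zero[of x2 t] L x by simp
  next
    case False
    then have "- (L * x2) \<le> G t x2" using G_Lipschitz_zero[of R L x2 t] L x by auto
    moreover have "L * x2 \<le> L * \<eta>" using L x by (intro mult_left_mono) auto
    ultimately show ?thesis by linarith
  qed
  then have "- G t x2 / (x2 - x1) \<le> (L * \<eta>) / \<delta>"
    using x L G_nonpos[of t x2] by (intro frac_le) auto
  then show ?thesis using G_zero[of x1 t] x by (simp add: slope_def)
qed

text \<open>On every block of length \<open>T\<close> either \<open>b1 + b2 \<ge> 0\<close> throughout, and the strict concavity of
  \<open>q\<close> contributes, or at some time \<open>b1 \<le> - \<eta>\<close> and \<open>\<eta> \<le> b2\<close>, and the negativity of \<open>G\<close>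
  contributes for a time \<open>\<tau>\<close>; a block with \<open>b2 < \<eta>\<close> throughout is excluded since there the
  difference \<open>b2 - b1\<close> would grow like \<open>exp (\<integral> d)\<close>.\<close>

lemma block_gain:
  fixes E b1 b2 p q :: "real \<Rightarrow> real" and \<eta> \<kappa> \<tau> n T r0 :: real
  assumes T: "2 * \<tau> \<le> T" "0 < \<tau>"
    and bc: "continuous_on {r0..r0 + T} b1" "continuous_on {r0..r0 + T} b2"
    and sep: "\<And>r. r \<in> {r0..r0 + T} \<Longrightarrow> 4 * \<eta> \<le> b2 r - b1 r" and \<eta>: "0 < \<eta>"
    and notlow: "\<exists>r\<in>{r0..r0 + T}. \<eta> \<le> b2 r"
    and move: "\<And>r r'. r \<in> {r0..r0 + T} \<Longrightarrow> r' \<in> {r0..r0 + T} \<Longrightarrow> \<bar>r - r'\<bar> \<le> \<tau> \<Longrightarrow>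
       \<bar>b1 r - b1 r'\<bar> \<le> \<eta> / 2 \<and> \<bar>b2 r - b2 r'\<bar> \<le> \<eta> / 2"
    and E: "continuous_on {r0..r0 + T} E" "\<And>r. r \<in> {r0..r0 + T} \<Longrightarrow> 0 \<le> E r"
    and p: "continuous_on UNIV p" "\<And>r. 0 \<le> p r" and q: "continuous_on UNIV q" "1 \<le> integral {r0..r0 + T} q"
    and \<kappa>: "0 < \<kappa>" and n: "\<tau> \<le> n" "0 < n"
    and Eq: "\<And>r. r \<in> {r0..r0 + T} \<Longrightarrow> 0 \<le> b1 r + b2 r \<Longrightarrow> \<kappa> * q r \<le> E r"
    and Ep: "\<And>r. r \<in> {r0..r0 + T} \<Longrightarrow> b1 r \<le> - (\<eta> / 2) \<Longrightarrow> \<eta> / 2 \<le> b2 r \<Longrightarrow> \<kappa> / n * (1 - p r) \<le> E r"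
  shows "\<kappa> * \<tau> / n \<le> integral {r0..r0 + T} (\<lambda>r. E r + \<kappa> / n * p r)"
proof -
  have T0: "0 < T" using T by simp
  let ?I = "{r0..r0 + T}"
  have Fc: "continuous_on ?I (\<lambda>r. E r + \<kappa> / n * p r)"
    by (intro continuous_intros E(1) continuous_on_subset[OF p(1)]) auto
  have F0: "0 \<le> E r + \<kappa> / n * p r" if "r \<in> ?I" for r using E(2)[OF that] p(2)[of r] \<kappa> n by simp
  show ?thesis
  proof (cases "\<forall>r\<in>?I. 0 \<le> b1 r + b2 r")
    case True
    have "\<kappa> * \<tau> / n \<le> \<kappa> * 1" using \<kappa> n by (simp add: field_simps)
    also have "\<dots> \<le> \<kappa> * integral ?I q" using q(2) \<kappa> by (intro mult_left_mono) auto
    also have "\<dots> = integral ?I (\<lambda>r. \<kappa> * q r)" by simp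
    also have "\<dots> \<le> integral ?I (\<lambda>r. E r + \<kappa> / n * p r)"
    proof (rule integral_le)
      show "(\<lambda>r. \<kappa> * q r) integrable_on ?I"
        by (intro integrable_continuous_interval continuous_intros continuous_on_subset[OF q(1)]) auto
      show "(\<lambda>r. E r + \<kappa> / n * p r) integrable_on ?I" by (rule integrable_continuous_interval[OF Fc])
      fix r assume r: "r \<in> ?I"
      have "0 \<le> \<kappa> / n * p r" using p(2)[of r] \<kappa> n by simp
      then show "\<kappa> * q r \<le> E r + \<kappa> / n * p r" using Eq[OF r] True r by force
    qed
    finally show ?thesis .
  next
    case False
    then obtain r1 where r1: "r1 \<in> ?I" "b1 r1 + b2 r1 < 0" by force
    have "\<exists>r\<in>?I. b1 r \<le> - \<eta> \<and> \<eta> \<le> b2 r"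
    proof (cases "\<exists>r\<in>?I. 0 \<le> b1 r + b2 r")
      case True
      then obtain r2 where r2: "r2 \<in> ?I" "0 \<le> b1 r2 + b2 r2" by blast
      have uc: "continuous_on (closed_segment r1 r2) (\<lambda>r. b1 r + b2 r)"
        by (intro continuous_intros continuous_on_subset[OF bc(1)] continuous_on_subset[OF bc(2)])
          (use r1 r2 in \<open>auto simp: closed_segment_eq_real_ivl split: if_splits\<close>)
      have "0 \<in> closed_segment (b1 r1 + b2 r1) (b1 r2 + b2 r2)"
        using r1(2) r2(2) by (simp add: closed_segment_eq_real_ivl)
      from IVT'_closed_segment_real[OF this uc] have "\<exists>r\<in>closed_segment r1 r2. b1 r + b2 r = 0" .
      then obtain r where r: "r \<in> closed_segment r1 r2" "b1 r + b2 r = 0" by blast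
      have rI: "r \<in> ?I" using r(1) r1(1) r2(1) by (auto simp: closed_segment_eq_real_ivl split: if_splits)
      have "b1 r \<le> - \<eta> \<and> \<eta> \<le> b2 r" using sep[OF rI] r(2) \<eta> by linarith
      then show ?thesis using rI by blast
    next
      case False
      obtain r where r: "r \<in> ?I" "\<eta> \<le> b2 r" using notlow by blast
      then have "\<not> 0 \<le> b1 r + b2 r" using False by blast
      then have "b1 r \<le> - \<eta> \<and> \<eta> \<le> b2 r" using r(2) by linarith
      then show ?thesis using r(1) by blast
    qed
    then obtain r where r: "r \<in> ?I" "b1 r \<le> - \<eta>" "\<eta> \<le> b2 r" by blast
    obtain a where a: "{a..a + \<tau>} \<subseteq> ?I" "\<And>r'. r' \<in> {a..a + \<tau>} \<Longrightarrow> \<bar>r' - r\<bar> \<le> \<tau>"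
    proof (cases "r + \<tau> \<le> r0 + T")
      case True
      then show ?thesis using that[of r] r(1) T by auto
    next
      case False
      then show ?thesis using that[of "r - \<tau>"] r(1) T by auto
    qed
    have "\<kappa> * \<tau> / n = integral {a..a + \<tau>} (\<lambda>_. \<kappa> / n)" using T by simp
    also have "\<dots> \<le> integral {a..a + \<tau>} (\<lambda>r. E r + \<kappa> / n * p r)"
    proof (rule integral_le)
      show "(\<lambda>r. E r + \<kappa> / n * p r) integrable_on {a..a + \<tau>}"
        by (intro integrable_continuous_interval continuous_on_subset[OF Fc] a(1))
      fix r' assume r': "r' \<in> {a..a + \<tau>}"
      then have r'I: "r' \<in> ?I" using a(1) by blast
      have "\<bar>b1 r' - b1 r\<bar> \<le> \<eta> / 2 \<and> \<bar>b2 r' - b2 r\<bar> \<le> \<eta> / 2" by (rule move[OF r'I r(1) a(2)[OF r']])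
      then have "b1 r' \<le> - (\<eta> / 2)" "\<eta> / 2 \<le> b2 r'" using r(2,3) by linarith+
      from Ep[OF r'I this] show "\<kappa> / n \<le> E r' + \<kappa> / n * p r'" unfolding right_diff_distrib by linarith
    qed (simp add: integrable_const_ivl)
    also have "\<dots> \<le> integral ?I (\<lambda>r. E r + \<kappa> / n * p r)"
      by (rule integral_subset_le[OF a(1) integrable_continuous_interval[OF continuous_on_subset[OF Fc a(1)]]
          integrable_continuous_interval[OF Fc]]) (use F0 in blast)
    finally show ?thesis .
  qed
qed

lemma slope_integral_bound:
  assumes b: "ode_sol f l1 {s..t} b1" "ode_sol f l2 {s..t} b2" and st: "s \<le> t"
    and bd: "\<And>r. r \<in> {s..t} \<Longrightarrow> \<bar>b1 r\<bar> \<le> R \<and> \<bar>b2 r\<bar> \<le> R \<and> \<delta> \<le> b2 r - b1 r" and \<delta>: "0 < \<delta>" and \<sigma>: "\<bar>l1 - l2\<bar> \<le> \<sigma>"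
  shows "\<bar>integral {s..t} (\<lambda>r. d r + slope r (b1 r) (b2 r))\<bar> \<le> ln (2 * R / \<delta>) + \<sigma> / \<delta> * (t - s)"
proof -
  define w where "w r = b2 r - b1 r" for r
  have w: "\<delta> \<le> w r" "w r \<le> 2 * R" "0 < w r" if "r \<in> {s..t}" for r
  proof -
    show "\<delta> \<le> w r" using bd[OF that] by (simp add: w_def)
    then show "0 < w r" using \<delta> by linarith
    have "b2 r \<le> R" "- R \<le> b1 r" using bd[OF that] by auto
    then show "w r \<le> 2 * R" by (simp add: w_def)
  qed
  have bc: "continuous_on {s..t} b1" "continuous_on {s..t} b2" using b by (auto intro: ode_sol_continuous)
  have wc: "continuous_on {s..t} w" unfolding w_def by (intro continuous_intros bc)
  have sc: "continuous_on {s..t} (\<lambda>r. d r + slope r (b1 r) (b2 r))"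
    by (intro continuous_intros slope_cont bc continuous_on_subset[OF d_cont]) (use w(3) in \<open>auto simp: w_def\<close>)
  have "((\<lambda>r. (d r + slope r (b1 r) (b2 r)) + (l2 - l1) / w r) has_integral (ln (w t) - ln (w s))) {s..t}"
  proof (rule has_integral_antiderivative[OF _ st])
    fix r assume r: "r \<in> {s..t}"
    have wd: "(w has_real_derivative (f r (b2 r) + l2) - (f r (b1 r) + l1)) (at r)"
      unfolding w_def using b r unfolding ode_sol_def by (intro DERIV_diff) auto
    have "(G r (b2 r) - G r (b1 r)) = w r * slope r (b1 r) (b2 r)"
      using slope_mult[of "b1 r" "b2 r" r] w(3)[OF r] by (simp add: w_def)
    then have "(f r (b2 r) + l2) - (f r (b1 r) + l1) = w r * (d r + slope r (b1 r) (b2 r)) + (l2 - l1)"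
      by (simp add: f_def w_def algebra_simps)
    then have "((f r (b2 r) + l2) - (f r (b1 r) + l1)) / w r = (d r + slope r (b1 r) (b2 r)) + (l2 - l1) / w r"
      using w(3)[OF r] by (simp add: field_simps)
    then show "((\<lambda>r. ln (w r)) has_real_derivative (d r + slope r (b1 r) (b2 r)) + (l2 - l1) / w r) (at r)"
      using DERIV_chain2[OF DERIV_ln_divide[OF w(3)[OF r]] wd] by simp
  qed
  moreover have lint: "(\<lambda>r. (l2 - l1) / w r) integrable_on {s..t}"
    by (intro integrable_continuous_interval continuous_intros wc) (use w(3) in force)
  moreover have sint: "(\<lambda>r. d r + slope r (b1 r) (b2 r)) integrable_on {s..t}" by (rule integrable_continuous_interval[OF sc])
  ultimately have eq: "integral {s..t} (\<lambda>r. d r + slope r (b1 r) (b2 r)) = ln (w t) - ln (w s) - integral {s..t} (\<lambda>r. (l2 - l1) / w r)"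
    using Henstock_Kurzweil_Integration.integral_add[OF sint lint] by (simp add: integral_unique)
  have lw: "ln \<delta> \<le> ln (w r)" "ln (w r) \<le> ln (2 * R)" if "r \<in> {s..t}" for r
    using w[OF that] \<delta> by simp_all
  have "R > 0" using w[of s] st \<delta> by auto
  then have "\<bar>ln (w t) - ln (w s)\<bar> \<le> ln (2 * R / \<delta>)"
    using lw[of s] lw[of t] st \<delta> by (auto simp: ln_div)
  moreover have "norm (integral {s..t} (\<lambda>r. (l2 - l1) / w r)) \<le> (\<sigma> / \<delta>) * (t - s)"
  proof (rule integral_bound[OF st])
    show "continuous_on {s..t} (\<lambda>r. (l2 - l1) / w r)" by (intro continuous_intros wc) (use w(3) in force)
    show "norm ((l2 - l1) / w r) \<le> \<sigma> / \<delta>" if "r \<in> {s..t}" for r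
      using w[OF that] \<delta> \<sigma> by (auto simp: abs_minus_commute intro!: frac_le)
  qed
  ultimately show ?thesis using eq unfolding real_norm_def by linarith
qed

theorem separated_solutions_hyperbolic:
  assumes \<delta>: "\<delta> > 0"
  shows "\<exists>\<sigma>>0. \<exists>\<gamma>>0. \<exists>D. \<forall>l1 l2 b1 b2 s t. s \<le> t \<longrightarrow> \<bar>l1\<bar> \<le> \<Lambda> \<longrightarrow> \<bar>l2\<bar> \<le> \<Lambda> \<longrightarrow>
        \<bar>l1 - l2\<bar> \<le> \<sigma> \<longrightarrow> ode_sol f l1 {s..t} b1 \<longrightarrow> ode_sol f l2 {s..t} b2 \<longrightarrow>
        (\<forall>r\<in>{s..t}. \<bar>b1 r\<bar> \<le> R0 \<and> \<bar>b2 r\<bar> \<le> R0 \<and> \<delta> \<le> b2 r - b1 r) \<longrightarrow>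
        integral {s..t} (\<lambda>r. fx r (b2 r)) \<le> D - \<gamma> * (t - s) \<and> \<gamma> * (t - s) - D \<le> integral {s..t} (\<lambda>r. fx r (b1 r))"
proof -
  define R where "R = max R0 (max 1 \<delta>)"
  have R: "R0 \<le> R" "1 \<le> R" "\<delta> \<le> R" by (auto simp: R_def)
  obtain \<gamma>d Dd where gd: "\<gamma>d > 0" "\<And>s t. s \<le> t \<Longrightarrow> \<gamma>d * (t - s) - Dd \<le> integral {s..t} d" using d_mean by blast
  obtain L0 where L0: "\<And>t x. \<bar>x\<bar> \<le> R \<Longrightarrow> \<bar>G t x\<bar> \<le> L0 \<and> \<bar>Gx t x\<bar> \<le> L0" using G_bdd[of R] by blast
  obtain M where M: "\<And>t. \<bar>c t\<bar> \<le> M \<and> \<bar>d t\<bar> \<le> M" using cd_bdd by blast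
  define L where "L = max L0 1"
  have L: "L > 0" "\<And>t x. \<bar>x\<bar> \<le> R \<Longrightarrow> \<bar>G t x\<bar> \<le> L" "\<And>t x. \<bar>x\<bar> \<le> R \<Longrightarrow> \<bar>Gx t x\<bar> \<le> L"
    using L0 by (auto simp: L_def le_max_iff_disj)
  define V where "V = M + M * R + L + \<bar>\<Lambda>\<bar> + 1"
  have M0: "M \<ge> 0" using M[of 0] by linarith
  have V: "V > 0" using M0 L(1) R by (auto simp: V_def intro!: add_nonneg_pos)
  have fV: "\<bar>f t x + l\<bar> \<le> V" if "\<bar>x\<bar> \<le> R" "\<bar>l\<bar> \<le> \<Lambda>" for t x l
  proof -
    have "\<bar>d t * x\<bar> \<le> M * R" unfolding abs_mult using M[of t] that M0 by (intro mult_mono) auto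
    then show ?thesis using M[of t] L(2)[OF that(1), of t] that(2) unfolding f_def V_def by linarith
  qed
  define \<eta> where "\<eta> = min 1 (min (\<delta> / 4) (\<delta> * \<gamma>d / (4 * L)))"
  have \<eta>: "0 < \<eta>" "\<eta> \<le> 1" "4 * \<eta> \<le> \<delta>" "L * \<eta> / \<delta> \<le> \<gamma>d / 4"
  proof -
    show "0 < \<eta>" "\<eta> \<le> 1" "4 * \<eta> \<le> \<delta>" using \<delta> gd L by (auto simp: \<eta>_def)
    have "\<eta> \<le> \<delta> * \<gamma>d / (4 * L)" by (simp add: \<eta>_def)
    then show "L * \<eta> / \<delta> \<le> \<gamma>d / 4" using \<delta> L(1) by (simp add: field_simps)
  qed
  define \<tau> where "\<tau> = \<eta> / (2 * V)"
  have \<tau>: "0 < \<tau>" "V * \<tau> = \<eta> / 2" using \<eta> V by (auto simp: \<tau>_def)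
  have \<eta>R: "\<eta> \<le> R" "\<eta> / 2 \<le> R" using \<eta> R by linarith+
  obtain q \<gamma>q Dq where q: "\<gamma>q > 0" "continuous_on UNIV q" "\<And>t. 0 \<le> q t"
    "\<And>s t. s \<le> t \<Longrightarrow> \<gamma>q * (t - s) - Dq \<le> integral {s..t} q"
    "\<And>t x y. 0 \<le> x \<Longrightarrow> x + \<eta> \<le> y \<Longrightarrow> y \<le> R \<Longrightarrow> 0 < q t \<Longrightarrow> q t \<le> Gx t x - Gx t y"
    using strict_mean[OF \<eta>(1) \<eta>R(1)] by blast
  define C0 where "C0 = ln (2 * R / \<delta>)"
  define T where "T = max (2 * \<tau>) (max ((1 + Dq) / \<gamma>q) (2 * (\<bar>C0\<bar> + \<bar>Dd\<bar> + 1) / \<gamma>d))"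
  have T: "2 * \<tau> \<le> T" "1 + Dq \<le> \<gamma>q * T" "2 * (\<bar>C0\<bar> + \<bar>Dd\<bar> + 1) \<le> \<gamma>d * T" "0 < T"
  proof -
    show "2 * \<tau> \<le> T" by (simp add: T_def)
    then show "0 < T" using \<tau> by linarith
    have "(1 + Dq) / \<gamma>q \<le> T" "2 * (\<bar>C0\<bar> + \<bar>Dd\<bar> + 1) / \<gamma>d \<le> T" by (simp_all add: T_def)
    then show "1 + Dq \<le> \<gamma>q * T" "2 * (\<bar>C0\<bar> + \<bar>Dd\<bar> + 1) \<le> \<gamma>d * T" using q(1) gd(1) by (simp_all add: pos_divide_le_eq mult.commute)
  qed
  have "\<eta> / 2 > 0" "\<tau> / (2 * T) > 0" using \<eta> \<tau> T by auto
  from neg_mean[OF this(1) \<eta>R(2) this(2)] obtain p n0 Dp where p: "n0 > 0" "continuous_on UNIV p" "\<And>t. 0 \<le> p t"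
    "\<And>s t. s \<le> t \<Longrightarrow> integral {s..t} p \<le> \<tau> / (2 * T) * (t - s) + Dp"
    "\<And>t x. \<eta> / 2 \<le> x \<Longrightarrow> x \<le> R \<Longrightarrow> 1 - p t \<le> n0 * (- G t x)" by blast
  define n where "n = max n0 \<tau>"
  have n: "n > 0" "\<tau> \<le> n" "n0 \<le> n" using p(1) by (auto simp: n_def)
  have pn: "1 - p t \<le> n * (- G t x)" if "\<eta> / 2 \<le> x" "x \<le> R" for t x
  proof -
    have "n0 * (- G t x) \<le> n * (- G t x)" using n(3) G_nonpos[of t x] by (intro mult_right_mono) auto
    then show ?thesis using p(5)[OF that, of t] by linarith
  qed
  define \<kappa> where "\<kappa> = \<eta> / (4 * R\<^sup>2)"
  have \<kappa>: "0 < \<kappa>" using \<eta> R by (simp add: \<kappa>_def)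
  define \<theta> where "\<theta> = \<kappa> * \<tau> / n"
  have \<theta>: "0 < \<theta>" using \<kappa> \<tau> n by (simp add: \<theta>_def)
  define \<gamma>1 where "\<gamma>1 = \<theta> / (2 * T)"
  have \<gamma>1: "0 < \<gamma>1" using \<theta> T by (simp add: \<gamma>1_def)
  have "\<gamma>1 / 4 > 0" using \<gamma>1 by simp
  from concave_mean[OF this, of R] obtain h Dh where h: "continuous_on UNIV h"
    "\<And>s t. s \<le> t \<Longrightarrow> integral {s..t} h \<le> \<gamma>1 / 4 * (t - s) + Dh"
    "\<And>t x y. - R \<le> x \<Longrightarrow> x \<le> y \<Longrightarrow> y \<le> R \<Longrightarrow> Gx t y - Gx t x \<le> h t" by blast
  define \<sigma> where "\<sigma> = \<delta> * min (\<gamma>d / 4) (\<gamma>1 / 4)"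
  have \<sigma>: "0 < \<sigma>" "\<sigma> / \<delta> \<le> \<gamma>d / 4" "\<sigma> / \<delta> \<le> \<gamma>1 / 4" using \<delta> gd \<gamma>1 by (auto simp: \<sigma>_def)
  define D1 where "D1 = \<theta> + \<kappa> / n * Dp"
  define D where "D = C0 + D1 + Dh"
  have main: "integral {s..t} (\<lambda>r. fx r (b2 r)) \<le> D - \<gamma>1 / 2 * (t - s) \<and> \<gamma>1 / 2 * (t - s) - D \<le> integral {s..t} (\<lambda>r. fx r (b1 r))"
    if st: "s \<le> t" and l: "\<bar>l1\<bar> \<le> \<Lambda>" "\<bar>l2\<bar> \<le> \<Lambda>" "\<bar>l1 - l2\<bar> \<le> \<sigma>"
      and b: "ode_sol f l1 {s..t} b1" "ode_sol f l2 {s..t} b2"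
      and bd0: "\<forall>r\<in>{s..t}. \<bar>b1 r\<bar> \<le> R0 \<and> \<bar>b2 r\<bar> \<le> R0 \<and> \<delta> \<le> b2 r - b1 r" for l1 l2 b1 b2 s t
  proof -
    have bd: "\<bar>b1 r\<bar> \<le> R \<and> \<bar>b2 r\<bar> \<le> R \<and> \<delta> \<le> b2 r - b1 r" if "r \<in> {s..t}" for r
      using bd0 that R(1) by (meson order_trans)
    have lt: "b1 r < b2 r" if "r \<in> {s..t}" for r using bd[OF that] \<delta> by linarith
    have bc: "continuous_on {s..t} b1" "continuous_on {s..t} b2" using b by (auto intro: ode_sol_continuous)
    define S where "S r = slope r (b1 r) (b2 r)" for r
    have Sc: "continuous_on {s..t} S" unfolding S_def by (rule slope_cont[OF bc lt])
    have slb: "\<bar>integral {a..a'} (\<lambda>r. d r + S r)\<bar> \<le> C0 + \<sigma> / \<delta> * (a' - a)" if "s \<le> a" "a \<le> a'" "a' \<le> t" for a a'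
      unfolding S_def C0_def
      by (rule slope_integral_bound[OF ode_sol_subset[OF b(1)] ode_sol_subset[OF b(2)] that(2) _ \<delta> l(3)])
        (use that bd in auto)
    have notlow: "\<exists>r\<in>{r0..r0 + T}. \<eta> \<le> b2 r" if r0: "s \<le> r0" "r0 + T \<le> t" for r0
    proof (rule ccontr)
      assume "\<not> ?thesis"
      then have low: "b2 r < \<eta>" if "r \<in> {r0..r0 + T}" for r using that by force
      have sub: "{r0..r0 + T} \<subseteq> {s..t}" using r0 by auto
      have "\<gamma>d * T - Dd - \<gamma>d / 4 * T \<le> integral {r0..r0 + T} d - integral {r0..r0 + T} (\<lambda>_. \<gamma>d / 4)"
        using gd(2)[of r0 "r0 + T"] T(4) by (simp add: mult.commute[of T])
      also have "\<dots> = integral {r0..r0 + T} (\<lambda>r. d r - \<gamma>d / 4)"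
        by (rule Henstock_Kurzweil_Integration.integral_diff[symmetric])
          (auto intro!: integrable_continuous_interval continuous_on_subset[OF d_cont])
      also have "\<dots> \<le> integral {r0..r0 + T} (\<lambda>r. d r + S r)"
      proof (rule integral_le)
        show "(\<lambda>r. d r - \<gamma>d / 4) integrable_on {r0..r0 + T}"
          by (intro integrable_continuous_interval continuous_intros continuous_on_subset[OF d_cont]) auto
        show "(\<lambda>r. d r + S r) integrable_on {r0..r0 + T}"
          by (intro integrable_continuous_interval continuous_intros continuous_on_subset[OF d_cont] continuous_on_subset[OF Sc sub]) auto
        fix r assume r: "r \<in> {r0..r0 + T}"
        have "- (L * \<eta> / \<delta>) \<le> S r" unfolding S_def
        proof (rule low_slope[OF L(3), where R = R])
          show "\<bar>b2 r\<bar> \<le> R" "\<delta> \<le> b2 r - b1 r" using bd[of r] r sub by blast+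
          then show "b1 r \<le> 0" using low[OF r] \<eta>(3) \<eta>(1) by linarith
        qed (use L(1) low[OF r] \<eta> \<delta> in auto)
        then show "d r - \<gamma>d / 4 \<le> d r + S r" using \<eta>(4) by linarith
      qed
      also have "\<dots> \<le> C0 + \<sigma> / \<delta> * T" using slb[of r0 "r0 + T"] r0 T(4) by simp
      also have "\<sigma> / \<delta> * T \<le> \<gamma>d / 4 * T" using \<sigma>(2) T(4) by (intro mult_right_mono) auto
      finally have "\<gamma>d * T - Dd - \<gamma>d / 4 * T \<le> C0 + \<gamma>d / 4 * T" by simp
      then have "\<gamma>d * T \<le> 2 * (C0 + Dd)" by (simp add: field_simps)
      then show False using T(3) abs_ge_self[of C0] abs_ge_self[of Dd] by argo
    qed
    have vel: "\<bar>b r - b r'\<bar> \<le> \<eta> / 2" if bb: "ode_sol f l' {s..t} b" "\<bar>l'\<bar> \<le> \<Lambda>" "\<And>r. r \<in> {s..t} \<Longrightarrow> \<bar>b r\<bar> \<le> R"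
      and rr: "r \<in> {s..t}" "r' \<in> {s..t}" "\<bar>r - r'\<bar> \<le> \<tau>" for b l' r r'
    proof -
      have *: "\<bar>b y - b x\<bar> \<le> V * (y - x)" if "x \<in> {s..t}" "y \<in> {s..t}" "x < y" for x y
      proof -
        have "\<exists>z. x < z \<and> z < y \<and> b y - b x = (y - x) * (f z (b z) + l')"
          using bb(1) that unfolding ode_sol_def by (intro MVT2) auto
        then obtain z where z: "x < z" "z < y" "b y - b x = (y - x) * (f z (b z) + l')" by blast
        have "\<bar>b y - b x\<bar> = (y - x) * \<bar>f z (b z) + l'\<bar>" using z(3) that by (simp add: abs_mult)
        also have "\<dots> \<le> (y - x) * V" using fV[OF bb(3) bb(2), of z z] z that by (intro mult_left_mono) auto
        finally show ?thesis by (simp add: mult.commute)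
      qed
      have "\<bar>b r - b r'\<bar> \<le> V * \<bar>r - r'\<bar>"
        using *[of r r'] *[of r' r] rr by (cases r r' rule: linorder_cases) (auto simp: abs_minus_commute)
      also have "\<dots> \<le> V * \<tau>" using rr(3) V by simp
      finally show ?thesis using \<tau>(2) by simp
    qed
    have gain: "\<gamma>1 * (t - s) - D1 \<le> integral {s..t} E"
      if Ec: "continuous_on {s..t} E" and E0: "\<And>r. r \<in> {s..t} \<Longrightarrow> 0 \<le> E r"
        and Eq: "\<And>r. r \<in> {s..t} \<Longrightarrow> 0 \<le> b1 r + b2 r \<Longrightarrow> \<kappa> * q r \<le> E r"
        and Ex: "\<And>r. r \<in> {s..t} \<Longrightarrow> b1 r \<le> - (\<eta> / 2) \<Longrightarrow> \<eta> / 2 \<le> b2 r \<Longrightarrow> \<kappa> * (- G r (b2 r)) \<le> E r" for E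
    proof -
      have Ep: "\<kappa> / n * (1 - p r) \<le> E r" if r: "r \<in> {s..t}" "b1 r \<le> - (\<eta> / 2)" "\<eta> / 2 \<le> b2 r" for r
      proof -
        have "b2 r \<le> R" using bd[OF r(1)] by auto
        then have "\<kappa> / n * (1 - p r) \<le> \<kappa> / n * (n * (- G r (b2 r)))" using pn[OF r(3), of r] \<kappa> n by (intro mult_left_mono) auto
        also have "\<dots> = \<kappa> * (- G r (b2 r))" using n by simp
        also have "\<dots> \<le> E r" by (rule Ex[OF r])
        finally show ?thesis .
      qed
      have Fc: "continuous_on {s..t} (\<lambda>r. E r + \<kappa> / n * p r)"
        by (intro continuous_intros Ec continuous_on_subset[OF p(2)]) auto
      have "(\<theta> / T) * (t - s) - \<theta> \<le> integral {s..t} (\<lambda>r. E r + \<kappa> / n * p r)"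
      proof (rule block_growth[OF st Fc _ T(4)])
        show "0 \<le> E r + \<kappa> / n * p r" if "r \<in> {s..t}" for r using E0[OF that] p(3)[of r] \<kappa> n by simp
        show "0 \<le> \<theta>" using \<theta> by simp
        fix r0 assume r0: "s \<le> r0" "r0 + T \<le> t"
        then have sub: "{r0..r0 + T} \<subseteq> {s..t}" by auto
        show "\<theta> \<le> integral {r0..r0 + T} (\<lambda>r. E r + \<kappa> / n * p r)" unfolding \<theta>_def
        proof (rule block_gain[OF T(1) \<tau>(1) continuous_on_subset[OF bc(1) sub] continuous_on_subset[OF bc(2) sub] _ \<eta>(1)
              notlow[OF r0] _ continuous_on_subset[OF Ec sub] _ p(2,3) q(2) _ \<kappa> n(2,1)])
          show "4 * \<eta> \<le> b2 r - b1 r" if "r \<in> {r0..r0 + T}" for r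
          proof -
            have "\<delta> \<le> b2 r - b1 r" using bd that sub by blast
            then show ?thesis using \<eta>(3) by linarith
          qed
          show "\<bar>b1 r - b1 r'\<bar> \<le> \<eta> / 2 \<and> \<bar>b2 r - b2 r'\<bar> \<le> \<eta> / 2"
            if "r \<in> {r0..r0 + T}" "r' \<in> {r0..r0 + T}" "\<bar>r - r'\<bar> \<le> \<tau>" for r r'
            using vel[OF b(1) l(1), of r r'] vel[OF b(2) l(2), of r r'] bd that sub by blast
          show "1 \<le> integral {r0..r0 + T} q" using q(4)[of r0 "r0 + T"] T(2,4) by simp
        qed (use E0 Eq Ep sub in auto)
      qed
      moreover have "integral {s..t} (\<lambda>r. E r + \<kappa> / n * p r) = integral {s..t} E + \<kappa> / n * integral {s..t} p"
      proof -
        have "integral {s..t} (\<lambda>r. E r + \<kappa> / n * p r) = integral {s..t} E + integral {s..t} (\<lambda>r. \<kappa> / n * p r)"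
          by (rule Henstock_Kurzweil_Integration.integral_add[OF integrable_continuous_interval[OF Ec]
              integrable_continuous_interval[OF continuous_on_mult_left[OF continuous_on_subset[OF p(2) subset_UNIV]]]])
        then show ?thesis by simp
      qed
      moreover have "\<kappa> / n * integral {s..t} p \<le> \<kappa> / n * (\<tau> / (2 * T) * (t - s) + Dp)"
        using p(4)[OF st] \<kappa> n by (intro mult_left_mono) auto
      moreover have "\<kappa> / n * (\<tau> / (2 * T) * (t - s) + Dp) = \<gamma>1 * (t - s) + \<kappa> / n * Dp"
        by (simp add: \<gamma>1_def \<theta>_def distrib_left)
      moreover have "\<theta> / T * (t - s) = \<gamma>1 * (t - s) + \<gamma>1 * (t - s)" using T(4) by (simp add: \<gamma>1_def)
      ultimately show ?thesis unfolding D1_def by linarith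
    qed
    have hint: "h integrable_on {s..t}" and dSint: "(\<lambda>r. d r + S r) integrable_on {s..t}"
      by (intro integrable_continuous_interval continuous_intros continuous_on_subset[OF h(1)] continuous_on_subset[OF d_cont] Sc; simp)+
    have fxc: "continuous_on {s..t} (\<lambda>r. Gx r (b1 r))" "continuous_on {s..t} (\<lambda>r. Gx r (b2 r))"
      by (intro curve_cont[OF Gx_cont] bc)+
    have dc: "continuous_on {s..t} d" "continuous_on {s..t} h" using continuous_on_subset[OF d_cont] continuous_on_subset[OF h(1)] by auto
    have pt: "\<bar>b1 r\<bar> \<le> R" "\<bar>b2 r\<bar> \<le> R" "4 * \<eta> \<le> b2 r - b1 r" if "r \<in> {s..t}" for r
      using bd[OF that] \<eta>(3) by linarith+
    have slt: "\<bar>integral {s..t} (\<lambda>r. d r + S r)\<bar> \<le> C0 + \<gamma>1 / 4 * (t - s)"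
    proof -
      have "\<sigma> / \<delta> * (t - s) \<le> \<gamma>1 / 4 * (t - s)" using \<sigma>(3) st by (intro mult_right_mono) auto
      then show ?thesis using slb[of s t] st by linarith
    qed
    define E1 where "E1 r = Gx r (b1 r) - S r + h r" for r
    define E2 where "E2 r = S r - Gx r (b2 r) + h r" for r
    have Ec: "continuous_on {s..t} E1" "continuous_on {s..t} E2"
      unfolding E1_def E2_def by (intro continuous_intros fxc Sc dc)+
    have g1: "\<gamma>1 * (t - s) - D1 \<le> integral {s..t} E1"
    proof (rule gain[OF Ec(1)])
      show "0 \<le> E1 r" if "r \<in> {s..t}" for r unfolding E1_def S_def
        by (rule gain_nonneg(1)[where R = R, OF h(3)]) (use pt[OF that] lt[OF that] in auto)
      show "\<kappa> * q r \<le> E1 r" if "r \<in> {s..t}" "0 \<le> b1 r + b2 r" for r unfolding E1_def S_def \<kappa>_def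
        by (rule gain_strict(1)[where R = R and \<eta> = \<eta>, OF h(3)]) (use pt[OF that(1)] \<eta> R(2) that q(3,5) in auto)
      show "\<kappa> * (- G r (b2 r)) \<le> E1 r" if "r \<in> {s..t}" "b1 r \<le> - (\<eta> / 2)" "\<eta> / 2 \<le> b2 r" for r unfolding E1_def S_def \<kappa>_def
        by (rule gain_cross(1)[where R = R and \<eta> = \<eta>, OF h(3)]) (use pt[OF that(1)] \<eta> R(2) that in auto)
    qed
    have g2: "\<gamma>1 * (t - s) - D1 \<le> integral {s..t} E2"
    proof (rule gain[OF Ec(2)])
      show "0 \<le> E2 r" if "r \<in> {s..t}" for r unfolding E2_def S_def
        by (rule gain_nonneg(2)[where R = R, OF h(3)]) (use pt[OF that] lt[OF that] in auto)
      show "\<kappa> * q r \<le> E2 r" if "r \<in> {s..t}" "0 \<le> b1 r + b2 r" for r unfolding E2_def S_def \<kappa>_def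
        by (rule gain_strict(2)[where R = R and \<eta> = \<eta>, OF h(3)]) (use pt[OF that(1)] \<eta> R(2) that q(3,5) in auto)
      show "\<kappa> * (- G r (b2 r)) \<le> E2 r" if "r \<in> {s..t}" "b1 r \<le> - (\<eta> / 2)" "\<eta> / 2 \<le> b2 r" for r unfolding E2_def S_def \<kappa>_def
        by (rule gain_cross(2)[where R = R and \<eta> = \<eta>, OF h(3)]) (use pt[OF that(1)] \<eta> R(2) that in auto)
    qed
    have Eint: "E1 integrable_on {s..t}" "E2 integrable_on {s..t}" using Ec by (auto intro: integrable_continuous_interval)
    have "integral {s..t} (\<lambda>r. fx r (b1 r)) = integral {s..t} (\<lambda>r. ((d r + S r) + E1 r) - h r)"
      by (rule arg_cong[of _ _ "integral {s..t}"]) (auto simp: fx_def E1_def)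
    also have "\<dots> = integral {s..t} (\<lambda>r. d r + S r) + integral {s..t} E1 - integral {s..t} h"
      using Henstock_Kurzweil_Integration.integral_diff[OF integrable_add[OF dSint Eint(1)] hint]
        Henstock_Kurzweil_Integration.integral_add[OF dSint Eint(1)] by simp
    finally have 1: "integral {s..t} (\<lambda>r. fx r (b1 r)) = integral {s..t} (\<lambda>r. d r + S r) + integral {s..t} E1 - integral {s..t} h" .
    have "integral {s..t} (\<lambda>r. fx r (b2 r)) = integral {s..t} (\<lambda>r. ((d r + S r) - E2 r) + h r)"
      by (rule arg_cong[of _ _ "integral {s..t}"]) (auto simp: fx_def E2_def)
    also have "\<dots> = integral {s..t} (\<lambda>r. d r + S r) - integral {s..t} E2 + integral {s..t} h"
      using Henstock_Kurzweil_Integration.integral_add[OF integrable_diff[OF dSint Eint(2)] hint]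
        Henstock_Kurzweil_Integration.integral_diff[OF dSint Eint(2)] by simp
    finally have 2: "integral {s..t} (\<lambda>r. fx r (b2 r)) = integral {s..t} (\<lambda>r. d r + S r) - integral {s..t} E2 + integral {s..t} h" .
    have "\<gamma>1 * (t - s) - \<gamma>1 / 4 * (t - s) - \<gamma>1 / 4 * (t - s) = \<gamma>1 / 2 * (t - s)" by (simp add: algebra_simps)
    then show ?thesis using 1 2 g1 g2 slt h(2)[OF st] unfolding D_def by linarith
  qed
  show ?thesis
    by (rule exI[of _ \<sigma>], rule conjI[OF \<sigma>(1)], rule exI[of _ "\<gamma>1 / 2"], rule conjI, use \<gamma>1 in simp, rule exI[of _ D])
      (intro allI impI, rule main)
qed

lemma family_cont: "continuous_on UNIV (\<lambda>(t, x). f t x)" "continuous_on UNIV (\<lambda>(t, x). fx t x)"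
proof -
  have cc: "continuous_on UNIV (\<lambda>p :: real \<times> real. c (fst p))" "continuous_on UNIV (\<lambda>p :: real \<times> real. d (fst p))"
    by (intro continuous_on_compose2[OF c_cont] continuous_on_compose2[OF d_cont] continuous_intros; simp)+
  show "continuous_on UNIV (\<lambda>(t, x). f t x)" "continuous_on UNIV (\<lambda>(t, x). fx t x)"
    unfolding f_def fx_def case_prod_unfold
    by (intro continuous_intros cc G_cont[unfolded case_prod_unfold] Gx_cont[unfolded case_prod_unfold])+
qed

lemma family_der: "(f t has_real_derivative fx t x) (at x)"
  unfolding f_def[abs_def] fx_def by (auto intro!: derivative_eq_intros G_der)

lemma family_bdd: "\<exists>M. \<forall>t x. \<bar>x\<bar> \<le> R \<longrightarrow> \<bar>f t x\<bar> \<le> M \<and> \<bar>fx t x\<bar> \<le> M"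
proof -
  obtain N where N: "\<And>t x. \<bar>x\<bar> \<le> R \<Longrightarrow> \<bar>G t x\<bar> \<le> N \<and> \<bar>Gx t x\<bar> \<le> N" using G_bdd[of R] by blast
  obtain M where M: "\<And>t. \<bar>c t\<bar> \<le> M \<and> \<bar>d t\<bar> \<le> M" using cd_bdd by blast
  have M0: "0 \<le> M" using M[of 0] by linarith
  have "\<bar>f t x\<bar> \<le> 2 * M + M * \<bar>R\<bar> + N \<and> \<bar>fx t x\<bar> \<le> 2 * M + M * \<bar>R\<bar> + N" if x: "\<bar>x\<bar> \<le> R" for t x
  proof -
    have "\<bar>d t * x\<bar> \<le> M * \<bar>R\<bar>" unfolding abs_mult using M[of t] x M0 by (intro mult_mono) auto
    moreover have "0 \<le> M * \<bar>R\<bar>" using M0 by simp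
    ultimately show ?thesis using M[of t] N[OF x, of t] M0 unfolding f_def fx_def by linarith
  qed
  then show ?thesis by blast
qed

lemma above_barrier_escape:
  "\<exists>X. \<forall>l\<le>\<Lambda>. \<forall>s t u. s \<le> t \<longrightarrow> ode_sub f l {s..t} u \<longrightarrow> X < u t \<longrightarrow> u t + (t - s) \<le> u s"
proof -
  obtain M where M: "\<And>t. \<bar>c t\<bar> \<le> M \<and> \<bar>d t\<bar> \<le> M" using cd_bdd by blast
  obtain X where X: "\<And>t x. X \<le> x \<Longrightarrow> d t * x + G t x \<le> - (M + \<Lambda> + 1)" using coercive by blast
  have neg: "f t x + l \<le> - 1" if "X \<le> x" "l \<le> \<Lambda>" for t x l
    using X[OF that(1), of t] M[of t] that(2) unfolding f_def by linarith
  have "u t + (t - s) \<le> u s" if l: "l \<le> \<Lambda>" and st: "s \<le> t" and u: "ode_sub f l {s..t} u" and ut: "X < u t" for l s t u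
  proof -
    obtain R1 where R1: "\<And>r. r \<in> {s..t} \<Longrightarrow> \<bar>u r\<bar> \<le> R1" using continuous_on_Icc_bounded[OF ode_sub_continuous[OF u]] by blast
    define R where "R = \<bar>R1\<bar> + (t - s)"
    obtain L where L: "\<And>t x. \<bar>x\<bar> \<le> R \<Longrightarrow> \<bar>f t x\<bar> \<le> L \<and> \<bar>fx t x\<bar> \<le> L" using family_bdd[of R] by blast
    have "\<forall>r\<in>{s..t}. \<exists>D. (u has_real_derivative D) (at r) \<and> D \<le> f r (u r) + l" using u unfolding ode_sub_def .
    then obtain D where D: "\<And>r. r \<in> {s..t} \<Longrightarrow> (u has_real_derivative D r) (at r) \<and> D r \<le> f r (u r) + l" by metis
    have "u t + (t - s) - u s \<le> 0"
    proof (rule comparison_backward[OF st, of "\<lambda>r. u t + (t - r) - u r" "\<lambda>r. - 1 - D r" L])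
      fix r assume r: "r \<in> {s..t}"
      show "((\<lambda>r. u t + (t - r) - u r) has_real_derivative - 1 - D r) (at r)"
        using D[OF r] by (auto intro!: derivative_eq_intros)
      assume pos: "u t + (t - r) - u r > 0"
      define v where "v = u t + (t - r)"
      have v: "u r < v" "X \<le> v" using pos ut r by (auto simp: v_def)
      obtain z where z: "u r < z" "z < v" "f r v - f r (u r) = (v - u r) * fx r z"
        using MVT2[OF v(1), of "f r" "fx r"] family_der by blast
      have "\<bar>u r\<bar> \<le> R1" "\<bar>u t\<bar> \<le> R1" using R1[OF r] R1[of t] st by auto
      then have "- R \<le> u r" "v \<le> R" using r st unfolding R_def v_def by auto
      then have "\<bar>z\<bar> \<le> R" using z(1,2) by linarith
      then have "- fx r z \<le> L" using L[of z r] by linarith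
      then have "(v - u r) * (- fx r z) \<le> (v - u r) * L" using v by (intro mult_left_mono) auto
      then have "f r (u r) \<le> f r v + L * (v - u r)" using z(3) by (simp add: mult.commute)
      then show "- (- 1 - D r) \<le> L * (u t + (t - r) - u r)"
        using neg[OF v(2) l, of r] D[OF r] unfolding v_def by linarith
    qed simp
    then show ?thesis by simp
  qed
  then show ?thesis by blast
qed

definition "bl l t = - integral {0..} (\<lambda>s. exp (- integral {0..s} (\<lambda>r. d (r + t))) * (c (s + t) + l))"

definition "unit_resp t = integral {0..} (\<lambda>s. exp (- integral {0..s} (\<lambda>r. d (r + t))) * 1)"

lemma forcing: "continuous_on UNIV (\<lambda>t. c t + l)" by (intro continuous_intros c_cont)

lemma bl_solution: "(bl l has_real_derivative d t * bl l t + (c t + l)) (at t)"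
proof -
  obtain \<gamma> D where gd: "\<gamma> > 0" "\<And>s t. s \<le> t \<Longrightarrow> \<gamma> * (t - s) - D \<le> integral {s..t} d" using d_mean by blast
  obtain M where M: "\<And>t. \<bar>c t\<bar> \<le> M \<and> \<bar>d t\<bar> \<le> M" using cd_bdd by blast
  have Q: "\<bar>c t + l\<bar> \<le> M + \<bar>l\<bar>" for t using M[of t] by linarith
  show ?thesis unfolding bl_def[abs_def] by (rule linear_solution[OF d_cont forcing Q gd])
qed


lemma bl_bdd: "\<exists>K. \<forall>l t. \<bar>l\<bar> \<le> \<Lambda> \<longrightarrow> \<bar>bl l t\<bar> \<le> K"
proof -
  obtain \<gamma> D where gd: "\<gamma> > 0" "\<And>s t. s \<le> t \<Longrightarrow> \<gamma> * (t - s) - D \<le> integral {s..t} d" using d_mean by blast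
  obtain M where M: "\<And>t. \<bar>c t\<bar> \<le> M \<and> \<bar>d t\<bar> \<le> M" using cd_bdd by blast
  have "\<bar>bl l t\<bar> \<le> (M + \<Lambda>) * exp D / \<gamma>" if l: "\<bar>l\<bar> \<le> \<Lambda>" for l t
  proof -
    have Q: "\<bar>c t + l\<bar> \<le> M + \<Lambda>" for t using M[of t] l by linarith
    show ?thesis unfolding bl_def abs_minus_cancel by (rule linear_bound[OF d_cont forcing Q gd])
  qed
  then show ?thesis by blast
qed

lemma unit_resp_bounds: "\<exists>e0 e1. 0 < e0 \<and> (\<forall>t. e0 \<le> unit_resp t \<and> unit_resp t \<le> e1)"
proof -
  obtain \<gamma> D where gd: "\<gamma> > 0" "\<And>s t. s \<le> t \<Longrightarrow> \<gamma> * (t - s) - D \<le> integral {s..t} d" using d_mean by blast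
  obtain M where M: "\<And>t. \<bar>c t\<bar> \<le> M \<and> \<bar>d t\<bar> \<le> M" using cd_bdd by blast
  have M1: "d t \<le> \<bar>M\<bar> + 1" for t using M[of t] by linarith
  have M2: "0 < \<bar>M\<bar> + 1" by simp
  have one: "continuous_on UNIV (\<lambda>_ :: real. 1 :: real)" by simp
  have one1: "\<bar>1 :: real\<bar> \<le> 1" by simp
  have "1 / (\<bar>M\<bar> + 1) \<le> unit_resp t" for t unfolding unit_resp_def by (rule linear_unit_lower[OF d_cont M1 M2 gd])
  moreover have "unit_resp t \<le> 1 * exp D / \<gamma>" for t
    using linear_bound[OF d_cont one one1 gd, of t] unfolding unit_resp_def by linarith
  ultimately show ?thesis using M2 by (intro exI[of _ "1 / (\<bar>M\<bar> + 1)"] exI[of _ "1 * exp D / \<gamma>"]) auto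
qed

lemma bl_affine: "bl l t = bl m t - (l - m) * unit_resp t"
proof -
  obtain \<gamma> D where gd: "\<gamma> > 0" "\<And>s t. s \<le> t \<Longrightarrow> \<gamma> * (t - s) - D \<le> integral {s..t} d" using d_mean by blast
  obtain M where M: "\<And>t. \<bar>c t\<bar> \<le> M \<and> \<bar>d t\<bar> \<le> M" using cd_bdd by blast
  have Q: "\<bar>c t + m\<bar> \<le> M + \<bar>m\<bar>" for t using M[of t] by linarith
  have one: "continuous_on UNIV (\<lambda>_ :: real. 1 :: real)" by simp
  have one1: "\<bar>1 :: real\<bar> \<le> 1" by simp
  let ?w = "\<lambda>s. exp (- integral {0..s} (\<lambda>r. d (r + t)))"
  have 1: "(\<lambda>s. ?w s * (c (s + t) + m)) integrable_on {0..}" by (rule linear_integrable[OF d_cont forcing Q gd])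
  have 2: "(\<lambda>s. ?w s * 1) integrable_on {0..}" by (rule linear_integrable[OF d_cont one one1 gd])
  have "((\<lambda>s. ?w s * (c (s + t) + m) + (l - m) * (?w s * 1)) has_integral
      (integral {0..} (\<lambda>s. ?w s * (c (s + t) + m)) + (l - m) * integral {0..} (\<lambda>s. ?w s * 1))) {0..}"
    by (intro has_integral_add has_integral_mult_right integrable_integral 1 2)
  moreover have "(\<lambda>s. ?w s * (c (s + t) + m) + (l - m) * (?w s * 1)) = (\<lambda>s. ?w s * (c (s + t) + l))"
    by (simp add: fun_eq_iff algebra_simps)
  ultimately have "integral {0..} (\<lambda>s. ?w s * (c (s + t) + l)) =
      integral {0..} (\<lambda>s. ?w s * (c (s + t) + m)) + (l - m) * integral {0..} (\<lambda>s. ?w s * 1)"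
    by (simp only: integral_unique)
  then show ?thesis unfolding bl_def unit_resp_def by linarith
qed

lemma below_bl_escape:
  "\<exists>k>0. \<forall>l s t u. s \<le> t \<longrightarrow> ode_sub f l {s..t} u \<longrightarrow> u s < bl l s \<longrightarrow>
     k * ((bl l s - u s) + (t - s) * min (bl l s - u s) 1) \<le> bl l t - u t"
proof -
  obtain \<gamma> D0 where gd: "\<gamma> > 0" "\<And>s t. s \<le> t \<Longrightarrow> \<gamma> * (t - s) - D0 \<le> integral {s..t} d" using d_mean by blast
  obtain P where P: "\<And>t. (P has_real_derivative d t) (at t)" using antiderivative_exists[OF d_cont] by metis
  define k where "k = exp (- D0) * min 1 \<gamma>"
  have k: "k > 0" using gd by (simp add: k_def)
  have "k * ((bl l s - u s) + (t - s) * min (bl l s - u s) 1) \<le> bl l t - u t"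
    if st: "s \<le> t" and u: "ode_sub f l {s..t} u" and us: "u s < bl l s" for l s t u
  proof -
    define y where "y r = bl l r - u r" for r
    have "exp (- P s) * y s \<le> exp (- P t) * y t"
    proof (rule DERIV_nonneg_imp_nondecreasing[OF st])
      fix r assume r: "s \<le> r" "r \<le> t"
      then obtain D where D: "(u has_real_derivative D) (at r)" "D \<le> f r (u r) + l"
        using u unfolding ode_sub_def by (meson atLeastAtMost_iff)
      have "((\<lambda>r. exp (- P r) * y r) has_real_derivative
          exp (- P r) * ((d r * bl l r + (c r + l) - D) - d r * y r)) (at r)"
        unfolding y_def by (auto intro!: derivative_eq_intros P bl_solution D(1) simp: algebra_simps)
      moreover have "0 \<le> (d r * bl l r + (c r + l) - D) - d r * y r"
        using D(2) G_nonpos[of r "u r"] unfolding f_def y_def by (simp add: algebra_simps)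
      ultimately show "\<exists>y'. ((\<lambda>r. exp (- P r) * y r) has_real_derivative y') (at r) \<and> 0 \<le> y'" by fastforce
    qed
    then have "exp (P t) * (exp (- P s) * y s) \<le> exp (P t) * (exp (- P t) * y t)" by (rule mult_left_mono) simp
    then have 1: "exp (P t - P s) * y s \<le> y t" by (simp add: mult.assoc[symmetric] exp_add[symmetric])
    have y0: "0 < y s" using us by (simp add: y_def)
    have "\<gamma> * (t - s) - D0 \<le> P t - P s"
      using gd(2)[OF st] integral_unique[OF has_integral_antiderivative[OF P st]] by simp
    then have "exp (\<gamma> * (t - s) - D0) \<le> exp (P t - P s)" by simp
    moreover have "exp (- D0) * (1 + \<gamma> * (t - s)) \<le> exp (- D0) * exp (\<gamma> * (t - s))" by simp
    moreover have "exp (- D0) * exp (\<gamma> * (t - s)) = exp (\<gamma> * (t - s) - D0)" by (simp add: exp_add[symmetric])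
    moreover have "k * (1 + (t - s)) \<le> exp (- D0) * (1 + \<gamma> * (t - s))"
    proof -
      have "min 1 \<gamma> * (t - s) \<le> \<gamma> * (t - s)" using st by (intro mult_right_mono) auto
      then have "min 1 \<gamma> * (1 + (t - s)) \<le> 1 + \<gamma> * (t - s)" unfolding distrib_left by simp
      then show ?thesis unfolding k_def mult.assoc by (intro mult_left_mono) auto
    qed
    ultimately have "k * (1 + (t - s)) \<le> exp (P t - P s)" by linarith
    then have 2: "k * (1 + (t - s)) * y s \<le> exp (P t - P s) * y s" using y0 by (intro mult_right_mono) auto
    have "(t - s) * min (y s) 1 \<le> (t - s) * y s" using st by (intro mult_left_mono) auto
    then have "k * (y s + (t - s) * min (y s) 1) \<le> k * (y s + (t - s) * y s)" using k by simp
    also have "\<dots> = k * (1 + (t - s)) * y s" by (simp add: algebra_simps)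
    finally show ?thesis using 1 2 unfolding y_def by linarith
  qed
  then show ?thesis using k by blast
qed

lemma bl_le_bounded_sol:
  assumes b: "bounded_sol (\<lambda>t x. f t x + l) b" shows "bl l t \<le> b t"
proof (rule ccontr)
  assume "\<not> bl l t \<le> b t"
  then have lt: "b t < bl l t" by simp
  obtain k where k: "k > 0" "\<And>l s t u. s \<le> t \<Longrightarrow> ode_sub f l {s..t} u \<Longrightarrow> u s < bl l s \<Longrightarrow>
     k * ((bl l s - u s) + (t - s) * min (bl l s - u s) 1) \<le> bl l t - u t" using below_bl_escape by blast
  obtain K where K: "\<And>t. \<bar>bl l t\<bar> \<le> K" using bl_bdd[of "\<bar>l\<bar>"] by blast
  obtain R where R: "\<And>t. \<bar>b t\<bar> \<le> R" using b unfolding bounded_sol_def bounded_iff by auto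
  have sol: "ode_sub f l UNIV b" using b ode_sol_imp_sub unfolding bounded_sol_iff by blast
  define y where "y = min (bl l t - b t) 1"
  have y: "y > 0" using lt by (simp add: y_def)
  define h where "h = (K + R + 1) / (k * y)"
  have KR: "0 \<le> K" "0 \<le> R" using K[of 0] R[of 0] by linarith+
  have h: "0 \<le> h" "k * (h * y) = K + R + 1" using KR k y by (simp_all add: h_def)
  have "k * ((bl l t - b t) + (t + h - t) * min (bl l t - b t) 1) \<le> bl l (t + h) - b (t + h)"
    by (rule k(2)[OF _ ode_sub_subset[OF sol] lt]) (use h in auto)
  moreover have "k * (h * y) \<le> k * ((bl l t - b t) + h * y)" using k lt by simp
  ultimately show False using h(2) K[of "t + h"] R[of "t + h"] unfolding y_def by auto
qed

lemma family_params_bdd: "bdd_below (bsol_params f)"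
proof -
  obtain X where X: "\<And>l s t u. l \<le> 0 \<Longrightarrow> s \<le> t \<Longrightarrow> ode_sub f l {s..t} u \<Longrightarrow> X < u t \<Longrightarrow> u t + (t - s) \<le> u s"
    using above_barrier_escape[of 0] by blast
  obtain e0 e1 where e: "0 < e0" "\<And>t. e0 \<le> unit_resp t \<and> unit_resp t \<le> e1" using unit_resp_bounds by blast
  have "min 0 (- (\<bar>X - bl 0 0\<bar> / e0)) \<le> l" if "l \<in> bsol_params f" for l
  proof (cases "l \<le> 0")
    case True
    obtain b where b: "bounded_sol (\<lambda>t x. f t x + l) b" using \<open>l \<in> bsol_params f\<close> unfolding bsol_params_def by blast
    obtain R where R: "\<And>t. \<bar>b t\<bar> \<le> R" using b unfolding bounded_sol_def bounded_iff by auto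
    have sol: "ode_sub f l UNIV b" using b ode_sol_imp_sub unfolding bounded_sol_iff by blast
    have R0: "0 \<le> R" using R[of 0] by linarith
    have "b 0 \<le> X"
    proof (rule ccontr)
      assume "\<not> b 0 \<le> X"
      then have "b 0 + (0 - (- (2 * R + 1))) \<le> b (- (2 * R + 1))"
        using R0 by (intro X[OF True _ ode_sub_subset[OF sol]]) auto
      then show False using R[of 0] R[of "- (2 * R + 1)"] by linarith
    qed
    then have "bl l 0 \<le> X" using bl_le_bounded_sol[OF b, of 0] by simp
    then have "- l * unit_resp 0 \<le> X - bl 0 0" using bl_affine[of l 0 0] by simp
    moreover have "- l * e0 \<le> - l * unit_resp 0" using e(2)[of 0] True by (intro mult_left_mono) auto
    ultimately have "- l * e0 \<le> \<bar>X - bl 0 0\<bar>" by linarith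
    then have "- l \<le> \<bar>X - bl 0 0\<bar> / e0" using e(1) by (simp add: pos_le_divide_eq)
    then show ?thesis by linarith
  qed simp
  then show ?thesis by (rule bdd_belowI)
qed

sublocale fam: scalar_family f fx
proof
  show "continuous_on UNIV (\<lambda>(t, x). f t x)" "continuous_on UNIV (\<lambda>(t, x). fx t x)" by (rule family_cont)+
  show "(f t has_real_derivative fx t x) (at x)" for t x by (rule family_der)
  show "\<exists>M. \<forall>t x. \<bar>x\<bar> \<le> R \<longrightarrow> \<bar>f t x\<bar> \<le> M \<and> \<bar>fx t x\<bar> \<le> M" for R by (rule family_bdd)
  show "\<exists>d>0. \<forall>t x y. \<bar>x\<bar> \<le> R \<longrightarrow> \<bar>y\<bar> \<le> R \<longrightarrow> \<bar>x - y\<bar> < d \<longrightarrow> \<bar>fx t x - fx t y\<bar> \<le> e" if "e > 0" for R e :: real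
    using Gx_ucont[OF that, of R] by (simp add: fx_def)
  show "bdd_below (bsol_params f)" by (rule family_params_bdd)
  fix \<Lambda> :: real
  show "\<exists>R. \<forall>l. \<bar>l\<bar> \<le> \<Lambda> \<longrightarrow> (\<exists>B k. k > 0 \<and> (\<forall>t. \<bar>B t\<bar> \<le> R) \<and>
        (\<forall>s t u. s \<le> t \<longrightarrow> ode_sub f l {s..t} u \<longrightarrow> B t < u t \<longrightarrow>
           k * ((u t - B t) + (t - s) * min (u t - B t) 1) \<le> u s - B s))"
  proof -
    obtain X where X: "\<And>l s t u. l \<le> \<Lambda> \<Longrightarrow> s \<le> t \<Longrightarrow> ode_sub f l {s..t} u \<Longrightarrow> X < u t \<Longrightarrow> u t + (t - s) \<le> u s"
      using above_barrier_escape[of \<Lambda>] by blast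
    have "1 * ((u t - X) + (t - s) * min (u t - X) 1) \<le> u s - X"
      if "\<bar>l\<bar> \<le> \<Lambda>" "s \<le> t" "ode_sub f l {s..t} u" "X < u t" for l s t u
    proof -
      have "1 * ((u t - X) + (t - s) * min (u t - X) 1) \<le> 1 * ((u t - X) + (t - s) * 1)"
        using that(2) by (intro mult_left_mono add_left_mono) auto
      also have "\<dots> \<le> u s - X" using X[OF _ that(2-4)] that(1) by simp
      finally show ?thesis .
    qed
    then show ?thesis
      by (intro exI[of _ "\<bar>X\<bar>"] allI impI exI[of _ "\<lambda>_. X"] exI[of _ 1] conjI) auto
  qed
  show "\<exists>R. \<forall>l. \<bar>l\<bar> \<le> \<Lambda> \<longrightarrow> (\<exists>B k. k > 0 \<and> (\<forall>t. \<bar>B t\<bar> \<le> R) \<and>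
        (\<forall>s t u. s \<le> t \<longrightarrow> ode_sub f l {s..t} u \<longrightarrow> u s < B s \<longrightarrow>
           k * ((B s - u s) + (t - s) * min (B s - u s) 1) \<le> B t - u t))"
  proof -
    obtain k where k: "k > 0" "\<And>l s t u. s \<le> t \<Longrightarrow> ode_sub f l {s..t} u \<Longrightarrow> u s < bl l s \<Longrightarrow>
     k * ((bl l s - u s) + (t - s) * min (bl l s - u s) 1) \<le> bl l t - u t" using below_bl_escape by blast
    obtain K where K: "\<And>l t. \<bar>l\<bar> \<le> \<Lambda> \<Longrightarrow> \<bar>bl l t\<bar> \<le> K" using bl_bdd[of \<Lambda>] by blast
    show ?thesis
    proof (intro exI[of _ K] allI impI)
      fix l assume "\<bar>l\<bar> \<le> \<Lambda>"
      then show "\<exists>B k. k > 0 \<and> (\<forall>t. \<bar>B t\<bar> \<le> K) \<and>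
        (\<forall>s t u. s \<le> t \<longrightarrow> ode_sub f l {s..t} u \<longrightarrow> u s < B s \<longrightarrow>
           k * ((B s - u s) + (t - s) * min (B s - u s) 1) \<le> B t - u t)"
        using K k by (intro exI[of _ "bl l"] exI[of _ k]) auto
    qed
  qed
  show "\<exists>\<sigma>>0. \<exists>\<gamma>>0. \<exists>D. \<forall>l1 l2 b1 b2 s t. s \<le> t \<longrightarrow> \<bar>l1\<bar> \<le> \<Lambda> \<longrightarrow> \<bar>l2\<bar> \<le> \<Lambda> \<longrightarrow>
        \<bar>l1 - l2\<bar> \<le> \<sigma> \<longrightarrow> ode_sol f l1 {s..t} b1 \<longrightarrow> ode_sol f l2 {s..t} b2 \<longrightarrow>
        (\<forall>r\<in>{s..t}. \<bar>b1 r\<bar> \<le> R \<and> \<bar>b2 r\<bar> \<le> R \<and> \<delta> \<le> b2 r - b1 r) \<longrightarrow>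
        integral {s..t} (\<lambda>r. fx r (b2 r)) \<le> D - \<gamma> * (t - s) \<and> \<gamma> * (t - s) - D \<le> integral {s..t} (\<lambda>r. fx r (b1 r))"
    if "\<delta> > 0" for \<delta> R by (rule separated_solutions_hyperbolic[OF that])
qed

definition "mu0 = Inf {l. \<forall>t. bl l t \<le> 0}"

lemma bl_nonpos: assumes "mu0 \<le> l" shows "bl l t \<le> 0"
proof -
  obtain e0 e1 where e: "0 < e0" "\<And>t. e0 \<le> unit_resp t \<and> unit_resp t \<le> e1" using unit_resp_bounds by blast
  obtain K where K: "\<And>t. \<bar>bl 0 t\<bar> \<le> K" using bl_bdd[of 0] by auto
  have K0: "0 \<le> K" using K[of 0] by linarith
  have up: "0 \<le> (m - l) * unit_resp t" "(m - l) * unit_resp t \<le> (m - l) * e1" if "l \<le> m" for l m t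
  proof -
    have "0 \<le> unit_resp t" using e(1) e(2)[of t] by linarith
    then show "0 \<le> (m - l) * unit_resp t" using that by simp
    show "(m - l) * unit_resp t \<le> (m - l) * e1" using that e(2)[of t] by (intro mult_left_mono) auto
  qed
  have "bl (K / e0) t \<le> 0" for t
  proof -
    have "K = K / e0 * e0" using e by simp
    also have "\<dots> \<le> K / e0 * unit_resp t" using e(1) e(2)[of t] K0 by (intro mult_left_mono) auto
    finally show ?thesis using bl_affine[of "K / e0" t 0] K[of t] by simp
  qed
  then have ne: "{l. \<forall>t. bl l t \<le> 0} \<noteq> {}" by blast
  have "bl mu0 t \<le> 0 + \<epsilon>" if "\<epsilon> > 0" for \<epsilon> :: real
  proof -
    have e1: "0 < e1" using e(1) e(2)[of 0] by linarith
    have "Inf {l. \<forall>t. bl l t \<le> 0} < mu0 + \<epsilon> / e1" using that e1 by (simp add: mu0_def)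
    then obtain m where m: "\<forall>t. bl m t \<le> 0" "m < mu0 + \<epsilon> / e1" using cInf_lessD[OF ne] by blast
    have "bl mu0 t = bl m t + (m - mu0) * unit_resp t" using bl_affine[of mu0 t m] by (simp add: algebra_simps)
    moreover have "(m - mu0) * unit_resp t \<le> \<epsilon>"
    proof (cases "mu0 \<le> m")
      case True
      have "(m - mu0) * e1 \<le> \<epsilon> / e1 * e1" using m(2) e1 by (intro mult_right_mono) auto
      then show ?thesis using up(2)[OF True, of t] e1 by simp
    next
      case False
      then show ?thesis using up(1)[of m mu0 t] that by (simp add: algebra_simps)
    qed
    ultimately show ?thesis using m(1)[rule_format, of t] by linarith
  qed
  then have "bl mu0 t \<le> 0" by (rule field_le_epsilon)
  then show ?thesis using bl_affine[of l t mu0] up(1)[OF assms, of t] by linarith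
qed

lemma bl_bounded_sol: assumes "mu0 \<le> l" shows "bounded_sol (\<lambda>t x. f t x + l) (bl l)"
proof -
  obtain K where K: "\<And>t. \<bar>bl l t\<bar> \<le> K" using bl_bdd[of "\<bar>l\<bar>"] by blast
  have "(bl l has_real_derivative f t (bl l t) + l) (at t)" for t
    using bl_solution[of l t] G_zero[OF bl_nonpos[OF assms, of t], of t] by (simp add: f_def algebra_simps)
  then show ?thesis unfolding bounded_sol_def bounded_iff using K by auto
qed

lemma lam0_less_mu0: "fam.lam0 < mu0"
proof (rule fam.hyperbolic_imp_gt[OF bl_bounded_sol[OF order_refl]])
  have "(\<lambda>r. fx r (bl mu0 r)) = d" using Gx_zero[OF bl_nonpos[OF order_refl]] by (simp add: fx_def)
  then have "fam.repulsive (bl mu0)" unfolding fam.repulsive_def using d_mean by simp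
  then show "fam.attractive (bl mu0) \<or> fam.repulsive (bl mu0)" by blast
qed

lemma lower_sol_eq_bl: assumes "mu0 \<le> l" shows "lower_sol f l t = bl l t"
proof (rule antisym)
  have l: "fam.lam0 \<le> l" using lam0_less_mu0 assms by simp
  show "lower_sol f l t \<le> bl l t" by (rule fam.lo_le[OF l bl_bounded_sol[OF assms]])
  show "bl l t \<le> lower_sol f l t" by (rule bl_le_bounded_sol[OF fam.lo_bsol[OF l]])
qed

end

section \<open>From ergodic measures to single orbits\<close>

lemma compact_parametric_max:
  fixes \<phi> :: "'a::metric_space \<Rightarrow> 'b::metric_space \<Rightarrow> real"
  assumes A: "compact A" and K: "compact K" "K \<noteq> {}" and \<phi>: "continuous_on (A \<times> K) (\<lambda>(x, k). \<phi> x k)"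
  shows "\<exists>\<Phi>. continuous_on A \<Phi> \<and> (\<forall>x\<in>A. (\<forall>k\<in>K. \<phi> x k \<le> \<Phi> x) \<and> (\<exists>k\<in>K. \<Phi> x = \<phi> x k))"
proof -
  have "\<exists>k\<in>K. \<forall>k'\<in>K. \<phi> x k' \<le> \<phi> x k" if "x \<in> A" for x
  proof (rule continuous_attains_sup[OF K])
    have "continuous_on K ((\<lambda>(x, k). \<phi> x k) \<circ> (\<lambda>k. (x, k)))"
      by (intro continuous_on_compose continuous_intros continuous_on_subset[OF \<phi>]) (use that in auto)
    then show "continuous_on K (\<phi> x)" by (simp add: o_def)
  qed
  then obtain k where k: "\<And>x. x \<in> A \<Longrightarrow> k x \<in> K" "\<And>x k'. x \<in> A \<Longrightarrow> k' \<in> K \<Longrightarrow> \<phi> x k' \<le> \<phi> x (k x)" by metis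
  have "uniformly_continuous_on (A \<times> K) (\<lambda>(x, k). \<phi> x k)"
    by (intro compact_uniformly_continuous \<phi> compact_Times A K)
  note uc = this[unfolded uniformly_continuous_on_def, rule_format]
  have "continuous_on A (\<lambda>x. \<phi> x (k x))"
    unfolding continuous_on_iff
  proof (intro ballI allI impI)
    fix x and e :: real assume x: "x \<in> A" and e: "0 < e"
    then obtain \<delta> where \<delta>: "\<delta> > 0" "\<And>p p'. p \<in> A \<times> K \<Longrightarrow> p' \<in> A \<times> K \<Longrightarrow> dist p' p < \<delta> \<Longrightarrow>
       dist ((\<lambda>(x, k). \<phi> x k) p') ((\<lambda>(x, k). \<phi> x k) p) < e" using uc[OF e] by blast
    have near: "\<bar>\<phi> x' j - \<phi> x j\<bar> < e" if "x' \<in> A" "dist x' x < \<delta>" "j \<in> K" for x' j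
      using \<delta>(2)[of "(x, j)" "(x', j)"] that x by (simp add: dist_Pair_Pair dist_real_def)
    show "\<exists>\<delta>>0. \<forall>x'\<in>A. dist x' x < \<delta> \<longrightarrow> dist (\<phi> x' (k x')) (\<phi> x (k x)) < e"
    proof (intro exI[of _ \<delta>] conjI \<delta>(1) ballI impI)
      fix x' assume x': "x' \<in> A" "dist x' x < \<delta>"
      show "dist (\<phi> x' (k x')) (\<phi> x (k x)) < e"
        using near[OF x' k(1)[OF x]] near[OF x' k(1)[OF x'(1)]] k(2)[OF x k(1)[OF x'(1)]] k(2)[OF x'(1) k(1)[OF x]]
        unfolding dist_real_def by linarith
    qed
  qed
  then show ?thesis using k by (intro exI[of _ "\<lambda>x. \<phi> x (k x)"]) auto
qed

lemma concave_imp_deriv_antimono: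
  assumes cv: "concave_on UNIV f" and der: "\<And>x. (f has_real_derivative f' x) (at x)" and xy: "x \<le> y"
  shows "f' y \<le> f' x"
proof (cases "x = y")
  case False
  have cx: "convex_on UNIV (\<lambda>x. - f x)" using cv unfolding concave_on_def .
  have tangent: "- f' u * (v - u) \<le> - f v - - f u" for u v
    by (rule convex_on_imp_above_tangent[OF cx]) (auto intro!: derivative_eq_intros der)
  have "(f' y - f' x) * (y - x) \<le> 0" using tangent[of x y] tangent[of y x] by (simp add: algebra_simps)
  then show ?thesis using xy False by (simp add: mult_le_0_iff)
qed simp

locale flow_family = compact_flow \<Omega> flw for \<Omega> :: "'w::metric_space set" and flw +
  fixes c d :: "'w \<Rightarrow> real" and g :: "'w \<Rightarrow> real \<Rightarrow> real"
  assumes hyps: "hyps_l \<Omega> flw c d g"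
begin

lemma c_cont: "continuous_on \<Omega> c" and d_cont: "continuous_on \<Omega> d"
  and g_cont: "continuous_on (\<Omega> \<times> UNIV) (\<lambda>(\<omega>, x). g \<omega> x)"
  and g_der: "\<And>\<omega> x. \<omega> \<in> \<Omega> \<Longrightarrow> (g \<omega> has_real_derivative deriv (g \<omega>) x) (at x)"
  and gx_cont: "continuous_on (\<Omega> \<times> UNIV) (\<lambda>(\<omega>, x). deriv (g \<omega>) x)"
  and d_pos: "\<And>m. m \<in> erg_measures \<Omega> flw \<Longrightarrow> integral\<^sup>L m d > 0"
  and coercive: "\<And>M. \<exists>X. \<forall>\<omega>\<in>\<Omega>. \<forall>x\<ge>X. d \<omega> * x + g \<omega> x \<le> M"
  and g_nonpos: "\<And>\<omega> x. \<omega> \<in> \<Omega> \<Longrightarrow> g \<omega> x \<le> 0" and g_zero: "\<And>\<omega> x. \<omega> \<in> \<Omega> \<Longrightarrow> x \<le> 0 \<Longrightarrow> g \<omega> x = 0"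
  and g_neg: "\<And>m. m \<in> erg_measures \<Omega> flw \<Longrightarrow> measure m {\<omega>\<in>\<Omega>. \<forall>x>0. g \<omega> x < 0} = 1"
  and g_concave: "\<And>m. m \<in> erg_measures \<Omega> flw \<Longrightarrow> measure m {\<omega>\<in>\<Omega>. concave_on UNIV (g \<omega>)} = 1"
  and g_strict: "\<And>m a b. m \<in> erg_measures \<Omega> flw \<Longrightarrow> 0 \<le> a \<Longrightarrow> a \<le> b \<Longrightarrow>
        measure m {\<omega>\<in>\<Omega>. \<forall>x\<in>{a..b}. \<forall>y\<in>{a..b}. x < y \<longrightarrow> deriv (g \<omega>) y < deriv (g \<omega>) x} > 0"
  using hyps unfolding hyps_l_def C01_def by blast+

lemma erg_prob: "m \<in> erg_measures \<Omega> flw \<Longrightarrow> prob_space m" and erg_space: "m \<in> erg_measures \<Omega> flw \<Longrightarrow> space m = \<Omega>"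
  and erg_sets: "m \<in> erg_measures \<Omega> flw \<Longrightarrow> sets m = sets (restrict_space borel \<Omega>)"
  unfolding erg_measures_def inv_measures_def by auto

lemma erg_integrable:
  fixes h :: "'w \<Rightarrow> real"
  assumes m: "m \<in> erg_measures \<Omega> flw" and h: "continuous_on \<Omega> h"
  shows "integrable m h"
proof -
  interpret prob_space m by (rule erg_prob[OF m])
  have hm: "h \<in> borel_measurable m"
    unfolding measurable_cong_sets[OF erg_sets[OF m] refl] by (rule borel_measurable_continuous_on_restrict[OF h])
  obtain B where B: "\<And>\<omega>. \<omega> \<in> \<Omega> \<Longrightarrow> \<bar>h \<omega>\<bar> \<le> B" using cont_bounded[OF h] by blast
  show ?thesis
    by (rule integrable_const_bound[OF AE_I2 hm, of B]) (use B erg_space[OF m] in auto)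
qed

lemma curve_along_orbit:
  assumes \<omega>: "\<omega> \<in> \<Omega>" and h: "continuous_on \<Omega> h" shows "continuous_on UNIV (\<lambda>t. h (flw t \<omega>))"
  by (rule continuous_on_compose2[OF h orbit_cont[OF \<omega>]]) (use flw_in[OF \<omega>] in auto)

lemma field_along_orbit:
  fixes h :: "'w \<Rightarrow> real \<Rightarrow> real"
  assumes \<omega>: "\<omega> \<in> \<Omega>" and h: "continuous_on (\<Omega> \<times> UNIV) (\<lambda>(\<omega>, x). h \<omega> x)"
  shows "continuous_on UNIV (\<lambda>(t, x). h (flw t \<omega>) x)"
proof -
  have "continuous_on UNIV ((\<lambda>(\<omega>, x). h \<omega> x) \<circ> (\<lambda>p. (flw (fst p) \<omega>, snd p)))"
  proof (intro continuous_on_compose continuous_on_Pair continuous_on_snd continuous_on_id)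
    show "continuous_on UNIV (\<lambda>p :: real \<times> real. flw (fst p) \<omega>)"
      by (rule continuous_on_compose2[OF orbit_cont[OF \<omega>, of UNIV]]) (auto intro: continuous_intros)
    show "continuous_on ((\<lambda>p :: real \<times> real. (flw (fst p) \<omega>, snd p)) ` UNIV) (\<lambda>(\<omega>, x). h \<omega> x)"
      by (rule continuous_on_subset[OF h]) (use flw_in[OF \<omega>] in auto)
  qed
  then show ?thesis by (simp add: o_def case_prod_unfold)
qed

lemma field_bounded:
  fixes h :: "'w \<Rightarrow> real \<Rightarrow> real"
  assumes h: "continuous_on (\<Omega> \<times> UNIV) (\<lambda>(\<omega>, x). h \<omega> x)"
  shows "\<exists>M. \<forall>\<omega>\<in>\<Omega>. \<forall>x. \<bar>x\<bar> \<le> R \<longrightarrow> \<bar>h \<omega> x\<bar> \<le> M"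
proof -
  have "compact ((\<lambda>(\<omega>, x). h \<omega> x) ` (\<Omega> \<times> {-R..R}))"
    by (intro compact_continuous_image continuous_on_subset[OF h] compact_Times comp compact_Icc) auto
  then have "bounded ((\<lambda>(\<omega>, x). h \<omega> x) ` (\<Omega> \<times> {-R..R}))" by (rule compact_imp_bounded)
  then obtain M where M: "\<forall>y\<in>(\<lambda>(\<omega>, x). h \<omega> x) ` (\<Omega> \<times> {-R..R}). norm y \<le> M" unfolding bounded_iff ..
  show ?thesis
  proof (intro exI[of _ M] ballI allI impI)
    fix \<omega> x assume "\<omega> \<in> \<Omega>" "\<bar>x\<bar> \<le> R"
    then have "(\<omega>, x) \<in> \<Omega> \<times> {-R..R}" by auto
    from bspec[OF M imageI[OF this]] show "\<bar>h \<omega> x\<bar> \<le> M" by simp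
  qed
qed

lemma field_uniform:
  fixes h :: "'w \<Rightarrow> real \<Rightarrow> real"
  assumes h: "continuous_on (\<Omega> \<times> UNIV) (\<lambda>(\<omega>, x). h \<omega> x)" and e: "e > 0"
  shows "\<exists>\<delta>>0. \<forall>\<omega>\<in>\<Omega>. \<forall>x y. \<bar>x\<bar> \<le> R \<longrightarrow> \<bar>y\<bar> \<le> R \<longrightarrow> \<bar>x - y\<bar> < \<delta> \<longrightarrow> \<bar>h \<omega> x - h \<omega> y\<bar> \<le> e"
proof -
  have "uniformly_continuous_on (\<Omega> \<times> {-R..R}) (\<lambda>(\<omega>, x). h \<omega> x)"
    by (intro compact_uniformly_continuous continuous_on_subset[OF h] compact_Times comp compact_Icc) auto
  from this[unfolded uniformly_continuous_on_def, rule_format, OF e]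
  obtain \<delta> where \<delta>: "\<delta> > 0" "\<And>p p'. p \<in> \<Omega> \<times> {-R..R} \<Longrightarrow> p' \<in> \<Omega> \<times> {-R..R} \<Longrightarrow> dist p' p < \<delta> \<Longrightarrow>
       dist ((\<lambda>(\<omega>, x). h \<omega> x) p') ((\<lambda>(\<omega>, x). h \<omega> x) p) < e" by blast
  have "\<bar>h \<omega> x - h \<omega> y\<bar> \<le> e" if "\<omega> \<in> \<Omega>" "\<bar>x\<bar> \<le> R" "\<bar>y\<bar> \<le> R" "\<bar>x - y\<bar> < \<delta>" for \<omega> x y
  proof -
    have "dist ((\<lambda>(\<omega>, x). h \<omega> x) (\<omega>, x)) ((\<lambda>(\<omega>, x). h \<omega> x) (\<omega>, y)) < e"
      by (rule \<delta>(2)) (use that in \<open>auto simp: dist_Pair_Pair dist_real_def\<close>)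
    then show ?thesis by (simp add: dist_real_def)
  qed
  then show ?thesis using \<delta>(1) by blast
qed

lemma gx_zero: assumes \<omega>: "\<omega> \<in> \<Omega>" and x: "x \<le> 0" shows "deriv (g \<omega>) x = 0"
  by (rule DERIV_local_max[OF g_der[OF \<omega>], of 1]) (use g_nonpos[OF \<omega>] g_zero[OF \<omega> x] in auto)

lemma gx_pair_cont: "continuous_on (\<Omega> \<times> K) (\<lambda>(\<omega>, p). deriv (g \<omega>) (snd p) - deriv (g \<omega>) (fst p))"
proof -
  have *: "continuous_on (\<Omega> \<times> K) ((\<lambda>(\<omega>, x). deriv (g \<omega>) x) \<circ> (\<lambda>q. (fst q, \<pi> (snd q))))"
    if "continuous_on UNIV \<pi>" for \<pi> :: "real \<times> real \<Rightarrow> real"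
    by (intro continuous_on_compose continuous_on_Pair continuous_on_fst continuous_on_id continuous_on_subset[OF gx_cont]
        continuous_on_compose2[OF that]) (auto intro: continuous_intros)
  have "continuous_on (\<Omega> \<times> K) (\<lambda>q. deriv (g (fst q)) (snd (snd q)) - deriv (g (fst q)) (fst (snd q)))"
    using continuous_on_diff[OF *[of snd] *[of fst]] by (simp add: o_def continuous_on_snd continuous_on_fst)
  then show ?thesis by (simp add: case_prod_unfold)
qed

lemma mean_d: "\<exists>\<gamma>>0. \<exists>D. \<forall>\<omega>\<in>\<Omega>. \<forall>s t. s \<le> t \<longrightarrow> \<gamma> * (t - s) - D \<le> integral {s..t} (\<lambda>r. d (flw r \<omega>))"
proof -
  have "\<exists>n::nat. \<exists>K D. K < 0 \<and> (\<forall>\<omega>\<in>\<Omega>. \<forall>s t. s \<le> t \<longrightarrow> integral {s..t} (\<lambda>r. - d (flw r \<omega>)) \<le> K * (t - s) + D)"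
    by (rule uniform_time_average[of "\<lambda>n \<omega>. - d \<omega>"]) (use d_cont d_pos in \<open>auto intro: continuous_intros\<close>)
  then obtain K D where K: "K < 0" "\<And>\<omega> s t. \<omega> \<in> \<Omega> \<Longrightarrow> s \<le> t \<Longrightarrow> integral {s..t} (\<lambda>r. - d (flw r \<omega>)) \<le> K * (t - s) + D"
    by blast
  have "- K * (t - s) - D \<le> integral {s..t} (\<lambda>r. d (flw r \<omega>))" if "\<omega> \<in> \<Omega>" "s \<le> t" for \<omega> s t
    using K(2)[OF that] by simp
  then show ?thesis using K(1) by (intro exI[of _ "- K"]) auto
qed

lemma compact_pairs: "compact {p :: real \<times> real. a \<le> fst p \<and> fst p + \<eta> \<le> snd p \<and> snd p \<le> b}"
proof -
  have "closed {p :: real \<times> real. a \<le> fst p \<and> fst p + \<eta> \<le> snd p \<and> snd p \<le> b}"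
    by (intro closed_Collect_conj closed_Collect_le continuous_intros)
  moreover have "{p :: real \<times> real. a \<le> fst p \<and> fst p + \<eta> \<le> snd p \<and> snd p \<le> b} \<subseteq> {a..b - \<eta>} \<times> {a + \<eta>..b}" by auto
  moreover have "bounded ({a..b - \<eta>} \<times> {a + \<eta>..b})"
    by (intro compact_imp_bounded compact_Times compact_Icc)
  ultimately show ?thesis unfolding compact_eq_bounded_closed by (blast intro: bounded_subset)
qed

lemma mean_concave:
  assumes e: "e > 0"
  shows "\<exists>\<Phi> D. continuous_on \<Omega> \<Phi> \<and> (\<forall>\<omega>\<in>\<Omega>. \<forall>s t. s \<le> t \<longrightarrow> integral {s..t} (\<lambda>r. \<Phi> (flw r \<omega>)) \<le> e * (t - s) + D) \<and>
     (\<forall>\<omega>\<in>\<Omega>. \<forall>x y. - R \<le> x \<longrightarrow> x \<le> y \<longrightarrow> y \<le> R \<longrightarrow> deriv (g \<omega>) y - deriv (g \<omega>) x \<le> \<Phi> \<omega>)"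
proof (cases "0 \<le> R")
  case False
  have "\<forall>\<omega>\<in>\<Omega>. \<forall>x y. - R \<le> x \<longrightarrow> x \<le> y \<longrightarrow> y \<le> R \<longrightarrow> deriv (g \<omega>) y - deriv (g \<omega>) x \<le> 0"
  proof (intro ballI allI impI)
    fix \<omega> and x y :: real assume "- R \<le> x" "x \<le> y" "y \<le> R"
    then have False using False by linarith
    then show "deriv (g \<omega>) y - deriv (g \<omega>) x \<le> 0" ..
  qed
  then show ?thesis using e by (intro exI[of _ "\<lambda>_. 0"] exI[of _ 0]) auto
next
  case True
  define K where "K = {p :: real \<times> real. - R \<le> fst p \<and> fst p + 0 \<le> snd p \<and> snd p \<le> R}"
  have K: "compact K" "(0, 0) \<in> K" using compact_pairs[of "- R" 0 R] True by (auto simp: K_def)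
  from compact_parametric_max[OF comp K(1) _ gx_pair_cont] K(2)
  obtain \<Phi> where \<Phi>: "continuous_on \<Omega> \<Phi>" "\<And>\<omega> p. \<omega> \<in> \<Omega> \<Longrightarrow> p \<in> K \<Longrightarrow> deriv (g \<omega>) (snd p) - deriv (g \<omega>) (fst p) \<le> \<Phi> \<omega>"
     "\<And>\<omega>. \<omega> \<in> \<Omega> \<Longrightarrow> \<exists>p\<in>K. \<Phi> \<omega> = deriv (g \<omega>) (snd p) - deriv (g \<omega>) (fst p)" by blast
  have zero: "\<Phi> \<omega> = 0" if \<omega>: "\<omega> \<in> \<Omega>" "concave_on UNIV (g \<omega>)" for \<omega>
  proof (rule antisym)
    obtain p where p: "p \<in> K" "\<Phi> \<omega> = deriv (g \<omega>) (snd p) - deriv (g \<omega>) (fst p)" using \<Phi>(3)[OF \<omega>(1)] by blast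
    have "deriv (g \<omega>) (snd p) \<le> deriv (g \<omega>) (fst p)"
      by (rule concave_imp_deriv_antimono[OF \<omega>(2) g_der[OF \<omega>(1)]]) (use p(1) in \<open>simp add: K_def\<close>)
    then show "\<Phi> \<omega> \<le> 0" using p(2) by simp
    show "0 \<le> \<Phi> \<omega>" using \<Phi>(2)[OF \<omega>(1) K(2)] by simp
  qed
  have "\<exists>n::nat. \<exists>K D. K < e \<and> (\<forall>\<omega>\<in>\<Omega>. \<forall>s t. s \<le> t \<longrightarrow> integral {s..t} (\<lambda>r. \<Phi> (flw r \<omega>)) \<le> K * (t - s) + D)"
  proof (rule uniform_time_average[of "\<lambda>n. \<Phi>"])
    show "continuous_on \<Omega> \<Phi>" by (rule \<Phi>(1))
    fix m assume m: "m \<in> erg_measures \<Omega> flw"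
    interpret prob_space m by (rule erg_prob[OF m])
    have "AE \<omega> in m. \<Phi> \<omega> = 0" using AE_prob_1[OF g_concave[OF m]] by eventually_elim (use zero in blast)
    then have "integral\<^sup>L m \<Phi> = 0" by (rule integral_eq_zero_AE)
    then show "\<exists>n::nat. integral\<^sup>L m \<Phi> < e" using e by simp
  qed simp
  then obtain k D where k: "k < e" "\<And>\<omega> s t. \<omega> \<in> \<Omega> \<Longrightarrow> s \<le> t \<Longrightarrow> integral {s..t} (\<lambda>r. \<Phi> (flw r \<omega>)) \<le> k * (t - s) + D" by blast
  have "integral {s..t} (\<lambda>r. \<Phi> (flw r \<omega>)) \<le> e * (t - s) + D" if "\<omega> \<in> \<Omega>" "s \<le> t" for \<omega> s t
  proof -
    have "k * (t - s) \<le> e * (t - s)" using k(1) that(2) by (intro mult_right_mono) auto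
    then show ?thesis using k(2)[OF that] by linarith
  qed
  moreover have "deriv (g \<omega>) y - deriv (g \<omega>) x \<le> \<Phi> \<omega>" if "\<omega> \<in> \<Omega>" "- R \<le> x" "x \<le> y" "y \<le> R" for \<omega> x y
    using \<Phi>(2)[OF that(1), of "(x, y)"] that by (simp add: K_def)
  ultimately show ?thesis using \<Phi>(1) by blast
qed

lemma mean_strict:
  assumes \<eta>: "0 < \<eta>" "\<eta> \<le> R"
  shows "\<exists>q \<gamma> D. \<gamma> > 0 \<and> continuous_on \<Omega> q \<and> (\<forall>\<omega>\<in>\<Omega>. 0 \<le> q \<omega>) \<and>
       (\<forall>\<omega>\<in>\<Omega>. \<forall>s t. s \<le> t \<longrightarrow> \<gamma> * (t - s) - D \<le> integral {s..t} (\<lambda>r. q (flw r \<omega>))) \<and>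
       (\<forall>\<omega>\<in>\<Omega>. \<forall>x y. 0 \<le> x \<longrightarrow> x + \<eta> \<le> y \<longrightarrow> y \<le> R \<longrightarrow> 0 < q \<omega> \<longrightarrow> q \<omega> \<le> deriv (g \<omega>) x - deriv (g \<omega>) y)"
proof -
  define K where "K = {p :: real \<times> real. 0 \<le> fst p \<and> fst p + \<eta> \<le> snd p \<and> snd p \<le> R}"
  have K: "compact K" "(0, \<eta>) \<in> K" using compact_pairs[of 0 \<eta> R] \<eta> by (auto simp: K_def)
  from compact_parametric_max[OF comp K(1) _ gx_pair_cont] K(2)
  obtain \<Phi> where \<Phi>: "continuous_on \<Omega> \<Phi>" "\<And>\<omega> p. \<omega> \<in> \<Omega> \<Longrightarrow> p \<in> K \<Longrightarrow> deriv (g \<omega>) (snd p) - deriv (g \<omega>) (fst p) \<le> \<Phi> \<omega>"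
     "\<And>\<omega>. \<omega> \<in> \<Omega> \<Longrightarrow> \<exists>p\<in>K. \<Phi> \<omega> = deriv (g \<omega>) (snd p) - deriv (g \<omega>) (fst p)" by blast
  define q where "q \<omega> = max 0 (- \<Phi> \<omega>)" for \<omega>
  have qc: "continuous_on \<Omega> q" unfolding q_def by (intro continuous_intros \<Phi>(1))
  have q0: "0 \<le> q \<omega>" for \<omega> by (simp add: q_def)
  have "\<exists>n::nat. \<exists>K D. K < 0 \<and> (\<forall>\<omega>\<in>\<Omega>. \<forall>s t. s \<le> t \<longrightarrow> integral {s..t} (\<lambda>r. - q (flw r \<omega>)) \<le> K * (t - s) + D)"
  proof (rule uniform_time_average[of "\<lambda>n \<omega>. - q \<omega>"])
    show "continuous_on \<Omega> (\<lambda>\<omega>. - q \<omega>)" by (intro continuous_intros qc)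
    fix m assume m: "m \<in> erg_measures \<Omega> flw"
    interpret prob_space m by (rule erg_prob[OF m])
    define S where "S = {\<omega>\<in>\<Omega>. \<forall>x\<in>{0..R}. \<forall>y\<in>{0..R}. x < y \<longrightarrow> deriv (g \<omega>) y < deriv (g \<omega>) x}"
    have S: "measure m S > 0" unfolding S_def by (rule g_strict[OF m]) (use \<eta> in auto)
    then have Sm: "S \<in> sets m" using measure_notin_sets by force
    have pos: "0 < q \<omega>" if "\<omega> \<in> S" for \<omega>
    proof -
      have \<omega>: "\<omega> \<in> \<Omega>" using that by (simp add: S_def)
      obtain p where p: "p \<in> K" "\<Phi> \<omega> = deriv (g \<omega>) (snd p) - deriv (g \<omega>) (fst p)" using \<Phi>(3)[OF \<omega>] by blast
      have "fst p \<in> {0..R}" "snd p \<in> {0..R}" "fst p < snd p" using p(1) \<eta> by (auto simp: K_def)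
      then have "deriv (g \<omega>) (snd p) < deriv (g \<omega>) (fst p)" using that by (simp add: S_def)
      then show ?thesis using p(2) by (simp add: q_def)
    qed
    have qi: "integrable m q" by (rule erg_integrable[OF m qc])
    have "integral\<^sup>L m q \<noteq> 0"
    proof
      assume "integral\<^sup>L m q = 0"
      then have "AE \<omega> in m. q \<omega> = 0" using integral_nonneg_eq_0_iff_AE[OF qi] q0 by simp
      then have "AE \<omega> in m. \<omega> \<notin> S" by eventually_elim (use pos in force)
      then have "S \<in> null_sets m" using AE_iff_null_sets[OF Sm] by simp
      then show False using S by (simp add: measure_def null_setsD1)
    qed
    moreover have "0 \<le> integral\<^sup>L m q" using q0 by simp
    ultimately show "\<exists>n::nat. integral\<^sup>L m (\<lambda>\<omega>. - q \<omega>) < 0" by simp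
  qed simp
  then obtain k D where k: "k < 0" "\<And>\<omega> s t. \<omega> \<in> \<Omega> \<Longrightarrow> s \<le> t \<Longrightarrow> integral {s..t} (\<lambda>r. - q (flw r \<omega>)) \<le> k * (t - s) + D" by blast
  have "- k * (t - s) - D \<le> integral {s..t} (\<lambda>r. q (flw r \<omega>))" if "\<omega> \<in> \<Omega>" "s \<le> t" for \<omega> s t
    using k(2)[OF that] by simp
  moreover have "q \<omega> \<le> deriv (g \<omega>) x - deriv (g \<omega>) y" if "\<omega> \<in> \<Omega>" "0 \<le> x" "x + \<eta> \<le> y" "y \<le> R" "0 < q \<omega>" for \<omega> x y
    using \<Phi>(2)[OF that(1), of "(x, y)"] that by (simp add: K_def q_def max_def split: if_splits)
  ultimately show ?thesis using qc q0 k(1) by (intro exI[of _ q] exI[of _ "- k"] exI[of _ D]) auto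
qed

lemma mean_negative:
  assumes \<eta>: "0 < \<eta>" "\<eta> \<le> R" and e: "0 < e"
  shows "\<exists>p n D. n > 0 \<and> continuous_on \<Omega> p \<and> (\<forall>\<omega>\<in>\<Omega>. 0 \<le> p \<omega>) \<and>
       (\<forall>\<omega>\<in>\<Omega>. \<forall>s t. s \<le> t \<longrightarrow> integral {s..t} (\<lambda>r. p (flw r \<omega>)) \<le> e * (t - s) + D) \<and>
       (\<forall>\<omega>\<in>\<Omega>. \<forall>x. \<eta> \<le> x \<longrightarrow> x \<le> R \<longrightarrow> 1 - p \<omega> \<le> n * (- g \<omega> x))"
proof -
  have "{\<eta>..R} \<noteq> {}" "continuous_on (\<Omega> \<times> {\<eta>..R}) (\<lambda>(\<omega>, x). g \<omega> x)"
    using \<eta> by (auto intro: continuous_on_subset[OF g_cont])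
  from compact_parametric_max[OF comp compact_Icc this]
  obtain \<Phi> where \<Phi>: "continuous_on \<Omega> \<Phi>" "\<And>\<omega> x. \<omega> \<in> \<Omega> \<Longrightarrow> x \<in> {\<eta>..R} \<Longrightarrow> g \<omega> x \<le> \<Phi> \<omega>"
     "\<And>\<omega>. \<omega> \<in> \<Omega> \<Longrightarrow> \<exists>x\<in>{\<eta>..R}. \<Phi> \<omega> = g \<omega> x" by blast
  have \<Phi>0: "\<Phi> \<omega> \<le> 0" if "\<omega> \<in> \<Omega>" for \<omega> using \<Phi>(3)[OF that] g_nonpos[OF that] by auto
  define H where "H n \<omega> = 1 - min 1 (real (Suc n) * (- \<Phi> \<omega>))" for n \<omega>
  have Hc: "continuous_on \<Omega> (H n)" for n unfolding H_def by (intro continuous_intros \<Phi>(1))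
  have H01: "0 \<le> H n \<omega>" "\<omega> \<in> \<Omega> \<Longrightarrow> H n \<omega> \<le> 1" for n \<omega>
  proof -
    show "0 \<le> H n \<omega>" by (simp add: H_def)
    assume "\<omega> \<in> \<Omega>"
    then have "0 \<le> real (Suc n) * (- \<Phi> \<omega>)" using \<Phi>0 by (intro mult_nonneg_nonneg) auto
    then show "H n \<omega> \<le> 1" unfolding H_def by simp
  qed
  have "\<exists>n k D. k < e \<and> (\<forall>\<omega>\<in>\<Omega>. \<forall>s t. s \<le> t \<longrightarrow> integral {s..t} (\<lambda>r. H n (flw r \<omega>)) \<le> k * (t - s) + D)"
  proof (rule uniform_time_average[of H, OF Hc])
    show "H k \<omega> \<le> H n \<omega>" if "n \<le> k" "\<omega> \<in> \<Omega>" for n k \<omega>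
    proof -
      have "real (Suc n) * (- \<Phi> \<omega>) \<le> real (Suc k) * (- \<Phi> \<omega>)" using that \<Phi>0 by (intro mult_right_mono) auto
      then have "min 1 (real (Suc n) * (- \<Phi> \<omega>)) \<le> min 1 (real (Suc k) * (- \<Phi> \<omega>))" by (rule min.mono[OF order_refl])
      then show ?thesis unfolding H_def by simp
    qed
    fix m assume m: "m \<in> erg_measures \<Omega> flw"
    interpret prob_space m by (rule erg_prob[OF m])
    have "(\<lambda>n. integral\<^sup>L m (H n)) \<longlonglongrightarrow> integral\<^sup>L m (\<lambda>_. 0)"
    proof (rule integral_dominated_convergence[where w = "\<lambda>_. 1"])
      show "H n \<in> borel_measurable m" for n using erg_integrable[OF m Hc] by (rule borel_measurable_integrable)
      show "AE \<omega> in m. norm (H n \<omega>) \<le> 1" for n using H01 erg_space[OF m] by (intro AE_I2) auto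
      show "AE \<omega> in m. (\<lambda>n. H n \<omega>) \<longlonglongrightarrow> 0"
        using AE_prob_1[OF g_neg[OF m]]
      proof eventually_elim
        case (elim \<omega>)
        then have \<omega>: "\<omega> \<in> \<Omega>" "\<forall>x>0. g \<omega> x < 0" by auto
        obtain x where "x \<in> {\<eta>..R}" "\<Phi> \<omega> = g \<omega> x" using \<Phi>(3)[OF \<omega>(1)] by blast
        then have neg: "0 < - \<Phi> \<omega>" using \<omega>(2) \<eta> by auto
        obtain N where N: "1 < real N * (- \<Phi> \<omega>)" using reals_Archimedean3[OF neg] by blast
        have "H n \<omega> = 0" if "n \<ge> N" for n
        proof -
          have "real N * (- \<Phi> \<omega>) \<le> real (Suc n) * (- \<Phi> \<omega>)" using that neg by (intro mult_right_mono) auto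
          then show ?thesis using N unfolding H_def by simp
        qed
        then have "\<forall>\<^sub>F n in sequentially. H n \<omega> = 0" unfolding eventually_sequentially by blast
        then show ?case by (rule tendsto_eventually)
      qed
    qed simp_all
    then have "(\<lambda>n. integral\<^sup>L m (H n)) \<longlonglongrightarrow> 0" by simp
    from order_tendstoD(2)[OF this e] show "\<exists>n. integral\<^sup>L m (H n) < e" unfolding eventually_sequentially by blast
  qed
  then obtain n k D where k: "k < e" "\<And>\<omega> s t. \<omega> \<in> \<Omega> \<Longrightarrow> s \<le> t \<Longrightarrow> integral {s..t} (\<lambda>r. H n (flw r \<omega>)) \<le> k * (t - s) + D" by blast
  have "integral {s..t} (\<lambda>r. H n (flw r \<omega>)) \<le> e * (t - s) + D" if "\<omega> \<in> \<Omega>" "s \<le> t" for \<omega> s t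
  proof -
    have "k * (t - s) \<le> e * (t - s)" using k(1) that(2) by (intro mult_right_mono) auto
    then show ?thesis using k(2)[OF that] by linarith
  qed
  moreover have "1 - H n \<omega> \<le> real (Suc n) * (- g \<omega> x)" if "\<omega> \<in> \<Omega>" "\<eta> \<le> x" "x \<le> R" for \<omega> x
  proof -
    have "real (Suc n) * (- \<Phi> \<omega>) \<le> real (Suc n) * (- g \<omega> x)" using \<Phi>(2)[OF that(1), of x] that by (intro mult_left_mono) auto
    then show ?thesis unfolding H_def by linarith
  qed
  ultimately show ?thesis using Hc H01(1) by (intro exI[of _ "H n"] exI[of _ "real (Suc n)"] exI[of _ D]) auto
qed

lemma concave_orbit:
  assumes \<omega>: "\<omega> \<in> \<Omega>"
  shows "concave_orbit (\<lambda>t. c (flw t \<omega>)) (\<lambda>t. d (flw t \<omega>)) (\<lambda>t. g (flw t \<omega>)) (\<lambda>t. deriv (g (flw t \<omega>)))"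
proof
  note in\<Omega> = flw_in[OF \<omega>]
  show "continuous_on UNIV (\<lambda>t. c (flw t \<omega>))" "continuous_on UNIV (\<lambda>t. d (flw t \<omega>))"
    by (rule curve_along_orbit[OF \<omega> c_cont] curve_along_orbit[OF \<omega> d_cont])+
  show "continuous_on UNIV (\<lambda>(t, x). g (flw t \<omega>) x)" by (rule field_along_orbit[OF \<omega> g_cont])
  show "continuous_on UNIV (\<lambda>(t, x). deriv (g (flw t \<omega>)) x)" by (rule field_along_orbit[OF \<omega> gx_cont])
  show "(g (flw t \<omega>) has_real_derivative deriv (g (flw t \<omega>)) x) (at x)" for t x by (rule g_der[OF in\<Omega>])
  show "g (flw t \<omega>) x \<le> 0" for t x by (rule g_nonpos[OF in\<Omega>])
  show "g (flw t \<omega>) x = 0" if "x \<le> 0" for t x by (rule g_zero[OF in\<Omega> that])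
  show "deriv (g (flw t \<omega>)) x = 0" if "x \<le> 0" for t x by (rule gx_zero[OF in\<Omega> that])
  obtain B1 where B1: "\<And>\<omega>. \<omega> \<in> \<Omega> \<Longrightarrow> \<bar>c \<omega>\<bar> \<le> B1" using cont_bounded[OF c_cont] by blast
  obtain B2 where B2: "\<And>\<omega>. \<omega> \<in> \<Omega> \<Longrightarrow> \<bar>d \<omega>\<bar> \<le> B2" using cont_bounded[OF d_cont] by blast
  show "\<exists>M. \<forall>t. \<bar>c (flw t \<omega>)\<bar> \<le> M \<and> \<bar>d (flw t \<omega>)\<bar> \<le> M"
    using B1[OF in\<Omega>] B2[OF in\<Omega>] by (intro exI[of _ "max B1 B2"]) (simp add: le_max_iff_disj)
  show "\<exists>M. \<forall>t x. \<bar>x\<bar> \<le> R \<longrightarrow> \<bar>g (flw t \<omega>) x\<bar> \<le> M \<and> \<bar>deriv (g (flw t \<omega>)) x\<bar> \<le> M" for R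
  proof -
    obtain M1 where M1: "\<And>\<omega> x. \<omega> \<in> \<Omega> \<Longrightarrow> \<bar>x\<bar> \<le> R \<Longrightarrow> \<bar>g \<omega> x\<bar> \<le> M1" using field_bounded[OF g_cont] by blast
    obtain M2 where M2: "\<And>\<omega> x. \<omega> \<in> \<Omega> \<Longrightarrow> \<bar>x\<bar> \<le> R \<Longrightarrow> \<bar>deriv (g \<omega>) x\<bar> \<le> M2" using field_bounded[OF gx_cont] by blast
    show ?thesis using M1[OF in\<Omega>] M2[OF in\<Omega>] by (intro exI[of _ "max M1 M2"]) (simp add: le_max_iff_disj)
  qed
  show "\<exists>\<delta>>0. \<forall>t x y. \<bar>x\<bar> \<le> R \<longrightarrow> \<bar>y\<bar> \<le> R \<longrightarrow> \<bar>x - y\<bar> < \<delta> \<longrightarrow>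
      \<bar>deriv (g (flw t \<omega>)) x - deriv (g (flw t \<omega>)) y\<bar> \<le> e" if e: "e > 0" for R e
  proof -
    obtain \<delta> where "\<delta> > 0" "\<forall>\<omega>\<in>\<Omega>. \<forall>x y. \<bar>x\<bar> \<le> R \<longrightarrow> \<bar>y\<bar> \<le> R \<longrightarrow> \<bar>x - y\<bar> < \<delta> \<longrightarrow> \<bar>deriv (g \<omega>) x - deriv (g \<omega>) y\<bar> \<le> e"
      using field_uniform[OF gx_cont e, of R] by blast
    then show ?thesis using in\<Omega> by (intro exI[of _ \<delta>]) blast
  qed
  show "\<exists>X. \<forall>t x. X \<le> x \<longrightarrow> d (flw t \<omega>) * x + g (flw t \<omega>) x \<le> M" for M
  proof -
    obtain X where "\<forall>\<omega>\<in>\<Omega>. \<forall>x\<ge>X. d \<omega> * x + g \<omega> x \<le> M" using coercive by blast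
    then show ?thesis using in\<Omega> by (intro exI[of _ X]) blast
  qed
  obtain \<gamma> D where "\<gamma> > 0" "\<forall>\<omega>\<in>\<Omega>. \<forall>s t. s \<le> t \<longrightarrow> \<gamma> * (t - s) - D \<le> integral {s..t} (\<lambda>r. d (flw r \<omega>))"
    using mean_d by blast
  then show "\<exists>\<gamma>>0. \<exists>D. \<forall>s t. s \<le> t \<longrightarrow> \<gamma> * (t - s) - D \<le> integral {s..t} (\<lambda>t. d (flw t \<omega>))" using \<omega> by blast
  show "\<exists>h D. continuous_on UNIV h \<and> (\<forall>s t. s \<le> t \<longrightarrow> integral {s..t} h \<le> e * (t - s) + D) \<and>
       (\<forall>t x y. - R \<le> x \<longrightarrow> x \<le> y \<longrightarrow> y \<le> R \<longrightarrow> deriv (g (flw t \<omega>)) y - deriv (g (flw t \<omega>)) x \<le> h t)" if e: "e > 0" for R e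
  proof -
    obtain \<Phi> D where "continuous_on \<Omega> \<Phi>" and P: "\<forall>\<omega>\<in>\<Omega>. \<forall>s t. s \<le> t \<longrightarrow> integral {s..t} (\<lambda>r. \<Phi> (flw r \<omega>)) \<le> e * (t - s) + D"
      "\<forall>\<omega>\<in>\<Omega>. \<forall>x y. - R \<le> x \<longrightarrow> x \<le> y \<longrightarrow> y \<le> R \<longrightarrow> deriv (g \<omega>) y - deriv (g \<omega>) x \<le> \<Phi> \<omega>"
      using mean_concave[OF e, of R] by blast
    then have "continuous_on UNIV (\<lambda>t. \<Phi> (flw t \<omega>))" by (intro curve_along_orbit[OF \<omega>])
    moreover have "integral {s..t} (\<lambda>t. \<Phi> (flw t \<omega>)) \<le> e * (t - s) + D" if "s \<le> t" for s t using P(1) \<omega> that by blast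
    moreover have "deriv (g (flw t \<omega>)) y - deriv (g (flw t \<omega>)) x \<le> \<Phi> (flw t \<omega>)" if "- R \<le> x" "x \<le> y" "y \<le> R" for t x y
      using P(2) in\<Omega>[of t] that by blast
    ultimately show ?thesis by (intro exI[of _ "\<lambda>t. \<Phi> (flw t \<omega>)"] exI[of _ D]) simp
  qed
  show "\<exists>q \<gamma> D. \<gamma> > 0 \<and> continuous_on UNIV q \<and> (\<forall>t. 0 \<le> q t) \<and>
       (\<forall>s t. s \<le> t \<longrightarrow> \<gamma> * (t - s) - D \<le> integral {s..t} q) \<and>
       (\<forall>t x y. 0 \<le> x \<longrightarrow> x + \<eta> \<le> y \<longrightarrow> y \<le> R \<longrightarrow> 0 < q t \<longrightarrow> q t \<le> deriv (g (flw t \<omega>)) x - deriv (g (flw t \<omega>)) y)"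
    if \<eta>: "0 < \<eta>" "\<eta> \<le> R" for \<eta> R
  proof -
    obtain q \<gamma> D where q: "\<gamma> > 0" "continuous_on \<Omega> q" and P: "\<forall>\<omega>\<in>\<Omega>. 0 \<le> q \<omega>"
       "\<forall>\<omega>\<in>\<Omega>. \<forall>s t. s \<le> t \<longrightarrow> \<gamma> * (t - s) - D \<le> integral {s..t} (\<lambda>r. q (flw r \<omega>))"
       "\<forall>\<omega>\<in>\<Omega>. \<forall>x y. 0 \<le> x \<longrightarrow> x + \<eta> \<le> y \<longrightarrow> y \<le> R \<longrightarrow> 0 < q \<omega> \<longrightarrow> q \<omega> \<le> deriv (g \<omega>) x - deriv (g \<omega>) y"
      using mean_strict[OF \<eta>] by blast
    then have "continuous_on UNIV (\<lambda>t. q (flw t \<omega>))" by (intro curve_along_orbit[OF \<omega>])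
    moreover have "0 \<le> q (flw t \<omega>)" for t using P(1) in\<Omega>[of t] by blast
    moreover have "\<gamma> * (t - s) - D \<le> integral {s..t} (\<lambda>t. q (flw t \<omega>))" if "s \<le> t" for s t using P(2) \<omega> that by blast
    moreover have "q (flw t \<omega>) \<le> deriv (g (flw t \<omega>)) x - deriv (g (flw t \<omega>)) y"
      if "0 \<le> x" "x + \<eta> \<le> y" "y \<le> R" "0 < q (flw t \<omega>)" for t x y using P(3) in\<Omega>[of t] that by blast
    ultimately show ?thesis using q(1) by (intro exI[of _ "\<lambda>t. q (flw t \<omega>)"] exI[of _ \<gamma>] exI[of _ D]) simp
  qed
  show "\<exists>p n D. n > 0 \<and> continuous_on UNIV p \<and> (\<forall>t. 0 \<le> p t) \<and>
       (\<forall>s t. s \<le> t \<longrightarrow> integral {s..t} p \<le> e * (t - s) + D) \<and>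
       (\<forall>t x. \<eta> \<le> x \<longrightarrow> x \<le> R \<longrightarrow> 1 - p t \<le> n * (- g (flw t \<omega>) x))"
    if \<eta>: "0 < \<eta>" "\<eta> \<le> R" "0 < e" for \<eta> R e
  proof -
    obtain p n D where p: "n > 0" "continuous_on \<Omega> p" and P: "\<forall>\<omega>\<in>\<Omega>. 0 \<le> p \<omega>"
       "\<forall>\<omega>\<in>\<Omega>. \<forall>s t. s \<le> t \<longrightarrow> integral {s..t} (\<lambda>r. p (flw r \<omega>)) \<le> e * (t - s) + D"
       "\<forall>\<omega>\<in>\<Omega>. \<forall>x. \<eta> \<le> x \<longrightarrow> x \<le> R \<longrightarrow> 1 - p \<omega> \<le> n * (- g \<omega> x)"
      using mean_negative[OF \<eta>] by (elim exE conjE) (rule that)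
    then have "continuous_on UNIV (\<lambda>t. p (flw t \<omega>))" by (intro curve_along_orbit[OF \<omega>])
    moreover have "0 \<le> p (flw t \<omega>)" for t using P(1) in\<Omega>[of t] by blast
    moreover have "integral {s..t} (\<lambda>t. p (flw t \<omega>)) \<le> e * (t - s) + D" if "s \<le> t" for s t using P(2) \<omega> that by blast
    moreover have "1 - p (flw t \<omega>) \<le> n * (- g (flw t \<omega>) x)" if "\<eta> \<le> x" "x \<le> R" for t x using P(3) in\<Omega>[of t] that by blast
    ultimately show ?thesis using p(1)
      by (intro exI[of _ "\<lambda>t. p (flw t \<omega>)"] exI[of _ n] exI[of _ D] conjI allI impI) assumption+
  qed
qed

abbreviation "orbit_field \<omega> \<equiv> concave_orbit.f (\<lambda>t. c (flw t \<omega>)) (\<lambda>t. d (flw t \<omega>)) (\<lambda>t. g (flw t \<omega>))"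

lemma orbit_field_eq: "\<omega> \<in> \<Omega> \<Longrightarrow> orbit_field \<omega> t x = c (flw t \<omega>) + d (flw t \<omega>) * x + g (flw t \<omega>) x"
  using concave_orbit.f_def[OF concave_orbit] by simp

lemma fE_eq: "\<omega> \<in> \<Omega> \<Longrightarrow> fE flw c d g \<omega> l = (\<lambda>t x. orbit_field \<omega> t x + l)"
  by (intro ext) (simp add: fE_def orbit_field_eq)

lemma field_cont: "continuous_on (\<Omega> \<times> UNIV) (\<lambda>(\<omega>, x). c \<omega> + d \<omega> * x + g \<omega> x)"
proof -
  have cc: "continuous_on (\<Omega> \<times> (UNIV :: real set)) (\<lambda>p. c (fst p))" "continuous_on (\<Omega> \<times> (UNIV :: real set)) (\<lambda>p. d (fst p))"
    by (rule continuous_on_compose2[OF c_cont] continuous_on_compose2[OF d_cont]; auto intro: continuous_intros)+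
  show ?thesis unfolding case_prod_unfold
    by (intro continuous_intros cc g_cont[unfolded case_prod_unfold])
qed

lemma orbit_field_close:
  assumes w: "w \<in> \<Omega>" and e: "e > 0"
  shows "\<exists>\<delta>>0. \<forall>w'\<in>\<Omega>. dist w' w < \<delta> \<longrightarrow> (\<forall>t x. \<bar>t\<bar> \<le> T \<longrightarrow> \<bar>x\<bar> \<le> R \<longrightarrow> \<bar>orbit_field w' t x - orbit_field w t x\<bar> \<le> e)"
proof -
  define \<Psi> where "\<Psi> p = (\<lambda>(\<omega>, x). c \<omega> + d \<omega> * x + g \<omega> x) (flw (fst (fst p)) (snd p), snd (fst p))" for p
  let ?C = "({-T..T} \<times> {-R..R}) \<times> \<Omega>"
  have fl: "continuous_on ?C (\<lambda>p. flw (fst (fst p)) (snd p))"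
  proof -
    have "continuous_on ?C ((\<lambda>(t, \<omega>). flw t \<omega>) \<circ> (\<lambda>p. (fst (fst p), snd p)))"
      by (intro continuous_on_compose continuous_intros continuous_on_subset[OF flw_joint]) auto
    then show ?thesis by (simp add: o_def)
  qed
  have "continuous_on ?C \<Psi>" unfolding \<Psi>_def
    by (rule continuous_on_compose2[OF field_cont]) (auto intro!: continuous_on_Pair fl continuous_intros flw_in)
  then have "uniformly_continuous_on ?C \<Psi>" by (intro compact_uniformly_continuous compact_Times compact_Icc comp)
  from this[unfolded uniformly_continuous_on_def, rule_format, OF e]
  obtain \<delta> where \<delta>: "\<delta> > 0" "\<And>p p'. p \<in> ?C \<Longrightarrow> p' \<in> ?C \<Longrightarrow> dist p' p < \<delta> \<Longrightarrow> dist (\<Psi> p') (\<Psi> p) < e" by blast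
  show ?thesis
  proof (intro exI[of _ \<delta>] conjI \<delta>(1) ballI allI impI)
    fix w' t x assume a: "w' \<in> \<Omega>" "dist w' w < \<delta>" "\<bar>t\<bar> \<le> T" "\<bar>x\<bar> \<le> R"
    have "dist (\<Psi> ((t, x), w')) (\<Psi> ((t, x), w)) < e"
      by (rule \<delta>(2)) (use a w in \<open>auto simp: dist_Pair_Pair\<close>)
    then show "\<bar>orbit_field w' t x - orbit_field w t x\<bar> \<le> e"
      by (simp add: \<Psi>_def orbit_field_eq a(1) w dist_real_def)
  qed
qed

lemma bsol_params_orbit_closure:
  assumes \<omega>: "\<omega> \<in> \<Omega>" and w: "w \<in> orbit_closure flw \<omega>"
  shows "bsol_params (orbit_field \<omega>) \<subseteq> bsol_params (orbit_field w)"
proof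
  have "range (\<lambda>t. flw t \<omega>) \<subseteq> \<Omega>" using flw_in[OF \<omega>] by auto
  then have "orbit_closure flw \<omega> \<subseteq> \<Omega>" unfolding orbit_closure_def by (rule closure_minimal[OF _ compact_imp_closed[OF comp]])
  then have w\<Omega>: "w \<in> \<Omega>" using w by blast
  from w obtain W where W: "\<And>n. W n \<in> range (\<lambda>t. flw t \<omega>)" "W \<longlonglongrightarrow> w" unfolding orbit_closure_def closure_sequential by blast
  from W(1) have "\<forall>n. \<exists>t. W n = flw t \<omega>" by blast
  then obtain \<tau> where \<tau>: "\<And>n. W n = flw (\<tau> n) \<omega>" by metis
  have W\<Omega>: "W n \<in> \<Omega>" for n using \<tau> flw_in[OF \<omega>] by simp
  have shift: "orbit_field (W n) t x = orbit_field \<omega> (t + \<tau> n) x" for n t x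
    by (simp add: orbit_field_eq W\<Omega> \<omega> \<tau> flw_add flw_in)
  interpret O: concave_orbit "\<lambda>t. c (flw t w)" "\<lambda>t. d (flw t w)" "\<lambda>t. g (flw t w)" "\<lambda>t. deriv (g (flw t w))"
    by (rule concave_orbit[OF w\<Omega>])
  fix l assume "l \<in> bsol_params (orbit_field \<omega>)"
  then obtain b where b: "\<And>t. (b has_real_derivative orbit_field \<omega> t (b t) + l) (at t)" "bounded (range b)"
    unfolding bsol_params_def bounded_sol_def by blast
  obtain R0 where R0: "\<And>t. \<bar>b t\<bar> \<le> R0" using b(2) unfolding bounded_iff by auto
  define R where "R = max R0 1"
  have R: "R > 0" "\<And>t. \<bar>b t\<bar> \<le> R" using R0 by (auto simp: R_def le_max_iff_disj)
  obtain M where M: "\<And>t x. \<bar>x\<bar> \<le> R \<Longrightarrow> \<bar>O.f t x\<bar> \<le> M \<and> \<bar>O.fx t x\<bar> \<le> M" using O.family_bdd by blast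
  have "\<exists>b' r. strict_mono (r :: nat \<Rightarrow> nat) \<and> (\<forall>t. (b' has_real_derivative O.f t (b' t) + l) (at t)) \<and> (\<forall>t. \<bar>b' t\<bar> \<le> R) \<and>
    (\<forall>t. (\<lambda>n. b (t + \<tau> (r n))) \<longlonglongrightarrow> b' t)"
  proof (rule solution_compactness[where fn = "\<lambda>n t x. orbit_field (W n) t x + l" and u = "\<lambda>n t. b (t + \<tau> n)" and f = "\<lambda>t x. O.f t x + l" and M = "M + \<bar>l\<bar>" and L = M])
    show "continuous_on UNIV (\<lambda>(t, x). O.f t x + l)"
      using O.family_cont(1) unfolding case_prod_unfold by (intro continuous_intros)
    show "R > 0" by (rule R(1))
    show "\<bar>O.f t x + l\<bar> \<le> M + \<bar>l\<bar>" if "\<bar>x\<bar> \<le> R" for t x using M[OF that, of t] by linarith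
    show "\<bar>O.f t x + l - (O.f t y + l)\<bar> \<le> M * \<bar>x - y\<bar>" if "\<bar>x\<bar> \<le> R" "\<bar>y\<bar> \<le> R" for t x y
      using O.fam.f_lip[of R M x y t] M that by simp
    show "((\<lambda>t. b (t + \<tau> n)) has_real_derivative orbit_field (W n) t (b (t + \<tau> n)) + l) (at t)" for n t
      using b(1)[of "t + \<tau> n"] unfolding shift by (simp add: DERIV_shift)
    show "\<bar>b (t + \<tau> n)\<bar> \<le> R" for n t by (rule R(2))
    show "\<exists>N. \<forall>n\<ge>N. \<forall>t x. \<bar>t\<bar> \<le> T \<longrightarrow> \<bar>x\<bar> \<le> R \<longrightarrow> \<bar>orbit_field (W n) t x + l - (O.f t x + l)\<bar> \<le> e" if e: "e > 0" for T e
    proof -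
      obtain \<delta> where \<delta>: "\<delta> > 0" "\<And>w' t x. w' \<in> \<Omega> \<Longrightarrow> dist w' w < \<delta> \<Longrightarrow> \<bar>t\<bar> \<le> T \<Longrightarrow> \<bar>x\<bar> \<le> R \<Longrightarrow> \<bar>orbit_field w' t x - orbit_field w t x\<bar> \<le> e"
        using orbit_field_close[OF w\<Omega> e, of T R] by blast
      obtain N where "\<And>n. n \<ge> N \<Longrightarrow> dist (W n) w < \<delta>" using metric_LIMSEQ_D[OF W(2) \<delta>(1)] by blast
      then have "\<forall>n\<ge>N. \<forall>t x. \<bar>t\<bar> \<le> T \<longrightarrow> \<bar>x\<bar> \<le> R \<longrightarrow> \<bar>orbit_field (W n) t x - O.f t x\<bar> \<le> e" using \<delta>(2) W\<Omega> by blast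
      then show ?thesis by (intro exI[of _ N]) simp
    qed
  qed
  then obtain b' where b': "\<And>t. (b' has_real_derivative O.f t (b' t) + l) (at t)" "\<And>t. \<bar>b' t\<bar> \<le> R" by blast
  have "bounded (range b')" unfolding bounded_iff using b'(2) by auto
  then show "l \<in> bsol_params O.f" unfolding bsol_params_def bounded_sol_def using b'(1) by blast
qed

lemma lam_minus_eq: "\<omega> \<in> \<Omega> \<Longrightarrow> lam_minus flw c d g \<omega> = Inf (bsol_params (orbit_field \<omega>))"
  by (simp add: lam_minus_def bsol_params_def fE_eq)

lemma lam_minus_orbit_closure:
  assumes "\<omega> \<in> \<Omega>" "w \<in> \<Omega>" "orbit_closure flw w = orbit_closure flw \<omega>"
  shows "lam_minus flw c d g w = lam_minus flw c d g \<omega>"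
proof -
  have mem: "u \<in> orbit_closure flw u" if "u \<in> \<Omega>" for u
  proof -
    have "u \<in> range (\<lambda>t. flw t u)" using rangeI[of "\<lambda>t. flw t u" 0] flw_0[OF that] by simp
    then show ?thesis unfolding orbit_closure_def by (rule subsetD[OF closure_subset])
  qed
  have "bsol_params (orbit_field w) = bsol_params (orbit_field \<omega>)"
    using bsol_params_orbit_closure[OF assms(1), of w] bsol_params_orbit_closure[OF assms(2), of \<omega>] mem assms by auto
  then show ?thesis using lam_minus_eq assms by simp
qed
end

theorem mainTheorem4:
  fixes \<Omega> :: "'w::metric_space set" and flw :: "real \<Rightarrow> 'w \<Rightarrow> 'w"
    and c d :: "'w \<Rightarrow> real" and g :: "'w \<Rightarrow> real \<Rightarrow> real" and \<omega>b :: 'w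
  assumes flow: "cont_flow \<Omega> flw"
    and hyps: "hyps_l \<Omega> flw c d g"
    and \<omega>b: "\<omega>b \<in> \<Omega>"
  defines "F \<equiv> fE flw c d g \<omega>b"
    and "lam0 \<equiv> lam_minus flw c d g \<omega>b"
  shows "\<exists>r a :: real \<Rightarrow> real \<Rightarrow> real.
    (\<forall>lam\<ge>lam0. lower_bsol (F lam) (r lam) \<and> upper_bsol (F lam) (a lam)) \<and>
    \<comment> \<open>(i)\<close>
    (\<forall>lam>lam0. (\<forall>t. r lam t < a lam t) \<and> unif_separated (r lam) (a lam) \<and>
        rep_hyperbolic (F lam) (r lam) \<and> attr_hyperbolic (F lam) (a lam)) \<and>
    (\<forall>b. bounded_sol (F lam0) b \<longrightarrow> \<not> hyperbolic (F lam0) b) \<and>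
    (\<forall>b1 b2. bounded_sol (F lam0) b1 \<and> bounded_sol (F lam0) b2 \<longrightarrow> \<not> unif_separated b1 b2) \<and>
    (\<forall>lam<lam0. \<not> (\<exists>b. bounded_sol (F lam) b)) \<and>
    \<comment> \<open>(ii)\<close>
    (\<forall>lam>lam0. \<forall>\<epsilon>>0. \<exists>\<delta>>0. \<forall>mu>lam0. \<bar>mu - lam\<bar> < \<delta> \<longrightarrow>
        (\<forall>t. \<bar>a mu t - a lam t\<bar> \<le> \<epsilon> \<and> \<bar>r mu t - r lam t\<bar> \<le> \<epsilon>)) \<and>
    (\<forall>lam mu. lam0 < lam \<and> lam < mu \<longrightarrow> (\<forall>t. a lam t < a mu t \<and> r mu t < r lam t)) \<and>
    (\<forall>t. ((\<lambda>lam. a lam t) \<longlongrightarrow> a lam0 t) (at_right lam0) \<and>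
         ((\<lambda>lam. r lam t) \<longlongrightarrow> r lam0 t) (at_right lam0)) \<and>
    (\<forall>M. \<exists>L. \<forall>lam\<ge>L. \<forall>t. a lam t \<ge> M \<and> r lam t \<le> - M) \<and>
    \<comment> \<open>(iii)\<close>
    (\<forall>\<omega>\<in>\<Omega>. orbit_closure flw \<omega> = orbit_closure flw \<omega>b \<longrightarrow>
        lam_minus flw c d g \<omega> = lam0) \<and>
    \<comment> \<open>(iv)\<close>
    (let mu0 = Inf {lam. \<forall>t. bfrak flw c d lam (flw t \<omega>b) \<le> 0} in
       mu0 > lam0 \<and> (\<forall>lam\<ge>mu0. \<forall>t. r lam t = bfrak flw c d lam (flw t \<omega>b))) \<and>
    \<comment> \<open>(v)\<close>
    (\<forall>lam s x \<alpha> \<beta> \<phi>. max_sol (F lam) s x \<alpha> \<beta> \<phi> \<longrightarrow>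
       (lam \<ge> lam0 \<longrightarrow>
          (filterlim \<phi> at_top (lower_end \<alpha>) \<longleftrightarrow> x > a lam s) \<and>
          (filterlim \<phi> at_bot (upper_end \<beta>) \<longleftrightarrow> x < r lam s)) \<and>
       (lam > lam0 \<longrightarrow>
          (\<alpha> = -\<infinity> \<and> ((\<lambda>t. \<bar>\<phi> t - r lam t\<bar>) \<longlongrightarrow> 0) at_bot \<longleftrightarrow> x < a lam s) \<and>
          (\<beta> = \<infinity> \<and> ((\<lambda>t. \<bar>\<phi> t - a lam t\<bar>) \<longlongrightarrow> 0) at_top \<longleftrightarrow> x > r lam s)) \<and>
       (lam < lam0 \<longrightarrow>
          filterlim \<phi> at_top (lower_end \<alpha>) \<or> filterlim \<phi> at_bot (upper_end \<beta>)))"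
proof -
  interpret flow_family \<Omega> flw c d g by (intro flow_family.intro compact_flow.intro flow_family_axioms.intro flow hyps)
  interpret O: concave_orbit "\<lambda>t. c (flw t \<omega>b)" "\<lambda>t. d (flw t \<omega>b)" "\<lambda>t. g (flw t \<omega>b)" "\<lambda>t. deriv (g (flw t \<omega>b))"
    by (rule concave_orbit[OF \<omega>b])
  have F: "F lam = (\<lambda>t x. O.f t x + lam)" for lam unfolding F_def by (rule fE_eq[OF \<omega>b])
  have L: "lam0 = O.fam.lam0" unfolding lam0_def O.fam.lam0_def by (rule lam_minus_eq[OF \<omega>b])
  have bl: "bfrak flw c d lam (flw t \<omega>b) = O.bl lam t" for lam t
    unfolding bfrak_def O.bl_def using flw_add[OF \<omega>b] by simp
  define r where "r = lower_sol O.f"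
  define a where "a = upper_sol O.f"
  have ext: "\<forall>lam\<ge>lam0. lower_bsol (F lam) (r lam) \<and> upper_bsol (F lam) (a lam)"
    unfolding F L r_def a_def using O.fam.lo_lower O.fam.up_upper by blast
  have sep: "(\<forall>t. r lam t < a lam t) \<and> unif_separated (r lam) (a lam) \<and>
        rep_hyperbolic (F lam) (r lam) \<and> attr_hyperbolic (F lam) (a lam)" if lam: "lam0 < lam" for lam
  proof -
    have l: "O.fam.lam0 < lam" "O.fam.lam0 \<le> lam" using lam unfolding L by simp_all
    obtain \<delta> where \<delta>: "\<delta> > 0" "\<And>t. r lam t + \<delta> \<le> a lam t" using O.fam.lo_up_separated[OF l(1)] unfolding r_def a_def by blast
    have "r lam t < a lam t \<and> \<delta> \<le> \<bar>r lam t - a lam t\<bar>" for t using \<delta>(1) \<delta>(2)[of t] by linarith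
    then have "(\<forall>t. r lam t < a lam t) \<and> unif_separated (r lam) (a lam)" unfolding unif_separated_def using \<delta>(1) by blast
    moreover have "rep_hyperbolic (F lam) (r lam)" unfolding F r_def
      using O.fam.rep_hyperbolic_iff O.fam.lo_bsol[OF l(2)] O.fam.lo_repulsive[OF l(1)] by blast
    moreover have "attr_hyperbolic (F lam) (a lam)" unfolding F a_def
      using O.fam.attr_hyperbolic_iff O.fam.up_bsol[OF l(2)] O.fam.up_attractive[OF l(1)] by blast
    ultimately show ?thesis by blast
  qed
  have nonhyp: "\<not> hyperbolic (F lam0) b" for b
  proof
    assume "hyperbolic (F lam0) b"
    then have "bounded_sol (\<lambda>t x. O.f t x + lam0) b \<and> (O.fam.attractive b \<or> O.fam.repulsive b)"
      unfolding hyperbolic_def F O.fam.attr_hyperbolic_iff O.fam.rep_hyperbolic_iff by blast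
    then have "O.fam.lam0 < lam0" using O.fam.hyperbolic_imp_gt[of lam0 b] by blast
    then show False unfolding L by simp
  qed
  have nonsep: "\<not> unif_separated b1 b2" if "bounded_sol (F lam0) b1" "bounded_sol (F lam0) b2" for b1 b2
    using that O.fam.not_separated_lam0[of b1 b2] unfolding F L by blast
  have none: "\<not> (\<exists>b. bounded_sol (F lam) b)" if "lam < lam0" for lam
    using that O.fam.bsol_iff[of lam] unfolding F L by simp
  have cont: "\<exists>\<delta>>0. \<forall>mu>lam0. \<bar>mu - lam\<bar> < \<delta> \<longrightarrow>
        (\<forall>t. \<bar>a mu t - a lam t\<bar> \<le> \<epsilon> \<and> \<bar>r mu t - r lam t\<bar> \<le> \<epsilon>)" if lam: "lam0 < lam" and \<epsilon>: "\<epsilon> > 0" for lam \<epsilon>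
  proof -
    have l: "O.fam.lam0 < lam" using lam unfolding L .
    obtain d1 where d1: "d1 > 0" "\<And>m t. O.fam.lam0 < m \<Longrightarrow> \<bar>m - lam\<bar> < d1 \<Longrightarrow> \<bar>a m t - a lam t\<bar> \<le> \<epsilon>"
      using O.fam.up_continuous[OF l \<epsilon>] unfolding a_def by blast
    obtain d2 where d2: "d2 > 0" "\<And>m t. O.fam.lam0 < m \<Longrightarrow> \<bar>m - lam\<bar> < d2 \<Longrightarrow> \<bar>r m t - r lam t\<bar> \<le> \<epsilon>"
      using O.fam.lo_continuous[OF l \<epsilon>] unfolding r_def by blast
    show ?thesis using d1 d2 unfolding L by (intro exI[of _ "min d1 d2"]) simp
  qed
  have mono: "a lam t < a mu t \<and> r mu t < r lam t" if "lam0 < lam" "lam < mu" for lam mu t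
    unfolding a_def r_def using O.fam.up_strict_mono[of lam mu t] O.fam.lo_strict_mono[of lam mu t] that unfolding L by simp
  have lim: "((\<lambda>lam. a lam t) \<longlongrightarrow> a lam0 t) (at_right lam0) \<and> ((\<lambda>lam. r lam t) \<longlongrightarrow> r lam0 t) (at_right lam0)" for t
    unfolding a_def r_def L using O.fam.up_tendsto_lam0 O.fam.lo_tendsto_lam0 by blast
  have unb: "\<exists>L. \<forall>lam\<ge>L. \<forall>t. a lam t \<ge> M \<and> r lam t \<le> - M" for M
    unfolding a_def r_def by (rule O.fam.up_lo_unbounded)
  have hull: "lam_minus flw c d g \<omega> = lam0" if "\<omega> \<in> \<Omega>" "orbit_closure flw \<omega> = orbit_closure flw \<omega>b" for \<omega>
    unfolding lam0_def by (rule lam_minus_orbit_closure[OF \<omega>b that])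
  have lin: "let mu0 = Inf {lam. \<forall>t. bfrak flw c d lam (flw t \<omega>b) \<le> 0} in
       mu0 > lam0 \<and> (\<forall>lam\<ge>mu0. \<forall>t. r lam t = bfrak flw c d lam (flw t \<omega>b))"
    unfolding bl Let_def O.mu0_def[symmetric] L r_def using O.lam0_less_mu0 O.lower_sol_eq_bl by blast
  have dyn: "(lam \<ge> lam0 \<longrightarrow>
          (filterlim \<phi> at_top (lower_end \<alpha>) \<longleftrightarrow> x > a lam s) \<and>
          (filterlim \<phi> at_bot (upper_end \<beta>) \<longleftrightarrow> x < r lam s)) \<and>
       (lam > lam0 \<longrightarrow>
          (\<alpha> = -\<infinity> \<and> ((\<lambda>t. \<bar>\<phi> t - r lam t\<bar>) \<longlongrightarrow> 0) at_bot \<longleftrightarrow> x < a lam s) \<and>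
          (\<beta> = \<infinity> \<and> ((\<lambda>t. \<bar>\<phi> t - a lam t\<bar>) \<longlongrightarrow> 0) at_top \<longleftrightarrow> x > r lam s)) \<and>
       (lam < lam0 \<longrightarrow>
          filterlim \<phi> at_top (lower_end \<alpha>) \<or> filterlim \<phi> at_bot (upper_end \<beta>))"
    if m: "max_sol (F lam) s x \<alpha> \<beta> \<phi>" for lam s x \<alpha> \<beta> \<phi>
  proof (intro conjI impI)
    note m' = m[unfolded F]
    show "filterlim \<phi> at_top (lower_end \<alpha>) \<longleftrightarrow> x > a lam s" "filterlim \<phi> at_bot (upper_end \<beta>) \<longleftrightarrow> x < r lam s"
      if "lam \<ge> lam0"
      unfolding a_def r_def by (rule O.fam.escape_up_iff[OF that[unfolded L] m'] O.fam.escape_dn_iff[OF that[unfolded L] m'])+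
    show "\<alpha> = -\<infinity> \<and> ((\<lambda>t. \<bar>\<phi> t - r lam t\<bar>) \<longlongrightarrow> 0) at_bot \<longleftrightarrow> x < a lam s"
      "\<beta> = \<infinity> \<and> ((\<lambda>t. \<bar>\<phi> t - a lam t\<bar>) \<longlongrightarrow> 0) at_top \<longleftrightarrow> x > r lam s" if "lam > lam0"
      unfolding a_def r_def
      by (rule O.fam.backward_attraction_iff[OF that[unfolded L] m'] O.fam.forward_attraction_iff[OF that[unfolded L] m'])+
    show "filterlim \<phi> at_top (lower_end \<alpha>) \<or> filterlim \<phi> at_bot (upper_end \<beta>)" if "lam < lam0"
    proof -
      have "\<not> bounded_sol (\<lambda>t x. O.f t x + lam) \<phi>" using none[OF that] unfolding F by blast
      then show ?thesis using O.fam.max_sol_trichotomy[OF m'] by blast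
    qed
  qed
  show ?thesis
    by (intro exI[of _ r] exI[of _ a] conjI;
        (rule ext lin | (intro allI impI ballI, (elim conjE)?, rule sep nonhyp nonsep none cont mono lim unb hull dyn, (assumption+)?)))
qed


end
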